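(* Let $R$ be a unital commutative ring such that all finitely-generated stably-free $R$-modules are free, and let $\mathfrak{Lie}$ be the Lie operad in $R$-modules. The kernel of the natural (with respect to $V\in\mathrm{Ob}\,\mathcal{S}(R)$) transformation $$\overline{\mathsf{Div}^{\mathfrak{Lie}}_V}:\mathrm{Der}^+(\mathfrak{Lie}(V))/\mathrm{Der}^{(1)}_{\mathrm{Lie}}(\mathfrak{Lie}(V))\to|\mathrm{Der}_\bullet^+(\mathfrak{Lie}(R\oplus V))|/\mathbf{Im}^{\mathfrak{Lie}}(V)\cong|\overline{T}(V)|/V$$ induced by the generalized divergence is $3$-torsion.
   Context: Take $\mathscr{O}=\mathfrak{Lie}$, the operad in $R$-modules encoding Lie algebras (generated by one antisymmetric binary operation subject to the Jacobi relation). Free algebras. $\mathscr{O}(V)=\bigoplus_n\mathscr{O}_n(V)$, $\mathscr{O}_n(V)=\mathscr{O}(n)\otimes_{\mathfrak{S}_n}V^{\otimes n}$, is the free $\mathscr{O}$-algebra on $V$; $\mathscr{O}(V;W)=\bigoplus_{n\ge1}\mathscr{O}(n)\otimes_{\mathfrak{S}_{n-1}}(V^{\otimes n-1}\otimes W)$ is the summand of $\mathscr{O}(V\oplus W)$ of terms linear in $W$. The category $\mathcal{S}(R)$ has objects the free $R$-modules of finite rank and morphisms $V\to W$ the pairs $(i:V\to W,\ r:W\to V)$ of $R$-linear maps with $r\circ i=\mathrm{id}_V$. Derivations. For $V$ free of finite rank, $\mathrm{Der}(\mathscr{O}(V))$ is the module of derivations of the $\mathscr{O}$-algebra $\mathscr{O}(V)$;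 restriction to $V$ gives $\mathrm{Der}(\mathscr{O}(V))\cong\mathrm{Hom}_R(V,\mathscr{O}(V))\cong\mathscr{O}(V)\otimes V^\sharp$, where $V^\sharp=\mathrm{Hom}_R(V,R)$. It is graded with $\mathrm{Hom}_R(V,\mathscr{O}_n(V))$ in degree $n-1$; $\mathrm{Der}^+$ is the part of positive degree. It is a functor on $\mathcal{S}(R)$: $(i,r)$ sends $d$ to the derivation whose restriction to $W$ is $\mathscr{O}(i)\circ d|_V\circ r$. The preLie product is $(d\lhd e)|_V=e\circ(d|_V)$, with Lie bracket $[d,e]=d\lhd e-e\lhd d$. $\mathrm{Der}^{(1)}_{\mathrm{Lie}}(\mathscr{O}(V))$ is the sub Lie algebra of $\mathrm{Der}(\mathscr{O}(V))$ generated by the degree one part $\mathrm{Hom}_R(V,\mathscr{O}_2(V))$. Pointed derivations. $\mathrm{Der}_\bullet(\mathscr{O}(R\oplus V)):=\mathrm{Hom}_R(R,\mathscr{O}(V;R))\cong\mathscr{O}(V;R)$, a submodule of $\mathrm{Der}(\mathscr{O}(R\oplus V))$ via $R\oplus V\twoheadrightarrow R$ and $\mathscr{O}(V;R)\subset\mathscr{O}(R\oplus V)$; $\lhd$ restricts to an associative unital product on it. $\mathrm{Der}^+_\bullet(\mathscr{O}(R\oplus V))$ is its intersection with $\mathrm{Der}^+(\mathscr{O}(R\oplus V))$. For an associative (possibly non-unital) algebra $A$, $|A|=A/[A,A]$ with $[A,A]$ the submodule generated by commutators. For $\mathscr{O}=\mathfrak{Lie}$, the algebra $\mathrm{Der}_\bullet(\mathfrak{Lie}(R\oplus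 V))$ is naturally isomorphic to the tensor algebra $T(V)$, with $v_1\otimes\cdots\otimes v_n\in T(V)$ corresponding to $[v_1,[v_2,[\ldots,[v_n,1]\ldots]]]\in\mathfrak{Lie}(V;R)$, where $1$ is the generator of $R$. Under this isomorphism $\mathrm{Der}^+_\bullet(\mathfrak{Lie}(R\oplus V))$ corresponds to the augmentation ideal $\overline{T}(V)=\bigoplus_{n\ge1}V^{\otimes n}$; $V\subset|\overline{T}(V)|$ denotes the degree one part. Divergence. Let $\delta_V:\mathscr{O}(V)\to\mathscr{O}(V;V)$ send $\mu(v_1,\dots,v_n)$ to $\sum_i\mu(v_1,\dots,\overline{v_i},\dots,v_n)$, with $\overline{v_i}$ in the linear argument. $\Phi^{\mathscr{O}}_V:\mathrm{Der}(\mathscr{O}(V))\cong\mathscr{O}(V)\otimes V^\sharp\to\mathscr{O}(V;R)\cong\mathrm{Der}_\bullet(\mathscr{O}(R\oplus V))$ is $x\otimes f\mapsto\mathscr{O}(V;f)(\delta_V(x))$. The generalized divergence $\mathsf{Div}^{\mathscr{O}}_V:\mathrm{Der}^+(\mathscr{O}(V))\to|\mathrm{Der}^+_\bullet(\mathscr{O}(R\oplus V))|$ is the restriction of $\Phi^{\mathscr{O}}_V$ followed by the quotient map. $\mathbf{Im}^{\mathscr{O}}(V):=\mathsf{Div}^{\mathscr{O}}_V(\mathrm{Der}^{(1)}_{\mathrm{Lie}}(\mathscr{O}(V)))$, and $\overline{\mathsf{Div}^{\mathscr{O}}_V}$ is the map induced by $\mathsf{Div}^{\mathscr{O}}_V$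 on the quotients by $\mathrm{Der}^{(1)}_{\mathrm{Lie}}(\mathscr{O}(V))$ and $\mathbf{Im}^{\mathscr{O}}(V)$. Torsion. A functor $F:\mathcal{S}(R)\to R\text{-modules}$ is $n$-torsion ($n\in\mathbb{N}$) if for every $V$ the map $F(j_n):F(V)\to F(V\oplus R^n)$ is zero, where $j_n$ is the canonical split inclusion.
   Formalization: The displayed isomorphism of the target with |T̄(V)|/V is asserted only for V not of rank 1: in rank 1 the divergence of every degree one derivation is 0, so Im(V)=0 while V≠0. Naturality and 3-torsion are proved for all V with target |Der•+|/Im(V). *)

theory Defs
  imports "HOL-Algebra.Module" "HOL-Algebra.QuotRing"
begin

section \<open>Modules\<close>

text \<open>
  Modules and (not necessarily associative or unital) algebras over \<open>R\<close> are both represented by the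
  record type \<^type>\<open>module\<close>. For plain modules the fields \<open>mult\<close> and \<open>one\<close> carry no information;
  for an algebra the field \<open>mult\<close> is the product (for a Lie algebra: the bracket).
\<close>

definition mod_hom ::
  "('a, 'r) ring_scheme \<Rightarrow> ('a, 'b, 'm) module_scheme \<Rightarrow> ('a, 'c, 'n) module_scheme \<Rightarrow> ('b \<Rightarrow> 'c) set"
  where "mod_hom R M N =
    {f \<in> carrier M \<rightarrow> carrier N.
       (\<forall>x\<in>carrier M. \<forall>y\<in>carrier M. f (x \<oplus>\<^bsub>M\<^esub> y) = f x \<oplus>\<^bsub>N\<^esub> f y) \<and>
       (\<forall>a\<in>carrier R. \<forall>x\<in>carrier M. f (a \<odot>\<^bsub>M\<^esub> x) = a \<odot>\<^bsub>N\<^esub> f x)}"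

definition mod_iso ::
  "('a, 'r) ring_scheme \<Rightarrow> ('a, 'b, 'm) module_scheme \<Rightarrow> ('a, 'c, 'n) module_scheme \<Rightarrow> ('b \<Rightarrow> 'c) set"
  where "mod_iso R M N = {f \<in> mod_hom R M N. bij_betw f (carrier M) (carrier N)}"

definition alg_hom ::
  "('a, 'r) ring_scheme \<Rightarrow> ('a, 'b, 'm) module_scheme \<Rightarrow> ('a, 'c, 'n) module_scheme \<Rightarrow> ('b \<Rightarrow> 'c) set"
  where "alg_hom R A B =
    {f \<in> mod_hom R A B. \<forall>x\<in>carrier A. \<forall>y\<in>carrier A. f (x \<otimes>\<^bsub>A\<^esub> y) = f x \<otimes>\<^bsub>B\<^esub> f y}"

definition self_mod :: "('a, 'r) ring_scheme \<Rightarrow> ('a, 'a) module"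
  where "self_mod R =
    \<lparr>carrier = carrier R, mult = mult R, one = one R, zero = zero R, add = add R, smult = mult R\<rparr>"

definition dsum :: "('a, 'b, 'm) module_scheme \<Rightarrow> ('a, 'c, 'n) module_scheme \<Rightarrow> ('a, 'b \<times> 'c) module"
  where "dsum M N =
    \<lparr>carrier = carrier M \<times> carrier N, mult = undefined, one = undefined,
     zero = (\<zero>\<^bsub>M\<^esub>, \<zero>\<^bsub>N\<^esub>),
     add = (\<lambda>x y. (fst x \<oplus>\<^bsub>M\<^esub> fst y, snd x \<oplus>\<^bsub>N\<^esub> snd y)),
     smult = (\<lambda>a x. (a \<odot>\<^bsub>M\<^esub> fst x, a \<odot>\<^bsub>N\<^esub> snd x))\<rparr>"

definition pow_mod :: "('a, 'r) ring_scheme \<Rightarrow> nat \<Rightarrow> ('a, nat \<Rightarrow> 'a) module"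
  where "pow_mod R n =
    \<lparr>carrier = {..<n} \<rightarrow>\<^sub>E carrier R, mult = undefined, one = undefined,
     zero = (\<lambda>i\<in>{..<n}. \<zero>\<^bsub>R\<^esub>),
     add = (\<lambda>x y. \<lambda>i\<in>{..<n}. x i \<oplus>\<^bsub>R\<^esub> y i),
     smult = (\<lambda>a x. \<lambda>i\<in>{..<n}. a \<otimes>\<^bsub>R\<^esub> x i)\<rparr>"

definition free_of_rank :: "('a, 'r) ring_scheme \<Rightarrow> ('a, 'b, 'm) module_scheme \<Rightarrow> nat \<Rightarrow> bool"
  where "free_of_rank R M n \<longleftrightarrow> module R M \<and> mod_iso R (pow_mod R n) M \<noteq> {}"

definition free_fin_rank :: "('a, 'r) ring_scheme \<Rightarrow> ('a, 'b, 'm) module_scheme \<Rightarrow> bool"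
  where "free_fin_rank R M \<longleftrightarrow> (\<exists>n. free_of_rank R M n)"

definition fin_gen :: "('a, 'r) ring_scheme \<Rightarrow> ('a, 'b, 'm) module_scheme \<Rightarrow> bool"
  where "fin_gen R M \<longleftrightarrow> (\<exists>n. \<exists>f\<in>mod_hom R (pow_mod R n) M. f ` carrier (pow_mod R n) = carrier M)"

definition stably_free :: "('a, 'r) ring_scheme \<Rightarrow> ('a, 'b, 'm) module_scheme \<Rightarrow> bool"
  where "stably_free R M \<longleftrightarrow> (\<exists>m n. mod_iso R (dsum M (pow_mod R m)) (pow_mod R n) \<noteq> {})"

text \<open>
  Every finitely generated stably free module is isomorphic to a submodule of some \<open>R\<^sup>n\<close>, so it is
  enough to consider modules with elements in the type \<^typ>\<open>nat \<Rightarrow> 'a\<close>.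
\<close>

definition fg_stably_free_are_free :: "('a, 'r) ring_scheme \<Rightarrow> bool"
  where "fg_stably_free_are_free R \<longleftrightarrow>
    (\<forall>M :: ('a, nat \<Rightarrow> 'a) module.
       module R M \<and> fin_gen R M \<and> stably_free R M \<longrightarrow> free_fin_rank R M)"

definition span_of :: "('a, 'r) ring_scheme \<Rightarrow> ('a, 'b, 'm) module_scheme \<Rightarrow> 'b set \<Rightarrow> 'b set"
  where "span_of R M G = \<Inter>{H. submodule H R M \<and> G \<subseteq> H}"

definition two_sided_ideal ::
  "('a, 'r) ring_scheme \<Rightarrow> ('a, 'b, 'm) module_scheme \<Rightarrow> 'b set \<Rightarrow> bool"
  where "two_sided_ideal R A I \<longleftrightarrow> submodule I R A \<and>
    (\<forall>x\<in>carrier A. \<forall>y\<in>I. x \<otimes>\<^bsub>A\<^esub> y \<in> I \<and> y \<otimes>\<^bsub>A\<^esub> x \<in> I)"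

definition ideal_of :: "('a, 'r) ring_scheme \<Rightarrow> ('a, 'b, 'm) module_scheme \<Rightarrow> 'b set \<Rightarrow> 'b set"
  where "ideal_of R A G = \<Inter>{I. two_sided_ideal R A I \<and> G \<subseteq> I}"

text \<open>
  Quotient by a submodule \<open>N\<close>; the product is only meaningful when \<open>N\<close> is a two-sided ideal.
\<close>

definition quot :: "('a, 'b, 'm) module_scheme \<Rightarrow> 'b set \<Rightarrow> ('a, 'b set) module"
  where "quot M N =
    \<lparr>carrier = a_rcosets\<^bsub>M\<^esub> N, mult = rcoset_mult M N, one = N +>\<^bsub>M\<^esub> \<one>\<^bsub>M\<^esub>, zero = N, add = set_add M,
     smult = (\<lambda>a X. \<Union>x\<in>X. N +>\<^bsub>M\<^esub> (a \<odot>\<^bsub>M\<^esub> x))\<rparr>"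

text \<open>
  The map out of a quotient induced by \<open>f\<close>, with values in \<open>quot N N'\<close>. On a coset \<open>X\<close> this is the
  union of all \<open>N' + f x\<close>, \<open>x \<in> X\<close>; it is a single coset precisely if \<open>f\<close> is constant modulo \<open>N'\<close>
  on \<open>X\<close>.
\<close>

definition induced :: "('a, 'c, 'n) module_scheme \<Rightarrow> 'c set \<Rightarrow> ('b \<Rightarrow> 'c) \<Rightarrow> 'b set \<Rightarrow> 'c set"
  where "induced N N' f X = (\<Union>x\<in>X. N' +>\<^bsub>N\<^esub> f x)"

definition comm_span :: "('a, 'r) ring_scheme \<Rightarrow> ('a, 'b, 'm) module_scheme \<Rightarrow> 'b set"
  where "comm_span R A =
    span_of R A {x \<otimes>\<^bsub>A\<^esub> y \<ominus>\<^bsub>A\<^esub> y \<otimes>\<^bsub>A\<^esub> x | x y. x \<in> carrier A \<and> y \<in> carrier A}"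

definition abel :: "('a, 'r) ring_scheme \<Rightarrow> ('a, 'b, 'm) module_scheme \<Rightarrow> ('a, 'b set) module"
  where "abel R A = quot A (comm_span R A)"

definition free_elems :: "('a, 'r) ring_scheme \<Rightarrow> 'x set \<Rightarrow> ('x \<Rightarrow> 'a) set"
  where "free_elems R X =
    {f. range f \<subseteq> carrier R \<and> finite {x. f x \<noteq> \<zero>\<^bsub>R\<^esub>} \<and> {x. f x \<noteq> \<zero>\<^bsub>R\<^esub>} \<subseteq> X}"

definition basis_elem :: "('a, 'r) ring_scheme \<Rightarrow> 'x \<Rightarrow> 'x \<Rightarrow> 'a"
  where "basis_elem R x = (\<lambda>y. if y = x then \<one>\<^bsub>R\<^esub> else \<zero>\<^bsub>R\<^esub>)"


section \<open>Free algebras over the Lie operad\<close>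

text \<open>
  An algebra over the operad generated by one antisymmetric binary operation subject to the Jacobi
  relation is a module with a bilinear bracket such that \<open>[x,y] + [y,x] = 0\<close> and the Jacobi identity
  holds; the identity \<open>[x,x] = 0\<close> is not imposed (it is not an operadic relation, and does not follow
  when \<open>2\<close> is not invertible). The free such algebra on \<open>V\<close> is presented as the module spanned by
  binary trees with leaves labelled by elements of \<open>V\<close>, modulo multilinearity in the labels,
  antisymmetry and Jacobi. The class of a tree with \<open>n\<close> leaves is the class of
  \<open>\<mu> \<otimes> (v\<^sub>1 \<otimes> \<dots> \<otimes> v\<^sub>n)\<close> in the arity \<open>n\<close> summand, where \<open>\<mu>\<close> is the operation described by the
  underlying tree.
\<close>

datatype 'v tree = Leaf 'v | Node "'v tree" "'v tree"

fun leaves :: "'v tree \<Rightarrow> nat"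
  where
    "leaves (Leaf v) = 1"
  | "leaves (Node s t) = leaves s + leaves t"

definition trees_on :: "('a, 'v, 'm) module_scheme \<Rightarrow> 'v tree set"
  where "trees_on V = {t. set_tree t \<subseteq> carrier V}"

definition tree_alg ::
  "('a, 'r) ring_scheme \<Rightarrow> ('a, 'v, 'm) module_scheme \<Rightarrow> ('a, 'v tree \<Rightarrow> 'a) module"
  where "tree_alg R V =
    \<lparr>carrier = free_elems R (trees_on V),
     mult = (\<lambda>f g t. case t of Leaf v \<Rightarrow> \<zero>\<^bsub>R\<^esub> | Node s u \<Rightarrow> f s \<otimes>\<^bsub>R\<^esub> g u),
     one = undefined,
     zero = (\<lambda>t. \<zero>\<^bsub>R\<^esub>),
     add = (\<lambda>f g t. f t \<oplus>\<^bsub>R\<^esub> g t),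
     smult = (\<lambda>a f t. a \<otimes>\<^bsub>R\<^esub> f t)\<rparr>"

definition lie_rels :: "('a, 'r) ring_scheme \<Rightarrow> ('a, 'v, 'm) module_scheme \<Rightarrow> ('v tree \<Rightarrow> 'a) set"
  where "lie_rels R V =
    (let A = tree_alg R V; g = (\<lambda>v. basis_elem R (Leaf v)) in
      {g (v \<oplus>\<^bsub>V\<^esub> w) \<ominus>\<^bsub>A\<^esub> (g v \<oplus>\<^bsub>A\<^esub> g w) | v w. v \<in> carrier V \<and> w \<in> carrier V} \<union>
      {g (a \<odot>\<^bsub>V\<^esub> v) \<ominus>\<^bsub>A\<^esub> a \<odot>\<^bsub>A\<^esub> g v | a v. a \<in> carrier R \<and> v \<in> carrier V} \<union>
      {x \<otimes>\<^bsub>A\<^esub> y \<oplus>\<^bsub>A\<^esub> y \<otimes>\<^bsub>A\<^esub> x | x y. x \<in> carrier A \<and> y \<in> carrier A} \<union>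
      {((x \<otimes>\<^bsub>A\<^esub> y) \<otimes>\<^bsub>A\<^esub> z) \<oplus>\<^bsub>A\<^esub> ((y \<otimes>\<^bsub>A\<^esub> z) \<otimes>\<^bsub>A\<^esub> x) \<oplus>\<^bsub>A\<^esub> ((z \<otimes>\<^bsub>A\<^esub> x) \<otimes>\<^bsub>A\<^esub> y) | x y z.
         x \<in> carrier A \<and> y \<in> carrier A \<and> z \<in> carrier A})"

definition lie_ideal :: "('a, 'r) ring_scheme \<Rightarrow> ('a, 'v, 'm) module_scheme \<Rightarrow> ('v tree \<Rightarrow> 'a) set"
  where "lie_ideal R V = ideal_of R (tree_alg R V) (lie_rels R V)"

definition Lie ::
  "('a, 'r) ring_scheme \<Rightarrow> ('a, 'v, 'm) module_scheme \<Rightarrow> ('a, ('v tree \<Rightarrow> 'a) set) module"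
  where "Lie R V = quot (tree_alg R V) (lie_ideal R V)"

definition tree_class ::
  "('a, 'r) ring_scheme \<Rightarrow> ('a, 'v, 'm) module_scheme \<Rightarrow> 'v tree \<Rightarrow> ('v tree \<Rightarrow> 'a) set"
  where "tree_class R V t = lie_ideal R V +>\<^bsub>tree_alg R V\<^esub> basis_elem R t"

definition gen ::
  "('a, 'r) ring_scheme \<Rightarrow> ('a, 'v, 'm) module_scheme \<Rightarrow> 'v \<Rightarrow> ('v tree \<Rightarrow> 'a) set"
  where "gen R V v = tree_class R V (Leaf v)"

text \<open>\<open>lie_part R V S\<close> is the direct sum of the arity \<open>n\<close> parts of \<open>Lie R V\<close> for \<open>n \<in> S\<close>.\<close>

definition lie_part ::
  "('a, 'r) ring_scheme \<Rightarrow> ('a, 'v, 'm) module_scheme \<Rightarrow> nat set \<Rightarrow> ('v tree \<Rightarrow> 'a) set set"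
  where "lie_part R V S = span_of R (Lie R V) (tree_class R V ` {t \<in> trees_on V. leaves t \<in> S})"

definition lie_map ::
  "('a, 'r) ring_scheme \<Rightarrow> ('a, 'v, 'm) module_scheme \<Rightarrow> ('a, 'w, 'n) module_scheme \<Rightarrow>
    ('v \<Rightarrow> 'w) \<Rightarrow> ('v tree \<Rightarrow> 'a) set \<Rightarrow> ('w tree \<Rightarrow> 'a) set"
  where "lie_map R V W g =
    (THE \<phi>. \<phi> \<in> alg_hom R (Lie R V) (Lie R W) \<inter> extensional (carrier (Lie R V)) \<and>
       (\<forall>v\<in>carrier V. \<phi> (gen R V v) = gen R W (g v)))"

text \<open>
  Terms linear in one argument: \<open>lie_lin R V W\<close> is \<open>Lie(V;W)\<close>, as a submodule of the free algebra on
  \<open>W \<oplus> V\<close>. The linear argument is the \<^emph>\<open>first\<close> summand, in accordance with \<open>Lie(R \<oplus> V)\<close>.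
\<close>

fun linear_in_fst ::
  "('a, 'w, 'n) module_scheme \<Rightarrow> ('a, 'v, 'm) module_scheme \<Rightarrow> ('w \<times> 'v) tree \<Rightarrow> bool"
  where
    "linear_in_fst W V (Leaf p) \<longleftrightarrow> snd p = \<zero>\<^bsub>V\<^esub>"
  | "linear_in_fst W V (Node s t) \<longleftrightarrow>
       linear_in_fst W V s \<and> fst ` set_tree t \<subseteq> {\<zero>\<^bsub>W\<^esub>} \<or>
       fst ` set_tree s \<subseteq> {\<zero>\<^bsub>W\<^esub>} \<and> linear_in_fst W V t"

definition lie_lin ::
  "('a, 'r) ring_scheme \<Rightarrow> ('a, 'v, 'm) module_scheme \<Rightarrow> ('a, 'w, 'n) module_scheme \<Rightarrow>
    (('w \<times> 'v) tree \<Rightarrow> 'a) set set"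
  where "lie_lin R V W = span_of R (Lie R (dsum W V))
    (tree_class R (dsum W V) ` {t \<in> trees_on (dsum W V). linear_in_fst W V t})"

fun marked_trees :: "('a, 'v, 'm) module_scheme \<Rightarrow> 'v tree \<Rightarrow> ('v \<times> 'v) tree list"
  where
    "marked_trees V (Leaf v) = [Leaf (v, \<zero>\<^bsub>V\<^esub>)]"
  | "marked_trees V (Node s t) =
       map (\<lambda>s'. Node s' (map_tree (Pair \<zero>\<^bsub>V\<^esub>) t)) (marked_trees V s) @
       map (\<lambda>t'. Node (map_tree (Pair \<zero>\<^bsub>V\<^esub>) s) t') (marked_trees V t)"

definition lie_delta ::
  "('a, 'r) ring_scheme \<Rightarrow> ('a, 'v, 'm) module_scheme \<Rightarrow> ('v tree \<Rightarrow> 'a) set \<Rightarrow>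
    (('v \<times> 'v) tree \<Rightarrow> 'a) set"
  where "lie_delta R V =
    (THE \<delta>. \<delta> \<in> mod_hom R (Lie R V) (Lie R (dsum V V)) \<inter> extensional (carrier (Lie R V)) \<and>
       (\<forall>t\<in>trees_on V. \<delta> (tree_class R V t) =
          (\<Oplus>\<^bsub>Lie R (dsum V V)\<^esub> k\<in>{..<length (marked_trees V t)}.
             tree_class R (dsum V V) (marked_trees V t ! k))))"


section \<open>Derivations\<close>

type_synonym ('a, 'v) der = "('v tree \<Rightarrow> 'a) set \<Rightarrow> ('v tree \<Rightarrow> 'a) set"

definition derivations :: "('a, 'r) ring_scheme \<Rightarrow> ('a, 'v, 'm) module_scheme \<Rightarrow> ('a, 'v) der set"
  where "derivations R V =
    {d \<in> mod_hom R (Lie R V) (Lie R V) \<inter> extensional (carrier (Lie R V)).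
       \<forall>x\<in>carrier (Lie R V). \<forall>y\<in>carrier (Lie R V).
         d (x \<otimes>\<^bsub>Lie R V\<^esub> y) = d x \<otimes>\<^bsub>Lie R V\<^esub> y \<oplus>\<^bsub>Lie R V\<^esub> x \<otimes>\<^bsub>Lie R V\<^esub> d y}"

text \<open>The inverse of the restriction isomorphism \<open>Der(Lie(V)) \<cong> Hom(V, Lie(V))\<close>.\<close>

definition der_ext ::
  "('a, 'r) ring_scheme \<Rightarrow> ('a, 'v, 'm) module_scheme \<Rightarrow> ('v \<Rightarrow> ('v tree \<Rightarrow> 'a) set) \<Rightarrow> ('a, 'v) der"
  where "der_ext R V h =
    (THE d. d \<in> derivations R V \<and> (\<forall>v\<in>carrier V. d (gen R V v) = h v))"

text \<open>The product of \<open>Der R V\<close> is the preLie product \<open>d \<lhd> e\<close>.\<close>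

definition Der ::
  "('a, 'r) ring_scheme \<Rightarrow> ('a, 'v, 'm) module_scheme \<Rightarrow> ('a, ('a, 'v) der) module"
  where "Der R V =
    \<lparr>carrier = derivations R V,
     mult = (\<lambda>d e. der_ext R V (\<lambda>v. e (d (gen R V v)))),
     one = undefined,
     zero = (\<lambda>x\<in>carrier (Lie R V). \<zero>\<^bsub>Lie R V\<^esub>),
     add = (\<lambda>d e. \<lambda>x\<in>carrier (Lie R V). d x \<oplus>\<^bsub>Lie R V\<^esub> e x),
     smult = (\<lambda>a d. \<lambda>x\<in>carrier (Lie R V). a \<odot>\<^bsub>Lie R V\<^esub> d x)\<rparr>"

definition der_bracket ::
  "('a, 'r) ring_scheme \<Rightarrow> ('a, 'v, 'm) module_scheme \<Rightarrow> ('a, 'v) der \<Rightarrow> ('a, 'v) der \<Rightarrow> ('a, 'v) der"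
  where "der_bracket R V d e = d \<otimes>\<^bsub>Der R V\<^esub> e \<ominus>\<^bsub>Der R V\<^esub> e \<otimes>\<^bsub>Der R V\<^esub> d"

definition Der_pos ::
  "('a, 'r) ring_scheme \<Rightarrow> ('a, 'v, 'm) module_scheme \<Rightarrow> ('a, ('a, 'v) der) module"
  where "Der_pos R V = (Der R V)\<lparr>carrier :=
    {d \<in> derivations R V. \<forall>v\<in>carrier V. d (gen R V v) \<in> lie_part R V {2..}}\<rparr>"

definition der_deg_one ::
  "('a, 'r) ring_scheme \<Rightarrow> ('a, 'v, 'm) module_scheme \<Rightarrow> ('a, 'v) der set"
  where "der_deg_one R V =
    {d \<in> derivations R V. \<forall>v\<in>carrier V. d (gen R V v) \<in> lie_part R V {2}}"

definition Der1 ::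
  "('a, 'r) ring_scheme \<Rightarrow> ('a, 'v, 'm) module_scheme \<Rightarrow> ('a, 'v) der set"
  where "Der1 R V =
    \<Inter>{H. submodule H R (Der R V) \<and> (\<forall>d\<in>H. \<forall>e\<in>H. der_bracket R V d e \<in> H) \<and> der_deg_one R V \<subseteq> H}"

abbreviation pt_mod ::
  "('a, 'r) ring_scheme \<Rightarrow> ('a, 'v, 'm) module_scheme \<Rightarrow> ('a, 'a \<times> 'v) module"
  where "pt_mod R V \<equiv> dsum (self_mod R) V"

definition Der_pt_pos ::
  "('a, 'r) ring_scheme \<Rightarrow> ('a, 'v, 'm) module_scheme \<Rightarrow> ('a, ('a, 'a \<times> 'v) der) module"
  where "Der_pt_pos R V = (Der R (pt_mod R V))\<lparr>carrier :=
    {d \<in> carrier (Der_pos R (pt_mod R V)).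
       (\<forall>v\<in>carrier V. d (gen R (pt_mod R V) (\<zero>\<^bsub>R\<^esub>, v)) = \<zero>\<^bsub>Lie R (pt_mod R V)\<^esub>) \<and>
       d (gen R (pt_mod R V) (\<one>\<^bsub>R\<^esub>, \<zero>\<^bsub>V\<^esub>)) \<in> lie_lin R V (self_mod R)}\<rparr>"

text \<open>
  The isomorphism from \<open>Lie(V;R)\<close> to the pointed derivations: \<open>y\<close> is the image of \<open>1\<close>.
\<close>

definition pt_der ::
  "('a, 'r) ring_scheme \<Rightarrow> ('a, 'v, 'm) module_scheme \<Rightarrow> (('a \<times> 'v) tree \<Rightarrow> 'a) set \<Rightarrow>
    ('a, 'a \<times> 'v) der"
  where "pt_der R V y = der_ext R (pt_mod R V) (\<lambda>p. fst p \<odot>\<^bsub>Lie R (pt_mod R V)\<^esub> y)"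


section \<open>The generalized divergence\<close>

text \<open>
  For \<open>x \<in> Lie(V)\<close> and a linear form \<open>f\<close>, the derivation corresponding to \<open>x \<otimes> f\<close> is the extension
  of \<open>v \<mapsto> f(v) x\<close>, and \<open>lie_map R (dsum V V) (pt_mod R V) (map_prod f id)\<close> restricts to
  \<open>Lie(V;f)\<close> on \<open>Lie(V;V)\<close>.
\<close>

definition Phi ::
  "('a, 'r) ring_scheme \<Rightarrow> ('a, 'v, 'm) module_scheme \<Rightarrow> ('a, 'v) der \<Rightarrow> ('a, 'a \<times> 'v) der"
  where "Phi R V =
    (THE \<Phi>. \<Phi> \<in> mod_hom R (Der R V) (Der R (pt_mod R V)) \<inter> extensional (carrier (Der R V)) \<and>
       (\<forall>x\<in>carrier (Lie R V). \<forall>f\<in>mod_hom R V (self_mod R).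
          \<Phi> (der_ext R V (\<lambda>v. f v \<odot>\<^bsub>Lie R V\<^esub> x)) =
          pt_der R V (lie_map R (dsum V V) (pt_mod R V) (map_prod f id) (lie_delta R V x))))"

definition Div ::
  "('a, 'r) ring_scheme \<Rightarrow> ('a, 'v, 'm) module_scheme \<Rightarrow> ('a, 'v) der \<Rightarrow> ('a, 'a \<times> 'v) der set"
  where "Div R V d = comm_span R (Der_pt_pos R V) +>\<^bsub>Der_pt_pos R V\<^esub> Phi R V d"

definition Im_Div ::
  "('a, 'r) ring_scheme \<Rightarrow> ('a, 'v, 'm) module_scheme \<Rightarrow> ('a, 'a \<times> 'v) der set set"
  where "Im_Div R V = Div R V ` Der1 R V"

definition div_source ::
  "('a, 'r) ring_scheme \<Rightarrow> ('a, 'v, 'm) module_scheme \<Rightarrow> ('a, ('a, 'v) der set) module"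
  where "div_source R V = quot (Der_pos R V) (Der1 R V)"

definition div_target ::
  "('a, 'r) ring_scheme \<Rightarrow> ('a, 'v, 'm) module_scheme \<Rightarrow> ('a, ('a, 'a \<times> 'v) der set set) module"
  where "div_target R V = quot (abel R (Der_pt_pos R V)) (Im_Div R V)"

definition Div_bar ::
  "('a, 'r) ring_scheme \<Rightarrow> ('a, 'v, 'm) module_scheme \<Rightarrow> ('a, 'v) der set \<Rightarrow>
    ('a, 'a \<times> 'v) der set set"
  where "Div_bar R V = induced (abel R (Der_pt_pos R V)) (Im_Div R V) (Div R V)"

definition Div_kernel ::
  "('a, 'r) ring_scheme \<Rightarrow> ('a, 'v, 'm) module_scheme \<Rightarrow> ('a, 'v) der set set"
  where "Div_kernel R V = {X \<in> carrier (div_source R V). Div_bar R V X = \<zero>\<^bsub>div_target R V\<^esub>}"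


section \<open>Functoriality on split monomorphisms\<close>

definition S_mor ::
  "('a, 'r) ring_scheme \<Rightarrow> ('a, 'v, 'm) module_scheme \<Rightarrow> ('a, 'w, 'n) module_scheme \<Rightarrow>
    (('v \<Rightarrow> 'w) \<times> ('w \<Rightarrow> 'v)) set"
  where "S_mor R V W =
    {(i, r). i \<in> mod_hom R V W \<and> r \<in> mod_hom R W V \<and> (\<forall>v\<in>carrier V. r (i v) = v)}"

definition Der_map ::
  "('a, 'r) ring_scheme \<Rightarrow> ('a, 'v, 'm) module_scheme \<Rightarrow> ('a, 'w, 'n) module_scheme \<Rightarrow>
    ('v \<Rightarrow> 'w) \<times> ('w \<Rightarrow> 'v) \<Rightarrow> ('a, 'v) der \<Rightarrow> ('a, 'w) der"
  where "Der_map R V W p d = der_ext R W (\<lambda>w. lie_map R V W (fst p) (d (gen R V (snd p w))))"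

definition div_source_map ::
  "('a, 'r) ring_scheme \<Rightarrow> ('a, 'v, 'm) module_scheme \<Rightarrow> ('a, 'w, 'n) module_scheme \<Rightarrow>
    ('v \<Rightarrow> 'w) \<times> ('w \<Rightarrow> 'v) \<Rightarrow> ('a, 'v) der set \<Rightarrow> ('a, 'w) der set"
  where "div_source_map R V W p = induced (Der_pos R W) (Der1 R W) (Der_map R V W p)"

definition div_target_map ::
  "('a, 'r) ring_scheme \<Rightarrow> ('a, 'v, 'm) module_scheme \<Rightarrow> ('a, 'w, 'n) module_scheme \<Rightarrow>
    ('v \<Rightarrow> 'w) \<times> ('w \<Rightarrow> 'v) \<Rightarrow> ('a, 'a \<times> 'v) der set set \<Rightarrow> ('a, 'a \<times> 'w) der set set"
  where "div_target_map R V W p =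
    induced (abel R (Der_pt_pos R W)) (Im_Div R W)
      (induced (Der_pt_pos R W) (comm_span R (Der_pt_pos R W))
        (Der_map R (pt_mod R V) (pt_mod R W) (map_prod id (fst p), map_prod id (snd p))))"

definition stab_mor ::
  "('a, 'r) ring_scheme \<Rightarrow> nat \<Rightarrow> ('v \<Rightarrow> 'v \<times> (nat \<Rightarrow> 'a)) \<times> ('v \<times> (nat \<Rightarrow> 'a) \<Rightarrow> 'v)"
  where "stab_mor R n = ((\<lambda>v. (v, \<zero>\<^bsub>pow_mod R n\<^esub>)), fst)"


section \<open>Tensor algebras\<close>

definition word_alg ::
  "('a, 'r) ring_scheme \<Rightarrow> ('a, 'v, 'm) module_scheme \<Rightarrow> ('a, 'v list \<Rightarrow> 'a) module"
  where "word_alg R V =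
    \<lparr>carrier = free_elems R (lists (carrier V)),
     mult = (\<lambda>f g w. \<Oplus>\<^bsub>R\<^esub> k\<in>{..length w}. f (take k w) \<otimes>\<^bsub>R\<^esub> g (drop k w)),
     one = basis_elem R [],
     zero = (\<lambda>w. \<zero>\<^bsub>R\<^esub>),
     add = (\<lambda>f g w. f w \<oplus>\<^bsub>R\<^esub> g w),
     smult = (\<lambda>a f w. a \<otimes>\<^bsub>R\<^esub> f w)\<rparr>"

definition tensor_rels :: "('a, 'r) ring_scheme \<Rightarrow> ('a, 'v, 'm) module_scheme \<Rightarrow> ('v list \<Rightarrow> 'a) set"
  where "tensor_rels R V =
    (let A = word_alg R V; g = (\<lambda>v. basis_elem R [v]) in
      {g (v \<oplus>\<^bsub>V\<^esub> w) \<ominus>\<^bsub>A\<^esub> (g v \<oplus>\<^bsub>A\<^esub> g w) | v w. v \<in> carrier V \<and> w \<in> carrier V} \<union>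
      {g (a \<odot>\<^bsub>V\<^esub> v) \<ominus>\<^bsub>A\<^esub> a \<odot>\<^bsub>A\<^esub> g v | a v. a \<in> carrier R \<and> v \<in> carrier V})"

definition tensor_ideal :: "('a, 'r) ring_scheme \<Rightarrow> ('a, 'v, 'm) module_scheme \<Rightarrow> ('v list \<Rightarrow> 'a) set"
  where "tensor_ideal R V = ideal_of R (word_alg R V) (tensor_rels R V)"

definition tensor_alg ::
  "('a, 'r) ring_scheme \<Rightarrow> ('a, 'v, 'm) module_scheme \<Rightarrow> ('a, ('v list \<Rightarrow> 'a) set) module"
  where "tensor_alg R V = quot (word_alg R V) (tensor_ideal R V)"

definition word_class ::
  "('a, 'r) ring_scheme \<Rightarrow> ('a, 'v, 'm) module_scheme \<Rightarrow> 'v list \<Rightarrow> ('v list \<Rightarrow> 'a) set"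
  where "word_class R V w = tensor_ideal R V +>\<^bsub>word_alg R V\<^esub> basis_elem R w"

definition tensor_pos ::
  "('a, 'r) ring_scheme \<Rightarrow> ('a, 'v, 'm) module_scheme \<Rightarrow> ('a, ('v list \<Rightarrow> 'a) set) module"
  where "tensor_pos R V = (tensor_alg R V)\<lparr>carrier :=
    span_of R (tensor_alg R V) (word_class R V ` {w \<in> lists (carrier V). w \<noteq> []})\<rparr>"

definition tensor_abel_deg_one ::
  "('a, 'r) ring_scheme \<Rightarrow> ('a, 'v, 'm) module_scheme \<Rightarrow> ('v list \<Rightarrow> 'a) set set set"
  where "tensor_abel_deg_one R V =
    (\<lambda>v. comm_span R (tensor_pos R V) +>\<^bsub>tensor_pos R V\<^esub> word_class R V [v]) ` carrier V"

definition right_normed ::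
  "('a, 'r) ring_scheme \<Rightarrow> ('a, 'v, 'm) module_scheme \<Rightarrow> 'v list \<Rightarrow> (('a \<times> 'v) tree \<Rightarrow> 'a) set"
  where "right_normed R V w =
    foldr (\<lambda>v x. gen R (pt_mod R V) (\<zero>\<^bsub>R\<^esub>, v) \<otimes>\<^bsub>Lie R (pt_mod R V)\<^esub> x) w
      (gen R (pt_mod R V) (\<one>\<^bsub>R\<^esub>, \<zero>\<^bsub>V\<^esub>))"

definition tensor_to_der ::
  "('a, 'r) ring_scheme \<Rightarrow> ('a, 'v, 'm) module_scheme \<Rightarrow> ('v list \<Rightarrow> 'a) set \<Rightarrow> ('a, 'a \<times> 'v) der"
  where "tensor_to_der R V =
    (THE \<theta>. \<theta> \<in> mod_hom R (tensor_alg R V) (Der R (pt_mod R V)) \<inter>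
          extensional (carrier (tensor_alg R V)) \<and>
       (\<forall>w\<in>lists (carrier V). \<theta> (word_class R V w) = pt_der R V (right_normed R V w)))"

definition tensor_comparison ::
  "('a, 'r) ring_scheme \<Rightarrow> ('a, 'v, 'm) module_scheme \<Rightarrow> ('v list \<Rightarrow> 'a) set set set \<Rightarrow>
    ('a, 'a \<times> 'v) der set set"
  where "tensor_comparison R V =
    induced (abel R (Der_pt_pos R V)) (Im_Div R V)
      (induced (Der_pt_pos R V) (comm_span R (Der_pt_pos R V)) (tensor_to_der R V))"

end

theory Submission
  imports Defs
begin

text \<open>
  Why the theorem holds. Write \<open>1\<close> for the marked generator of \<open>Lie(R \<oplus> V)\<close>. A pointed derivation
  is determined by the image \<open>z\<close> of \<open>1\<close>, an element of \<open>Lie(V;R)\<close>, and in these terms \<open>y \<lhd> z\<close>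
  substitutes \<open>z\<close> for \<open>1\<close> in \<open>y\<close>. For a linear form \<open>f\<close> on \<open>V\<close> let \<open>D\<^sub>f : Lie(V) \<rightarrow> Lie(V;R)\<close> be the
  Fox derivative, that is, the derivation over the inclusion \<open>Lie(V) \<rightarrow> Lie(R \<oplus> V)\<close> which sends a
  generator \<open>v\<close> to \<open>f(v)\<cdot>1\<close>. Then the divergence of the derivation \<open>x \<otimes> f\<close> is the class of \<open>D\<^sub>f(x)\<close>,
  and since \<open>V\<close> is free of finite rank these derivations span.

  \<^item> \<^emph>\<open>The divergence on the algebra generated in degree one.\<close> For \<open>e = y \<otimes> g\<close> and \<open>e'\<close> its extension to
    \<open>Lie(R \<oplus> V)\<close> killing \<open>1\<close> one has \<open>D\<^sub>f(e(x)) = e'(D\<^sub>f(x)) + D\<^sub>g(x) \<lhd> D\<^sub>f(y)\<close> (lemma \<open>fox_elem_der\<close>),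
    hence \<open>Div [d,e] = e'(Div d) - d'(Div e)\<close> modulo commutators. The map \<open>e'\<close> is a derivation for
    \<open>\<lhd>\<close>, so it preserves commutators, and it sends \<open>[v,1]\<close> to \<open>[e(v),1]\<close>, which is a commutator when \<open>e\<close>
    is positive. So the positive derivations whose divergence lies in the span of the commutators and
    the \<open>[v,1]\<close> form a Lie subalgebra; it contains the degree one part, because
    \<open>D\<^sub>f[u,w] = [f(w)u - f(u)w, 1]\<close> (lemma \<open>div_lin_Der1\<close>). The last formula also shows that every
    \<open>[v,1]\<close> is a divergence, except when \<open>V\<close> has rank one, where the expression vanishes.

  \<^item> \<^emph>\<open>Torsion.\<close> Let \<open>W = V \<oplus> R\<^sup>3\<close>, with new basis vectors \<open>c\<^sub>0, c\<^sub>1, c\<^sub>2\<close> and dual forms \<open>c\<^sub>s\<^sup>*\<close>. If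
    \<open>c\<^sub>s\<^sup>*(u) = 0\<close>, then \<open>[[u,c\<^sub>s] \<otimes> f, z \<otimes> c\<^sub>s\<^sup>*] = [u,z] \<otimes> f - (([u,c\<^sub>s] \<otimes> f)(z)) \<otimes> c\<^sub>s\<^sup>*\<close>. This identity
    does all the work. First, \<open>x \<otimes> c\<^sub>s\<^sup>*\<close> is generated in degree one when \<open>x\<close> has arity at least two and
    does not involve two of the new vectors, one of them being \<open>c\<^sub>s\<close> (lemma \<open>fresh_coordinate\<close>). Second, modulo \<open>Der\<^sup>(\<^sup>1\<^sup>)\<close>
    every positive \<open>d\<close> of \<open>Lie(V)\<close> becomes equal to \<open>z(c\<^sub>0) \<otimes> c\<^sub>0\<^sup>*\<close>, where \<open>z\<close> is its divergence and
    \<open>z(c)\<close> is obtained from \<open>z\<close> by putting \<open>c\<close> for \<open>1\<close> (lemma \<open>stabilize_reduce\<close>). Third, the bracket of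
    \<open>y(c\<^sub>t) \<otimes> c\<^sub>s\<^sup>*\<close> and \<open>z(c\<^sub>s) \<otimes> c\<^sub>t\<^sup>*\<close> is
    \<open>(y \<lhd> z)(c\<^sub>s) \<otimes> c\<^sub>s\<^sup>* - (z \<lhd> y)(c\<^sub>t) \<otimes> c\<^sub>t\<^sup>*\<close>; moving through the three indices in a circle shows
    that \<open>z(c\<^sub>0) \<otimes> c\<^sub>0\<^sup>*\<close> is generated in degree one when \<open>z\<close> is a commutator (lemma \<open>plug_der_low\<close>).

  \<^item> \<^emph>\<open>Comparison with the tensor algebra.\<close> Sending \<open>v\<^sub>1 \<otimes> \<dots> \<otimes> v\<^sub>n\<close> to \<open>[v\<^sub>1,[\<dots>,[v\<^sub>n,1]]]\<close> turns the product of
    \<open>T(V)\<close> into \<open>\<lhd>\<close> and is onto \<open>Lie(V;R)\<close> by the Jacobi identity. It is injective because the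
    derivation \<open>Lie(R \<oplus> V) \<rightarrow> T(V)\<close> with \<open>1 \<mapsto> 1\<close> and \<open>v \<mapsto> 0\<close>, taken over \<open>v \<mapsto> v\<close> and the action of
    \<open>T(V)\<close> on itself by left multiplication, is a left inverse (lemma \<open>tensor_retraction\<close>).

  Existence and uniqueness of all derivations involved come from the universal property of the free
  algebra, applied to split extensions of Lie algebras.
\<close>

section \<open>Linear algebra over a commutative ring\<close>

definition bilin_alg :: "('a, 'r) ring_scheme \<Rightarrow> ('a, 'b, 'm) module_scheme \<Rightarrow> bool"
  where "bilin_alg R A \<longleftrightarrow> module R A \<and>
    (\<forall>x\<in>carrier A. (\<lambda>y. x \<otimes>\<^bsub>A\<^esub> y) \<in> mod_hom R A A \<and> (\<lambda>y. y \<otimes>\<^bsub>A\<^esub> x) \<in> mod_hom R A A)"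

definition lie_alg :: "('a, 'r) ring_scheme \<Rightarrow> ('a, 'b, 'm) module_scheme \<Rightarrow> bool"
  where "lie_alg R L \<longleftrightarrow> bilin_alg R L \<and>
    (\<forall>x\<in>carrier L. \<forall>y\<in>carrier L. x \<otimes>\<^bsub>L\<^esub> y \<oplus>\<^bsub>L\<^esub> y \<otimes>\<^bsub>L\<^esub> x = \<zero>\<^bsub>L\<^esub>) \<and>
    (\<forall>x\<in>carrier L. \<forall>y\<in>carrier L. \<forall>z\<in>carrier L.
      ((x \<otimes>\<^bsub>L\<^esub> y) \<otimes>\<^bsub>L\<^esub> z) \<oplus>\<^bsub>L\<^esub> ((y \<otimes>\<^bsub>L\<^esub> z) \<otimes>\<^bsub>L\<^esub> x) \<oplus>\<^bsub>L\<^esub> ((z \<otimes>\<^bsub>L\<^esub> x) \<otimes>\<^bsub>L\<^esub> y) = \<zero>\<^bsub>L\<^esub>)"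

context cring
begin

lemma mod_abelian: "module R M \<Longrightarrow> abelian_group M"
  by (rule module.axioms(2))

lemma
  assumes "module R M"
  shows mod_add[simp]: "x \<in> carrier M \<Longrightarrow> y \<in> carrier M \<Longrightarrow> x \<oplus>\<^bsub>M\<^esub> y \<in> carrier M"
    and mod_zero[simp]: "\<zero>\<^bsub>M\<^esub> \<in> carrier M"
    and mod_neg[simp]: "x \<in> carrier M \<Longrightarrow> \<ominus>\<^bsub>M\<^esub> x \<in> carrier M"
    and mod_diff[simp]: "x \<in> carrier M \<Longrightarrow> y \<in> carrier M \<Longrightarrow> x \<ominus>\<^bsub>M\<^esub> y \<in> carrier M"
    and mod_smult[simp]: "a \<in> carrier R \<Longrightarrow> x \<in> carrier M \<Longrightarrow> a \<odot>\<^bsub>M\<^esub> x \<in> carrier M"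
    and mod_l_zero[simp]: "x \<in> carrier M \<Longrightarrow> \<zero>\<^bsub>M\<^esub> \<oplus>\<^bsub>M\<^esub> x = x"
    and mod_r_zero[simp]: "x \<in> carrier M \<Longrightarrow> x \<oplus>\<^bsub>M\<^esub> \<zero>\<^bsub>M\<^esub> = x"
    and mod_neg_zero[simp]: "\<ominus>\<^bsub>M\<^esub> \<zero>\<^bsub>M\<^esub> = \<zero>\<^bsub>M\<^esub>"
    and mod_neg_neg[simp]: "x \<in> carrier M \<Longrightarrow> \<ominus>\<^bsub>M\<^esub> (\<ominus>\<^bsub>M\<^esub> x) = x"
    and mod_l_neg[simp]: "x \<in> carrier M \<Longrightarrow> \<ominus>\<^bsub>M\<^esub> x \<oplus>\<^bsub>M\<^esub> x = \<zero>\<^bsub>M\<^esub>"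
    and mod_r_neg[simp]: "x \<in> carrier M \<Longrightarrow> x \<oplus>\<^bsub>M\<^esub> \<ominus>\<^bsub>M\<^esub> x = \<zero>\<^bsub>M\<^esub>"
    and mod_diff_self[simp]: "x \<in> carrier M \<Longrightarrow> x \<ominus>\<^bsub>M\<^esub> x = \<zero>\<^bsub>M\<^esub>"
    and mod_smult_zero[simp]: "a \<in> carrier R \<Longrightarrow> a \<odot>\<^bsub>M\<^esub> \<zero>\<^bsub>M\<^esub> = \<zero>\<^bsub>M\<^esub>"
    and mod_zero_smult[simp]: "x \<in> carrier M \<Longrightarrow> \<zero> \<odot>\<^bsub>M\<^esub> x = \<zero>\<^bsub>M\<^esub>"
    and mod_one_smult[simp]: "x \<in> carrier M \<Longrightarrow> \<one> \<odot>\<^bsub>M\<^esub> x = x"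
    and mod_assoc: "x \<in> carrier M \<Longrightarrow> y \<in> carrier M \<Longrightarrow> z \<in> carrier M \<Longrightarrow>
      (x \<oplus>\<^bsub>M\<^esub> y) \<oplus>\<^bsub>M\<^esub> z = x \<oplus>\<^bsub>M\<^esub> (y \<oplus>\<^bsub>M\<^esub> z)"
    and mod_comm: "x \<in> carrier M \<Longrightarrow> y \<in> carrier M \<Longrightarrow> x \<oplus>\<^bsub>M\<^esub> y = y \<oplus>\<^bsub>M\<^esub> x"
    and mod_lcomm: "x \<in> carrier M \<Longrightarrow> y \<in> carrier M \<Longrightarrow> z \<in> carrier M \<Longrightarrow>
      x \<oplus>\<^bsub>M\<^esub> (y \<oplus>\<^bsub>M\<^esub> z) = y \<oplus>\<^bsub>M\<^esub> (x \<oplus>\<^bsub>M\<^esub> z)"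
    and mod_neg_add: "x \<in> carrier M \<Longrightarrow> y \<in> carrier M \<Longrightarrow> \<ominus>\<^bsub>M\<^esub> (x \<oplus>\<^bsub>M\<^esub> y) = \<ominus>\<^bsub>M\<^esub> x \<oplus>\<^bsub>M\<^esub> \<ominus>\<^bsub>M\<^esub> y"
    and mod_cancel1: "x \<in> carrier M \<Longrightarrow> y \<in> carrier M \<Longrightarrow> x \<oplus>\<^bsub>M\<^esub> (\<ominus>\<^bsub>M\<^esub> x \<oplus>\<^bsub>M\<^esub> y) = y"
    and mod_cancel2: "x \<in> carrier M \<Longrightarrow> y \<in> carrier M \<Longrightarrow> \<ominus>\<^bsub>M\<^esub> x \<oplus>\<^bsub>M\<^esub> (x \<oplus>\<^bsub>M\<^esub> y) = y"
    and mod_smult_add: "a \<in> carrier R \<Longrightarrow> x \<in> carrier M \<Longrightarrow> y \<in> carrier M \<Longrightarrow>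
      a \<odot>\<^bsub>M\<^esub> (x \<oplus>\<^bsub>M\<^esub> y) = a \<odot>\<^bsub>M\<^esub> x \<oplus>\<^bsub>M\<^esub> a \<odot>\<^bsub>M\<^esub> y"
    and mod_add_smult: "a \<in> carrier R \<Longrightarrow> b \<in> carrier R \<Longrightarrow> x \<in> carrier M \<Longrightarrow>
      (a \<oplus> b) \<odot>\<^bsub>M\<^esub> x = a \<odot>\<^bsub>M\<^esub> x \<oplus>\<^bsub>M\<^esub> b \<odot>\<^bsub>M\<^esub> x"
    and mod_mult_smult: "a \<in> carrier R \<Longrightarrow> b \<in> carrier R \<Longrightarrow> x \<in> carrier M \<Longrightarrow>
      (a \<otimes> b) \<odot>\<^bsub>M\<^esub> x = a \<odot>\<^bsub>M\<^esub> (b \<odot>\<^bsub>M\<^esub> x)"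
    and mod_smult_neg: "a \<in> carrier R \<Longrightarrow> x \<in> carrier M \<Longrightarrow> a \<odot>\<^bsub>M\<^esub> (\<ominus>\<^bsub>M\<^esub> x) = \<ominus>\<^bsub>M\<^esub> (a \<odot>\<^bsub>M\<^esub> x)"
    and mod_neg_smult: "a \<in> carrier R \<Longrightarrow> x \<in> carrier M \<Longrightarrow> (\<ominus> a) \<odot>\<^bsub>M\<^esub> x = \<ominus>\<^bsub>M\<^esub> (a \<odot>\<^bsub>M\<^esub> x)"
    and mod_diff_eq: "x \<in> carrier M \<Longrightarrow> y \<in> carrier M \<Longrightarrow> x \<ominus>\<^bsub>M\<^esub> y = x \<oplus>\<^bsub>M\<^esub> \<ominus>\<^bsub>M\<^esub> y"
    and mod_diff_zero_iff: "x \<in> carrier M \<Longrightarrow> y \<in> carrier M \<Longrightarrow> x \<ominus>\<^bsub>M\<^esub> y = \<zero>\<^bsub>M\<^esub> \<longleftrightarrow> x = y"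
    and mod_add_zero_iff: "x \<in> carrier M \<Longrightarrow> y \<in> carrier M \<Longrightarrow> x \<oplus>\<^bsub>M\<^esub> y = \<zero>\<^bsub>M\<^esub> \<longleftrightarrow> x = \<ominus>\<^bsub>M\<^esub> y"
proof -
  interpret M: module R M by fact
  show "x \<in> carrier M \<Longrightarrow> y \<in> carrier M \<Longrightarrow> x \<oplus>\<^bsub>M\<^esub> y \<in> carrier M"
    "\<zero>\<^bsub>M\<^esub> \<in> carrier M"
    "x \<in> carrier M \<Longrightarrow> \<ominus>\<^bsub>M\<^esub> x \<in> carrier M"
    "x \<in> carrier M \<Longrightarrow> y \<in> carrier M \<Longrightarrow> x \<ominus>\<^bsub>M\<^esub> y \<in> carrier M"
    "a \<in> carrier R \<Longrightarrow> x \<in> carrier M \<Longrightarrow> a \<odot>\<^bsub>M\<^esub> x \<in> carrier M"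
    "x \<in> carrier M \<Longrightarrow> \<zero>\<^bsub>M\<^esub> \<oplus>\<^bsub>M\<^esub> x = x"
    "x \<in> carrier M \<Longrightarrow> x \<oplus>\<^bsub>M\<^esub> \<zero>\<^bsub>M\<^esub> = x"
    "\<ominus>\<^bsub>M\<^esub> \<zero>\<^bsub>M\<^esub> = \<zero>\<^bsub>M\<^esub>"
    "x \<in> carrier M \<Longrightarrow> \<ominus>\<^bsub>M\<^esub> (\<ominus>\<^bsub>M\<^esub> x) = x"
    "x \<in> carrier M \<Longrightarrow> \<ominus>\<^bsub>M\<^esub> x \<oplus>\<^bsub>M\<^esub> x = \<zero>\<^bsub>M\<^esub>"
    "x \<in> carrier M \<Longrightarrow> x \<oplus>\<^bsub>M\<^esub> \<ominus>\<^bsub>M\<^esub> x = \<zero>\<^bsub>M\<^esub>"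
    "x \<in> carrier M \<Longrightarrow> x \<ominus>\<^bsub>M\<^esub> x = \<zero>\<^bsub>M\<^esub>"
    "a \<in> carrier R \<Longrightarrow> a \<odot>\<^bsub>M\<^esub> \<zero>\<^bsub>M\<^esub> = \<zero>\<^bsub>M\<^esub>"
    "x \<in> carrier M \<Longrightarrow> \<zero> \<odot>\<^bsub>M\<^esub> x = \<zero>\<^bsub>M\<^esub>"
    "x \<in> carrier M \<Longrightarrow> \<one> \<odot>\<^bsub>M\<^esub> x = x"
    by (simp_all add: M.l_neg M.r_neg M.minus_eq M.add.inv_one)
  show "x \<in> carrier M \<Longrightarrow> y \<in> carrier M \<Longrightarrow> z \<in> carrier M \<Longrightarrow>
      (x \<oplus>\<^bsub>M\<^esub> y) \<oplus>\<^bsub>M\<^esub> z = x \<oplus>\<^bsub>M\<^esub> (y \<oplus>\<^bsub>M\<^esub> z)"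
    "x \<in> carrier M \<Longrightarrow> y \<in> carrier M \<Longrightarrow> x \<oplus>\<^bsub>M\<^esub> y = y \<oplus>\<^bsub>M\<^esub> x"
    "x \<in> carrier M \<Longrightarrow> y \<in> carrier M \<Longrightarrow> z \<in> carrier M \<Longrightarrow>
      x \<oplus>\<^bsub>M\<^esub> (y \<oplus>\<^bsub>M\<^esub> z) = y \<oplus>\<^bsub>M\<^esub> (x \<oplus>\<^bsub>M\<^esub> z)"
    "x \<in> carrier M \<Longrightarrow> y \<in> carrier M \<Longrightarrow> \<ominus>\<^bsub>M\<^esub> (x \<oplus>\<^bsub>M\<^esub> y) = \<ominus>\<^bsub>M\<^esub> x \<oplus>\<^bsub>M\<^esub> \<ominus>\<^bsub>M\<^esub> y"
    "x \<in> carrier M \<Longrightarrow> y \<in> carrier M \<Longrightarrow> x \<oplus>\<^bsub>M\<^esub> (\<ominus>\<^bsub>M\<^esub> x \<oplus>\<^bsub>M\<^esub> y) = y"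
    "x \<in> carrier M \<Longrightarrow> y \<in> carrier M \<Longrightarrow> \<ominus>\<^bsub>M\<^esub> x \<oplus>\<^bsub>M\<^esub> (x \<oplus>\<^bsub>M\<^esub> y) = y"
    "a \<in> carrier R \<Longrightarrow> x \<in> carrier M \<Longrightarrow> y \<in> carrier M \<Longrightarrow>
      a \<odot>\<^bsub>M\<^esub> (x \<oplus>\<^bsub>M\<^esub> y) = a \<odot>\<^bsub>M\<^esub> x \<oplus>\<^bsub>M\<^esub> a \<odot>\<^bsub>M\<^esub> y"
    "a \<in> carrier R \<Longrightarrow> b \<in> carrier R \<Longrightarrow> x \<in> carrier M \<Longrightarrow>
      (a \<oplus> b) \<odot>\<^bsub>M\<^esub> x = a \<odot>\<^bsub>M\<^esub> x \<oplus>\<^bsub>M\<^esub> b \<odot>\<^bsub>M\<^esub> x"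
    "a \<in> carrier R \<Longrightarrow> b \<in> carrier R \<Longrightarrow> x \<in> carrier M \<Longrightarrow>
      (a \<otimes> b) \<odot>\<^bsub>M\<^esub> x = a \<odot>\<^bsub>M\<^esub> (b \<odot>\<^bsub>M\<^esub> x)"
    "a \<in> carrier R \<Longrightarrow> x \<in> carrier M \<Longrightarrow> a \<odot>\<^bsub>M\<^esub> (\<ominus>\<^bsub>M\<^esub> x) = \<ominus>\<^bsub>M\<^esub> (a \<odot>\<^bsub>M\<^esub> x)"
    "a \<in> carrier R \<Longrightarrow> x \<in> carrier M \<Longrightarrow> (\<ominus> a) \<odot>\<^bsub>M\<^esub> x = \<ominus>\<^bsub>M\<^esub> (a \<odot>\<^bsub>M\<^esub> x)"
    "x \<in> carrier M \<Longrightarrow> y \<in> carrier M \<Longrightarrow> x \<ominus>\<^bsub>M\<^esub> y = x \<oplus>\<^bsub>M\<^esub> \<ominus>\<^bsub>M\<^esub> y"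
    by (rule M.a_assoc M.a_comm M.a_lcomm M.minus_add M.r_neg1 M.r_neg2 M.smult_r_distr
        M.smult_l_distr M.smult_assoc1 M.smult_l_minus M.smult_r_minus M.minus_eq; assumption)+
  show "x \<in> carrier M \<Longrightarrow> y \<in> carrier M \<Longrightarrow> x \<oplus>\<^bsub>M\<^esub> y = \<zero>\<^bsub>M\<^esub> \<longleftrightarrow> x = \<ominus>\<^bsub>M\<^esub> y"
    using M.minus_equality M.l_neg by (metis M.minus_minus)
  then show "x \<in> carrier M \<Longrightarrow> y \<in> carrier M \<Longrightarrow> x \<ominus>\<^bsub>M\<^esub> y = \<zero>\<^bsub>M\<^esub> \<longleftrightarrow> x = y"
    unfolding M.minus_eq using M.minus_equality M.r_neg by (metis M.minus_minus M.a_inv_closed M.a_comm)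
qed

text \<open>Associative-commutative rewriting puts \<open>x\<close> somewhere to the left of \<open>\<ominus>x\<close>; these rules
  cancel the two across up to three intermediate summands.\<close>

lemma mod_cancel_far:
  assumes "module R M"
  shows "x \<in> carrier M \<Longrightarrow> a \<in> carrier M \<Longrightarrow> x \<oplus>\<^bsub>M\<^esub> (a \<oplus>\<^bsub>M\<^esub> \<ominus>\<^bsub>M\<^esub> x) = a"
    "x \<in> carrier M \<Longrightarrow> a \<in> carrier M \<Longrightarrow> t \<in> carrier M \<Longrightarrow>
      x \<oplus>\<^bsub>M\<^esub> (a \<oplus>\<^bsub>M\<^esub> (\<ominus>\<^bsub>M\<^esub> x \<oplus>\<^bsub>M\<^esub> t)) = a \<oplus>\<^bsub>M\<^esub> t"
    "x \<in> carrier M \<Longrightarrow> a \<in> carrier M \<Longrightarrow> b \<in> carrier M \<Longrightarrow>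
      x \<oplus>\<^bsub>M\<^esub> (a \<oplus>\<^bsub>M\<^esub> (b \<oplus>\<^bsub>M\<^esub> \<ominus>\<^bsub>M\<^esub> x)) = a \<oplus>\<^bsub>M\<^esub> b"
    "x \<in> carrier M \<Longrightarrow> a \<in> carrier M \<Longrightarrow> b \<in> carrier M \<Longrightarrow> t \<in> carrier M \<Longrightarrow>
      x \<oplus>\<^bsub>M\<^esub> (a \<oplus>\<^bsub>M\<^esub> (b \<oplus>\<^bsub>M\<^esub> (\<ominus>\<^bsub>M\<^esub> x \<oplus>\<^bsub>M\<^esub> t))) = a \<oplus>\<^bsub>M\<^esub> (b \<oplus>\<^bsub>M\<^esub> t)"
    "x \<in> carrier M \<Longrightarrow> a \<in> carrier M \<Longrightarrow> b \<in> carrier M \<Longrightarrow> c \<in> carrier M \<Longrightarrow>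
      x \<oplus>\<^bsub>M\<^esub> (a \<oplus>\<^bsub>M\<^esub> (b \<oplus>\<^bsub>M\<^esub> (c \<oplus>\<^bsub>M\<^esub> \<ominus>\<^bsub>M\<^esub> x))) = a \<oplus>\<^bsub>M\<^esub> (b \<oplus>\<^bsub>M\<^esub> c)"
    "x \<in> carrier M \<Longrightarrow> a \<in> carrier M \<Longrightarrow> b \<in> carrier M \<Longrightarrow> c \<in> carrier M \<Longrightarrow> t \<in> carrier M \<Longrightarrow>
      x \<oplus>\<^bsub>M\<^esub> (a \<oplus>\<^bsub>M\<^esub> (b \<oplus>\<^bsub>M\<^esub> (c \<oplus>\<^bsub>M\<^esub> (\<ominus>\<^bsub>M\<^esub> x \<oplus>\<^bsub>M\<^esub> t)))) = a \<oplus>\<^bsub>M\<^esub> (b \<oplus>\<^bsub>M\<^esub> (c \<oplus>\<^bsub>M\<^esub> t))"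
  using assms by (simp_all add: mod_lcomm[of M x a] mod_lcomm[of M x b] mod_lcomm[of M x c] mod_cancel1)

lemmas mod_ac = mod_assoc mod_comm mod_lcomm mod_neg_add mod_cancel1 mod_cancel2 mod_diff_eq
  mod_cancel_far

lemma mod_diff_zero: "module R M \<Longrightarrow> x \<in> carrier M \<Longrightarrow> x \<ominus>\<^bsub>M\<^esub> \<zero>\<^bsub>M\<^esub> = x"
  by (simp add: mod_diff_eq)

lemma mod_swap:
  assumes "module R M" "a \<in> carrier M" "b \<in> carrier M" "c \<in> carrier M" "d \<in> carrier M"
  shows "(a \<oplus>\<^bsub>M\<^esub> b) \<oplus>\<^bsub>M\<^esub> (c \<oplus>\<^bsub>M\<^esub> d) = (a \<oplus>\<^bsub>M\<^esub> c) \<oplus>\<^bsub>M\<^esub> (b \<oplus>\<^bsub>M\<^esub> d)"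
  using assms by (simp add: mod_ac)

lemma mod_smult_comm:
  assumes "module R M" "a \<in> carrier R" "b \<in> carrier R" "x \<in> carrier M"
  shows "a \<odot>\<^bsub>M\<^esub> (b \<odot>\<^bsub>M\<^esub> x) = b \<odot>\<^bsub>M\<^esub> (a \<odot>\<^bsub>M\<^esub> x)"
  using assms by (metis m_comm mod_mult_smult)

subsection \<open>Linear maps\<close>

lemma mod_homI:
  assumes "\<And>x. x \<in> carrier M \<Longrightarrow> f x \<in> carrier N"
    and "\<And>x y. x \<in> carrier M \<Longrightarrow> y \<in> carrier M \<Longrightarrow> f (x \<oplus>\<^bsub>M\<^esub> y) = f x \<oplus>\<^bsub>N\<^esub> f y"
    and "\<And>a x. a \<in> carrier R \<Longrightarrow> x \<in> carrier M \<Longrightarrow> f (a \<odot>\<^bsub>M\<^esub> x) = a \<odot>\<^bsub>N\<^esub> f x"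
  shows "f \<in> mod_hom R M N"
  using assms by (auto simp: mod_hom_def)

lemma
  assumes "f \<in> mod_hom R M N"
  shows hom_closed: "x \<in> carrier M \<Longrightarrow> f x \<in> carrier N"
    and hom_add: "x \<in> carrier M \<Longrightarrow> y \<in> carrier M \<Longrightarrow> f (x \<oplus>\<^bsub>M\<^esub> y) = f x \<oplus>\<^bsub>N\<^esub> f y"
    and hom_smult: "a \<in> carrier R \<Longrightarrow> x \<in> carrier M \<Longrightarrow> f (a \<odot>\<^bsub>M\<^esub> x) = a \<odot>\<^bsub>N\<^esub> f x"
  using assms by (auto simp: mod_hom_def)

lemma hom_zero:
  assumes "module R M" "module R N" "f \<in> mod_hom R M N"
  shows "f \<zero>\<^bsub>M\<^esub> = \<zero>\<^bsub>N\<^esub>"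
  using hom_smult[OF assms(3), of \<zero> "\<zero>\<^bsub>M\<^esub>"] hom_closed[OF assms(3), of "\<zero>\<^bsub>M\<^esub>"] assms by simp

lemma mod_neg_as_smult: "module R M \<Longrightarrow> x \<in> carrier M \<Longrightarrow> \<ominus>\<^bsub>M\<^esub> x = (\<ominus> \<one>) \<odot>\<^bsub>M\<^esub> x"
  by (simp add: mod_neg_smult)

lemma hom_neg:
  assumes "module R M" "module R N" "f \<in> mod_hom R M N" "x \<in> carrier M"
  shows "f (\<ominus>\<^bsub>M\<^esub> x) = \<ominus>\<^bsub>N\<^esub> f x"
  using assms by (simp add: mod_neg_as_smult hom_smult hom_closed[OF assms(3)])

lemma hom_diff:
  assumes "module R M" "module R N" "f \<in> mod_hom R M N" "x \<in> carrier M" "y \<in> carrier M"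
  shows "f (x \<ominus>\<^bsub>M\<^esub> y) = f x \<ominus>\<^bsub>N\<^esub> f y"
  using assms hom_closed[OF assms(3)] by (simp add: mod_diff_eq hom_add hom_neg)

lemma hom_id: "(\<lambda>x. x) \<in> mod_hom R M M"
  by (auto simp: mod_hom_def)

lemma hom_comp: "f \<in> mod_hom R M N \<Longrightarrow> g \<in> mod_hom R N P \<Longrightarrow> (\<lambda>x. g (f x)) \<in> mod_hom R M P"
  by (auto simp: mod_hom_def Pi_iff)

lemma hom_restrict:
  "module R M \<Longrightarrow> f \<in> mod_hom R M N \<Longrightarrow> restrict f (carrier M) \<in> mod_hom R M N"
  by (auto simp: mod_hom_def Pi_iff)

lemma hom_cong: "f \<in> mod_hom R M N \<Longrightarrow> module R M \<Longrightarrow> (\<And>x. x \<in> carrier M \<Longrightarrow> g x = f x) \<Longrightarrow> g \<in> mod_hom R M N"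
  by (auto simp: mod_hom_def Pi_iff)

lemma hom_zero_map: "module R N \<Longrightarrow> (\<lambda>x. \<zero>\<^bsub>N\<^esub>) \<in> mod_hom R M N"
  by (rule mod_homI) auto

lemma hom_add_map:
  assumes "module R N" "f \<in> mod_hom R M N" "g \<in> mod_hom R M N"
  shows "(\<lambda>x. f x \<oplus>\<^bsub>N\<^esub> g x) \<in> mod_hom R M N"
  using assms hom_closed[OF assms(2)] hom_closed[OF assms(3)]
  by (intro mod_homI) (auto simp: hom_add hom_smult mod_swap mod_smult_add)

lemma hom_smult_map:
  assumes "module R N" "f \<in> mod_hom R M N" "a \<in> carrier R"
  shows "(\<lambda>x. a \<odot>\<^bsub>N\<^esub> f x) \<in> mod_hom R M N"
  using assms hom_closed[OF assms(2)]
  by (intro mod_homI) (auto simp: hom_add hom_smult mod_smult_comm mod_smult_add)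

lemma hom_neg_map:
  assumes "module R N" "f \<in> mod_hom R M N"
  shows "(\<lambda>x. \<ominus>\<^bsub>N\<^esub> f x) \<in> mod_hom R M N"
  using assms hom_closed[OF assms(2)]
  by (intro mod_homI) (auto simp: hom_add hom_smult mod_smult_neg mod_neg_add)

lemma hom_diff_map:
  assumes "module R N" "f \<in> mod_hom R M N" "g \<in> mod_hom R M N"
  shows "(\<lambda>x. f x \<ominus>\<^bsub>N\<^esub> g x) \<in> mod_hom R M N"
  unfolding a_minus_def using assms by (intro hom_add_map hom_neg_map)

lemma module_self[simp]: "module R (self_mod R)"
proof -
  have "abelian_group (self_mod R)"
    by (rule abelian_groupI) (auto simp: self_mod_def a_ac intro!: bexI[of _ "\<ominus> _"] l_neg)
  then show ?thesis
    by (intro moduleI is_cring) (auto simp: self_mod_def l_distr r_distr m_assoc)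
qed

lemma self_mod_sel[simp]: "carrier (self_mod R) = carrier R" "add (self_mod R) = add R"
  "zero (self_mod R) = zero R" "smult (self_mod R) = mult R"
  by (simp_all add: self_mod_def)

lemma hom_form_smult:
  assumes "module R N" "f \<in> mod_hom R M (self_mod R)" "y \<in> carrier N"
  shows "(\<lambda>x. f x \<odot>\<^bsub>N\<^esub> y) \<in> mod_hom R M N"
  using assms hom_closed[OF assms(2)]
  by (intro mod_homI) (auto simp: hom_add[OF assms(2)] hom_smult[OF assms(2)] mod_add_smult mod_mult_smult)

lemma hom_finsum:
  assumes "module R M" "module R N" "f \<in> mod_hom R M N" "finite I" "g \<in> I \<rightarrow> carrier M"
  shows "f (finsum M g I) = finsum N (\<lambda>i. f (g i)) I"
proof -
  interpret M: abelian_group M using assms by (simp add: mod_abelian)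
  interpret N: abelian_group N using assms by (simp add: mod_abelian)
  show ?thesis using \<open>finite I\<close> \<open>g \<in> I \<rightarrow> carrier M\<close>
    by induction (use hom_closed[OF assms(3)] in \<open>auto simp: hom_zero[OF assms(1-3)] hom_add[OF assms(3)] Pi_iff\<close>)
qed

lemma hom_finsum_map:
  assumes M: "module R M" and "module R N" "finite I" "\<And>i. i \<in> I \<Longrightarrow> f i \<in> mod_hom R M N"
  shows "(\<lambda>x. \<Oplus>\<^bsub>N\<^esub>i\<in>I. f i x) \<in> mod_hom R M N"
  using assms(3,4)
proof (induction rule: finite_induct)
  case empty
  interpret N: abelian_group N using assms by (simp add: mod_abelian)
  show ?case by (simp add: hom_zero_map assms)
next
  case (insert i I)
  interpret N: abelian_group N using assms by (simp add: mod_abelian)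
  have "(\<lambda>x. f i x \<oplus>\<^bsub>N\<^esub> (\<Oplus>\<^bsub>N\<^esub>i\<in>I. f i x)) \<in> mod_hom R M N"
    using insert by (intro hom_add_map assms(2)) auto
  moreover have "(\<Oplus>\<^bsub>N\<^esub>i\<in>insert i I. f i x) = f i x \<oplus>\<^bsub>N\<^esub> (\<Oplus>\<^bsub>N\<^esub>i\<in>I. f i x)" if "x \<in> carrier M" for x
  proof -
    have "f k x \<in> carrier N" if "k \<in> insert i I" for k
      using hom_closed[OF insert.prems[OF that] \<open>x \<in> carrier M\<close>] .
    then show ?thesis using insert.hyps by (intro N.finsum_insert) auto
  qed
  ultimately show ?case by (rule hom_cong[OF _ M])
qed

subsection \<open>Submodules and spans\<close>

lemma subI:
  assumes "module R M" "H \<subseteq> carrier M" "\<zero>\<^bsub>M\<^esub> \<in> H"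
    and "\<And>x y. x \<in> H \<Longrightarrow> y \<in> H \<Longrightarrow> x \<oplus>\<^bsub>M\<^esub> y \<in> H"
    and "\<And>a x. a \<in> carrier R \<Longrightarrow> x \<in> H \<Longrightarrow> a \<odot>\<^bsub>M\<^esub> x \<in> H"
  shows "submodule H R M"
proof (rule module.submoduleI)
  show "\<ominus>\<^bsub>M\<^esub> x \<in> H" if "x \<in> H" for x
    using assms(5)[of "\<ominus> \<one>" x] assms(2) that mod_neg_as_smult[OF assms(1)] by auto
qed (use assms in auto)

lemma
  assumes "module R M" "submodule H R M"
  shows sub_subset: "H \<subseteq> carrier M"
    and sub_carrier: "x \<in> H \<Longrightarrow> x \<in> carrier M"
    and sub_zero: "\<zero>\<^bsub>M\<^esub> \<in> H"
    and sub_add: "x \<in> H \<Longrightarrow> y \<in> H \<Longrightarrow> x \<oplus>\<^bsub>M\<^esub> y \<in> H"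
    and sub_smult: "a \<in> carrier R \<Longrightarrow> x \<in> H \<Longrightarrow> a \<odot>\<^bsub>M\<^esub> x \<in> H"
    and sub_neg: "x \<in> H \<Longrightarrow> \<ominus>\<^bsub>M\<^esub> x \<in> H"
    and sub_diff: "x \<in> H \<Longrightarrow> y \<in> H \<Longrightarrow> x \<ominus>\<^bsub>M\<^esub> y \<in> H"
proof -
  note E = module.submoduleE[OF assms]
  show "H \<subseteq> carrier M" "x \<in> H \<Longrightarrow> x \<in> carrier M" "x \<in> H \<Longrightarrow> y \<in> H \<Longrightarrow> x \<oplus>\<^bsub>M\<^esub> y \<in> H"
    "a \<in> carrier R \<Longrightarrow> x \<in> H \<Longrightarrow> a \<odot>\<^bsub>M\<^esub> x \<in> H" "x \<in> H \<Longrightarrow> \<ominus>\<^bsub>M\<^esub> x \<in> H"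
    "x \<in> H \<Longrightarrow> y \<in> H \<Longrightarrow> x \<ominus>\<^bsub>M\<^esub> y \<in> H"
    using E by (auto simp: a_minus_def)
  show "\<zero>\<^bsub>M\<^esub> \<in> H"
    using subgroup.one_closed[OF submodule.axioms(1)[OF assms(2)]] by simp
qed

lemma sub_whole: "module R M \<Longrightarrow> submodule (carrier M) R M"
  by (intro subI) auto

lemma sub_vimage:
  assumes "module R M" "module R N" "f \<in> mod_hom R M N" "submodule H R N"
  shows "submodule {x \<in> carrier M. f x \<in> H} R M"
  using assms sub_zero[OF assms(2,4)] sub_add[OF assms(2,4)] sub_smult[OF assms(2,4)]
  by (intro subI) (auto simp: hom_zero hom_add hom_smult)

lemma sub_equalizer:
  assumes "module R M" "module R N" "f \<in> mod_hom R M N" "g \<in> mod_hom R M N"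
  shows "submodule {x \<in> carrier M. f x = g x} R M"
  using assms by (intro subI) (auto simp: hom_zero hom_add hom_smult)

lemma sub_Int:
  assumes "module R M" "submodule H R M" "submodule K R M"
  shows "submodule (H \<inter> K) R M"
  using assms by (intro subI) (auto intro: sub_carrier sub_zero sub_add sub_smult)

lemma sub_Inter:
  assumes "module R M" "\<And>H. H \<in> S \<Longrightarrow> submodule H R M" "S \<noteq> {}"
  shows "submodule (\<Inter>S) R M"
  using assms by (intro subI) (auto intro: sub_carrier sub_zero sub_add sub_smult)

lemma sub_image:
  assumes "module R M" "module R N" "f \<in> mod_hom R M N" "submodule H R M"
  shows "submodule (f ` H) R N"
proof (rule subI)
  show "\<zero>\<^bsub>N\<^esub> \<in> f ` H"
    using hom_zero[OF assms(1-3)] sub_zero[OF assms(1,4)] by (metis imageI)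
  show "f ` H \<subseteq> carrier N"
    using sub_carrier[OF assms(1,4)] hom_closed[OF assms(3)] by auto
  show "x \<oplus>\<^bsub>N\<^esub> y \<in> f ` H" if "x \<in> f ` H" "y \<in> f ` H" for x y
  proof -
    obtain a b where "a \<in> H" "b \<in> H" "x = f a" "y = f b" using \<open>x \<in> f ` H\<close> \<open>y \<in> f ` H\<close> by blast
    then have "x \<oplus>\<^bsub>N\<^esub> y = f (a \<oplus>\<^bsub>M\<^esub> b)"
      using hom_add[OF assms(3)] sub_carrier[OF assms(1,4)] by simp
    then show ?thesis using sub_add[OF assms(1,4)] \<open>a \<in> H\<close> \<open>b \<in> H\<close> by auto
  qed
  show "r \<odot>\<^bsub>N\<^esub> x \<in> f ` H" if "r \<in> carrier R" "x \<in> f ` H" for r x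
  proof -
    obtain a where "a \<in> H" "x = f a" using \<open>x \<in> f ` H\<close> by blast
    then have "r \<odot>\<^bsub>N\<^esub> x = f (r \<odot>\<^bsub>M\<^esub> a)"
      using hom_smult[OF assms(3)] sub_carrier[OF assms(1,4)] that by simp
    then show ?thesis using sub_smult[OF assms(1,4)] \<open>a \<in> H\<close> that by auto
  qed
qed fact

lemma sub_plus:
  assumes "module R M" "submodule H R M" "submodule K R M"
  shows "submodule {x \<oplus>\<^bsub>M\<^esub> y | x y. x \<in> H \<and> y \<in> K} R M"
proof (rule subI)
  note H = sub_carrier[OF assms(1,2)] and K = sub_carrier[OF assms(1,3)]
  show "{x \<oplus>\<^bsub>M\<^esub> y | x y. x \<in> H \<and> y \<in> K} \<subseteq> carrier M" using H K assms by auto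
  show "\<zero>\<^bsub>M\<^esub> \<in> {x \<oplus>\<^bsub>M\<^esub> y | x y. x \<in> H \<and> y \<in> K}"
    using sub_zero[OF assms(1,2)] sub_zero[OF assms(1,3)] assms(1)
    by (auto intro!: exI[of _ "\<zero>\<^bsub>M\<^esub>"])
  show "u \<oplus>\<^bsub>M\<^esub> v \<in> {x \<oplus>\<^bsub>M\<^esub> y | x y. x \<in> H \<and> y \<in> K}"
    if "u \<in> {x \<oplus>\<^bsub>M\<^esub> y | x y. x \<in> H \<and> y \<in> K}" "v \<in> {x \<oplus>\<^bsub>M\<^esub> y | x y. x \<in> H \<and> y \<in> K}" for u v
  proof -
    obtain x y x' y' where *: "u = x \<oplus>\<^bsub>M\<^esub> y" "v = x' \<oplus>\<^bsub>M\<^esub> y'" "x \<in> H" "y \<in> K" "x' \<in> H" "y' \<in> K"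
      using \<open>u \<in> _\<close> \<open>v \<in> _\<close> by auto
    then have "u \<oplus>\<^bsub>M\<^esub> v = (x \<oplus>\<^bsub>M\<^esub> x') \<oplus>\<^bsub>M\<^esub> (y \<oplus>\<^bsub>M\<^esub> y')"
      using H K assms(1) by (simp add: mod_swap)
    then show ?thesis using * sub_add[OF assms(1,2)] sub_add[OF assms(1,3)] by blast
  qed
  show "a \<odot>\<^bsub>M\<^esub> u \<in> {x \<oplus>\<^bsub>M\<^esub> y | x y. x \<in> H \<and> y \<in> K}"
    if "a \<in> carrier R" "u \<in> {x \<oplus>\<^bsub>M\<^esub> y | x y. x \<in> H \<and> y \<in> K}" for a u
  proof -
    obtain x y where *: "u = x \<oplus>\<^bsub>M\<^esub> y" "x \<in> H" "y \<in> K"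
      using \<open>u \<in> _\<close> by auto
    then have "a \<odot>\<^bsub>M\<^esub> u = a \<odot>\<^bsub>M\<^esub> x \<oplus>\<^bsub>M\<^esub> a \<odot>\<^bsub>M\<^esub> y"
      using H K assms(1) that by (simp add: mod_smult_add)
    then show ?thesis using * that sub_smult[OF assms(1,2)] sub_smult[OF assms(1,3)] by blast
  qed
qed fact

lemma span_sub: "module R M \<Longrightarrow> G \<subseteq> carrier M \<Longrightarrow> submodule (span_of R M G) R M"
  unfolding span_of_def by (rule sub_Inter) (auto intro!: exI[of _ "carrier M"] sub_whole)

lemma span_incl: "x \<in> G \<Longrightarrow> x \<in> span_of R M G"
  by (auto simp: span_of_def)

lemma span_le: "submodule H R M \<Longrightarrow> G \<subseteq> H \<Longrightarrow> x \<in> span_of R M G \<Longrightarrow> x \<in> H"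
  by (auto simp: span_of_def)

lemma span_carrier: "module R M \<Longrightarrow> G \<subseteq> carrier M \<Longrightarrow> x \<in> span_of R M G \<Longrightarrow> x \<in> carrier M"
  by (metis sub_carrier span_sub)

lemma span_hom_into:
  assumes "module R M" "module R N" "f \<in> mod_hom R M N" "submodule H R N" "G \<subseteq> carrier M"
    and "\<And>x. x \<in> G \<Longrightarrow> f x \<in> H" "x \<in> span_of R M G"
  shows "f x \<in> H"
  using span_le[OF sub_vimage[OF assms(1-4)], of G x] assms by auto

lemma span_hom_eq:
  assumes "module R M" "module R N" "f \<in> mod_hom R M N" "g \<in> mod_hom R M N" "G \<subseteq> carrier M"
    and "\<And>x. x \<in> G \<Longrightarrow> f x = g x" "x \<in> span_of R M G"
  shows "f x = g x"
  using span_le[OF sub_equalizer[OF assms(1-4)], of G x] assms by auto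

lemma span_image:
  assumes "module R M" "module R N" "f \<in> mod_hom R M N" "G \<subseteq> carrier M"
  shows "f ` span_of R M G = span_of R N (f ` G)"
proof
  have G: "f ` G \<subseteq> carrier N" using assms(4) hom_closed[OF assms(3)] by auto
  show "f ` span_of R M G \<subseteq> span_of R N (f ` G)"
    using span_hom_into[OF assms(1-3) span_sub[OF assms(2) G] assms(4)] by (auto intro: span_incl)
  show "span_of R N (f ` G) \<subseteq> f ` span_of R M G"
    using span_le[OF sub_image[OF assms(1-3) span_sub[OF assms(1,4)]], of "f ` G"]
    by (auto intro: span_incl)
qed

lemma sub_in_sub:
  assumes "module R M" "submodule K R M"
  shows "submodule H R (M\<lparr>carrier := K\<rparr>) \<longleftrightarrow> submodule H R M \<and> H \<subseteq> K"
proof -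
  note MK = submodule.submodule_is_module[OF assms(2,1)]
  show ?thesis
  proof safe
    assume H: "submodule H R (M\<lparr>carrier := K\<rparr>)"
    have HK: "H \<subseteq> K" using sub_subset[OF MK H] by simp
    then show "\<And>x. x \<in> H \<Longrightarrow> x \<in> K" by auto
    show "submodule H R M"
      using sub_zero[OF MK H] sub_add[OF MK H] sub_smult[OF MK H] HK sub_subset[OF assms]
      by (intro subI assms(1)) auto
  next
    assume H: "submodule H R M" "H \<subseteq> K"
    show "submodule H R (M\<lparr>carrier := K\<rparr>)"
      using sub_zero[OF assms(1) H(1)] sub_add[OF assms(1) H(1)] sub_smult[OF assms(1) H(1)] H
      by (intro subI MK) auto
  qed
qed

lemma sub_neg_eq:
  assumes "module R M" "submodule K R M" "x \<in> K"
  shows "\<ominus>\<^bsub>M\<lparr>carrier := K\<rparr>\<^esub> x = \<ominus>\<^bsub>M\<^esub> x"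
  using submodule.submodule_is_module[OF assms(2,1)] assms sub_carrier[OF assms]
  by (subst (1 2) mod_neg_as_smult) auto

lemma sub_diff_eq:
  assumes "module R M" "submodule K R M" "x \<in> K" "y \<in> K"
  shows "x \<ominus>\<^bsub>M\<lparr>carrier := K\<rparr>\<^esub> y = x \<ominus>\<^bsub>M\<^esub> y"
  using assms by (simp add: a_minus_def sub_neg_eq)

lemma span_in_sub:
  assumes "module R M" "submodule K R M" "G \<subseteq> K"
  shows "span_of R (M\<lparr>carrier := K\<rparr>) G = span_of R M G"
proof
  have s: "submodule (span_of R M G) R M"
    using span_sub[OF assms(1)] assms(3) sub_subset[OF assms(1,2)] by blast
  have "submodule (span_of R M G) R (M\<lparr>carrier := K\<rparr>)"
    using s span_le[OF assms(2,3)] by (auto simp: sub_in_sub[OF assms(1,2)])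
  then show "span_of R (M\<lparr>carrier := K\<rparr>) G \<subseteq> span_of R M G"
    using span_le[of "span_of R M G" "M\<lparr>carrier := K\<rparr>" G] span_incl[of _ G] by blast
  have "submodule (span_of R (M\<lparr>carrier := K\<rparr>) G) R (M\<lparr>carrier := K\<rparr>)"
    using span_sub[OF submodule.submodule_is_module[OF assms(2,1)], of G] assms(3) by simp
  then show "span_of R M G \<subseteq> span_of R (M\<lparr>carrier := K\<rparr>) G"
    using span_le[of "span_of R (M\<lparr>carrier := K\<rparr>) G" M G] span_incl[of _ G]
    unfolding sub_in_sub[OF assms(1,2)] by blast
qed

subsection \<open>Quotients\<close>

lemma sub_abelian:
  assumes "module R M" "submodule N R M"
  shows "abelian_subgroup N M"
  using assms mod_abelian submodule.axioms(1)
  by (intro abelian_subgroupI3 additive_subgroupI) auto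

lemma coset_eq_iff:
  assumes "module R M" "submodule N R M" "x \<in> carrier M" "y \<in> carrier M"
  shows "N +>\<^bsub>M\<^esub> x = N +>\<^bsub>M\<^esub> y \<longleftrightarrow> x \<ominus>\<^bsub>M\<^esub> y \<in> N"
proof -
  interpret abelian_subgroup N M using sub_abelian[OF assms(1,2)] .
  show ?thesis
  proof
    assume "N +>\<^bsub>M\<^esub> x = N +>\<^bsub>M\<^esub> y"
    then have "x \<in> N +>\<^bsub>M\<^esub> y" using a_rcos_self[OF assms(3)] by auto
    then obtain n where "n \<in> N" "x = n \<oplus>\<^bsub>M\<^esub> y" by (auto simp: a_r_coset_def')
    then show "x \<ominus>\<^bsub>M\<^esub> y \<in> N"
      using assms sub_carrier[OF assms(1,2)] by (simp add: mod_ac)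
  next
    assume n: "x \<ominus>\<^bsub>M\<^esub> y \<in> N"
    have "x = (x \<ominus>\<^bsub>M\<^esub> y) \<oplus>\<^bsub>M\<^esub> y" using assms by (simp add: mod_ac)
    then have "x \<in> N +>\<^bsub>M\<^esub> y" using n by (auto simp: a_r_coset_def')
    then show "N +>\<^bsub>M\<^esub> x = N +>\<^bsub>M\<^esub> y"
      using a_repr_independence[OF _ assms(4) a_subgroup] by simp
  qed
qed

lemma coset_mem_iff:
  assumes "module R M" "submodule N R M" "x \<in> carrier M" "y \<in> carrier M"
  shows "y \<in> N +>\<^bsub>M\<^esub> x \<longleftrightarrow> N +>\<^bsub>M\<^esub> y = N +>\<^bsub>M\<^esub> x"
proof -
  interpret abelian_subgroup N M using sub_abelian[OF assms(1,2)] .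
  show ?thesis
    using a_rcos_self[OF assms(4)] a_repr_independence[OF _ assms(3) a_subgroup] by auto
qed

lemma coset_subset:
  assumes "module R M" "submodule N R M" "x \<in> carrier M" "y \<in> N +>\<^bsub>M\<^esub> x"
  shows "y \<in> carrier M"
  using assms(4) sub_carrier[OF assms(1,2)] assms(1,3) by (auto simp: a_r_coset_def')

lemma coset_self: "module R M \<Longrightarrow> submodule N R M \<Longrightarrow> x \<in> carrier M \<Longrightarrow> x \<in> N +>\<^bsub>M\<^esub> x"
  by (simp add: coset_mem_iff)

lemma quot_carrier: "carrier (quot M N) = (\<lambda>x. N +>\<^bsub>M\<^esub> x) ` carrier M"
  by (auto simp: quot_def A_RCOSETS_def')

lemma coset_add_eq:
  assumes "module R M" "submodule N R M" "x \<in> carrier M" "y \<in> carrier M"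
  shows "(N +>\<^bsub>M\<^esub> x) \<oplus>\<^bsub>quot M N\<^esub> (N +>\<^bsub>M\<^esub> y) = N +>\<^bsub>M\<^esub> (x \<oplus>\<^bsub>M\<^esub> y)"
  using abelian_subgroup.a_rcos_sum[OF sub_abelian[OF assms(1,2)] assms(3,4)]
  by (simp add: quot_def)

lemma Union_const: "X \<noteq> {} \<Longrightarrow> (\<And>x. x \<in> X \<Longrightarrow> f x = c) \<Longrightarrow> (\<Union>x\<in>X. f x) = c"
  by auto

lemma induced_coset:
  assumes M: "module R M" "submodule N R M" and M': "module R M'" "submodule N' R M'"
    and f: "f \<in> mod_hom R M M'" "\<And>x. x \<in> N \<Longrightarrow> f x \<in> N'" and x: "x \<in> carrier M"
  shows "induced M' N' f (N +>\<^bsub>M\<^esub> x) = N' +>\<^bsub>M'\<^esub> f x"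
  unfolding induced_def
proof (rule Union_const)
  show "N +>\<^bsub>M\<^esub> x \<noteq> {}" using coset_self[OF M x] by auto
  fix y assume y: "y \<in> N +>\<^bsub>M\<^esub> x"
  have yc: "y \<in> carrier M" using coset_subset[OF M x y] .
  have "y \<ominus>\<^bsub>M\<^esub> x \<in> N" using y by (simp add: coset_mem_iff[OF M x yc] coset_eq_iff[OF M yc x])
  then have "f y \<ominus>\<^bsub>M'\<^esub> f x \<in> N'"
    using f(2) hom_diff[OF M(1) M'(1) f(1) yc x] by metis
  then show "N' +>\<^bsub>M'\<^esub> f y = N' +>\<^bsub>M'\<^esub> f x"
    using coset_eq_iff[OF M'] hom_closed[OF f(1)] x yc by simp
qed

lemma coset_smult_eq:
  assumes "module R M" "submodule N R M" "a \<in> carrier R" "x \<in> carrier M"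
  shows "a \<odot>\<^bsub>quot M N\<^esub> (N +>\<^bsub>M\<^esub> x) = N +>\<^bsub>M\<^esub> (a \<odot>\<^bsub>M\<^esub> x)"
  using induced_coset[OF assms(1,2,1,2), of "\<lambda>x. a \<odot>\<^bsub>M\<^esub> x" x] assms
    sub_smult[OF assms(1,2)] hom_smult_map[OF assms(1) hom_id]
  by (simp add: quot_def induced_def)

lemma coset_zero:
  assumes "module R M" "submodule N R M"
  shows "\<zero>\<^bsub>quot M N\<^esub> = N +>\<^bsub>M\<^esub> \<zero>\<^bsub>M\<^esub>"
  using abelian_group.a_coset_add_zero[OF mod_abelian[OF assms(1)] sub_subset[OF assms]]
  by (simp add: quot_def)

lemma module_quot:
  assumes "module R M" "submodule N R M"
  shows "module R (quot M N)"
proof -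
  note M[simp] = assms(1)
  note s = coset_add_eq[OF assms] coset_smult_eq[OF assms] coset_zero[OF assms]
  have "abelian_group (quot M N)"
  proof (rule abelian_groupI)
    show "\<exists>y\<in>carrier (quot M N). y \<oplus>\<^bsub>quot M N\<^esub> x = \<zero>\<^bsub>quot M N\<^esub>" if "x \<in> carrier (quot M N)" for x
    proof -
      obtain u where u: "u \<in> carrier M" "x = N +>\<^bsub>M\<^esub> u" using \<open>x \<in> carrier (quot M N)\<close> unfolding quot_carrier by blast
      then show ?thesis
        by (intro bexI[of _ "N +>\<^bsub>M\<^esub> (\<ominus>\<^bsub>M\<^esub> u)"]) (auto simp: s quot_carrier)
    qed
  qed (auto simp: quot_carrier s mod_ac)
  then show ?thesis
    by (intro moduleI is_cring) (auto simp: quot_carrier s mod_smult_add mod_add_smult mod_mult_smult)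
qed

lemma proj_hom: "module R M \<Longrightarrow> submodule N R M \<Longrightarrow> (\<lambda>x. N +>\<^bsub>M\<^esub> x) \<in> mod_hom R M (quot M N)"
  by (rule mod_homI) (auto simp: quot_carrier coset_add_eq coset_smult_eq)

lemma coset_zero_iff:
  assumes "module R M" "submodule N R M" "x \<in> carrier M"
  shows "N +>\<^bsub>M\<^esub> x = \<zero>\<^bsub>quot M N\<^esub> \<longleftrightarrow> x \<in> N"
  using assms coset_eq_iff[of M N x "\<zero>\<^bsub>M\<^esub>"] by (simp add: coset_zero mod_diff_eq)

lemma induced_hom:
  assumes M: "module R M" "submodule N R M" and M': "module R M'" "submodule N' R M'"
    and f: "f \<in> mod_hom R M M'" "\<And>x. x \<in> N \<Longrightarrow> f x \<in> N'"
  shows "induced M' N' f \<in> mod_hom R (quot M N) (quot M' N')"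
proof -
  note i = induced_coset[OF M M' f]
  show ?thesis
    by (rule mod_homI)
      (auto simp: quot_carrier coset_add_eq[OF M] coset_smult_eq[OF M] i
        hom_add[OF f(1)] hom_smult[OF f(1)] hom_closed[OF f(1)] coset_add_eq[OF M'] coset_smult_eq[OF M']
        mod_add[OF M(1)] mod_smult[OF M(1)])
qed

lemma induced_iso:
  assumes M: "module R M" "submodule N R M" and M': "module R M'" "submodule N' R M'"
    and f: "f \<in> mod_iso R M M'" "f ` N = N'"
  shows "induced M' N' f \<in> mod_iso R (quot M N) (quot M' N')"
proof -
  have h: "f \<in> mod_hom R M M'" and b: "bij_betw f (carrier M) (carrier M')"
    using f(1) by (auto simp: mod_iso_def)
  have fN: "\<And>x. x \<in> N \<Longrightarrow> f x \<in> N'" using f(2) by auto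
  note i = induced_coset[OF M M' h fN]
  have "bij_betw (induced M' N' f) (carrier (quot M N)) (carrier (quot M' N'))"
  proof (rule bij_betw_imageI)
    show "inj_on (induced M' N' f) (carrier (quot M N))"
    proof (rule inj_onI)
      fix X Y assume "X \<in> carrier (quot M N)" "Y \<in> carrier (quot M N)"
        and eq: "induced M' N' f X = induced M' N' f Y"
      then obtain x y where xy: "x \<in> carrier M" "y \<in> carrier M" "X = N +>\<^bsub>M\<^esub> x" "Y = N +>\<^bsub>M\<^esub> y"
        by (auto simp: quot_carrier)
      have "f x \<ominus>\<^bsub>M'\<^esub> f y \<in> N'"
        using eq xy i hom_closed[OF h] by (simp add: coset_eq_iff[OF M'])
      then have "f (x \<ominus>\<^bsub>M\<^esub> y) \<in> f ` N" using hom_diff[OF M(1) M'(1) h] xy f(2) by simp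
      then obtain n where n: "n \<in> N" "f (x \<ominus>\<^bsub>M\<^esub> y) = f n" by auto
      then have "x \<ominus>\<^bsub>M\<^esub> y = n"
        using b xy M(1) sub_carrier[OF M] by (auto simp: bij_betw_def dest: inj_onD)
      then show "X = Y" using n xy by (simp add: coset_eq_iff[OF M])
    qed
    show "induced M' N' f ` carrier (quot M N) = carrier (quot M' N')"
      using b by (simp add: quot_carrier image_image i bij_betw_def flip: image_image[of "\<lambda>x. N' +>\<^bsub>M'\<^esub> x" f])
  qed
  then show ?thesis using induced_hom[OF M M' h fN] by (auto simp: mod_iso_def)
qed

subsection \<open>Algebras and Lie algebras\<close>

lemma bilin_module[simp]: "bilin_alg R A \<Longrightarrow> module R A"
  by (simp add: bilin_alg_def)

lemma
  assumes "bilin_alg R A"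
  shows bil_closed[simp]: "x \<in> carrier A \<Longrightarrow> y \<in> carrier A \<Longrightarrow> x \<otimes>\<^bsub>A\<^esub> y \<in> carrier A"
    and bil_hom1: "x \<in> carrier A \<Longrightarrow> (\<lambda>y. x \<otimes>\<^bsub>A\<^esub> y) \<in> mod_hom R A A"
    and bil_hom2: "x \<in> carrier A \<Longrightarrow> (\<lambda>y. y \<otimes>\<^bsub>A\<^esub> x) \<in> mod_hom R A A"
    and bil_radd: "x \<in> carrier A \<Longrightarrow> y \<in> carrier A \<Longrightarrow> z \<in> carrier A \<Longrightarrow>
      x \<otimes>\<^bsub>A\<^esub> (y \<oplus>\<^bsub>A\<^esub> z) = x \<otimes>\<^bsub>A\<^esub> y \<oplus>\<^bsub>A\<^esub> x \<otimes>\<^bsub>A\<^esub> z"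
    and bil_ladd: "x \<in> carrier A \<Longrightarrow> y \<in> carrier A \<Longrightarrow> z \<in> carrier A \<Longrightarrow>
      (x \<oplus>\<^bsub>A\<^esub> y) \<otimes>\<^bsub>A\<^esub> z = x \<otimes>\<^bsub>A\<^esub> z \<oplus>\<^bsub>A\<^esub> y \<otimes>\<^bsub>A\<^esub> z"
    and bil_rsmult: "a \<in> carrier R \<Longrightarrow> x \<in> carrier A \<Longrightarrow> y \<in> carrier A \<Longrightarrow>
      x \<otimes>\<^bsub>A\<^esub> (a \<odot>\<^bsub>A\<^esub> y) = a \<odot>\<^bsub>A\<^esub> (x \<otimes>\<^bsub>A\<^esub> y)"
    and bil_lsmult: "a \<in> carrier R \<Longrightarrow> x \<in> carrier A \<Longrightarrow> y \<in> carrier A \<Longrightarrow>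
      (a \<odot>\<^bsub>A\<^esub> x) \<otimes>\<^bsub>A\<^esub> y = a \<odot>\<^bsub>A\<^esub> (x \<otimes>\<^bsub>A\<^esub> y)"
    and bil_rzero[simp]: "x \<in> carrier A \<Longrightarrow> x \<otimes>\<^bsub>A\<^esub> \<zero>\<^bsub>A\<^esub> = \<zero>\<^bsub>A\<^esub>"
    and bil_lzero[simp]: "x \<in> carrier A \<Longrightarrow> \<zero>\<^bsub>A\<^esub> \<otimes>\<^bsub>A\<^esub> x = \<zero>\<^bsub>A\<^esub>"
    and bil_rneg: "x \<in> carrier A \<Longrightarrow> y \<in> carrier A \<Longrightarrow> x \<otimes>\<^bsub>A\<^esub> (\<ominus>\<^bsub>A\<^esub> y) = \<ominus>\<^bsub>A\<^esub> (x \<otimes>\<^bsub>A\<^esub> y)"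
    and bil_lneg: "x \<in> carrier A \<Longrightarrow> y \<in> carrier A \<Longrightarrow> (\<ominus>\<^bsub>A\<^esub> x) \<otimes>\<^bsub>A\<^esub> y = \<ominus>\<^bsub>A\<^esub> (x \<otimes>\<^bsub>A\<^esub> y)"
    and bil_rdiff: "x \<in> carrier A \<Longrightarrow> y \<in> carrier A \<Longrightarrow> z \<in> carrier A \<Longrightarrow>
      x \<otimes>\<^bsub>A\<^esub> (y \<ominus>\<^bsub>A\<^esub> z) = x \<otimes>\<^bsub>A\<^esub> y \<ominus>\<^bsub>A\<^esub> x \<otimes>\<^bsub>A\<^esub> z"
    and bil_ldiff: "x \<in> carrier A \<Longrightarrow> y \<in> carrier A \<Longrightarrow> z \<in> carrier A \<Longrightarrow>
      (x \<ominus>\<^bsub>A\<^esub> y) \<otimes>\<^bsub>A\<^esub> z = x \<otimes>\<^bsub>A\<^esub> z \<ominus>\<^bsub>A\<^esub> y \<otimes>\<^bsub>A\<^esub> z"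
proof -
  have m: "module R A" using assms by (simp add: bilin_alg_def)
  show 1: "(\<lambda>y. x \<otimes>\<^bsub>A\<^esub> y) \<in> mod_hom R A A" if "x \<in> carrier A" for x
    using that assms by (simp add: bilin_alg_def)
  show 2: "(\<lambda>y. y \<otimes>\<^bsub>A\<^esub> x) \<in> mod_hom R A A" if "x \<in> carrier A" for x
    using that assms by (simp add: bilin_alg_def)
  show "x \<in> carrier A \<Longrightarrow> y \<in> carrier A \<Longrightarrow> x \<otimes>\<^bsub>A\<^esub> y \<in> carrier A" using hom_closed[OF 1] .
  show "x \<in> carrier A \<Longrightarrow> y \<in> carrier A \<Longrightarrow> z \<in> carrier A \<Longrightarrow>
      x \<otimes>\<^bsub>A\<^esub> (y \<oplus>\<^bsub>A\<^esub> z) = x \<otimes>\<^bsub>A\<^esub> y \<oplus>\<^bsub>A\<^esub> x \<otimes>\<^bsub>A\<^esub> z" using hom_add[OF 1] .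
  show "x \<in> carrier A \<Longrightarrow> y \<in> carrier A \<Longrightarrow> z \<in> carrier A \<Longrightarrow>
      (x \<oplus>\<^bsub>A\<^esub> y) \<otimes>\<^bsub>A\<^esub> z = x \<otimes>\<^bsub>A\<^esub> z \<oplus>\<^bsub>A\<^esub> y \<otimes>\<^bsub>A\<^esub> z" using hom_add[OF 2] .
  show "a \<in> carrier R \<Longrightarrow> x \<in> carrier A \<Longrightarrow> y \<in> carrier A \<Longrightarrow>
      x \<otimes>\<^bsub>A\<^esub> (a \<odot>\<^bsub>A\<^esub> y) = a \<odot>\<^bsub>A\<^esub> (x \<otimes>\<^bsub>A\<^esub> y)" using hom_smult[OF 1] .
  show "a \<in> carrier R \<Longrightarrow> x \<in> carrier A \<Longrightarrow> y \<in> carrier A \<Longrightarrow>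
      (a \<odot>\<^bsub>A\<^esub> x) \<otimes>\<^bsub>A\<^esub> y = a \<odot>\<^bsub>A\<^esub> (x \<otimes>\<^bsub>A\<^esub> y)" using hom_smult[OF 2] .
  show "x \<in> carrier A \<Longrightarrow> x \<otimes>\<^bsub>A\<^esub> \<zero>\<^bsub>A\<^esub> = \<zero>\<^bsub>A\<^esub>" using hom_zero[OF m m 1] .
  show "x \<in> carrier A \<Longrightarrow> \<zero>\<^bsub>A\<^esub> \<otimes>\<^bsub>A\<^esub> x = \<zero>\<^bsub>A\<^esub>" using hom_zero[OF m m 2] .
  show "x \<in> carrier A \<Longrightarrow> y \<in> carrier A \<Longrightarrow> x \<otimes>\<^bsub>A\<^esub> (\<ominus>\<^bsub>A\<^esub> y) = \<ominus>\<^bsub>A\<^esub> (x \<otimes>\<^bsub>A\<^esub> y)" using hom_neg[OF m m 1] .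
  show "x \<in> carrier A \<Longrightarrow> y \<in> carrier A \<Longrightarrow> (\<ominus>\<^bsub>A\<^esub> x) \<otimes>\<^bsub>A\<^esub> y = \<ominus>\<^bsub>A\<^esub> (x \<otimes>\<^bsub>A\<^esub> y)" using hom_neg[OF m m 2] .
  show "x \<in> carrier A \<Longrightarrow> y \<in> carrier A \<Longrightarrow> z \<in> carrier A \<Longrightarrow>
      x \<otimes>\<^bsub>A\<^esub> (y \<ominus>\<^bsub>A\<^esub> z) = x \<otimes>\<^bsub>A\<^esub> y \<ominus>\<^bsub>A\<^esub> x \<otimes>\<^bsub>A\<^esub> z" using hom_diff[OF m m 1] .
  show "x \<in> carrier A \<Longrightarrow> y \<in> carrier A \<Longrightarrow> z \<in> carrier A \<Longrightarrow>
      (x \<ominus>\<^bsub>A\<^esub> y) \<otimes>\<^bsub>A\<^esub> z = x \<otimes>\<^bsub>A\<^esub> z \<ominus>\<^bsub>A\<^esub> y \<otimes>\<^bsub>A\<^esub> z" using hom_diff[OF m m 2] .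
qed

lemmas bil_simps = bil_radd bil_ladd bil_rneg bil_lneg bil_rsmult bil_lsmult

lemma lie_bilin[simp]: "lie_alg R L \<Longrightarrow> bilin_alg R L"
  by (simp add: lie_alg_def)

lemma lie_antisym:
  assumes "lie_alg R L" "x \<in> carrier L" "y \<in> carrier L"
  shows "y \<otimes>\<^bsub>L\<^esub> x = \<ominus>\<^bsub>L\<^esub> (x \<otimes>\<^bsub>L\<^esub> y)"
proof -
  have "y \<otimes>\<^bsub>L\<^esub> x \<oplus>\<^bsub>L\<^esub> x \<otimes>\<^bsub>L\<^esub> y = \<zero>\<^bsub>L\<^esub>" using assms by (simp add: lie_alg_def)
  then show ?thesis using assms by (simp add: mod_add_zero_iff)
qed

lemma lie_leibniz:
  assumes L: "lie_alg R L" and [simp]: "x \<in> carrier L" "y \<in> carrier L" "z \<in> carrier L"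
  shows "x \<otimes>\<^bsub>L\<^esub> (y \<otimes>\<^bsub>L\<^esub> z) = (x \<otimes>\<^bsub>L\<^esub> y) \<otimes>\<^bsub>L\<^esub> z \<oplus>\<^bsub>L\<^esub> y \<otimes>\<^bsub>L\<^esub> (x \<otimes>\<^bsub>L\<^esub> z)"
proof -
  note [simp] = L
  have J: "((x \<otimes>\<^bsub>L\<^esub> y) \<otimes>\<^bsub>L\<^esub> z) \<oplus>\<^bsub>L\<^esub> ((y \<otimes>\<^bsub>L\<^esub> z) \<otimes>\<^bsub>L\<^esub> x) \<oplus>\<^bsub>L\<^esub> ((z \<otimes>\<^bsub>L\<^esub> x) \<otimes>\<^bsub>L\<^esub> y) = \<zero>\<^bsub>L\<^esub>"
    using L by (simp add: lie_alg_def)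
  have 1: "(y \<otimes>\<^bsub>L\<^esub> z) \<otimes>\<^bsub>L\<^esub> x = \<ominus>\<^bsub>L\<^esub> (x \<otimes>\<^bsub>L\<^esub> (y \<otimes>\<^bsub>L\<^esub> z))"
    by (rule lie_antisym) auto
  have 2: "(z \<otimes>\<^bsub>L\<^esub> x) \<otimes>\<^bsub>L\<^esub> y = y \<otimes>\<^bsub>L\<^esub> (x \<otimes>\<^bsub>L\<^esub> z)"
    using lie_antisym[OF L, of y "z \<otimes>\<^bsub>L\<^esub> x"] lie_antisym[OF L, of x z] by (simp add: bil_rneg)
  have "((x \<otimes>\<^bsub>L\<^esub> y) \<otimes>\<^bsub>L\<^esub> z \<oplus>\<^bsub>L\<^esub> y \<otimes>\<^bsub>L\<^esub> (x \<otimes>\<^bsub>L\<^esub> z)) \<ominus>\<^bsub>L\<^esub> x \<otimes>\<^bsub>L\<^esub> (y \<otimes>\<^bsub>L\<^esub> z) = \<zero>\<^bsub>L\<^esub>"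
    using J unfolding 1 2 by (simp add: mod_ac)
  then show ?thesis by (simp add: mod_diff_zero_iff)
qed

lemma lie_algI:
  assumes A: "bilin_alg R L"
    and as0: "\<And>x y. x \<in> carrier L \<Longrightarrow> y \<in> carrier L \<Longrightarrow> x \<otimes>\<^bsub>L\<^esub> y \<oplus>\<^bsub>L\<^esub> y \<otimes>\<^bsub>L\<^esub> x = \<zero>\<^bsub>L\<^esub>"
    and lb: "\<And>x y z. x \<in> carrier L \<Longrightarrow> y \<in> carrier L \<Longrightarrow> z \<in> carrier L \<Longrightarrow>
      x \<otimes>\<^bsub>L\<^esub> (y \<otimes>\<^bsub>L\<^esub> z) = (x \<otimes>\<^bsub>L\<^esub> y) \<otimes>\<^bsub>L\<^esub> z \<oplus>\<^bsub>L\<^esub> y \<otimes>\<^bsub>L\<^esub> (x \<otimes>\<^bsub>L\<^esub> z)"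
  shows "lie_alg R L"
  unfolding lie_alg_def
proof (intro conjI ballI A)
  note [simp] = A
  have as: "y \<otimes>\<^bsub>L\<^esub> x = \<ominus>\<^bsub>L\<^esub> (x \<otimes>\<^bsub>L\<^esub> y)" if "x \<in> carrier L" "y \<in> carrier L" for x y
    using as0[of y x] that by (simp add: mod_add_zero_iff)
  fix x y assume [simp]: "x \<in> carrier L" "y \<in> carrier L"
  show "x \<otimes>\<^bsub>L\<^esub> y \<oplus>\<^bsub>L\<^esub> y \<otimes>\<^bsub>L\<^esub> x = \<zero>\<^bsub>L\<^esub>" using as[of x y] by simp
  fix z assume [simp]: "z \<in> carrier L"
  have 1: "(y \<otimes>\<^bsub>L\<^esub> z) \<otimes>\<^bsub>L\<^esub> x = \<ominus>\<^bsub>L\<^esub> (x \<otimes>\<^bsub>L\<^esub> (y \<otimes>\<^bsub>L\<^esub> z))" by (rule as) auto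
  have 2: "(z \<otimes>\<^bsub>L\<^esub> x) \<otimes>\<^bsub>L\<^esub> y = y \<otimes>\<^bsub>L\<^esub> (x \<otimes>\<^bsub>L\<^esub> z)"
    using as[of y "z \<otimes>\<^bsub>L\<^esub> x"] as[of x z] by (simp add: bil_rneg)
  show "((x \<otimes>\<^bsub>L\<^esub> y) \<otimes>\<^bsub>L\<^esub> z) \<oplus>\<^bsub>L\<^esub> ((y \<otimes>\<^bsub>L\<^esub> z) \<otimes>\<^bsub>L\<^esub> x) \<oplus>\<^bsub>L\<^esub> ((z \<otimes>\<^bsub>L\<^esub> x) \<otimes>\<^bsub>L\<^esub> y) = \<zero>\<^bsub>L\<^esub>"
    unfolding 1 2 lb[OF \<open>x \<in> _\<close> \<open>y \<in> _\<close> \<open>z \<in> _\<close>] by (simp add: mod_ac)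
qed

lemma alg_homD:
  assumes "f \<in> alg_hom R A B"
  shows alg_hom_hom: "f \<in> mod_hom R A B"
    and alg_hom_mult: "x \<in> carrier A \<Longrightarrow> y \<in> carrier A \<Longrightarrow> f (x \<otimes>\<^bsub>A\<^esub> y) = f x \<otimes>\<^bsub>B\<^esub> f y"
  using assms by (auto simp: alg_hom_def)

lemma alg_hom_comp:
  "f \<in> alg_hom R A B \<Longrightarrow> g \<in> alg_hom R B C \<Longrightarrow> (\<lambda>x. g (f x)) \<in> alg_hom R A C"
  by (auto simp: alg_hom_def hom_comp hom_closed)

lemma ideal_two_sided:
  assumes "bilin_alg R A" "G \<subseteq> carrier A"
  shows "two_sided_ideal R A (ideal_of R A G)"
proof -
  have whole: "two_sided_ideal R A (carrier A)"
    using assms by (auto simp: two_sided_ideal_def sub_whole)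
  have "submodule (ideal_of R A G) R A"
    unfolding ideal_of_def using assms whole
    by (intro sub_Inter) (auto simp: two_sided_ideal_def)
  then show ?thesis by (auto simp: two_sided_ideal_def ideal_of_def)
qed

lemma ideal_incl: "x \<in> G \<Longrightarrow> x \<in> ideal_of R A G"
  by (auto simp: ideal_of_def)

lemma ideal_le: "two_sided_ideal R A I \<Longrightarrow> G \<subseteq> I \<Longrightarrow> x \<in> ideal_of R A G \<Longrightarrow> x \<in> I"
  by (auto simp: ideal_of_def)

lemma coset_mult_eq:
  assumes A: "bilin_alg R A" and I: "two_sided_ideal R A I" and x: "x \<in> carrier A" and y: "y \<in> carrier A"
  shows "(I +>\<^bsub>A\<^esub> x) \<otimes>\<^bsub>quot A I\<^esub> (I +>\<^bsub>A\<^esub> y) = I +>\<^bsub>A\<^esub> (x \<otimes>\<^bsub>A\<^esub> y)"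
proof -
  have s: "submodule I R A" using I by (simp add: two_sided_ideal_def)
  note m = bilin_module[OF A]
  note self = coset_self[OF m s] and sub = coset_subset[OF m s]
  have "I +>\<^bsub>A\<^esub> (x' \<otimes>\<^bsub>A\<^esub> y') = I +>\<^bsub>A\<^esub> (x \<otimes>\<^bsub>A\<^esub> y)"
    if "x' \<in> I +>\<^bsub>A\<^esub> x" "y' \<in> I +>\<^bsub>A\<^esub> y" for x' y'
  proof -
    have c[simp]: "x' \<in> carrier A" "y' \<in> carrier A" using that sub x y by auto
    have 1: "x' \<ominus>\<^bsub>A\<^esub> x \<in> I" "y' \<ominus>\<^bsub>A\<^esub> y \<in> I"
      using that by (simp_all add: coset_mem_iff[OF m s] coset_eq_iff[OF m s] x y)
    have "(x' \<ominus>\<^bsub>A\<^esub> x) \<otimes>\<^bsub>A\<^esub> y' \<oplus>\<^bsub>A\<^esub> x \<otimes>\<^bsub>A\<^esub> (y' \<ominus>\<^bsub>A\<^esub> y) \<in> I"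
      using 1 I x c sub_add[OF m s] by (simp add: two_sided_ideal_def)
    moreover have "(x' \<ominus>\<^bsub>A\<^esub> x) \<otimes>\<^bsub>A\<^esub> y' \<oplus>\<^bsub>A\<^esub> x \<otimes>\<^bsub>A\<^esub> (y' \<ominus>\<^bsub>A\<^esub> y) = x' \<otimes>\<^bsub>A\<^esub> y' \<ominus>\<^bsub>A\<^esub> x \<otimes>\<^bsub>A\<^esub> y"
      using A x y m by (simp add: bil_simps mod_ac)
    ultimately show ?thesis using A x y by (simp add: coset_eq_iff[OF m s])
  qed
  then have "rcoset_mult A I (I +>\<^bsub>A\<^esub> x) (I +>\<^bsub>A\<^esub> y) = I +>\<^bsub>A\<^esub> (x \<otimes>\<^bsub>A\<^esub> y)"
    unfolding rcoset_mult_def using self[OF x] self[OF y] by (intro Union_const) blast+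
  then show ?thesis by (simp add: quot_def)
qed

lemma quot_bilin:
  assumes A: "bilin_alg R A" and I: "two_sided_ideal R A I"
  shows "bilin_alg R (quot A I)"
proof -
  have s: "submodule I R A" using I by (simp add: two_sided_ideal_def)
  note m = bilin_module[OF A]
  show ?thesis
    unfolding bilin_alg_def
    by (intro conjI ballI mod_homI module_quot[OF m s])
      (auto simp: quot_carrier coset_mult_eq[OF A I] coset_add_eq[OF m s] coset_smult_eq[OF m s]
        bil_closed[OF A] bil_radd[OF A] bil_ladd[OF A] bil_rsmult[OF A] bil_lsmult[OF A]
        mod_add[OF m] mod_smult[OF m])
qed

end

section \<open>Free modules and free Lie algebras\<close>

definition free_on :: "('a, 'r) ring_scheme \<Rightarrow> ('a, 'x \<Rightarrow> 'a, 'm) module_scheme \<Rightarrow> 'x set \<Rightarrow> bool"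
  where "free_on R M X \<longleftrightarrow> carrier M = free_elems R X \<and> \<zero>\<^bsub>M\<^esub> = (\<lambda>x. \<zero>\<^bsub>R\<^esub>) \<and>
    add M = (\<lambda>f g x. f x \<oplus>\<^bsub>R\<^esub> g x) \<and> smult M = (\<lambda>a f x. a \<otimes>\<^bsub>R\<^esub> f x)"

definition free_ext :: "('a, 'r) ring_scheme \<Rightarrow> ('a, 'b, 'm) module_scheme \<Rightarrow> ('x \<Rightarrow> 'b) \<Rightarrow> ('x \<Rightarrow> 'a) \<Rightarrow> 'b"
  where "free_ext R N \<phi> f = (\<Oplus>\<^bsub>N\<^esub>x\<in>{x. f x \<noteq> \<zero>\<^bsub>R\<^esub>}. f x \<odot>\<^bsub>N\<^esub> \<phi> x)"

fun tree_eval :: "('a, 'b, 'm) module_scheme \<Rightarrow> ('v \<Rightarrow> 'b) \<Rightarrow> 'v tree \<Rightarrow> 'b"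
  where "tree_eval B \<phi> (Leaf v) = \<phi> v"
  | "tree_eval B \<phi> (Node s t) = tree_eval B \<phi> s \<otimes>\<^bsub>B\<^esub> tree_eval B \<phi> t"

text \<open>If \<open>f\<close> is linear and vanishes on a submodule, the image of a coset is a singleton.\<close>

definition quot_lift :: "('b \<Rightarrow> 'c) \<Rightarrow> 'b set \<Rightarrow> 'c"
  where "quot_lift f X = the_elem (f ` X)"

definition lie_ext :: "('a, 'r) ring_scheme \<Rightarrow> ('a, 'b, 'm) module_scheme \<Rightarrow> ('v \<Rightarrow> 'b) \<Rightarrow>
    ('v tree \<Rightarrow> 'a) set \<Rightarrow> 'b"
  where "lie_ext R B \<phi> = quot_lift (free_ext R B (tree_eval B \<phi>))"

text \<open>The split extension of the Lie algebra \<open>B\<close> by its representation \<open>M\<close>, on which the bracket is zero.\<close>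

definition semidirect :: "('a, 'b, 'm) module_scheme \<Rightarrow> ('a, 'c, 'n) module_scheme \<Rightarrow> ('b \<Rightarrow> 'c \<Rightarrow> 'c) \<Rightarrow>
    ('a, 'b \<times> 'c) module"
  where "semidirect B M act = (dsum B M)\<lparr>mult := (\<lambda>p q. (fst p \<otimes>\<^bsub>B\<^esub> fst q,
    act (fst p) (snd q) \<ominus>\<^bsub>M\<^esub> act (fst q) (snd p)))\<rparr>"

definition lie_module :: "('a, 'r) ring_scheme \<Rightarrow> ('a, 'b, 'm) module_scheme \<Rightarrow>
    ('a, 'c, 'n) module_scheme \<Rightarrow> ('b \<Rightarrow> 'c \<Rightarrow> 'c) \<Rightarrow> bool"
  where "lie_module R B M act \<longleftrightarrow> module R M \<and>
    (\<forall>a\<in>carrier B. act a \<in> mod_hom R M M) \<and> (\<forall>m\<in>carrier M. (\<lambda>a. act a m) \<in> mod_hom R B M) \<and>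
    (\<forall>a\<in>carrier B. \<forall>b\<in>carrier B. \<forall>m\<in>carrier M.
      act (a \<otimes>\<^bsub>B\<^esub> b) m = act a (act b m) \<ominus>\<^bsub>M\<^esub> act b (act a m))"

text \<open>A derivation over \<open>j\<close> with values in a representation of \<open>B\<close> is the second component of a
  homomorphism into the split extension whose first component is \<open>j\<close>. The universal property of the
  free algebra therefore produces it from its values \<open>h\<close> on generators.\<close>

definition der_along :: "('a, 'r) ring_scheme \<Rightarrow> ('a, 'v, 'k) module_scheme \<Rightarrow> ('a, 'b, 'm) module_scheme \<Rightarrow>
    ('a, 'c, 'n) module_scheme \<Rightarrow> ('b \<Rightarrow> 'c \<Rightarrow> 'c) \<Rightarrow> (('v tree \<Rightarrow> 'a) set \<Rightarrow> 'b) \<Rightarrow> ('v \<Rightarrow> 'c) \<Rightarrow>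
    ('v tree \<Rightarrow> 'a) set \<Rightarrow> 'c"
  where "der_along R V B M act j h x = snd (lie_ext R (semidirect B M act) (\<lambda>v. (j (gen R V v), h v)) x)"

context cring
begin

subsection \<open>Free modules\<close>

lemma free_carrier_iff:
  "free_on R M X \<Longrightarrow> f \<in> carrier M \<longleftrightarrow>
    (\<forall>x. f x \<in> carrier R) \<and> finite {x. f x \<noteq> \<zero>} \<and> (\<forall>x. f x \<noteq> \<zero> \<longrightarrow> x \<in> X)"
  by (auto simp: free_on_def free_elems_def)

lemma
  assumes "free_on R M X"
  shows free_add: "(f \<oplus>\<^bsub>M\<^esub> g) x = f x \<oplus> g x"
    and free_smult: "(a \<odot>\<^bsub>M\<^esub> f) x = a \<otimes> f x"
    and free_zero: "\<zero>\<^bsub>M\<^esub> x = \<zero>"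
  using assms by (simp_all add: free_on_def)

lemma free_module:
  assumes F: "free_on R M X"
  shows "module R M"
proof -
  note c = free_carrier_iff[OF F] and s = free_add[OF F] free_smult[OF F] free_zero[OF F]
  have add: "f \<oplus>\<^bsub>M\<^esub> g \<in> carrier M" if "f \<in> carrier M" "g \<in> carrier M" for f g
  proof -
    have "{x. (f \<oplus>\<^bsub>M\<^esub> g) x \<noteq> \<zero>} \<subseteq> {x. f x \<noteq> \<zero>} \<union> {x. g x \<noteq> \<zero>}"
      using that by (auto simp: s c)
    moreover have "finite ({x. f x \<noteq> \<zero>} \<union> {x. g x \<noteq> \<zero>})" using that by (simp add: c)
    ultimately show ?thesis
      using that finite_subset by (auto simp: c s intro: finite_subset)
  qed
  have smult: "a \<odot>\<^bsub>M\<^esub> f \<in> carrier M" if "f \<in> carrier M" "a \<in> carrier R" for f a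
  proof -
    have "{x. (a \<odot>\<^bsub>M\<^esub> f) x \<noteq> \<zero>} \<subseteq> {x. f x \<noteq> \<zero>}"
      using that by (auto simp: s c)
    moreover have "finite {x. f x \<noteq> \<zero>}" using that by (simp add: c)
    ultimately show ?thesis
      using that finite_subset by (auto simp: c s intro: finite_subset)
  qed
  have z: "\<zero>\<^bsub>M\<^esub> \<in> carrier M" by (simp add: c s)
  have v: "f x \<in> carrier R" if "f \<in> carrier M" for f x using that by (simp add: c)
  have "abelian_group M"
  proof (rule abelian_groupI)
    show "\<exists>g\<in>carrier M. g \<oplus>\<^bsub>M\<^esub> f = \<zero>\<^bsub>M\<^esub>" if f: "f \<in> carrier M" for f
      using smult[OF f, of "\<ominus> \<one>"] f
      by (intro bexI[of _ "(\<ominus> \<one>) \<odot>\<^bsub>M\<^esub> f"] ext) (auto simp: s v l_minus l_neg)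
  qed (auto simp: add z s v fun_eq_iff a_ac)
  then show ?thesis
    by (intro moduleI is_cring) (auto simp: smult s v fun_eq_iff l_distr r_distr m_assoc)
qed

lemma basis_carrier: "free_on R M X \<Longrightarrow> x \<in> X \<Longrightarrow> basis_elem R x \<in> carrier M"
  by (auto simp: free_carrier_iff basis_elem_def)

text \<open>Induction on a finite set containing the support, removing one point at a time.\<close>

lemma free_span:
  assumes F: "free_on R M X"
  shows "carrier M = span_of R M (basis_elem R ` X)"
proof
  note c = free_carrier_iff[OF F] and s = free_add[OF F] free_smult[OF F] free_zero[OF F]
  note M = free_module[OF F]
  have sub: "basis_elem R ` X \<subseteq> carrier M" using basis_carrier[OF F] by auto
  then show "span_of R M (basis_elem R ` X) \<subseteq> carrier M" using span_carrier[OF M] by blast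
  note H = span_sub[OF M sub]
  have "f \<in> span_of R M (basis_elem R ` X)"
    if "finite S" "f \<in> carrier M" "{x. f x \<noteq> \<zero>} \<subseteq> S" for S f
    using that
  proof (induction S arbitrary: f rule: finite_induct)
    case empty
    then have "f = \<zero>\<^bsub>M\<^esub>" by (auto simp: s)
    then show ?case using sub_zero[OF M H] by simp
  next
    case (insert x S)
    have "finite {y. (f(x := \<zero>)) y \<noteq> \<zero>}"
      by (rule finite_subset[of _ "{x. f x \<noteq> \<zero>}"]) (use insert.prems(1) in \<open>auto simp: c\<close>)
    then have f'[simplified fun_upd_def]: "f(x := \<zero>) \<in> carrier M"
      using insert.prems(1) unfolding c by simp
    then have 1: "f(x := \<zero>) \<in> span_of R M (basis_elem R ` X)"
      using insert.prems by (intro insert.IH) auto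
    have 2: "f x \<odot>\<^bsub>M\<^esub> basis_elem R x \<in> span_of R M (basis_elem R ` X)"
    proof (cases "f x = \<zero>")
      case True
      then have "f x \<odot>\<^bsub>M\<^esub> basis_elem R x = \<zero>\<^bsub>M\<^esub>" by (auto simp: s basis_elem_def)
      then show ?thesis using sub_zero[OF M H] by simp
    next
      case False
      then show ?thesis
        using insert.prems(1) by (intro sub_smult[OF M H] span_incl) (auto simp: c)
    qed
    have "f = f(x := \<zero>) \<oplus>\<^bsub>M\<^esub> f x \<odot>\<^bsub>M\<^esub> basis_elem R x"
      using insert.prems(1) by (auto simp: s basis_elem_def c)
    then show ?case using sub_add[OF M H 1 2] by simp
  qed
  then show "carrier M \<subseteq> span_of R M (basis_elem R ` X)" by (auto simp: c)
qed

lemma free_ext_eq: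
  assumes F: "free_on R M X" and N: "module R N" and \<phi>: "\<And>x. x \<in> X \<Longrightarrow> \<phi> x \<in> carrier N"
    and f: "f \<in> carrier M" and S: "finite S" "{x. f x \<noteq> \<zero>} \<subseteq> S" "S \<subseteq> X"
  shows "free_ext R N \<phi> f = (\<Oplus>\<^bsub>N\<^esub>x\<in>S. f x \<odot>\<^bsub>N\<^esub> \<phi> x)"
proof -
  interpret N: module R N by fact
  show ?thesis
    unfolding free_ext_def
    by (rule N.add.finprod_mono_neutral_cong_left)
      (use S f \<phi> in \<open>auto simp: free_carrier_iff[OF F] subset_iff\<close>)
qed

lemma free_ext_basis:
  assumes F: "free_on R M X" and N: "module R N" and \<phi>: "\<And>x. x \<in> X \<Longrightarrow> \<phi> x \<in> carrier N" and x: "x \<in> X"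
  shows "free_ext R N \<phi> (basis_elem R x) = \<phi> x"
proof -
  interpret N: module R N by fact
  have "free_ext R N \<phi> (basis_elem R x) = (\<Oplus>\<^bsub>N\<^esub>y\<in>{x}. basis_elem R x y \<odot>\<^bsub>N\<^esub> \<phi> y)"
    by (rule free_ext_eq[OF F N \<phi> basis_carrier[OF F x]]) (use x in \<open>auto simp: basis_elem_def\<close>)
  then show ?thesis using \<phi>[OF x] by (simp add: basis_elem_def)
qed

lemma free_ext_hom:
  assumes F: "free_on R M X" and N: "module R N" and \<phi>: "\<And>x. x \<in> X \<Longrightarrow> \<phi> x \<in> carrier N"
  shows "free_ext R N \<phi> \<in> mod_hom R M N"
proof -
  interpret N: module R N by fact
  note c = free_carrier_iff[OF F] and s = free_add[OF F] free_smult[OF F] free_zero[OF F]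
  note M = free_module[OF F] and e = free_ext_eq[OF F N \<phi>]
  show ?thesis
  proof (rule mod_homI)
    show "free_ext R N \<phi> f \<in> carrier N" if "f \<in> carrier M" for f
      unfolding free_ext_def using that \<phi> by (intro N.finsum_closed) (auto simp: c)
    show "free_ext R N \<phi> (f \<oplus>\<^bsub>M\<^esub> g) = free_ext R N \<phi> f \<oplus>\<^bsub>N\<^esub> free_ext R N \<phi> g"
      if f: "f \<in> carrier M" and g: "g \<in> carrier M" for f g
    proof -
      let ?S = "{x. f x \<noteq> \<zero>} \<union> {x. g x \<noteq> \<zero>}"
      have S: "finite ?S" "?S \<subseteq> X" using f g by (auto simp: c)
      have "free_ext R N \<phi> (f \<oplus>\<^bsub>M\<^esub> g) = (\<Oplus>\<^bsub>N\<^esub>x\<in>?S. (f \<oplus>\<^bsub>M\<^esub> g) x \<odot>\<^bsub>N\<^esub> \<phi> x)"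
        by (rule e[OF _ mod_add[OF M f g] S(1) _ S(2)]) (auto simp: s)
      also have "\<dots> = (\<Oplus>\<^bsub>N\<^esub>x\<in>?S. f x \<odot>\<^bsub>N\<^esub> \<phi> x \<oplus>\<^bsub>N\<^esub> g x \<odot>\<^bsub>N\<^esub> \<phi> x)"
        by (rule N.finsum_cong') (use S f g \<phi> in \<open>auto simp: s c N.smult_l_distr\<close>)
      also have "\<dots> = (\<Oplus>\<^bsub>N\<^esub>x\<in>?S. f x \<odot>\<^bsub>N\<^esub> \<phi> x) \<oplus>\<^bsub>N\<^esub> (\<Oplus>\<^bsub>N\<^esub>x\<in>?S. g x \<odot>\<^bsub>N\<^esub> \<phi> x)"
        by (rule N.finsum_addf) (use S f g \<phi> in \<open>auto simp: c subset_iff\<close>)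
      also have "\<dots> = free_ext R N \<phi> f \<oplus>\<^bsub>N\<^esub> free_ext R N \<phi> g"
        using e[OF _ f S(1) _ S(2)] e[OF _ g S(1) _ S(2)] by auto
      finally show ?thesis .
    qed
    show "free_ext R N \<phi> (a \<odot>\<^bsub>M\<^esub> f) = a \<odot>\<^bsub>N\<^esub> free_ext R N \<phi> f" if a: "a \<in> carrier R" and f: "f \<in> carrier M" for a f
    proof -
      let ?S = "{x. f x \<noteq> \<zero>}"
      have S: "finite ?S" "?S \<subseteq> X" using f by (auto simp: c)
      have "free_ext R N \<phi> (a \<odot>\<^bsub>M\<^esub> f) = (\<Oplus>\<^bsub>N\<^esub>x\<in>?S. (a \<odot>\<^bsub>M\<^esub> f) x \<odot>\<^bsub>N\<^esub> \<phi> x)"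
        by (rule e[OF _ mod_smult[OF M a f] S(1) _ S(2)]) (use a in \<open>auto simp: s\<close>)
      also have "\<dots> = (\<Oplus>\<^bsub>N\<^esub>x\<in>?S. a \<odot>\<^bsub>N\<^esub> (f x \<odot>\<^bsub>N\<^esub> \<phi> x))"
        by (rule N.finsum_cong') (use S f a \<phi> in \<open>auto simp: s c N.smult_assoc1\<close>)
      also have "\<dots> = a \<odot>\<^bsub>N\<^esub> (\<Oplus>\<^bsub>N\<^esub>x\<in>?S. f x \<odot>\<^bsub>N\<^esub> \<phi> x)"
        by (rule N.finsum_smult_ldistr[symmetric]) (use S f a \<phi> in \<open>auto simp: c subset_iff\<close>)
      finally show ?thesis by (simp add: free_ext_def)
    qed
  qed
qed

subsection \<open>The free Lie algebra\<close>

lemma tree_free: "free_on R (tree_alg R V) (trees_on V)"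
  by (simp add: free_on_def tree_alg_def)

lemmas tree_module[simp] = free_module[OF tree_free]

lemma tree_mult: "(f \<otimes>\<^bsub>tree_alg R V\<^esub> g) t = (case t of Leaf v \<Rightarrow> \<zero> | Node s u \<Rightarrow> f s \<otimes> g u)"
  by (simp add: tree_alg_def)

lemma tree_bilin[simp]: "bilin_alg R (tree_alg R V)"
proof -
  note c = free_carrier_iff[OF tree_free] and s = free_add[OF tree_free] free_smult[OF tree_free]
  have cl: "f \<otimes>\<^bsub>tree_alg R V\<^esub> g \<in> carrier (tree_alg R V)"
    if f: "f \<in> carrier (tree_alg R V)" and g: "g \<in> carrier (tree_alg R V)" for f g
  proof -
    have "{t. (f \<otimes>\<^bsub>tree_alg R V\<^esub> g) t \<noteq> \<zero>} \<subseteq> case_prod Node ` ({x. f x \<noteq> \<zero>} \<times> {x. g x \<noteq> \<zero>})"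
    proof
      fix t assume t: "t \<in> {t. (f \<otimes>\<^bsub>tree_alg R V\<^esub> g) t \<noteq> \<zero>}"
      then obtain s u where "t = Node s u" by (cases t) (auto simp: tree_mult)
      moreover have "f s \<noteq> \<zero>" "g u \<noteq> \<zero>" using t calculation f g by (auto simp: tree_mult c)
      ultimately show "t \<in> case_prod Node ` ({x. f x \<noteq> \<zero>} \<times> {x. g x \<noteq> \<zero>})" by auto
    qed
    moreover have "finite (case_prod Node ` ({x. f x \<noteq> \<zero>} \<times> {x. g x \<noteq> \<zero>}))"
      using f g by (simp add: c)
    moreover have "t \<in> trees_on V" if "(f \<otimes>\<^bsub>tree_alg R V\<^esub> g) t \<noteq> \<zero>" for t
    proof (cases t)
      case (Leaf v)
      then show ?thesis using that by (simp add: tree_mult)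
    next
      case (Node s u)
      have "f s \<noteq> \<zero>" "g u \<noteq> \<zero>" using that Node f g by (auto simp: tree_mult c)
      then have "s \<in> trees_on V" "u \<in> trees_on V" using f g by (auto simp: c)
      then show ?thesis using Node by (auto simp: trees_on_def)
    qed
    moreover have "(f \<otimes>\<^bsub>tree_alg R V\<^esub> g) t \<in> carrier R" for t
      using f g by (auto simp: tree_mult c split: tree.splits)
    ultimately show ?thesis unfolding c using finite_subset by blast
  qed
  show ?thesis
    unfolding bilin_alg_def
  proof (intro conjI ballI mod_homI tree_module cl; assumption?)
    fix x y z a assume "x \<in> carrier (tree_alg R V)" "y \<in> carrier (tree_alg R V)" "z \<in> carrier (tree_alg R V)"
    then have *: "\<And>t. x t \<in> carrier R" "\<And>t. y t \<in> carrier R" "\<And>t. z t \<in> carrier R" by (auto simp: c)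
    show "x \<otimes>\<^bsub>tree_alg R V\<^esub> (y \<oplus>\<^bsub>tree_alg R V\<^esub> z) = x \<otimes>\<^bsub>tree_alg R V\<^esub> y \<oplus>\<^bsub>tree_alg R V\<^esub> x \<otimes>\<^bsub>tree_alg R V\<^esub> z"
      "(y \<oplus>\<^bsub>tree_alg R V\<^esub> z) \<otimes>\<^bsub>tree_alg R V\<^esub> x = y \<otimes>\<^bsub>tree_alg R V\<^esub> x \<oplus>\<^bsub>tree_alg R V\<^esub> z \<otimes>\<^bsub>tree_alg R V\<^esub> x"
      by (auto simp: fun_eq_iff tree_mult s * r_distr l_distr split: tree.splits)
  next
    fix x y z a assume "x \<in> carrier (tree_alg R V)" "y \<in> carrier (tree_alg R V)" and a: "a \<in> carrier R"
    then have *: "\<And>t. x t \<in> carrier R" "\<And>t. y t \<in> carrier R" by (auto simp: c)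
    show "x \<otimes>\<^bsub>tree_alg R V\<^esub> (a \<odot>\<^bsub>tree_alg R V\<^esub> y) = a \<odot>\<^bsub>tree_alg R V\<^esub> (x \<otimes>\<^bsub>tree_alg R V\<^esub> y)"
      "(a \<odot>\<^bsub>tree_alg R V\<^esub> y) \<otimes>\<^bsub>tree_alg R V\<^esub> x = a \<odot>\<^bsub>tree_alg R V\<^esub> (y \<otimes>\<^bsub>tree_alg R V\<^esub> x)"
      using a by (auto simp: fun_eq_iff tree_mult s * m_ac split: tree.splits)
  qed
qed

lemma tree_basis_mult:
  "basis_elem R s \<otimes>\<^bsub>tree_alg R V\<^esub> basis_elem R t = basis_elem R (Node s t)"
  by (auto simp: fun_eq_iff tree_mult basis_elem_def split: tree.splits)

lemma trees_on_simps[simp]: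
  "Leaf v \<in> trees_on V \<longleftrightarrow> v \<in> carrier V" "Node s t \<in> trees_on V \<longleftrightarrow> s \<in> trees_on V \<and> t \<in> trees_on V"
  by (auto simp: trees_on_def)

lemma tree_eval_closed:
  "bilin_alg R B \<Longrightarrow> (\<And>v. v \<in> carrier V \<Longrightarrow> \<phi> v \<in> carrier B) \<Longrightarrow> t \<in> trees_on V \<Longrightarrow> tree_eval B \<phi> t \<in> carrier B"
  by (induction t) auto

text \<open>Both sides are bilinear, so multiplicativity may be tested on a spanning set.\<close>

lemma mult_hom_by_span:
  assumes A: "bilin_alg R A" and B: "bilin_alg R B" and f: "f \<in> mod_hom R A B"
    and G: "G \<subseteq> carrier A" "carrier A = span_of R A G"
    and eq: "\<And>x y. x \<in> G \<Longrightarrow> y \<in> G \<Longrightarrow> f (x \<otimes>\<^bsub>A\<^esub> y) = f x \<otimes>\<^bsub>B\<^esub> f y"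
  shows "f \<in> alg_hom R A B"
proof -
  note mA = bilin_module[OF A] and mB = bilin_module[OF B] and fc = hom_closed[OF f]
  have 1: "f (x \<otimes>\<^bsub>A\<^esub> y) = f x \<otimes>\<^bsub>B\<^esub> f y" if x: "x \<in> G" and y: "y \<in> carrier A" for x y
  proof (rule span_hom_eq[OF mA mB, where f = "\<lambda>y. f (x \<otimes>\<^bsub>A\<^esub> y)" and g = "\<lambda>y. f x \<otimes>\<^bsub>B\<^esub> f y" and G = G])
    show "(\<lambda>y. f (x \<otimes>\<^bsub>A\<^esub> y)) \<in> mod_hom R A B" using x G by (intro hom_comp[OF bil_hom1[OF A] f]) auto
    show "(\<lambda>y. f x \<otimes>\<^bsub>B\<^esub> f y) \<in> mod_hom R A B" using x G fc by (intro hom_comp[OF f bil_hom1[OF B]]) auto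
  qed (use x y G eq in auto)
  have 2: "f (x \<otimes>\<^bsub>A\<^esub> y) = f x \<otimes>\<^bsub>B\<^esub> f y" if x: "x \<in> carrier A" and y: "y \<in> carrier A" for x y
  proof (rule span_hom_eq[OF mA mB, where f = "\<lambda>x. f (x \<otimes>\<^bsub>A\<^esub> y)" and g = "\<lambda>x. f x \<otimes>\<^bsub>B\<^esub> f y" and G = G])
    show "(\<lambda>x. f (x \<otimes>\<^bsub>A\<^esub> y)) \<in> mod_hom R A B" using y by (intro hom_comp[OF bil_hom2[OF A] f]) auto
    show "(\<lambda>x. f x \<otimes>\<^bsub>B\<^esub> f y) \<in> mod_hom R A B" using y fc by (intro hom_comp[OF f bil_hom2[OF B]]) auto
  qed (use x y G 1 in auto)
  then show ?thesis using f by (auto simp: alg_hom_def)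
qed

lemma tree_ext_hom:
  assumes B: "bilin_alg R B" and \<phi>: "\<And>v. v \<in> carrier V \<Longrightarrow> \<phi> v \<in> carrier B"
  shows "free_ext R B (tree_eval B \<phi>) \<in> alg_hom R (tree_alg R V) B"
proof (rule mult_hom_by_span[OF tree_bilin B _ _ free_span[OF tree_free]])
  note cl = tree_eval_closed[OF B \<phi>]
  note b = free_ext_basis[OF tree_free bilin_module[OF B], of V "tree_eval B \<phi>", OF cl]
  show "free_ext R B (tree_eval B \<phi>) \<in> mod_hom R (tree_alg R V) B"
    by (rule free_ext_hom[OF tree_free bilin_module[OF B] cl])
  show "basis_elem R ` trees_on V \<subseteq> carrier (tree_alg R V)"
    using basis_carrier[OF tree_free] by auto
  fix x y assume "x \<in> basis_elem R ` trees_on V" "y \<in> basis_elem R ` trees_on V"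
  then obtain s t where "s \<in> trees_on V" "t \<in> trees_on V" "x = basis_elem R s" "y = basis_elem R t" by auto
  then show "free_ext R B (tree_eval B \<phi>) (x \<otimes>\<^bsub>tree_alg R V\<^esub> y) =
      free_ext R B (tree_eval B \<phi>) x \<otimes>\<^bsub>B\<^esub> free_ext R B (tree_eval B \<phi>) y"
    by (simp add: tree_basis_mult b)
qed

lemma image_const: "a \<in> A \<Longrightarrow> (\<And>y. y \<in> A \<Longrightarrow> f y = c) \<Longrightarrow> f ` A = {c}"
  by auto

lemma quot_lift_coset:
  assumes M: "module R M" "submodule N R M" and B: "module R B" and f: "f \<in> mod_hom R M B"
    and 0: "\<And>x. x \<in> N \<Longrightarrow> f x = \<zero>\<^bsub>B\<^esub>" and x: "x \<in> carrier M"
  shows "quot_lift f (N +>\<^bsub>M\<^esub> x) = f x"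
proof -
  have "f y = f x" if y: "y \<in> N +>\<^bsub>M\<^esub> x" for y
  proof -
    have yc: "y \<in> carrier M" using coset_subset[OF M x y] .
    have "y \<ominus>\<^bsub>M\<^esub> x \<in> N" using y by (simp add: coset_mem_iff[OF M x yc] coset_eq_iff[OF M yc x])
    then have "f y \<ominus>\<^bsub>B\<^esub> f x = \<zero>\<^bsub>B\<^esub>" using 0 hom_diff[OF M(1) B f yc x] by metis
    then show ?thesis using hom_closed[OF f] x yc B by (simp add: mod_diff_zero_iff)
  qed
  then have "f ` (N +>\<^bsub>M\<^esub> x) = {f x}" by (rule image_const[OF coset_self[OF M x]])
  then show ?thesis by (simp add: quot_lift_def)
qed

lemma quot_lift_hom:
  assumes M: "module R M" "submodule N R M" and B: "module R B" and f: "f \<in> mod_hom R M B"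
    and 0: "\<And>x. x \<in> N \<Longrightarrow> f x = \<zero>\<^bsub>B\<^esub>"
  shows "quot_lift f \<in> mod_hom R (quot M N) B"
  by (rule mod_homI) (auto simp: quot_carrier coset_add_eq[OF M] coset_smult_eq[OF M]
      quot_lift_coset[OF M B f 0] hom_add[OF f] hom_smult[OF f] hom_closed[OF f] mod_add[OF M(1)] mod_smult[OF M(1)])

text \<open>This is how homomorphisms descend to algebras given by generators and relations: once the relations
  are killed, so is the ideal which they generate.\<close>

lemma kernel_two_sided:
  assumes A: "bilin_alg R A" and B: "bilin_alg R B" and f: "f \<in> alg_hom R A B"
  shows "two_sided_ideal R A {x \<in> carrier A. f x = \<zero>\<^bsub>B\<^esub>}"
proof -
  have "submodule {x \<in> carrier A. f x \<in> {\<zero>\<^bsub>B\<^esub>}} R A"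
    using A B by (intro sub_vimage[OF _ _ alg_hom_hom[OF f]] subI) auto
  then show ?thesis
    using A B hom_closed[OF alg_hom_hom[OF f]] by (auto simp: two_sided_ideal_def alg_hom_mult[OF f])
qed

context
  fixes V :: "('a, 'v, 'k) module_scheme"
  assumes V: "module R V"
begin

lemma lie_rels_carrier: "lie_rels R V \<subseteq> carrier (tree_alg R V)"
  using basis_carrier[OF tree_free, of _ V] V by (auto simp: lie_rels_def Let_def)

lemma lie_ideal_two_sided: "two_sided_ideal R (tree_alg R V) (lie_ideal R V)"
  unfolding lie_ideal_def by (rule ideal_two_sided[OF tree_bilin lie_rels_carrier])

lemma lie_ideal_sub: "submodule (lie_ideal R V) R (tree_alg R V)"
  using lie_ideal_two_sided by (simp add: two_sided_ideal_def)

lemma Lie_carrier: "carrier (Lie R V) = (\<lambda>x. lie_ideal R V +>\<^bsub>tree_alg R V\<^esub> x) ` carrier (tree_alg R V)"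
  by (simp add: Lie_def quot_carrier)

lemma Lie_lie_alg: "lie_alg R (Lie R V)"
proof -
  let ?A = "tree_alg R V" and ?I = "lie_ideal R V"
  have bil: "bilin_alg R (Lie R V)"
    unfolding Lie_def by (rule quot_bilin[OF tree_bilin lie_ideal_two_sided])
  have incl: "x \<in> lie_rels R V \<Longrightarrow> x \<in> ?I" for x by (simp add: lie_ideal_def ideal_incl)
  note e = coset_add_eq[OF tree_module lie_ideal_sub] coset_mult_eq[OF tree_bilin lie_ideal_two_sided]
    coset_zero_iff[OF tree_module lie_ideal_sub]
  show ?thesis
    unfolding lie_alg_def
  proof (intro conjI bil ballI)
    fix x y assume "x \<in> carrier (Lie R V)" "y \<in> carrier (Lie R V)"
    then obtain a b where ab: "a \<in> carrier ?A" "b \<in> carrier ?A" "x = ?I +>\<^bsub>?A\<^esub> a" "y = ?I +>\<^bsub>?A\<^esub> b"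
      by (auto simp: Lie_carrier)
    then have "a \<otimes>\<^bsub>?A\<^esub> b \<oplus>\<^bsub>?A\<^esub> b \<otimes>\<^bsub>?A\<^esub> a \<in> ?I" by (intro incl) (auto simp: lie_rels_def Let_def)
    then show "x \<otimes>\<^bsub>Lie R V\<^esub> y \<oplus>\<^bsub>Lie R V\<^esub> y \<otimes>\<^bsub>Lie R V\<^esub> x = \<zero>\<^bsub>Lie R V\<^esub>"
      using ab by (simp add: Lie_def e)
    fix z assume "z \<in> carrier (Lie R V)"
    then obtain c where c: "c \<in> carrier ?A" "z = ?I +>\<^bsub>?A\<^esub> c" by (auto simp: Lie_carrier)
    have "((a \<otimes>\<^bsub>?A\<^esub> b) \<otimes>\<^bsub>?A\<^esub> c) \<oplus>\<^bsub>?A\<^esub> ((b \<otimes>\<^bsub>?A\<^esub> c) \<otimes>\<^bsub>?A\<^esub> a) \<oplus>\<^bsub>?A\<^esub> ((c \<otimes>\<^bsub>?A\<^esub> a) \<otimes>\<^bsub>?A\<^esub> b) \<in> ?I"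
      using ab c by (intro incl) (unfold lie_rels_def Let_def, blast)
    then show "((x \<otimes>\<^bsub>Lie R V\<^esub> y) \<otimes>\<^bsub>Lie R V\<^esub> z) \<oplus>\<^bsub>Lie R V\<^esub> ((y \<otimes>\<^bsub>Lie R V\<^esub> z) \<otimes>\<^bsub>Lie R V\<^esub> x) \<oplus>\<^bsub>Lie R V\<^esub>
        ((z \<otimes>\<^bsub>Lie R V\<^esub> x) \<otimes>\<^bsub>Lie R V\<^esub> y) = \<zero>\<^bsub>Lie R V\<^esub>"
      using ab c by (simp add: Lie_def e)
  qed
qed

lemma tree_class_carrier: "t \<in> trees_on V \<Longrightarrow> tree_class R V t \<in> carrier (Lie R V)"
  by (simp add: tree_class_def Lie_carrier basis_carrier[OF tree_free])

lemma tree_class_Node: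
  "s \<in> trees_on V \<Longrightarrow> t \<in> trees_on V \<Longrightarrow>
    tree_class R V (Node s t) = tree_class R V s \<otimes>\<^bsub>Lie R V\<^esub> tree_class R V t"
  by (simp add: tree_class_def Lie_def coset_mult_eq[OF tree_bilin lie_ideal_two_sided]
      basis_carrier[OF tree_free] tree_basis_mult)

lemma Lie_span: "carrier (Lie R V) = span_of R (Lie R V) (tree_class R V ` trees_on V)"
proof -
  let ?A = "tree_alg R V"
  have "carrier (Lie R V) = (\<lambda>x. lie_ideal R V +>\<^bsub>?A\<^esub> x) ` span_of R ?A (basis_elem R ` trees_on V)"
    by (simp add: Lie_carrier free_span[OF tree_free, of V, symmetric])
  also have "\<dots> = span_of R (Lie R V) ((\<lambda>x. lie_ideal R V +>\<^bsub>?A\<^esub> x) ` basis_elem R ` trees_on V)"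
    unfolding Lie_def using basis_carrier[OF tree_free, of _ V]
    by (intro span_image[OF tree_module module_quot[OF tree_module lie_ideal_sub]
          proj_hom[OF tree_module lie_ideal_sub]]) auto
  finally show ?thesis by (simp add: image_image tree_class_def)
qed

lemma gen_carrier: "v \<in> carrier V \<Longrightarrow> gen R V v \<in> carrier (Lie R V)"
  by (simp add: gen_def tree_class_carrier)

lemma gen_hom: "gen R V \<in> mod_hom R V (Lie R V)"
proof -
  let ?A = "tree_alg R V" and ?I = "lie_ideal R V"
  have incl: "x \<in> lie_rels R V \<Longrightarrow> x \<in> ?I" for x by (simp add: lie_ideal_def ideal_incl)
  note b = basis_carrier[OF tree_free]
  note e = coset_add_eq[OF tree_module lie_ideal_sub] coset_smult_eq[OF tree_module lie_ideal_sub]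
  show ?thesis
  proof (rule mod_homI)
    fix v w assume vw: "v \<in> carrier V" "w \<in> carrier V"
    then have "basis_elem R (Leaf (v \<oplus>\<^bsub>V\<^esub> w)) \<ominus>\<^bsub>?A\<^esub> (basis_elem R (Leaf v) \<oplus>\<^bsub>?A\<^esub> basis_elem R (Leaf w)) \<in> ?I"
      by (intro incl) (auto simp: lie_rels_def Let_def)
    then show "gen R V (v \<oplus>\<^bsub>V\<^esub> w) = gen R V v \<oplus>\<^bsub>Lie R V\<^esub> gen R V w"
      using vw V by (simp add: gen_def tree_class_def Lie_def e b coset_eq_iff[OF tree_module lie_ideal_sub])
  next
    fix a v assume av: "a \<in> carrier R" "v \<in> carrier V"
    then have "basis_elem R (Leaf (a \<odot>\<^bsub>V\<^esub> v)) \<ominus>\<^bsub>?A\<^esub> (a \<odot>\<^bsub>?A\<^esub> basis_elem R (Leaf v)) \<in> ?I"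
      by (intro incl) (auto simp: lie_rels_def Let_def)
    then show "gen R V (a \<odot>\<^bsub>V\<^esub> v) = a \<odot>\<^bsub>Lie R V\<^esub> gen R V v"
      using av V by (simp add: gen_def tree_class_def Lie_def e b coset_eq_iff[OF tree_module lie_ideal_sub])
  qed (simp add: gen_carrier)
qed

lemma Lie_induct:
  assumes H: "submodule H R (Lie R V)" and g: "\<And>v. v \<in> carrier V \<Longrightarrow> gen R V v \<in> H"
    and m: "\<And>x y. x \<in> H \<Longrightarrow> y \<in> H \<Longrightarrow> x \<otimes>\<^bsub>Lie R V\<^esub> y \<in> H" and x: "x \<in> carrier (Lie R V)"
  shows "x \<in> H"
proof -
  have "tree_class R V t \<in> H" if "t \<in> trees_on V" for t
    using that by (induction t) (auto simp: g m tree_class_Node gen_def[symmetric])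
  then show ?thesis using span_le[OF H, of "tree_class R V ` trees_on V" x] x Lie_span by auto
qed

text \<open>By the Jacobi identity the elements whose adjoint action preserves \<open>H\<close> form a subalgebra. It contains
  the generators, so it is everything, and \<open>H\<close> is itself a subalgebra.\<close>

lemma Lie_right_normed_induct:
  assumes H: "submodule H R (Lie R V)" and g: "\<And>v. v \<in> carrier V \<Longrightarrow> gen R V v \<in> H"
    and m: "\<And>v y. v \<in> carrier V \<Longrightarrow> y \<in> H \<Longrightarrow> gen R V v \<otimes>\<^bsub>Lie R V\<^esub> y \<in> H" and x: "x \<in> carrier (Lie R V)"
  shows "x \<in> H"
proof -
  let ?L = "Lie R V"
  note [simp] = Lie_lie_alg and Hc[simp] = sub_carrier[OF bilin_module[OF lie_bilin[OF Lie_lie_alg]] H]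
  define S where "S = {x \<in> carrier ?L. \<forall>y\<in>H. x \<otimes>\<^bsub>?L\<^esub> y \<in> H}"
  have S: "submodule S R ?L"
    unfolding S_def
    by (rule subI) (auto simp: bil_ladd bil_lsmult intro: sub_zero[OF _ H] sub_add[OF _ H] sub_smult[OF _ H])
  have "z \<in> S" if "z \<in> carrier ?L" for z
  proof (rule Lie_induct[OF S _ _ that])
    show "gen R V v \<in> S" if "v \<in> carrier V" for v using that m by (simp add: S_def gen_carrier)
    fix x y assume xy: "x \<in> S" "y \<in> S"
    have "(x \<otimes>\<^bsub>?L\<^esub> y) \<otimes>\<^bsub>?L\<^esub> u \<in> H" if u: "u \<in> H" for u
    proof -
      have "x \<otimes>\<^bsub>?L\<^esub> (y \<otimes>\<^bsub>?L\<^esub> u) \<ominus>\<^bsub>?L\<^esub> y \<otimes>\<^bsub>?L\<^esub> (x \<otimes>\<^bsub>?L\<^esub> u) \<in> H"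
        using xy u by (intro sub_diff[OF _ H]) (auto simp: S_def)
      moreover have "x \<otimes>\<^bsub>?L\<^esub> (y \<otimes>\<^bsub>?L\<^esub> u) \<ominus>\<^bsub>?L\<^esub> y \<otimes>\<^bsub>?L\<^esub> (x \<otimes>\<^bsub>?L\<^esub> u) = (x \<otimes>\<^bsub>?L\<^esub> y) \<otimes>\<^bsub>?L\<^esub> u"
        using xy u lie_leibniz[OF Lie_lie_alg, of x y u] by (simp add: S_def mod_ac)
      ultimately show ?thesis by simp
    qed
    then show "x \<otimes>\<^bsub>?L\<^esub> y \<in> S" using xy by (simp add: S_def)
  qed
  then show ?thesis
    using Lie_induct[OF H g _ x] by (simp add: S_def)
qed

lemma Lie_hom_unique:
  assumes B: "bilin_alg R B" and f: "f \<in> alg_hom R (Lie R V) B" and g: "g \<in> alg_hom R (Lie R V) B"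
    and eq: "\<And>v. v \<in> carrier V \<Longrightarrow> f (gen R V v) = g (gen R V v)" and x: "x \<in> carrier (Lie R V)"
  shows "f x = g x"
proof -
  have "x \<in> {x \<in> carrier (Lie R V). f x = g x}"
  proof (rule Lie_induct[OF _ _ _ x])
    show "submodule {x \<in> carrier (Lie R V). f x = g x} R (Lie R V)"
      using B Lie_lie_alg by (intro sub_equalizer[OF _ _ alg_hom_hom[OF f] alg_hom_hom[OF g]]) auto
  qed (use B Lie_lie_alg in \<open>auto simp: eq gen_carrier alg_hom_mult[OF f] alg_hom_mult[OF g]\<close>)
  then show ?thesis by simp
qed

lemma lie_ext:
  assumes B: "lie_alg R B" and \<phi>: "\<phi> \<in> mod_hom R V B"
  shows lie_ext_hom: "lie_ext R B \<phi> \<in> alg_hom R (Lie R V) B"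
    and lie_ext_gen: "v \<in> carrier V \<Longrightarrow> lie_ext R B \<phi> (gen R V v) = \<phi> v"
proof -
  let ?A = "tree_alg R V" and ?I = "lie_ideal R V" and ?F = "free_ext R B (tree_eval B \<phi>)"
  note \<phi>c = hom_closed[OF \<phi>] and [simp] = B
  have F: "?F \<in> alg_hom R ?A B" by (rule tree_ext_hom) (auto simp: \<phi>c)
  note Fh = alg_hom_hom[OF F] and Fm = alg_hom_mult[OF F]
  note Fc[simp] = hom_closed[OF Fh]
  have b: "?F (basis_elem R (Leaf v)) = \<phi> v" if "v \<in> carrier V" for v
    using free_ext_basis[OF tree_free, of B V "tree_eval B \<phi>" "Leaf v"] tree_eval_closed[of B V \<phi>] \<phi>c that by simp
  note bc[simp] = basis_carrier[OF tree_free]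
  have "lie_rels R V \<subseteq> {x \<in> carrier ?A. ?F x = \<zero>\<^bsub>B\<^esub>}"
  proof
    fix x assume x: "x \<in> lie_rels R V"
    then have xc: "x \<in> carrier ?A" using lie_rels_carrier by auto
    have J2: "a \<otimes>\<^bsub>B\<^esub> b \<oplus>\<^bsub>B\<^esub> b \<otimes>\<^bsub>B\<^esub> a = \<zero>\<^bsub>B\<^esub>" if "a \<in> carrier B" "b \<in> carrier B" for a b
      using B that by (auto simp: lie_alg_def)
    have J: "((a \<otimes>\<^bsub>B\<^esub> b) \<otimes>\<^bsub>B\<^esub> c) \<oplus>\<^bsub>B\<^esub> ((b \<otimes>\<^bsub>B\<^esub> c) \<otimes>\<^bsub>B\<^esub> a) \<oplus>\<^bsub>B\<^esub> ((c \<otimes>\<^bsub>B\<^esub> a) \<otimes>\<^bsub>B\<^esub> b) = \<zero>\<^bsub>B\<^esub>"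
      if "a \<in> carrier B" "b \<in> carrier B" "c \<in> carrier B" for a b c
      using B that by (auto simp: lie_alg_def)
    have "?F x = \<zero>\<^bsub>B\<^esub>"
      using x V unfolding lie_rels_def Let_def
      by (auto simp: hom_diff[OF tree_module _ Fh] hom_add[OF Fh] hom_smult[OF Fh] Fm b J J2
          hom_add[OF \<phi>] hom_smult[OF \<phi>] \<phi>c)
    then show "x \<in> {x \<in> carrier ?A. ?F x = \<zero>\<^bsub>B\<^esub>}" using xc by simp
  qed
  then have 0: "?F x = \<zero>\<^bsub>B\<^esub>" if "x \<in> ?I" for x
    using ideal_le[OF kernel_two_sided[OF tree_bilin _ F], of "lie_rels R V" x] that
    by (auto simp: lie_ideal_def)
  note q = quot_lift_coset[OF tree_module lie_ideal_sub bilin_module[OF lie_bilin[OF B]] Fh 0]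
  have "lie_ext R B \<phi> \<in> mod_hom R (Lie R V) B"
    unfolding lie_ext_def Lie_def
    by (rule quot_lift_hom[OF tree_module lie_ideal_sub _ Fh 0]) auto
  then show "lie_ext R B \<phi> \<in> alg_hom R (Lie R V) B"
    unfolding alg_hom_def
    by (auto simp: lie_ext_def Lie_def quot_carrier coset_mult_eq[OF tree_bilin lie_ideal_two_sided] q Fm)
  show "v \<in> carrier V \<Longrightarrow> lie_ext R B \<phi> (gen R V v) = \<phi> v"
    by (simp add: gen_def tree_class_def lie_ext_def q b)
qed

end

subsection \<open>Derivations with values in a module\<close>

lemma dsum_sel[simp]:
  "carrier (dsum M N) = carrier M \<times> carrier N" "\<zero>\<^bsub>dsum M N\<^esub> = (\<zero>\<^bsub>M\<^esub>, \<zero>\<^bsub>N\<^esub>)"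
  "p \<oplus>\<^bsub>dsum M N\<^esub> q = (fst p \<oplus>\<^bsub>M\<^esub> fst q, snd p \<oplus>\<^bsub>N\<^esub> snd q)" "a \<odot>\<^bsub>dsum M N\<^esub> p = (a \<odot>\<^bsub>M\<^esub> fst p, a \<odot>\<^bsub>N\<^esub> snd p)"
  by (simp_all add: dsum_def)

lemma module_dsum[simp]:
  assumes [simp]: "module R M" "module R N"
  shows "module R (dsum M N)"
proof -
  have "abelian_group (dsum M N)"
  proof (rule abelian_groupI)
    show "\<exists>y\<in>carrier (dsum M N). y \<oplus>\<^bsub>dsum M N\<^esub> x = \<zero>\<^bsub>dsum M N\<^esub>" if "x \<in> carrier (dsum M N)" for x
      using that by (intro bexI[of _ "(\<ominus>\<^bsub>M\<^esub> fst x, \<ominus>\<^bsub>N\<^esub> snd x)"]) auto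
  qed (auto simp: mod_ac)
  then show ?thesis
    by (intro moduleI is_cring) (auto simp: mod_smult_add mod_add_smult mod_mult_smult)
qed

lemma semidirect_sel[simp]:
  "carrier (semidirect M N act) = carrier M \<times> carrier N" "\<zero>\<^bsub>semidirect M N act\<^esub> = (\<zero>\<^bsub>M\<^esub>, \<zero>\<^bsub>N\<^esub>)"
  "p \<oplus>\<^bsub>semidirect M N act\<^esub> q = (fst p \<oplus>\<^bsub>M\<^esub> fst q, snd p \<oplus>\<^bsub>N\<^esub> snd q)"
  "a \<odot>\<^bsub>semidirect M N act\<^esub> p = (a \<odot>\<^bsub>M\<^esub> fst p, a \<odot>\<^bsub>N\<^esub> snd p)"
  "p \<otimes>\<^bsub>semidirect M N act\<^esub> q = (fst p \<otimes>\<^bsub>M\<^esub> fst q, act (fst p) (snd q) \<ominus>\<^bsub>N\<^esub> act (fst q) (snd p))"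
  by (simp_all add: dsum_def semidirect_def)

lemma module_cong:
  assumes "module R M" "carrier N = carrier M" "add N = add M" "zero N = zero M" "smult N = smult M"
  shows "module R N"
proof -
  have "abelian_group N"
  proof (rule abelian_groupI)
    show "\<exists>y\<in>carrier N. y \<oplus>\<^bsub>N\<^esub> x = \<zero>\<^bsub>N\<^esub>" if "x \<in> carrier N" for x
      using that assms by (intro bexI[of _ "\<ominus>\<^bsub>M\<^esub> x"]) auto
  qed (use assms in \<open>auto simp: mod_ac\<close>)
  then show ?thesis
    using assms by (intro moduleI is_cring) (auto simp: mod_smult_add mod_add_smult mod_mult_smult)
qed

lemma
  assumes "lie_module R B M act"
  shows act_module: "module R M"
    and act_hom: "a \<in> carrier B \<Longrightarrow> act a \<in> mod_hom R M M"
    and act_hom2: "m \<in> carrier M \<Longrightarrow> (\<lambda>a. act a m) \<in> mod_hom R B M"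
    and act_bracket: "a \<in> carrier B \<Longrightarrow> b \<in> carrier B \<Longrightarrow> m \<in> carrier M \<Longrightarrow>
      act (a \<otimes>\<^bsub>B\<^esub> b) m = act a (act b m) \<ominus>\<^bsub>M\<^esub> act b (act a m)"
  using assms by (auto simp: lie_module_def)

lemma semidirect_lie:
  assumes B: "lie_alg R B" and M: "lie_module R B M act"
  shows "lie_alg R (semidirect B M act)"
proof -
  note m[simp] = act_module[OF M] and [simp] = B
  note c[simp] = hom_closed[OF act_hom[OF M]]
  note a = hom_add[OF act_hom[OF M]] hom_smult[OF act_hom[OF M]] hom_neg[OF m m act_hom[OF M]]
    hom_add[OF act_hom2[OF M]] hom_smult[OF act_hom2[OF M]] act_bracket[OF M]
  show ?thesis
  proof (rule lie_algI)
    show "bilin_alg R (semidirect B M act)"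
      unfolding bilin_alg_def
    proof (intro conjI ballI mod_homI)
      show "module R (semidirect B M act)"
        by (rule module_cong[of "dsum B M"]) (auto simp: fun_eq_iff semidirect_def)
    qed (auto simp: a bil_simps mod_smult_add mod_smult_neg mod_ac)
    fix x y assume "x \<in> carrier (semidirect B M act)" "y \<in> carrier (semidirect B M act)"
    then show "x \<otimes>\<^bsub>semidirect B M act\<^esub> y \<oplus>\<^bsub>semidirect B M act\<^esub> y \<otimes>\<^bsub>semidirect B M act\<^esub> x = \<zero>\<^bsub>semidirect B M act\<^esub>"
      using lie_antisym[OF B, of "fst x" "fst y"] by (auto simp: mod_ac)
    fix z assume "z \<in> carrier (semidirect B M act)"
    then show "x \<otimes>\<^bsub>semidirect B M act\<^esub> (y \<otimes>\<^bsub>semidirect B M act\<^esub> z) = (x \<otimes>\<^bsub>semidirect B M act\<^esub> y) \<otimes>\<^bsub>semidirect B M act\<^esub> z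
        \<oplus>\<^bsub>semidirect B M act\<^esub> y \<otimes>\<^bsub>semidirect B M act\<^esub> (x \<otimes>\<^bsub>semidirect B M act\<^esub> z)"
      using \<open>x \<in> _\<close> \<open>y \<in> _\<close> lie_leibniz[OF B, of "fst x" "fst y" "fst z"]
      by (auto simp: a mod_ac)
  qed
qed

context
  fixes V :: "('a, 'v, 'k) module_scheme" and B :: "('a, 'e, 'm) module_scheme"
    and M :: "('a, 'c, 'n) module_scheme" and act j h
  assumes V: "module R V" and B: "lie_alg R B" and M: "lie_module R B M act"
    and j: "j \<in> alg_hom R (Lie R V) B" and h: "h \<in> mod_hom R V M"
begin

lemma der_along:
  shows der_along_hom: "der_along R V B M act j h \<in> mod_hom R (Lie R V) M"
    and der_along_gen: "v \<in> carrier V \<Longrightarrow> der_along R V B M act j h (gen R V v) = h v"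
    and der_along_mult: "x \<in> carrier (Lie R V) \<Longrightarrow> y \<in> carrier (Lie R V) \<Longrightarrow>
      der_along R V B M act j h (x \<otimes>\<^bsub>Lie R V\<^esub> y) =
      act (j x) (der_along R V B M act j h y) \<ominus>\<^bsub>M\<^esub> act (j y) (der_along R V B M act j h x)"
proof -
  let ?S = "semidirect B M act"
  define \<phi> where "\<phi> = (\<lambda>v. (j (gen R V v), h v))"
  have \<phi>: "\<phi> \<in> mod_hom R V ?S"
    by (rule mod_homI) (auto simp: \<phi>_def hom_add[OF h] hom_smult[OF h] hom_closed[OF h]
        hom_add[OF hom_comp[OF gen_hom[OF V] alg_hom_hom[OF j]]] hom_smult[OF hom_comp[OF gen_hom[OF V] alg_hom_hom[OF j]]]
        hom_closed[OF alg_hom_hom[OF j]] gen_carrier[OF V])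
  note E = lie_ext_hom[OF V semidirect_lie[OF B M] \<phi>] and Eg = lie_ext_gen[OF V semidirect_lie[OF B M] \<phi>]
  have fst: "fst \<in> alg_hom R ?S B" and snd: "snd \<in> mod_hom R ?S M"
    by (auto simp: alg_hom_def mod_hom_def)
  have f: "fst (lie_ext R ?S \<phi> x) = j x" if "x \<in> carrier (Lie R V)" for x
    by (rule Lie_hom_unique[OF V lie_bilin[OF B] alg_hom_comp[OF E fst] j _ that]) (simp add: Eg, simp add: \<phi>_def)
  have d: "der_along R V B M act j h = (\<lambda>x. snd (lie_ext R ?S \<phi> x))"
    by (simp add: der_along_def \<phi>_def fun_eq_iff)
  show "der_along R V B M act j h \<in> mod_hom R (Lie R V) M"
    unfolding d by (rule hom_comp[OF alg_hom_hom[OF E] snd])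
  show "v \<in> carrier V \<Longrightarrow> der_along R V B M act j h (gen R V v) = h v"
    by (simp add: d Eg, simp add: \<phi>_def)
  show "x \<in> carrier (Lie R V) \<Longrightarrow> y \<in> carrier (Lie R V) \<Longrightarrow>
      der_along R V B M act j h (x \<otimes>\<^bsub>Lie R V\<^esub> y) =
      act (j x) (der_along R V B M act j h y) \<ominus>\<^bsub>M\<^esub> act (j y) (der_along R V B M act j h x)"
    by (simp add: d alg_hom_mult[OF E] f)
qed

end

end

section \<open>Derivations of free Lie algebras\<close>

definition lie_der :: "('a, 'r) ring_scheme \<Rightarrow> ('a, 'v, 'k) module_scheme \<Rightarrow> ('a, 'b, 'm) module_scheme \<Rightarrow>
    (('v tree \<Rightarrow> 'a) set \<Rightarrow> 'b) \<Rightarrow> (('v tree \<Rightarrow> 'a) set \<Rightarrow> 'b) \<Rightarrow> bool"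
  where "lie_der R V B j d \<longleftrightarrow> d \<in> mod_hom R (Lie R V) B \<and>
    (\<forall>x\<in>carrier (Lie R V). \<forall>y\<in>carrier (Lie R V). d (x \<otimes>\<^bsub>Lie R V\<^esub> y) = d x \<otimes>\<^bsub>B\<^esub> j y \<oplus>\<^bsub>B\<^esub> j x \<otimes>\<^bsub>B\<^esub> d y)"

context cring
begin

text \<open>For the adjoint representation, derivations over \<open>j\<close> satisfy the usual Leibniz rule.\<close>

lemma adjoint_lie_module:
  assumes L: "lie_alg R L"
  shows "lie_module R L L (mult L)"
  unfolding lie_module_def
proof (intro conjI ballI)
  note [simp] = L
  fix a b m assume [simp]: "a \<in> carrier L" "b \<in> carrier L" "m \<in> carrier L"
  show "(a \<otimes>\<^bsub>L\<^esub> b) \<otimes>\<^bsub>L\<^esub> m = a \<otimes>\<^bsub>L\<^esub> (b \<otimes>\<^bsub>L\<^esub> m) \<ominus>\<^bsub>L\<^esub> b \<otimes>\<^bsub>L\<^esub> (a \<otimes>\<^bsub>L\<^esub> m)"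
    using lie_leibniz[OF L, of a b m] by (simp add: mod_ac)
qed (use L in \<open>auto simp: bil_hom1 bil_hom2\<close>)

lemma Lie_module[simp]: "module R V \<Longrightarrow> module R (Lie R V)"
  and Lie_bilin[simp]: "module R V \<Longrightarrow> bilin_alg R (Lie R V)"
  by (simp_all add: Lie_lie_alg)

lemmas gen_closed[simp] = gen_carrier

lemma lie_derD:
  assumes "lie_der R V B j d"
  shows lie_der_hom: "d \<in> mod_hom R (Lie R V) B"
    and lie_der_mult: "x \<in> carrier (Lie R V) \<Longrightarrow> y \<in> carrier (Lie R V) \<Longrightarrow>
      d (x \<otimes>\<^bsub>Lie R V\<^esub> y) = d x \<otimes>\<^bsub>B\<^esub> j y \<oplus>\<^bsub>B\<^esub> j x \<otimes>\<^bsub>B\<^esub> d y"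
  using assms by (auto simp: lie_der_def)

lemma lie_der_along:
  assumes V: "module R V" and B: "lie_alg R B" and j: "j \<in> alg_hom R (Lie R V) B" and h: "h \<in> mod_hom R V B"
  shows "lie_der R V B j (der_along R V B B (mult B) j h)"
proof -
  note D = der_along[OF V B adjoint_lie_module[OF B] j h]
  have "j x \<otimes>\<^bsub>B\<^esub> b \<ominus>\<^bsub>B\<^esub> j y \<otimes>\<^bsub>B\<^esub> c = c \<otimes>\<^bsub>B\<^esub> j y \<oplus>\<^bsub>B\<^esub> j x \<otimes>\<^bsub>B\<^esub> b"
    if "x \<in> carrier (Lie R V)" "y \<in> carrier (Lie R V)" "b \<in> carrier B" "c \<in> carrier B" for x y b c
    using that B hom_closed[OF alg_hom_hom[OF j]] lie_antisym[OF B, of "j y" c] by (simp add: mod_ac)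
  then show ?thesis
    unfolding lie_der_def using D(1,3) hom_closed[OF D(1)] by simp
qed

lemma lie_der_unique:
  assumes V: "module R V" and B: "bilin_alg R B" and j: "j \<in> mod_hom R (Lie R V) B"
    and d: "lie_der R V B j d" and e: "lie_der R V B j e"
    and eq: "\<And>v. v \<in> carrier V \<Longrightarrow> d (gen R V v) = e (gen R V v)" and x: "x \<in> carrier (Lie R V)"
  shows "d x = e x"
proof -
  have "x \<in> {x \<in> carrier (Lie R V). d x = e x}"
  proof (rule Lie_induct[OF V _ _ _ x])
    show "submodule {x \<in> carrier (Lie R V). d x = e x} R (Lie R V)"
      using V B by (intro sub_equalizer[OF _ _ lie_der_hom[OF d] lie_der_hom[OF e]]) auto
  qed (use V B in \<open>auto simp: eq lie_der_mult[OF d] lie_der_mult[OF e]\<close>)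
  then show ?thesis by simp
qed

lemma lie_der_add:
  assumes B: "bilin_alg R B" and j: "j \<in> mod_hom R (Lie R V) B"
    and d: "lie_der R V B j d" and e: "lie_der R V B j e"
  shows "lie_der R V B j (\<lambda>x. d x \<oplus>\<^bsub>B\<^esub> e x)"
  unfolding lie_der_def
  using hom_add_map[OF bilin_module[OF B] lie_der_hom[OF d] lie_der_hom[OF e]] B
    hom_closed[OF lie_der_hom[OF d]] hom_closed[OF lie_der_hom[OF e]] hom_closed[OF j]
  by (auto simp: lie_der_mult[OF d] lie_der_mult[OF e] bil_ladd bil_radd mod_ac)

lemma lie_der_smult:
  assumes B: "bilin_alg R B" and j: "j \<in> mod_hom R (Lie R V) B"
    and d: "lie_der R V B j d" and a: "a \<in> carrier R"
  shows "lie_der R V B j (\<lambda>x. a \<odot>\<^bsub>B\<^esub> d x)"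
  unfolding lie_der_def
  using hom_smult_map[OF bilin_module[OF B] lie_der_hom[OF d] a] B a
    hom_closed[OF lie_der_hom[OF d]] hom_closed[OF j]
  by (auto simp: lie_der_mult[OF d] bil_lsmult bil_rsmult mod_smult_add)

lemma lie_der_zero:
  assumes B: "bilin_alg R B" and j: "j \<in> mod_hom R (Lie R V) B"
  shows "lie_der R V B j (\<lambda>x. \<zero>\<^bsub>B\<^esub>)"
  unfolding lie_der_def using B hom_closed[OF j] by (auto simp: hom_zero_map)

lemma lie_der_post:
  assumes B: "bilin_alg R B" and j: "j \<in> mod_hom R (Lie R V) B"
    and d: "lie_der R V B j d" and f: "f \<in> alg_hom R B C"
  shows "lie_der R V C (\<lambda>x. f (j x)) (\<lambda>x. f (d x))"
  unfolding lie_der_def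
  using hom_comp[OF lie_der_hom[OF d] alg_hom_hom[OF f]] B
    hom_closed[OF lie_der_hom[OF d]] hom_closed[OF j]
  by (auto simp: lie_der_mult[OF d] alg_hom_mult[OF f] hom_add[OF alg_hom_hom[OF f]])

lemma lie_der_pre:
  assumes g: "g \<in> alg_hom R (Lie R U) (Lie R V)" and d: "lie_der R V B j d"
  shows "lie_der R U B (\<lambda>x. j (g x)) (\<lambda>x. d (g x))"
  unfolding lie_der_def
  using hom_comp[OF alg_hom_hom[OF g] lie_der_hom[OF d]] hom_closed[OF alg_hom_hom[OF g]]
  by (auto simp: lie_der_mult[OF d] alg_hom_mult[OF g])

lemma alg_hom_id: "(\<lambda>x. x) \<in> alg_hom R L L"
  by (auto simp: alg_hom_def hom_id)

subsection \<open>The module of derivations\<close>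

lemma derivations_iff:
  "d \<in> derivations R V \<longleftrightarrow> lie_der R V (Lie R V) (\<lambda>x. x) d \<and> d \<in> extensional (carrier (Lie R V))"
  by (auto simp: derivations_def lie_der_def)

lemma derivations_lie_der: "d \<in> derivations R V \<Longrightarrow> lie_der R V (Lie R V) (\<lambda>x. x) d"
  by (simp add: derivations_iff)

lemma derivations_hom: "d \<in> derivations R V \<Longrightarrow> d \<in> mod_hom R (Lie R V) (Lie R V)"
  by (auto simp: derivations_def)

lemma derivations_closed[simp]: "d \<in> derivations R V \<Longrightarrow> x \<in> carrier (Lie R V) \<Longrightarrow> d x \<in> carrier (Lie R V)"
  by (rule hom_closed[OF derivations_hom])

lemma derivations_mult: "d \<in> derivations R V \<Longrightarrow> x \<in> carrier (Lie R V) \<Longrightarrow> y \<in> carrier (Lie R V) \<Longrightarrow>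
    d (x \<otimes>\<^bsub>Lie R V\<^esub> y) = d x \<otimes>\<^bsub>Lie R V\<^esub> y \<oplus>\<^bsub>Lie R V\<^esub> x \<otimes>\<^bsub>Lie R V\<^esub> d y"
  by (auto simp: derivations_def)

lemma lie_der_restrict:
  assumes V: "module R V" and d: "lie_der R V (Lie R V) (\<lambda>x. x) d"
  shows "restrict d (carrier (Lie R V)) \<in> derivations R V"
  using hom_restrict[OF _ lie_der_hom[OF d]] V by (auto simp: derivations_def lie_der_mult[OF d])

lemma der_eqI:
  assumes V: "module R V" and d: "d \<in> derivations R V" and e: "e \<in> derivations R V"
    and eq: "\<And>v. v \<in> carrier V \<Longrightarrow> d (gen R V v) = e (gen R V v)"
  shows "d = e"
proof
  fix x show "d x = e x"
  proof (cases "x \<in> carrier (Lie R V)")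
    case True
    then show ?thesis
      using lie_der_unique[OF V Lie_bilin[OF V] hom_id derivations_lie_der[OF d] derivations_lie_der[OF e] eq] by simp
  next
    case False
    then show ?thesis using d e by (auto simp: derivations_def extensional_def)
  qed
qed

lemma der_ext:
  assumes V: "module R V" and h: "h \<in> mod_hom R V (Lie R V)"
  shows der_ext_der: "der_ext R V h \<in> derivations R V"
    and der_ext_gen: "v \<in> carrier V \<Longrightarrow> der_ext R V h (gen R V v) = h v"
proof -
  let ?L = "Lie R V"
  let ?d = "restrict (der_along R V ?L ?L (mult ?L) (\<lambda>x. x) h) (carrier ?L)"
  have d: "?d \<in> derivations R V"
    by (rule lie_der_restrict[OF V lie_der_along[OF V Lie_lie_alg[OF V] alg_hom_id h]])
  have g: "?d (gen R V v) = h v" if "v \<in> carrier V" for v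
    using that der_along_gen[OF V Lie_lie_alg[OF V] adjoint_lie_module[OF Lie_lie_alg[OF V]] alg_hom_id h] V by simp
  have "der_ext R V h \<in> derivations R V \<and> (\<forall>v\<in>carrier V. der_ext R V h (gen R V v) = h v)"
    unfolding der_ext_def
  proof (rule theI[of _ ?d])
    fix e assume "e \<in> derivations R V \<and> (\<forall>v\<in>carrier V. e (gen R V v) = h v)"
    then show "e = ?d" using g by (intro der_eqI[OF V _ d]) auto
  next
    show "?d \<in> derivations R V \<and> (\<forall>v\<in>carrier V. ?d (gen R V v) = h v)" using d g by blast
  qed
  then show "der_ext R V h \<in> derivations R V" "v \<in> carrier V \<Longrightarrow> der_ext R V h (gen R V v) = h v"
    by auto
qed

lemma der_gen_hom: "module R V \<Longrightarrow> d \<in> derivations R V \<Longrightarrow> (\<lambda>v. d (gen R V v)) \<in> mod_hom R V (Lie R V)"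
  by (rule hom_comp[OF gen_hom derivations_hom])

lemma Der_sel[simp]: "carrier (Der R V) = derivations R V"
  by (simp add: Der_def)

lemma Der_apply:
  assumes "x \<in> carrier (Lie R V)"
  shows "(d \<oplus>\<^bsub>Der R V\<^esub> e) x = d x \<oplus>\<^bsub>Lie R V\<^esub> e x" "(a \<odot>\<^bsub>Der R V\<^esub> d) x = a \<odot>\<^bsub>Lie R V\<^esub> d x"
    "\<zero>\<^bsub>Der R V\<^esub> x = \<zero>\<^bsub>Lie R V\<^esub>"
  using assms by (simp_all add: Der_def)

context
  fixes V :: "('a, 'v) module"
  assumes V[simp]: "module R V"
begin

lemma Der_add_closed: "d \<in> derivations R V \<Longrightarrow> e \<in> derivations R V \<Longrightarrow> d \<oplus>\<^bsub>Der R V\<^esub> e \<in> derivations R V"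
  unfolding Der_def
  using lie_der_restrict[OF V lie_der_add[OF Lie_bilin[OF V] hom_id derivations_lie_der derivations_lie_der]] by simp

lemma Der_smult_closed: "a \<in> carrier R \<Longrightarrow> d \<in> derivations R V \<Longrightarrow> a \<odot>\<^bsub>Der R V\<^esub> d \<in> derivations R V"
  unfolding Der_def
  using lie_der_restrict[OF V lie_der_smult[OF Lie_bilin[OF V] hom_id derivations_lie_der]] by simp

lemma Der_zero_closed: "\<zero>\<^bsub>Der R V\<^esub> \<in> derivations R V"
  unfolding Der_def
  using lie_der_restrict[OF V lie_der_zero[OF Lie_bilin[OF V] hom_id]] by simp

lemma Der_module[simp]: "module R (Der R V)"
proof -
  note cl = Der_add_closed Der_smult_closed Der_zero_closed
  have "abelian_group (Der R V)"
  proof (rule abelian_groupI)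
    show "\<exists>e\<in>carrier (Der R V). e \<oplus>\<^bsub>Der R V\<^esub> d = \<zero>\<^bsub>Der R V\<^esub>" if "d \<in> carrier (Der R V)" for d
      using that
      by (intro bexI[of _ "(\<ominus> \<one>) \<odot>\<^bsub>Der R V\<^esub> d"] der_eqI[OF V])
        (auto simp: cl Der_apply mod_neg_smult)
    show "d \<oplus>\<^bsub>Der R V\<^esub> e = e \<oplus>\<^bsub>Der R V\<^esub> d" if "d \<in> carrier (Der R V)" "e \<in> carrier (Der R V)" for d e
      using that by (intro der_eqI[OF V]) (auto simp: cl Der_apply mod_ac)
    show "(d \<oplus>\<^bsub>Der R V\<^esub> e) \<oplus>\<^bsub>Der R V\<^esub> f = d \<oplus>\<^bsub>Der R V\<^esub> (e \<oplus>\<^bsub>Der R V\<^esub> f)"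
      if "d \<in> carrier (Der R V)" "e \<in> carrier (Der R V)" "f \<in> carrier (Der R V)" for d e f
      using that by (intro der_eqI[OF V]) (auto simp: cl Der_apply mod_ac)
    show "\<zero>\<^bsub>Der R V\<^esub> \<oplus>\<^bsub>Der R V\<^esub> d = d" if "d \<in> carrier (Der R V)" for d
      using that by (intro der_eqI[OF V]) (auto simp: cl Der_apply)
  qed (auto simp: cl)
  then show ?thesis
    by (intro moduleI is_cring der_eqI[OF V])
      (auto simp: cl Der_apply mod_smult_add mod_add_smult mod_mult_smult)
qed

lemma der_neg_apply: "d \<in> derivations R V \<Longrightarrow> x \<in> carrier (Lie R V) \<Longrightarrow> (\<ominus>\<^bsub>Der R V\<^esub> d) x = \<ominus>\<^bsub>Lie R V\<^esub> d x"
  by (simp add: mod_neg_as_smult Der_apply)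

lemma der_diff_apply: "d \<in> derivations R V \<Longrightarrow> e \<in> derivations R V \<Longrightarrow> x \<in> carrier (Lie R V) \<Longrightarrow>
    (d \<ominus>\<^bsub>Der R V\<^esub> e) x = d x \<ominus>\<^bsub>Lie R V\<^esub> e x"
  by (simp add: a_minus_def Der_apply der_neg_apply)

lemma der_eval_hom: "x \<in> carrier (Lie R V) \<Longrightarrow> (\<lambda>d. d x) \<in> mod_hom R (Der R V) (Lie R V)"
  by (rule mod_homI) (auto simp: Der_apply)

lemma Der_mult_gen:
  assumes "d \<in> derivations R V" "e \<in> derivations R V"
  shows Der_mult_closed[simp]: "d \<otimes>\<^bsub>Der R V\<^esub> e \<in> derivations R V"
    and Der_mult_apply: "v \<in> carrier V \<Longrightarrow> (d \<otimes>\<^bsub>Der R V\<^esub> e) (gen R V v) = e (d (gen R V v))"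
  using der_ext[OF V hom_comp[OF der_gen_hom[OF V assms(1)] derivations_hom[OF assms(2)]]]
  by (simp_all add: Der_def)

lemma Der_bilin[simp]: "bilin_alg R (Der R V)"
  unfolding bilin_alg_def
proof (intro conjI ballI mod_homI)
  note cl = Der_add_closed Der_smult_closed Der_zero_closed
  note H = hom_add[OF derivations_hom] hom_smult[OF derivations_hom]
  fix d e f assume *: "d \<in> carrier (Der R V)" "e \<in> carrier (Der R V)" "f \<in> carrier (Der R V)"
  show "d \<otimes>\<^bsub>Der R V\<^esub> (e \<oplus>\<^bsub>Der R V\<^esub> f) = d \<otimes>\<^bsub>Der R V\<^esub> e \<oplus>\<^bsub>Der R V\<^esub> d \<otimes>\<^bsub>Der R V\<^esub> f"
    using * by (intro der_eqI[OF V]) (auto simp: cl Der_mult_apply Der_apply)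
  show "(e \<oplus>\<^bsub>Der R V\<^esub> f) \<otimes>\<^bsub>Der R V\<^esub> d = e \<otimes>\<^bsub>Der R V\<^esub> d \<oplus>\<^bsub>Der R V\<^esub> f \<otimes>\<^bsub>Der R V\<^esub> d"
    using * by (intro der_eqI[OF V]) (auto simp: cl Der_mult_apply Der_apply H)
next
  note cl = Der_add_closed Der_smult_closed Der_zero_closed
  note H = hom_add[OF derivations_hom] hom_smult[OF derivations_hom]
  fix d e a assume *: "d \<in> carrier (Der R V)" "e \<in> carrier (Der R V)" "a \<in> carrier R"
  show "d \<otimes>\<^bsub>Der R V\<^esub> (a \<odot>\<^bsub>Der R V\<^esub> e) = a \<odot>\<^bsub>Der R V\<^esub> (d \<otimes>\<^bsub>Der R V\<^esub> e)"
    using * by (intro der_eqI[OF V]) (auto simp: cl Der_mult_apply Der_apply)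
  show "(a \<odot>\<^bsub>Der R V\<^esub> e) \<otimes>\<^bsub>Der R V\<^esub> d = a \<odot>\<^bsub>Der R V\<^esub> (e \<otimes>\<^bsub>Der R V\<^esub> d)"
    using * by (intro der_eqI[OF V]) (auto simp: cl Der_mult_apply Der_apply H)
qed auto

lemma der_bracket_closed[simp]:
  "d \<in> derivations R V \<Longrightarrow> e \<in> derivations R V \<Longrightarrow> der_bracket R V d e \<in> derivations R V"
  using mod_diff[OF Der_module, of "d \<otimes>\<^bsub>Der R V\<^esub> e" "e \<otimes>\<^bsub>Der R V\<^esub> d"] by (simp add: der_bracket_def)

lemma der_bracket_apply:
  "d \<in> derivations R V \<Longrightarrow> e \<in> derivations R V \<Longrightarrow> v \<in> carrier V \<Longrightarrow>
    der_bracket R V d e (gen R V v) = e (d (gen R V v)) \<ominus>\<^bsub>Lie R V\<^esub> d (e (gen R V v))"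
  by (simp add: der_bracket_def der_diff_apply Der_mult_apply)

subsection \<open>Arity, positive derivations and the algebra generated in degree one\<close>

lemma lie_part_carrier: "tree_class R V ` {t \<in> trees_on V. leaves t \<in> S} \<subseteq> carrier (Lie R V)"
  by (auto simp: tree_class_carrier)

lemma lie_part_sub: "submodule (lie_part R V S) R (Lie R V)"
  unfolding lie_part_def by (rule span_sub[OF Lie_module[OF V] lie_part_carrier])

lemma leaves_pos: "leaves t \<ge> 1"
  by (induction t) auto

lemma lie_pos_mult:
  assumes x: "x \<in> carrier (Lie R V)" and y: "y \<in> carrier (Lie R V)"
  shows "x \<otimes>\<^bsub>Lie R V\<^esub> y \<in> lie_part R V {2..}"
proof -
  let ?L = "Lie R V" and ?T = "tree_class R V ` trees_on V"
  have T: "?T \<subseteq> carrier ?L" by (auto simp: tree_class_carrier)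
  have 0: "tree_class R V s \<otimes>\<^bsub>?L\<^esub> tree_class R V t \<in> lie_part R V {2..}" if "s \<in> trees_on V" "t \<in> trees_on V" for s t
    unfolding tree_class_Node[OF V that, symmetric] lie_part_def
    using that leaves_pos[of s] leaves_pos[of t] by (intro span_incl imageI) simp
  have 1: "tree_class R V s \<otimes>\<^bsub>?L\<^esub> y \<in> lie_part R V {2..}" if "s \<in> trees_on V" for s
    by (rule span_hom_into[of ?L ?L "\<lambda>y. tree_class R V s \<otimes>\<^bsub>?L\<^esub> y", OF _ _ _ lie_part_sub T])
      (use that y Lie_span[OF V] 0 in \<open>auto simp: bil_hom1 tree_class_carrier\<close>)
  show ?thesis
    by (rule span_hom_into[of ?L ?L "\<lambda>x. x \<otimes>\<^bsub>?L\<^esub> y", OF _ _ _ lie_part_sub T])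
      (use x y Lie_span[OF V] 1 in \<open>auto simp: bil_hom2\<close>)
qed

text \<open>The Jacobi identity rewrites \<open>[[a,b],y]\<close> as \<open>[a,[b,y]] - [b,[a,y]]\<close>, so brackets whose left factor is a
  generator already span everything of arity at least two.\<close>

lemma lie_pos_induct:
  assumes H: "submodule H R (Lie R V)"
    and g: "\<And>u y. u \<in> carrier V \<Longrightarrow> y \<in> carrier (Lie R V) \<Longrightarrow> gen R V u \<otimes>\<^bsub>Lie R V\<^esub> y \<in> H"
    and x: "x \<in> lie_part R V {2..}"
  shows "x \<in> H"
proof -
  let ?L = "Lie R V"
  have all: "z \<in> {z \<in> carrier ?L. \<forall>y\<in>carrier ?L. z \<otimes>\<^bsub>?L\<^esub> y \<in> H}" if "z \<in> carrier ?L" for z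
  proof (rule Lie_induct[OF V _ _ _ that])
    show "submodule {z \<in> carrier ?L. \<forall>y\<in>carrier ?L. z \<otimes>\<^bsub>?L\<^esub> y \<in> H} R ?L"
      by (rule subI) (auto simp: bil_ladd bil_lsmult intro: sub_zero[OF _ H] sub_add[OF _ H] sub_smult[OF _ H])
    fix a b assume ab: "a \<in> {z \<in> carrier ?L. \<forall>y\<in>carrier ?L. z \<otimes>\<^bsub>?L\<^esub> y \<in> H}"
      "b \<in> {z \<in> carrier ?L. \<forall>y\<in>carrier ?L. z \<otimes>\<^bsub>?L\<^esub> y \<in> H}"
    have "(a \<otimes>\<^bsub>?L\<^esub> b) \<otimes>\<^bsub>?L\<^esub> y \<in> H" if y: "y \<in> carrier ?L" for y
    proof -
      have "a \<otimes>\<^bsub>?L\<^esub> (b \<otimes>\<^bsub>?L\<^esub> y) \<ominus>\<^bsub>?L\<^esub> b \<otimes>\<^bsub>?L\<^esub> (a \<otimes>\<^bsub>?L\<^esub> y) \<in> H"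
        using ab y by (intro sub_diff[OF _ H]) auto
      moreover have "a \<otimes>\<^bsub>?L\<^esub> (b \<otimes>\<^bsub>?L\<^esub> y) \<ominus>\<^bsub>?L\<^esub> b \<otimes>\<^bsub>?L\<^esub> (a \<otimes>\<^bsub>?L\<^esub> y) = (a \<otimes>\<^bsub>?L\<^esub> b) \<otimes>\<^bsub>?L\<^esub> y"
        using ab y lie_leibniz[OF Lie_lie_alg[OF V], of a b y] by (simp add: mod_ac)
      ultimately show ?thesis by simp
    qed
    then show "a \<otimes>\<^bsub>?L\<^esub> b \<in> {z \<in> carrier ?L. \<forall>y\<in>carrier ?L. z \<otimes>\<^bsub>?L\<^esub> y \<in> H}" using ab by auto
  qed (use g in auto)
  have "tree_class R V t \<in> H" if "t \<in> trees_on V" "leaves t \<ge> 2" for t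
    using that all by (cases t) (auto simp: tree_class_Node[OF V] tree_class_carrier[OF V])
  then show ?thesis
    using x span_le[OF H, of "tree_class R V ` {t \<in> trees_on V. leaves t \<in> {2..}}" x] by (auto simp: lie_part_def)
qed

lemma lie_two_incl: "u \<in> carrier V \<Longrightarrow> v \<in> carrier V \<Longrightarrow> gen R V u \<otimes>\<^bsub>Lie R V\<^esub> gen R V v \<in> lie_part R V {2}"
  unfolding gen_def lie_part_def
  by (subst tree_class_Node[OF V, symmetric]) (auto intro!: span_incl imageI)

lemma lie_two_induct:
  assumes H: "submodule H R (Lie R V)"
    and g: "\<And>u v. u \<in> carrier V \<Longrightarrow> v \<in> carrier V \<Longrightarrow> gen R V u \<otimes>\<^bsub>Lie R V\<^esub> gen R V v \<in> H"
    and x: "x \<in> lie_part R V {2}"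
  shows "x \<in> H"
proof -
  have "tree_class R V t \<in> H" if t: "t \<in> trees_on V" "leaves t = 2" for t
  proof -
    obtain s s' where s: "t = Node s s'" using t by (cases t) auto
    then have "leaves s = 1" "leaves s' = 1" using t leaves_pos[of s] leaves_pos[of s'] by auto
    moreover have "\<exists>v. r = Leaf v" if "leaves r = 1" for r :: "'v tree"
    proof (cases r)
      case (Node s1 s2)
      then show ?thesis using that leaves_pos[of s1] leaves_pos[of s2] by simp
    qed auto
    ultimately obtain u v where "t = Node (Leaf u) (Leaf v)" using s by blast
    then show ?thesis using t g[of u v] by (simp add: tree_class_Node[OF V] gen_def)
  qed
  then show ?thesis
    using x span_le[OF H, of "tree_class R V ` {t \<in> trees_on V. leaves t \<in> {2}}" x] by (auto simp: lie_part_def)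
qed

lemma lie_two_subset: "x \<in> lie_part R V {2} \<Longrightarrow> x \<in> lie_part R V {2..}"
  by (rule lie_two_induct[OF lie_part_sub]) (auto intro: lie_pos_mult)

lemma Lie_split_induct:
  assumes H: "submodule H R (Lie R V)"
    and g: "\<And>v. v \<in> carrier V \<Longrightarrow> gen R V v \<in> H" and p: "\<And>x. x \<in> lie_part R V {2..} \<Longrightarrow> x \<in> H"
    and x: "x \<in> carrier (Lie R V)"
  shows "x \<in> H"
  by (rule Lie_induct[OF V H g _ x]) (auto intro!: p lie_pos_mult sub_carrier[OF _ H])

lemma lie_part_closed[simp]: "x \<in> lie_part R V S \<Longrightarrow> x \<in> carrier (Lie R V)"
  using sub_carrier[OF _ lie_part_sub] by simp

end

end

section \<open>Pointed derivations\<close>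

abbreviation LP :: "('a, 'r) ring_scheme \<Rightarrow> ('a, 'v, 'm) module_scheme \<Rightarrow> ('a, (('a \<times> 'v) tree \<Rightarrow> 'a) set) module"
  where "LP R V \<equiv> Lie R (pt_mod R V)"

text \<open>The marked generator \<open>1\<close> of \<open>Lie(R \<oplus> V)\<close>.\<close>

definition pt_one :: "('a, 'r) ring_scheme \<Rightarrow> ('a, 'v, 'm) module_scheme \<Rightarrow> (('a \<times> 'v) tree \<Rightarrow> 'a) set"
  where "pt_one R V = gen R (pt_mod R V) (\<one>\<^bsub>R\<^esub>, \<zero>\<^bsub>V\<^esub>)"

definition pt_gen :: "('a, 'r) ring_scheme \<Rightarrow> ('a, 'v, 'm) module_scheme \<Rightarrow> 'v \<Rightarrow> (('a \<times> 'v) tree \<Rightarrow> 'a) set"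
  where "pt_gen R V v = gen R (pt_mod R V) (\<zero>\<^bsub>R\<^esub>, v)"

definition pt_incl :: "('a, 'r) ring_scheme \<Rightarrow> ('a, 'v, 'm) module_scheme \<Rightarrow>
    ('v tree \<Rightarrow> 'a) set \<Rightarrow> (('a \<times> 'v) tree \<Rightarrow> 'a) set"
  where "pt_incl R V = lie_ext R (LP R V) (pt_gen R V)"

text \<open>The Fox derivative \<open>D\<^sub>f\<close>; it is the composite of \<open>\<delta>\<close> with \<open>Lie(V;f)\<close>, as shown below.\<close>

definition fox :: "('a, 'r) ring_scheme \<Rightarrow> ('a, 'v, 'm) module_scheme \<Rightarrow> ('v \<Rightarrow> 'a) \<Rightarrow>
    ('v tree \<Rightarrow> 'a) set \<Rightarrow> (('a \<times> 'v) tree \<Rightarrow> 'a) set"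
  where "fox R V f = der_along R V (LP R V) (LP R V) (mult (LP R V)) (pt_incl R V)
    (\<lambda>v. f v \<odot>\<^bsub>LP R V\<^esub> pt_one R V)"

text \<open>The extension of \<open>e\<close> to \<open>Lie(R \<oplus> V)\<close> which kills the marked generator.\<close>

definition pt_lift :: "('a, 'r) ring_scheme \<Rightarrow> ('a, 'v, 'm) module_scheme \<Rightarrow> ('a, 'v) der \<Rightarrow> ('a, 'a \<times> 'v) der"
  where "pt_lift R V e = der_ext R (pt_mod R V) (\<lambda>p. pt_incl R V (e (gen R V (snd p))))"

text \<open>The possible images of the marked generator under a positive pointed derivation.\<close>

definition lin_pos :: "('a, 'r) ring_scheme \<Rightarrow> ('a, 'v, 'm) module_scheme \<Rightarrow> (('a \<times> 'v) tree \<Rightarrow> 'a) set set"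
  where "lin_pos R V = lie_lin R V (self_mod R) \<inter> lie_part R (pt_mod R V) {2..}"

text \<open>The elements that correspond to the commutator submodule of the positive pointed derivations; the
  product \<open>y \<lhd> z\<close> of the derivations given by \<open>y\<close> and \<open>z\<close> is given by \<open>pt_der R V z y\<close>.\<close>

definition lin_comm :: "('a, 'r) ring_scheme \<Rightarrow> ('a, 'v, 'm) module_scheme \<Rightarrow> (('a \<times> 'v) tree \<Rightarrow> 'a) set set"
  where "lin_comm R V = span_of R (LP R V)
    {pt_der R V z y \<ominus>\<^bsub>LP R V\<^esub> pt_der R V y z | y z. y \<in> lin_pos R V \<and> z \<in> lin_pos R V}"

text \<open>The derivation \<open>x \<otimes> f\<close>.\<close>

definition elem_der :: "('a, 'r) ring_scheme \<Rightarrow> ('a, 'v, 'm) module_scheme \<Rightarrow> ('v \<Rightarrow> 'a) \<Rightarrow>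
    ('v tree \<Rightarrow> 'a) set \<Rightarrow> ('a, 'v) der"
  where "elem_der R V f x = der_ext R V (\<lambda>v. f v \<odot>\<^bsub>Lie R V\<^esub> x)"

context cring
begin

lemma lie_der_commutator:
  assumes V: "module R V" and d: "lie_der R V (Lie R V) (\<lambda>x. x) d" and e: "lie_der R V (Lie R V) (\<lambda>x. x) e"
  shows "lie_der R V (Lie R V) (\<lambda>x. x) (\<lambda>x. d (e x) \<ominus>\<^bsub>Lie R V\<^esub> e (d x))"
  unfolding lie_der_def
proof (intro conjI ballI)
  note [simp] = V and dc[simp] = hom_closed[OF lie_der_hom[OF d]] and ec[simp] = hom_closed[OF lie_der_hom[OF e]]
  show "(\<lambda>x. d (e x) \<ominus>\<^bsub>Lie R V\<^esub> e (d x)) \<in> mod_hom R (Lie R V) (Lie R V)"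
    using V by (intro hom_diff_map hom_comp[OF lie_der_hom[OF d] lie_der_hom[OF e]] hom_comp[OF lie_der_hom[OF e] lie_der_hom[OF d]]) auto
  fix x y assume "x \<in> carrier (Lie R V)" "y \<in> carrier (Lie R V)"
  then show "d (e (x \<otimes>\<^bsub>Lie R V\<^esub> y)) \<ominus>\<^bsub>Lie R V\<^esub> e (d (x \<otimes>\<^bsub>Lie R V\<^esub> y)) =
      (d (e x) \<ominus>\<^bsub>Lie R V\<^esub> e (d x)) \<otimes>\<^bsub>Lie R V\<^esub> y \<oplus>\<^bsub>Lie R V\<^esub> x \<otimes>\<^bsub>Lie R V\<^esub> (d (e y) \<ominus>\<^bsub>Lie R V\<^esub> e (d y))"
    by (simp add: lie_der_mult[OF d] lie_der_mult[OF e] hom_add[OF lie_der_hom[OF d]] hom_add[OF lie_der_hom[OF e]]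
        bil_simps mod_ac)
qed

context
  fixes V :: "('a, 'v) module"
  assumes V[simp]: "module R V"
begin

lemma P_module: "module R (pt_mod R V)"
  by simp

lemma pt_one_closed[simp]: "pt_one R V \<in> carrier (LP R V)"
  and pt_gen_closed[simp]: "v \<in> carrier V \<Longrightarrow> pt_gen R V v \<in> carrier (LP R V)"
  by (simp_all add: pt_one_def pt_gen_def)

lemma pt_gen_hom: "pt_gen R V \<in> mod_hom R V (LP R V)"
  unfolding pt_gen_def
  by (rule hom_comp[OF _ gen_hom[OF P_module]]) (auto simp: mod_hom_def)

lemma gen_pt_split:
  assumes "r \<in> carrier R" "v \<in> carrier V"
  shows "gen R (pt_mod R V) (r, v) = r \<odot>\<^bsub>LP R V\<^esub> pt_one R V \<oplus>\<^bsub>LP R V\<^esub> pt_gen R V v"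
proof -
  have "(r, v) = r \<odot>\<^bsub>pt_mod R V\<^esub> (\<one>, \<zero>\<^bsub>V\<^esub>) \<oplus>\<^bsub>pt_mod R V\<^esub> (\<zero>, v)" using assms by simp
  then show ?thesis
    unfolding pt_one_def pt_gen_def
    using hom_add[OF gen_hom[OF P_module], of "r \<odot>\<^bsub>pt_mod R V\<^esub> (\<one>, \<zero>\<^bsub>V\<^esub>)" "(\<zero>, v)"]
      hom_smult[OF gen_hom[OF P_module], of r "(\<one>, \<zero>\<^bsub>V\<^esub>)"] assms by simp
qed

lemma pt_incl_hom: "pt_incl R V \<in> alg_hom R (Lie R V) (LP R V)"
  and pt_incl_gen[simp]: "v \<in> carrier V \<Longrightarrow> pt_incl R V (gen R V v) = pt_gen R V v"
  using lie_ext[OF V Lie_lie_alg[OF P_module] pt_gen_hom] by (simp_all add: pt_incl_def)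

lemmas pt_incl_lin = alg_hom_hom[OF pt_incl_hom]
lemmas pt_incl_closed[simp] = hom_closed[OF pt_incl_lin]
lemmas pt_incl_mult = alg_hom_mult[OF pt_incl_hom]

lemma pt_der_eqI:
  assumes B: "bilin_alg R B" and j: "j \<in> mod_hom R (LP R V) B"
    and d: "lie_der R (pt_mod R V) B j d" and e: "lie_der R (pt_mod R V) B j e"
    and 1: "d (pt_one R V) = e (pt_one R V)" and g: "\<And>v. v \<in> carrier V \<Longrightarrow> d (pt_gen R V v) = e (pt_gen R V v)"
    and x: "x \<in> carrier (LP R V)"
  shows "d x = e x"
proof (rule lie_der_unique[OF P_module B j d e _ x])
  fix p assume "p \<in> carrier (pt_mod R V)"
  then show "d (gen R (pt_mod R V) p) = e (gen R (pt_mod R V) p)"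
    using 1 g by (cases p) (simp add: gen_pt_split hom_add[OF lie_der_hom[OF d]] hom_smult[OF lie_der_hom[OF d]]
      hom_add[OF lie_der_hom[OF e]] hom_smult[OF lie_der_hom[OF e]])
qed

subsection \<open>The part linear in the marked generator\<close>

lemma lie_lin_carrier:
  "tree_class R (pt_mod R V) ` {t \<in> trees_on (pt_mod R V). linear_in_fst (self_mod R) V t} \<subseteq> carrier (LP R V)"
  by (auto simp: tree_class_carrier)

lemma lie_lin_sub: "submodule (lie_lin R V (self_mod R)) R (LP R V)"
  unfolding lie_lin_def by (rule span_sub[OF Lie_module[OF P_module] lie_lin_carrier])

lemma lie_lin_closed[simp]: "z \<in> lie_lin R V (self_mod R) \<Longrightarrow> z \<in> carrier (LP R V)"
  by (rule sub_carrier[OF _ lie_lin_sub]) simp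

lemma right_normed_simps[simp]:
  "right_normed R V [] = pt_one R V"
  "right_normed R V (v # w) = pt_gen R V v \<otimes>\<^bsub>LP R V\<^esub> right_normed R V w"
  by (simp_all add: right_normed_def pt_one_def pt_gen_def)

lemma right_normed_closed[simp]: "w \<in> lists (carrier V) \<Longrightarrow> right_normed R V w \<in> carrier (LP R V)"
  by (induction w) auto

lemma pure_tree_class:
  "t \<in> trees_on (pt_mod R V) \<Longrightarrow> fst ` set_tree t \<subseteq> {\<zero>} \<Longrightarrow>
    \<exists>x\<in>carrier (Lie R V). tree_class R (pt_mod R V) t = pt_incl R V x"
proof (induction t)
  case (Leaf p)
  then show ?case
    by (intro bexI[of _ "gen R V (snd p)"]; cases p) (simp_all add: pt_gen_def, simp_all add: gen_def)
next
  case (Node s t)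
  then obtain x y where "x \<in> carrier (Lie R V)" "tree_class R (pt_mod R V) s = pt_incl R V x"
    "y \<in> carrier (Lie R V)" "tree_class R (pt_mod R V) t = pt_incl R V y" by (auto simp: image_Un)
  then show ?case
    using Node.prems by (intro bexI[of _ "x \<otimes>\<^bsub>Lie R V\<^esub> y"]) (auto simp: tree_class_Node pt_incl_mult)
qed

lemma right_normed_subset: "right_normed R V ` lists (carrier V) \<subseteq> carrier (LP R V)"
  by (rule image_subsetI) (rule right_normed_closed)

text \<open>The Jacobi identity extends stability from the generators of \<open>Lie(V)\<close> to all of \<open>Lie(V)\<close>.\<close>

lemma incl_stable:
  assumes N: "submodule N R (LP R V)"
    and step: "\<And>v z. v \<in> carrier V \<Longrightarrow> z \<in> N \<Longrightarrow> pt_gen R V v \<otimes>\<^bsub>LP R V\<^esub> z \<in> N"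
    and x: "x \<in> carrier (Lie R V)" and z: "z \<in> N"
  shows "pt_incl R V x \<otimes>\<^bsub>LP R V\<^esub> z \<in> N"
proof -
  have Nc[simp]: "z \<in> carrier (LP R V)" if "z \<in> N" for z using sub_carrier[OF _ N that] by simp
  have "x \<in> {x \<in> carrier (Lie R V). \<forall>z\<in>N. pt_incl R V x \<otimes>\<^bsub>LP R V\<^esub> z \<in> N}"
  proof (rule Lie_induct[OF V _ _ _ x])
    show "submodule {x \<in> carrier (Lie R V). \<forall>z\<in>N. pt_incl R V x \<otimes>\<^bsub>LP R V\<^esub> z \<in> N} R (Lie R V)"
      by (rule subI) (auto simp: hom_zero[OF _ _ pt_incl_lin] hom_add[OF pt_incl_lin] hom_smult[OF pt_incl_lin]
          bil_ladd bil_lsmult intro: sub_zero[OF _ N] sub_add[OF _ N] sub_smult[OF _ N])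
    fix x y assume xy: "x \<in> {x \<in> carrier (Lie R V). \<forall>z\<in>N. pt_incl R V x \<otimes>\<^bsub>LP R V\<^esub> z \<in> N}"
      "y \<in> {x \<in> carrier (Lie R V). \<forall>z\<in>N. pt_incl R V x \<otimes>\<^bsub>LP R V\<^esub> z \<in> N}"
    have "(pt_incl R V x \<otimes>\<^bsub>LP R V\<^esub> pt_incl R V y) \<otimes>\<^bsub>LP R V\<^esub> z \<in> N" if z: "z \<in> N" for z
    proof -
      have "pt_incl R V x \<otimes>\<^bsub>LP R V\<^esub> (pt_incl R V y \<otimes>\<^bsub>LP R V\<^esub> z) \<ominus>\<^bsub>LP R V\<^esub> pt_incl R V y \<otimes>\<^bsub>LP R V\<^esub> (pt_incl R V x \<otimes>\<^bsub>LP R V\<^esub> z) \<in> N"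
        using xy z by (intro sub_diff[OF _ N]) auto
      then show ?thesis
        using xy z lie_leibniz[OF Lie_lie_alg[OF P_module], of "pt_incl R V x" "pt_incl R V y" z] by (simp add: mod_ac)
    qed
    then show "x \<otimes>\<^bsub>Lie R V\<^esub> y \<in> {x \<in> carrier (Lie R V). \<forall>z\<in>N. pt_incl R V x \<otimes>\<^bsub>LP R V\<^esub> z \<in> N}"
      using xy by (auto simp: pt_incl_mult)
  qed (auto simp: step)
  then show ?thesis using z by simp
qed

lemma right_normed_step:
  assumes v: "v \<in> carrier V" and z: "z \<in> span_of R (LP R V) (right_normed R V ` lists (carrier V))"
  shows "pt_gen R V v \<otimes>\<^bsub>LP R V\<^esub> z \<in> span_of R (LP R V) (right_normed R V ` lists (carrier V))"
proof (rule span_hom_into[of "LP R V" "LP R V" "\<lambda>z. pt_gen R V v \<otimes>\<^bsub>LP R V\<^esub> z", OF _ _ _ span_sub right_normed_subset _ z])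
  fix x assume "x \<in> right_normed R V ` lists (carrier V)"
  then obtain w where w: "w \<in> lists (carrier V)" "x = right_normed R V w" by blast
  have "right_normed R V (v # w) \<in> span_of R (LP R V) (right_normed R V ` lists (carrier V))"
    using v w by (intro span_incl imageI) simp
  then show "pt_gen R V v \<otimes>\<^bsub>LP R V\<^esub> x \<in> span_of R (LP R V) (right_normed R V ` lists (carrier V))"
    using w by simp
qed (use v right_normed_subset in \<open>simp_all add: bil_hom1\<close>)

text \<open>At its root a tree that is linear in the marked generator splits into a tree of the same kind and a
  tree with all leaves in \<open>V\<close>; the latter acts through the bracket with an element of \<open>Lie(V)\<close>.\<close>

lemma lie_lin_span: "lie_lin R V (self_mod R) = span_of R (LP R V) (right_normed R V ` lists (carrier V))"
proof
  let ?N = "span_of R (LP R V) (right_normed R V ` lists (carrier V))"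
  have N: "submodule ?N R (LP R V)" by (rule span_sub[OF _ right_normed_subset]) simp
  have one: "pt_one R V \<in> ?N"
    using span_incl[OF imageI[of "[]" "lists (carrier V)" "right_normed R V"]] by simp
  note pure = incl_stable[OF N right_normed_step]
  have "tree_class R (pt_mod R V) t \<in> ?N" if "t \<in> trees_on (pt_mod R V)" "linear_in_fst (self_mod R) V t" for t
    using that
  proof (induction t)
    case (Leaf p)
    then have "tree_class R (pt_mod R V) (Leaf p) = gen R (pt_mod R V) (fst p, \<zero>\<^bsub>V\<^esub>)" "fst p \<in> carrier R"
      by (cases p, auto simp: gen_def)+
    then show ?case
      using sub_smult[OF _ N _ one, of "fst p"] hom_zero[OF _ _ pt_gen_hom] by (simp add: gen_pt_split)
  next
    case (Node s t)
    then have st: "s \<in> trees_on (pt_mod R V)" "t \<in> trees_on (pt_mod R V)" by auto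
    note cl = tree_class_carrier[OF P_module st(1)] tree_class_carrier[OF P_module st(2)]
    from Node.prems(2) consider "linear_in_fst (self_mod R) V s" "fst ` set_tree t \<subseteq> {\<zero>}"
      | "linear_in_fst (self_mod R) V t" "fst ` set_tree s \<subseteq> {\<zero>}" by auto
    then show ?case
    proof cases
      case 1
      then have "tree_class R (pt_mod R V) t \<otimes>\<^bsub>LP R V\<^esub> tree_class R (pt_mod R V) s \<in> ?N"
        using pure_tree_class[OF st(2) 1(2)] Node.IH(1)[OF st(1) 1(1)] pure by auto
      then show ?thesis
        using cl lie_antisym[OF Lie_lie_alg[OF P_module] cl(2) cl(1)] sub_neg[OF _ N] by (simp add: tree_class_Node[OF P_module st])
    next
      case 2
      then show ?thesis
        using pure_tree_class[OF st(1) 2(2)] Node.IH(2)[OF st(2) 2(1)] pure by (auto simp: tree_class_Node[OF P_module st])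
    qed
  qed
  then show "lie_lin R V (self_mod R) \<subseteq> ?N" unfolding lie_lin_def by (intro subsetI, elim span_le[OF N, rotated]) blast
  have "\<exists>t\<in>trees_on (pt_mod R V). linear_in_fst (self_mod R) V t \<and> right_normed R V w = tree_class R (pt_mod R V) t"
    if "w \<in> lists (carrier V)" for w
    using that
  proof (induction w)
    case Nil
    show ?case by (intro bexI[of _ "Leaf (\<one>, \<zero>\<^bsub>V\<^esub>)"]) (auto simp: pt_one_def gen_def)
  next
    case (Cons v w)
    then obtain t where "t \<in> trees_on (pt_mod R V)" "linear_in_fst (self_mod R) V t"
      "right_normed R V w = tree_class R (pt_mod R V) t" by auto
    then show ?case
      using Cons.hyps by (intro bexI[of _ "Node (Leaf (\<zero>, v)) t"]) (auto simp: tree_class_Node pt_gen_def gen_def)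
  qed
  then have "right_normed R V ` lists (carrier V) \<subseteq> lie_lin R V (self_mod R)"
    unfolding lie_lin_def by (intro image_subsetI span_incl) blast
  then show "?N \<subseteq> lie_lin R V (self_mod R)" by (intro subsetI, elim span_le[OF lie_lin_sub, rotated])
qed

lemma lie_lin_induct:
  assumes H: "submodule H R (LP R V)" and one: "pt_one R V \<in> H"
    and step: "\<And>v z. v \<in> carrier V \<Longrightarrow> z \<in> lie_lin R V (self_mod R) \<Longrightarrow> z \<in> H \<Longrightarrow> pt_gen R V v \<otimes>\<^bsub>LP R V\<^esub> z \<in> H"
    and z: "z \<in> lie_lin R V (self_mod R)"
  shows "z \<in> H"
proof -
  have "right_normed R V w \<in> H" if "w \<in> lists (carrier V)" for w
    using that
    by (induction w) (use one step lie_lin_span in \<open>auto intro: span_incl\<close>)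
  then show ?thesis using z span_le[OF H] unfolding lie_lin_span by blast
qed

lemma one_lin[simp]: "pt_one R V \<in> lie_lin R V (self_mod R)"
  using span_incl[OF imageI[of "[]" "lists (carrier V)" "right_normed R V"]] unfolding lie_lin_span by simp

lemma gen_lin[simp]: "v \<in> carrier V \<Longrightarrow> z \<in> lie_lin R V (self_mod R) \<Longrightarrow> pt_gen R V v \<otimes>\<^bsub>LP R V\<^esub> z \<in> lie_lin R V (self_mod R)"
  unfolding lie_lin_span by (rule right_normed_step)

lemma incl_lin: "x \<in> carrier (Lie R V) \<Longrightarrow> z \<in> lie_lin R V (self_mod R) \<Longrightarrow> pt_incl R V x \<otimes>\<^bsub>LP R V\<^esub> z \<in> lie_lin R V (self_mod R)"
  by (rule incl_stable[OF lie_lin_sub gen_lin])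

lemma incl_lin_right:
  assumes x: "x \<in> carrier (Lie R V)" and z: "z \<in> lie_lin R V (self_mod R)"
  shows "z \<otimes>\<^bsub>LP R V\<^esub> pt_incl R V x \<in> lie_lin R V (self_mod R)"
proof -
  have "\<ominus>\<^bsub>LP R V\<^esub> (pt_incl R V x \<otimes>\<^bsub>LP R V\<^esub> z) \<in> lie_lin R V (self_mod R)"
    using incl_lin[OF x z] by (intro sub_neg[OF _ lie_lin_sub]) auto
  then show ?thesis
    using lie_antisym[OF Lie_lie_alg[OF P_module], of "pt_incl R V x" z] x z by simp
qed

lemma lin_pos_sub: "submodule (lin_pos R V) R (LP R V)"
  unfolding lin_pos_def by (rule sub_Int[OF _ lie_lin_sub lie_part_sub]) auto

lemma lin_posD[simp]: "z \<in> lin_pos R V \<Longrightarrow> z \<in> lie_lin R V (self_mod R)"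
  by (simp add: lin_pos_def)

lemma gen_lin_pos[simp]: "v \<in> carrier V \<Longrightarrow> z \<in> lie_lin R V (self_mod R) \<Longrightarrow> pt_gen R V v \<otimes>\<^bsub>LP R V\<^esub> z \<in> lin_pos R V"
  by (simp add: lin_pos_def lie_pos_mult)

text \<open>The augmentation \<open>Lie(R \<oplus> V) \<rightarrow> R\<close> onto the abelian Lie algebra \<open>R\<close> detects the coefficient of
  the marked generator and vanishes on all brackets.\<close>

lemma pt_augmentation:
  obtains \<alpha> where "\<alpha> \<in> mod_hom R (LP R V) (self_mod R)" "\<alpha> (pt_one R V) = \<one>"
    "\<And>z. z \<in> lie_part R (pt_mod R V) {2..} \<Longrightarrow> \<alpha> z = \<zero>"
proof -
  define A where "A = (self_mod R)\<lparr>mult := \<lambda>x y. \<zero>\<rparr>"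
  have sel: "carrier A = carrier R" "add A = add R" "\<zero>\<^bsub>A\<^esub> = \<zero>" "smult A = mult R" "\<And>x y. x \<otimes>\<^bsub>A\<^esub> y = \<zero>"
    by (simp_all add: A_def)
  have mA: "module R A" by (rule module_cong[OF module_self]) (auto simp: sel)
  have A: "lie_alg R A"
    by (rule lie_algI) (auto simp: bilin_alg_def mA sel intro!: mod_homI)
  have f: "fst \<in> mod_hom R (pt_mod R V) A" by (auto simp: mod_hom_def sel)
  let ?\<alpha> = "lie_ext R A fst"
  note h = lie_ext_hom[OF P_module A f] and g = lie_ext_gen[OF P_module A f]
  note hl = alg_hom_hom[OF h]
  have "?\<alpha> z = \<zero>" if z: "z \<in> lie_part R (pt_mod R V) {2..}" for z
  proof -
    have "z \<in> {z \<in> carrier (LP R V). ?\<alpha> z \<in> {\<zero>\<^bsub>A\<^esub>}}"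
    proof (rule lie_pos_induct[OF P_module _ _ z])
      show "submodule {z \<in> carrier (LP R V). ?\<alpha> z \<in> {\<zero>\<^bsub>A\<^esub>}} R (LP R V)"
        by (rule sub_vimage[OF _ mA hl]) (auto intro!: subI mA simp: sel)
    qed (auto simp: alg_hom_mult[OF h] sel)
    then show ?thesis by (simp add: sel)
  qed
  moreover have "?\<alpha> \<in> mod_hom R (LP R V) (self_mod R)" using hl by (simp add: mod_hom_def sel)
  moreover have "?\<alpha> (pt_one R V) = \<one>" by (simp add: pt_one_def g)
  ultimately show ?thesis using that by blast
qed

text \<open>An element of \<open>Lie(V;R)\<close> is a multiple of the marked generator plus a combination of brackets, and the
  augmentation shows that the multiple is zero in positive degree.\<close>

lemma lin_pos_induct:
  assumes H: "submodule H R (LP R V)"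
    and step: "\<And>v z. v \<in> carrier V \<Longrightarrow> z \<in> lie_lin R V (self_mod R) \<Longrightarrow> pt_gen R V v \<otimes>\<^bsub>LP R V\<^esub> z \<in> H"
    and z: "z \<in> lin_pos R V"
  shows "z \<in> H"
proof -
  let ?G = "(\<lambda>r. r \<odot>\<^bsub>LP R V\<^esub> pt_one R V) ` carrier R" and ?H = "H \<inter> lie_part R (pt_mod R V) {2..}"
  have G: "submodule ?G R (LP R V)"
    using sub_image[OF module_self _ hom_form_smult[OF _ hom_id pt_one_closed] sub_whole[OF module_self]] by simp
  have H': "submodule ?H R (LP R V)" by (rule sub_Int[OF _ H lie_part_sub]) auto
  have "z \<in> {x \<oplus>\<^bsub>LP R V\<^esub> y | x y. x \<in> ?G \<and> y \<in> ?H}"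
  proof (rule lie_lin_induct[OF sub_plus[OF _ G H']])
    have "pt_one R V = \<one> \<odot>\<^bsub>LP R V\<^esub> pt_one R V \<oplus>\<^bsub>LP R V\<^esub> \<zero>\<^bsub>LP R V\<^esub>" by simp
    moreover have "\<one> \<odot>\<^bsub>LP R V\<^esub> pt_one R V \<in> ?G" using one_closed by (rule imageI)
    moreover have "\<zero>\<^bsub>LP R V\<^esub> \<in> ?H" by (rule sub_zero[OF _ H']) simp
    ultimately show "pt_one R V \<in> {x \<oplus>\<^bsub>LP R V\<^esub> y | x y. x \<in> ?G \<and> y \<in> ?H}" by blast
    \<comment> \<open>brackets have coefficient zero at the marked generator\<close>
    fix v u assume vu: "v \<in> carrier V" "u \<in> lie_lin R V (self_mod R)"
    have "pt_gen R V v \<otimes>\<^bsub>LP R V\<^esub> u = \<zero> \<odot>\<^bsub>LP R V\<^esub> pt_one R V \<oplus>\<^bsub>LP R V\<^esub> pt_gen R V v \<otimes>\<^bsub>LP R V\<^esub> u"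
      using vu by simp
    moreover have "pt_gen R V v \<otimes>\<^bsub>LP R V\<^esub> u \<in> ?H" using vu step by (simp add: lie_pos_mult)
    ultimately show "pt_gen R V v \<otimes>\<^bsub>LP R V\<^esub> u \<in> {x \<oplus>\<^bsub>LP R V\<^esub> y | x y. x \<in> ?G \<and> y \<in> ?H}" by blast
  qed (use z in auto)
  then obtain r h where rh: "r \<in> carrier R" "h \<in> H" "h \<in> lie_part R (pt_mod R V) {2..}"
    "z = r \<odot>\<^bsub>LP R V\<^esub> pt_one R V \<oplus>\<^bsub>LP R V\<^esub> h" by auto
  obtain \<alpha> where \<alpha>: "\<alpha> \<in> mod_hom R (LP R V) (self_mod R)" "\<alpha> (pt_one R V) = \<one>"
    "\<And>z. z \<in> lie_part R (pt_mod R V) {2..} \<Longrightarrow> \<alpha> z = \<zero>" using pt_augmentation by blast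
  have "\<alpha> z = r" using rh \<alpha> by (simp add: hom_add[OF \<alpha>(1)] hom_smult[OF \<alpha>(1)])
  then have "r = \<zero>" using \<alpha>(3)[of z] z by (simp add: lin_pos_def)
  then show ?thesis using rh by simp
qed

end

end

context cring
begin

lemma der_pos_stable:
  fixes V :: "('a, 'v) module" and U :: "('a, 'u) module"
  assumes V: "module R V" and B: "module R U" and j: "j \<in> mod_hom R (Lie R V) (Lie R U)"
    and d: "lie_der R V (Lie R U) j d" and x: "x \<in> lie_part R V {2..}"
  shows "d x \<in> lie_part R U {2..}"
proof -
  note [simp] = V B
  have "x \<in> {x \<in> carrier (Lie R V). d x \<in> lie_part R U {2..}}"
  proof (rule lie_pos_induct[OF V _ _ x])
    show "submodule {x \<in> carrier (Lie R V). d x \<in> lie_part R U {2..}} R (Lie R V)"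
      by (rule sub_vimage[OF _ _ lie_der_hom[OF d] lie_part_sub]) auto
  qed (use hom_closed[OF lie_der_hom[OF d]] hom_closed[OF j] in
      \<open>auto simp: lie_der_mult[OF d] lie_pos_mult intro!: sub_add[OF _ lie_part_sub]\<close>)
  then show ?thesis by simp
qed

lemma elem_der:
  fixes V :: "('a, 'v) module"
  assumes "module R V" "f \<in> mod_hom R V (self_mod R)" "x \<in> carrier (Lie R V)"
  shows elem_der_der[simp]: "elem_der R V f x \<in> derivations R V"
    and elem_der_gen: "v \<in> carrier V \<Longrightarrow> elem_der R V f x (gen R V v) = f v \<odot>\<^bsub>Lie R V\<^esub> x"
  using der_ext[OF assms(1) hom_form_smult[OF _ assms(2,3)]] assms(1) by (simp_all add: elem_der_def)

context
  fixes V :: "('a, 'v) module"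
  assumes V[simp]: "module R V"
begin

lemma LP_module[simp]: "module R (LP R V)" and LP_bilin[simp]: "bilin_alg R (LP R V)"
  and LP_lie[simp]: "lie_alg R (LP R V)"
  by (simp_all add: Lie_lie_alg)

lemma pt_derivation_eqI:
  assumes d: "d \<in> derivations R (pt_mod R V)" and e: "e \<in> derivations R (pt_mod R V)"
    and 1: "d (pt_one R V) = e (pt_one R V)" and g: "\<And>v. v \<in> carrier V \<Longrightarrow> d (pt_gen R V v) = e (pt_gen R V v)"
  shows "d = e"
proof (rule der_eqI[OF P_module[OF V] d e])
  fix p assume "p \<in> carrier (pt_mod R V)"
  then show "d (gen R (pt_mod R V) p) = e (gen R (pt_mod R V) p)"
    by (intro pt_der_eqI[OF V LP_bilin hom_id derivations_lie_der[OF d] derivations_lie_der[OF e] 1 g]) auto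
qed

lemma pt_der:
  assumes y: "y \<in> carrier (LP R V)"
  shows pt_der_der[simp]: "pt_der R V y \<in> derivations R (pt_mod R V)"
    and pt_der_one[simp]: "pt_der R V y (pt_one R V) = y"
    and pt_der_gen[simp]: "v \<in> carrier V \<Longrightarrow> pt_der R V y (pt_gen R V v) = \<zero>\<^bsub>LP R V\<^esub>"
    and pt_der_incl[simp]: "x \<in> carrier (Lie R V) \<Longrightarrow> pt_der R V y (pt_incl R V x) = \<zero>\<^bsub>LP R V\<^esub>"
proof -
  have f: "fst \<in> mod_hom R (pt_mod R V) (self_mod R)" by (auto simp: mod_hom_def)
  note E = der_ext[OF P_module[OF V] hom_form_smult[OF LP_module f y]]
  show d: "pt_der R V y \<in> derivations R (pt_mod R V)" using E(1) by (simp add: pt_der_def)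
  show "pt_der R V y (pt_one R V) = y" using E(2) y by (simp add: pt_der_def pt_one_def)
  show g: "pt_der R V y (pt_gen R V v) = \<zero>\<^bsub>LP R V\<^esub>" if "v \<in> carrier V" for v
    using E(2) y that by (simp add: pt_der_def pt_gen_def)
  show "x \<in> carrier (Lie R V) \<Longrightarrow> pt_der R V y (pt_incl R V x) = \<zero>\<^bsub>LP R V\<^esub>"
    by (rule lie_der_unique[OF V LP_bilin pt_incl_lin[OF V] lie_der_pre[OF pt_incl_hom[OF V] derivations_lie_der[OF d]]
          lie_der_zero[OF LP_bilin pt_incl_lin[OF V]]]) (simp_all add: g)
qed

lemma pt_der_apply_closed[simp]:
  "y \<in> carrier (LP R V) \<Longrightarrow> z \<in> carrier (LP R V) \<Longrightarrow> pt_der R V z y \<in> carrier (LP R V)"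
  by (rule derivations_closed[OF pt_der_der])

lemma pt_der_hom: "pt_der R V \<in> mod_hom R (LP R V) (Der R (pt_mod R V))"
proof (rule mod_homI)
  note [simp] = Der_add_closed[OF P_module[OF V]] Der_smult_closed[OF P_module[OF V]]
  fix x y assume "x \<in> carrier (LP R V)" "y \<in> carrier (LP R V)"
  then show "pt_der R V (x \<oplus>\<^bsub>LP R V\<^esub> y) = pt_der R V x \<oplus>\<^bsub>Der R (pt_mod R V)\<^esub> pt_der R V y"
    by (intro pt_derivation_eqI) (simp_all add: Der_apply)
next
  note [simp] = Der_add_closed[OF P_module[OF V]] Der_smult_closed[OF P_module[OF V]]
  fix a y assume "a \<in> carrier R" "y \<in> carrier (LP R V)"
  then show "pt_der R V (a \<odot>\<^bsub>LP R V\<^esub> y) = a \<odot>\<^bsub>Der R (pt_mod R V)\<^esub> pt_der R V y"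
    by (intro pt_derivation_eqI) (simp_all add: Der_apply)
qed simp

lemma pt_der_step:
  "x \<in> carrier (Lie R V) \<Longrightarrow> y \<in> carrier (LP R V) \<Longrightarrow> z \<in> carrier (LP R V) \<Longrightarrow>
    pt_der R V z (pt_incl R V x \<otimes>\<^bsub>LP R V\<^esub> y) = pt_incl R V x \<otimes>\<^bsub>LP R V\<^esub> pt_der R V z y"
  by (simp add: derivations_mult[OF pt_der_der])

lemma pt_der_step_gen:
  "v \<in> carrier V \<Longrightarrow> y \<in> carrier (LP R V) \<Longrightarrow> z \<in> carrier (LP R V) \<Longrightarrow>
    pt_der R V z (pt_gen R V v \<otimes>\<^bsub>LP R V\<^esub> y) = pt_gen R V v \<otimes>\<^bsub>LP R V\<^esub> pt_der R V z y"
  by (simp add: derivations_mult[OF pt_der_der])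

lemma pt_der_lin:
  assumes z: "z \<in> lie_lin R V (self_mod R)" and y: "y \<in> lie_lin R V (self_mod R)"
  shows "pt_der R V z y \<in> lie_lin R V (self_mod R)"
proof -
  have zc: "z \<in> carrier (LP R V)" using z by simp
  have "y \<in> {y \<in> carrier (LP R V). pt_der R V z y \<in> lie_lin R V (self_mod R)}"
  proof (rule lie_lin_induct[OF V _ _ _ y])
    show "submodule {y \<in> carrier (LP R V). pt_der R V z y \<in> lie_lin R V (self_mod R)} R (LP R V)"
      by (rule sub_vimage[OF _ _ derivations_hom[OF pt_der_der[OF zc]] lie_lin_sub]) auto
  qed (use z in \<open>auto simp: pt_der_step_gen\<close>)
  then show ?thesis by simp
qed

lemma lin_posI: "z \<in> lie_lin R V (self_mod R) \<Longrightarrow> z \<in> lie_part R (pt_mod R V) {2..} \<Longrightarrow> z \<in> lin_pos R V"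
  and lin_pos_pos: "z \<in> lin_pos R V \<Longrightarrow> z \<in> lie_part R (pt_mod R V) {2..}"
  by (simp_all add: lin_pos_def)

lemma lin_pos_closed[simp]: "z \<in> lin_pos R V \<Longrightarrow> z \<in> carrier (LP R V)"
  by simp

lemma pt_der_lin_pos:
  assumes z: "z \<in> lie_lin R V (self_mod R)" and y: "y \<in> lin_pos R V"
  shows "pt_der R V z y \<in> lin_pos R V"
  using lin_posI[OF pt_der_lin[OF z lin_posD[OF V y]] der_pos_stable[OF P_module[OF V] P_module[OF V] hom_id
      derivations_lie_der[OF pt_der_der[OF lie_lin_closed[OF V z]]] lin_pos_pos[OF y]]] .

subsection \<open>The algebra of positive pointed derivations\<close>

lemma Der_pt_pos_carrier: "carrier (Der_pt_pos R V) = pt_der R V ` lin_pos R V"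
proof
  show "carrier (Der_pt_pos R V) \<subseteq> pt_der R V ` lin_pos R V"
  proof
    fix d assume "d \<in> carrier (Der_pt_pos R V)"
    then have d: "d \<in> derivations R (pt_mod R V)" "\<And>v. v \<in> carrier V \<Longrightarrow> d (pt_gen R V v) = \<zero>\<^bsub>LP R V\<^esub>"
      "d (pt_one R V) \<in> lie_lin R V (self_mod R)" "d (pt_one R V) \<in> lie_part R (pt_mod R V) {2..}"
      by (auto simp: Der_pt_pos_def Der_pos_def pt_gen_def pt_one_def)
    have "d = pt_der R V (d (pt_one R V))"
      using d by (intro pt_derivation_eqI) auto
    then show "d \<in> pt_der R V ` lin_pos R V" using d by (auto simp: lin_pos_def)
  qed
  show "pt_der R V ` lin_pos R V \<subseteq> carrier (Der_pt_pos R V)"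
  proof
    fix d assume "d \<in> pt_der R V ` lin_pos R V"
    then obtain z where z: "z \<in> lin_pos R V" "d = pt_der R V z" by blast
    have "d (gen R (pt_mod R V) (r, v)) \<in> lie_part R (pt_mod R V) {2..}" if "r \<in> carrier R" "v \<in> carrier V" for r v
    proof -
      have "d (gen R (pt_mod R V) (r, v)) = r \<odot>\<^bsub>LP R V\<^esub> z"
        using z that by (simp add: gen_pt_split hom_add[OF derivations_hom[OF pt_der_der]] hom_smult[OF derivations_hom[OF pt_der_der]])
      then show ?thesis using z that by (simp add: lin_pos_def sub_smult[OF _ lie_part_sub])
    qed
    then show "d \<in> carrier (Der_pt_pos R V)"
      using z pt_der_gen[of z] pt_der_one[of z] by (auto simp: Der_pt_pos_def Der_pos_def pt_gen_def[symmetric] pt_one_def[symmetric])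
  qed
qed

lemma Der_pt_pos_eq: "Der_pt_pos R V = (Der R (pt_mod R V))\<lparr>carrier := pt_der R V ` lin_pos R V\<rparr>"
  using Der_pt_pos_carrier by (simp add: Der_pt_pos_def)

lemma lin_pos_image_sub: "submodule (pt_der R V ` lin_pos R V) R (Der R (pt_mod R V))"
  by (rule sub_image[OF LP_module _ pt_der_hom lin_pos_sub[OF V]]) simp

lemma Der_pt_pos_module[simp]: "module R (Der_pt_pos R V)"
  unfolding Der_pt_pos_eq by (rule submodule.submodule_is_module[OF lin_pos_image_sub]) simp

text \<open>The preLie product of pointed derivations is substitution for the marked generator.\<close>

lemma pt_der_mult:
  assumes "y \<in> carrier (LP R V)" "z \<in> carrier (LP R V)"
  shows "pt_der R V y \<otimes>\<^bsub>Der R (pt_mod R V)\<^esub> pt_der R V z = pt_der R V (pt_der R V z y)"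
proof (rule pt_derivation_eqI)
  show "(pt_der R V y \<otimes>\<^bsub>Der R (pt_mod R V)\<^esub> pt_der R V z) (pt_one R V) = pt_der R V (pt_der R V z y) (pt_one R V)"
    using assms Der_mult_apply[OF P_module[OF V], of "pt_der R V y" "pt_der R V z" "(\<one>, \<zero>\<^bsub>V\<^esub>)"]
    by (simp add: pt_one_def[symmetric])
  show "(pt_der R V y \<otimes>\<^bsub>Der R (pt_mod R V)\<^esub> pt_der R V z) (pt_gen R V v) = pt_der R V (pt_der R V z y) (pt_gen R V v)"
    if "v \<in> carrier V" for v
    using assms that Der_mult_apply[OF P_module[OF V], of "pt_der R V y" "pt_der R V z" "(\<zero>, v)"]
    by (simp add: pt_gen_def[symmetric] hom_zero[OF _ _ derivations_hom[OF pt_der_der]])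
qed (use assms in \<open>auto intro!: Der_mult_closed[OF P_module[OF V]]\<close>)

lemma lin_comm_gens:
  "{pt_der R V z y \<ominus>\<^bsub>LP R V\<^esub> pt_der R V y z | y z. y \<in> lin_pos R V \<and> z \<in> lin_pos R V} \<subseteq> lin_pos R V"
  using pt_der_lin_pos by (auto intro!: sub_diff[OF _ lin_pos_sub[OF V]])

lemma lin_comm_sub: "submodule (lin_comm R V) R (LP R V)"
  unfolding lin_comm_def using lin_comm_gens by (intro span_sub) auto

lemma lin_comm_subset: "z \<in> lin_comm R V \<Longrightarrow> z \<in> lin_pos R V"
  unfolding lin_comm_def using span_le[OF lin_pos_sub[OF V] lin_comm_gens] .

lemma lin_comm_incl:
  "y \<in> lin_pos R V \<Longrightarrow> z \<in> lin_pos R V \<Longrightarrow> pt_der R V z y \<ominus>\<^bsub>LP R V\<^esub> pt_der R V y z \<in> lin_comm R V"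
  unfolding lin_comm_def by (rule span_incl) blast

text \<open>Calculations modulo commutators can therefore be carried out in \<open>Lie(V;R)\<close>.\<close>

lemma comm_span_Der_pt_pos: "comm_span R (Der_pt_pos R V) = pt_der R V ` lin_comm R V"
proof -
  let ?D = "Der R (pt_mod R V)" and ?Z = "pt_der R V ` lin_pos R V"
  let ?G = "{pt_der R V z y \<ominus>\<^bsub>LP R V\<^esub> pt_der R V y z | y z. y \<in> lin_pos R V \<and> z \<in> lin_pos R V}"
  have eq: "x \<otimes>\<^bsub>Der_pt_pos R V\<^esub> x' \<ominus>\<^bsub>Der_pt_pos R V\<^esub> x' \<otimes>\<^bsub>Der_pt_pos R V\<^esub> x =
      pt_der R V (pt_der R V z y \<ominus>\<^bsub>LP R V\<^esub> pt_der R V y z)"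
    if "y \<in> lin_pos R V" "z \<in> lin_pos R V" "x = pt_der R V y" "x' = pt_der R V z" for x x' y z
  proof -
    have 1: "pt_der R V z y \<in> lin_pos R V" "pt_der R V y z \<in> lin_pos R V" using that pt_der_lin_pos by auto
    have "x \<otimes>\<^bsub>Der_pt_pos R V\<^esub> x' \<ominus>\<^bsub>Der_pt_pos R V\<^esub> x' \<otimes>\<^bsub>Der_pt_pos R V\<^esub> x =
        pt_der R V (pt_der R V z y) \<ominus>\<^bsub>?D\<lparr>carrier := ?Z\<rparr>\<^esub> pt_der R V (pt_der R V y z)"
      using that by (simp add: Der_pt_pos_eq pt_der_mult)
    also have "\<dots> = pt_der R V (pt_der R V z y) \<ominus>\<^bsub>?D\<^esub> pt_der R V (pt_der R V y z)"
      using 1 by (intro sub_diff_eq[OF _ lin_pos_image_sub]) auto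
    finally show ?thesis using 1 that by (simp add: hom_diff[OF _ _ pt_der_hom])
  qed
  have "{x \<otimes>\<^bsub>Der_pt_pos R V\<^esub> y \<ominus>\<^bsub>Der_pt_pos R V\<^esub> y \<otimes>\<^bsub>Der_pt_pos R V\<^esub> x | x y.
      x \<in> carrier (Der_pt_pos R V) \<and> y \<in> carrier (Der_pt_pos R V)} = pt_der R V ` ?G"
    (is "?A = ?B")
  proof
    show "?A \<subseteq> ?B" unfolding Der_pt_pos_carrier using eq by blast
    show "?B \<subseteq> ?A"
    proof
      fix b assume "b \<in> ?B"
      then obtain y z where yz: "y \<in> lin_pos R V" "z \<in> lin_pos R V"
        "b = pt_der R V (pt_der R V z y \<ominus>\<^bsub>LP R V\<^esub> pt_der R V y z)" by blast
      have "b = pt_der R V y \<otimes>\<^bsub>Der_pt_pos R V\<^esub> pt_der R V z \<ominus>\<^bsub>Der_pt_pos R V\<^esub> pt_der R V z \<otimes>\<^bsub>Der_pt_pos R V\<^esub> pt_der R V y"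
        using eq[OF yz(1,2) refl refl] yz(3) by simp
      then show "b \<in> ?A" unfolding Der_pt_pos_carrier using yz(1,2) by blast
    qed
  qed
  then have "comm_span R (Der_pt_pos R V) = span_of R (Der_pt_pos R V) (pt_der R V ` ?G)"
    by (simp add: comm_span_def)
  also have "\<dots> = span_of R ?D (pt_der R V ` ?G)"
    unfolding Der_pt_pos_eq using lin_comm_gens by (intro span_in_sub[OF _ lin_pos_image_sub]) auto
  also have "\<dots> = pt_der R V ` lin_comm R V"
    unfolding lin_comm_def using lin_comm_gens by (intro span_image[symmetric] pt_der_hom) auto
  finally show ?thesis .
qed

subsection \<open>Fox derivatives\<close>

lemma fox:
  assumes f: "f \<in> mod_hom R V (self_mod R)"
  shows fox_der: "lie_der R V (LP R V) (pt_incl R V) (fox R V f)"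
    and fox_gen: "v \<in> carrier V \<Longrightarrow> fox R V f (gen R V v) = f v \<odot>\<^bsub>LP R V\<^esub> pt_one R V"
  unfolding fox_def
  using lie_der_along[OF V LP_lie pt_incl_hom[OF V] hom_form_smult[OF LP_module f pt_one_closed[OF V]]]
    der_along_gen[OF V LP_lie adjoint_lie_module[OF LP_lie] pt_incl_hom[OF V] hom_form_smult[OF LP_module f pt_one_closed[OF V]]]
  by auto

lemmas fox_hom = lie_der_hom[OF fox_der]
lemmas fox_closed[simp] = hom_closed[OF fox_hom]
lemmas fox_mult = lie_der_mult[OF fox_der]

lemma fox_lin:
  assumes f: "f \<in> mod_hom R V (self_mod R)" and x: "x \<in> carrier (Lie R V)"
  shows "fox R V f x \<in> lie_lin R V (self_mod R)"
proof -
  have "x \<in> {x \<in> carrier (Lie R V). fox R V f x \<in> lie_lin R V (self_mod R)}"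
  proof (rule Lie_induct[OF V _ _ _ x])
    show "submodule {x \<in> carrier (Lie R V). fox R V f x \<in> lie_lin R V (self_mod R)} R (Lie R V)"
      by (rule sub_vimage[OF _ _ fox_hom[OF f] lie_lin_sub]) auto
    show "gen R V v \<in> {x \<in> carrier (Lie R V). fox R V f x \<in> lie_lin R V (self_mod R)}" if "v \<in> carrier V" for v
      using that f hom_closed[OF f that] by (simp add: fox_gen sub_smult[OF _ lie_lin_sub])
  qed (use f in \<open>auto simp: fox_mult incl_lin incl_lin_right intro!: sub_add[OF _ lie_lin_sub]\<close>)
  then show ?thesis by simp
qed

lemma fox_pos:
  assumes f: "f \<in> mod_hom R V (self_mod R)" and x: "x \<in> lie_part R V {2..}"
  shows "fox R V f x \<in> lin_pos R V"
  using x by (intro lin_posI fox_lin[OF f] der_pos_stable[OF V P_module[OF V] pt_incl_lin[OF V] fox_der[OF f] x]) simp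

lemma pt_lift:
  assumes e: "e \<in> derivations R V"
  shows pt_lift_der[simp]: "pt_lift R V e \<in> derivations R (pt_mod R V)"
    and pt_lift_one[simp]: "pt_lift R V e (pt_one R V) = \<zero>\<^bsub>LP R V\<^esub>"
    and pt_lift_gen[simp]: "v \<in> carrier V \<Longrightarrow> pt_lift R V e (pt_gen R V v) = pt_incl R V (e (gen R V v))"
    and pt_lift_incl[simp]: "x \<in> carrier (Lie R V) \<Longrightarrow> pt_lift R V e (pt_incl R V x) = pt_incl R V (e x)"
proof -
  have "snd \<in> mod_hom R (pt_mod R V) V" by (auto simp: mod_hom_def)
  from hom_comp[OF hom_comp[OF this der_gen_hom[OF V e]] pt_incl_lin[OF V]]
  have h: "(\<lambda>p. pt_incl R V (e (gen R V (snd p)))) \<in> mod_hom R (pt_mod R V) (LP R V)" .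
  note E = der_ext[OF P_module[OF V] h]
  show d: "pt_lift R V e \<in> derivations R (pt_mod R V)" using E(1) by (simp add: pt_lift_def)
  show "pt_lift R V e (pt_one R V) = \<zero>\<^bsub>LP R V\<^esub>"
    using E(2) by (simp add: pt_lift_def pt_one_def hom_zero[OF _ _ gen_hom[OF V]] hom_zero[OF _ _ derivations_hom[OF e]]
        hom_zero[OF _ _ pt_incl_lin[OF V]])
  show g: "pt_lift R V e (pt_gen R V v) = pt_incl R V (e (gen R V v))" if "v \<in> carrier V" for v
    using E(2) that by (simp add: pt_lift_def pt_gen_def)
  show "x \<in> carrier (Lie R V) \<Longrightarrow> pt_lift R V e (pt_incl R V x) = pt_incl R V (e x)"
    by (rule lie_der_unique[OF V LP_bilin pt_incl_lin[OF V] lie_der_pre[OF pt_incl_hom[OF V] derivations_lie_der[OF d]]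
          lie_der_post[OF Lie_bilin[OF V] hom_id derivations_lie_der[OF e] pt_incl_hom[OF V]]]) (simp_all add: g)
qed

lemma pt_lift_hom: "z \<in> carrier (LP R V) \<Longrightarrow> (\<lambda>e. pt_lift R V e z) \<in> mod_hom R (Der R V) (LP R V)"
proof -
  note [simp] = Der_add_closed[OF P_module[OF V]] Der_smult_closed[OF P_module[OF V]] Der_add_closed[OF V] Der_smult_closed[OF V]
  note i = hom_add[OF pt_incl_lin[OF V]] hom_smult[OF pt_incl_lin[OF V]]
  have "pt_lift R V \<in> mod_hom R (Der R V) (Der R (pt_mod R V))"
  proof (rule mod_homI)
    fix d e assume "d \<in> carrier (Der R V)" "e \<in> carrier (Der R V)"
    then show "pt_lift R V (d \<oplus>\<^bsub>Der R V\<^esub> e) = pt_lift R V d \<oplus>\<^bsub>Der R (pt_mod R V)\<^esub> pt_lift R V e"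
      by (intro pt_derivation_eqI) (simp_all add: Der_apply i)
  next
    fix a e assume "a \<in> carrier R" "e \<in> carrier (Der R V)"
    then show "pt_lift R V (a \<odot>\<^bsub>Der R V\<^esub> e) = a \<odot>\<^bsub>Der R (pt_mod R V)\<^esub> pt_lift R V e"
      by (intro pt_derivation_eqI) (simp_all add: Der_apply i)
  qed simp
  then show "z \<in> carrier (LP R V) \<Longrightarrow> (\<lambda>e. pt_lift R V e z) \<in> mod_hom R (Der R V) (LP R V)"
    by (rule hom_comp[OF _ der_eval_hom[OF P_module[OF V]]])
qed

lemma pt_lift_lin:
  assumes e: "e \<in> derivations R V" and y: "y \<in> lie_lin R V (self_mod R)"
  shows "pt_lift R V e y \<in> lie_lin R V (self_mod R)"
proof -
  note d = pt_lift_der[OF e]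
  have "y \<in> {y \<in> carrier (LP R V). pt_lift R V e y \<in> lie_lin R V (self_mod R)}"
  proof (rule lie_lin_induct[OF V _ _ _ y])
    show "submodule {y \<in> carrier (LP R V). pt_lift R V e y \<in> lie_lin R V (self_mod R)} R (LP R V)"
      by (rule sub_vimage[OF _ _ derivations_hom[OF d] lie_lin_sub]) auto
  qed (use e sub_zero[OF _ lie_lin_sub[OF V]] in
      \<open>auto simp: derivations_mult[OF d] incl_lin intro!: sub_add[OF _ lie_lin_sub]\<close>)
  then show ?thesis by simp
qed

lemma pt_lift_lin_pos:
  assumes e: "e \<in> derivations R V" and y: "y \<in> lin_pos R V"
  shows "pt_lift R V e y \<in> lin_pos R V"
  by (rule lin_posI[OF pt_lift_lin[OF e lin_posD[OF V y]] der_pos_stable[OF P_module[OF V] P_module[OF V] hom_id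
      derivations_lie_der[OF pt_lift_der[OF e]] lin_pos_pos[OF y]]])

text \<open>The commutator of the lift of \<open>e\<close> with the pointed derivation given by \<open>z\<close> kills \<open>V\<close> and sends the
  marked generator to the image of \<open>z\<close> under the lift. So the lift is a derivation for \<open>\<lhd>\<close>.\<close>

lemma pt_lift_pt_der:
  assumes e: "e \<in> derivations R V" and y: "y \<in> carrier (LP R V)" and z: "z \<in> carrier (LP R V)"
  shows "pt_lift R V e (pt_der R V z y) = pt_der R V (pt_lift R V e z) y \<oplus>\<^bsub>LP R V\<^esub> pt_der R V z (pt_lift R V e y)"
proof -
  let ?e = "pt_lift R V e"
  note d = pt_lift_der[OF e]
  have ez[simp]: "?e u \<in> carrier (LP R V)" if "u \<in> carrier (LP R V)" for u using d that by simp
  have "?e (pt_der R V z y) \<ominus>\<^bsub>LP R V\<^esub> pt_der R V z (?e y) = pt_der R V (?e z) y"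
    by (rule pt_der_eqI[OF V LP_bilin hom_id lie_der_commutator[OF P_module[OF V] derivations_lie_der[OF d] derivations_lie_der[OF pt_der_der[OF z]]]
          derivations_lie_der[OF pt_der_der[OF ez[OF z]]] _ _ y])
      (use e z in \<open>simp_all add: hom_zero[OF _ _ derivations_hom[OF d]] hom_zero[OF _ _ derivations_hom[OF pt_der_der]] mod_ac\<close>)
  then have "pt_der R V (?e z) y \<oplus>\<^bsub>LP R V\<^esub> pt_der R V z (?e y) =
      (?e (pt_der R V z y) \<ominus>\<^bsub>LP R V\<^esub> pt_der R V z (?e y)) \<oplus>\<^bsub>LP R V\<^esub> pt_der R V z (?e y)" by simp
  also have "\<dots> = ?e (pt_der R V z y)" using y z by (simp add: mod_ac)
  finally show ?thesis by simp
qed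

lemma pt_lift_lin_comm:
  assumes e: "e \<in> derivations R V" and k: "k \<in> lin_comm R V"
  shows "pt_lift R V e k \<in> lin_comm R V"
proof (rule span_hom_into[OF LP_module LP_module derivations_hom[OF pt_lift_der[OF e]] lin_comm_sub _ _ k[unfolded lin_comm_def]])
  let ?e = "pt_lift R V e"
  note h = derivations_hom[OF pt_lift_der[OF e]]
  show "{pt_der R V z y \<ominus>\<^bsub>LP R V\<^esub> pt_der R V y z | y z. y \<in> lin_pos R V \<and> z \<in> lin_pos R V} \<subseteq> carrier (LP R V)"
    by auto
  fix x assume "x \<in> {pt_der R V z y \<ominus>\<^bsub>LP R V\<^esub> pt_der R V y z | y z. y \<in> lin_pos R V \<and> z \<in> lin_pos R V}"
  then obtain y z where yz: "y \<in> lin_pos R V" "z \<in> lin_pos R V" "x = pt_der R V z y \<ominus>\<^bsub>LP R V\<^esub> pt_der R V y z" by blast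
  have p: "?e y \<in> lin_pos R V" "?e z \<in> lin_pos R V" using pt_lift_lin_pos[OF e] yz by auto
  note c = lin_pos_closed[OF yz(1)] lin_pos_closed[OF yz(2)] lin_pos_closed[OF p(1)] lin_pos_closed[OF p(2)]
  have "?e x = ?e (pt_der R V z y) \<ominus>\<^bsub>LP R V\<^esub> ?e (pt_der R V y z)"
    using c unfolding yz(3) by (intro hom_diff[OF _ _ h]) auto
  also have "\<dots> = (pt_der R V z (?e y) \<ominus>\<^bsub>LP R V\<^esub> pt_der R V (?e y) z) \<oplus>\<^bsub>LP R V\<^esub> (pt_der R V (?e z) y \<ominus>\<^bsub>LP R V\<^esub> pt_der R V y (?e z))"
    using c by (simp add: pt_lift_pt_der[OF e] mod_ac)
  finally show "?e x \<in> lin_comm R V"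
    using lin_comm_incl[OF p(1) yz(2)] lin_comm_incl[OF yz(1) p(2)] sub_add[OF _ lin_comm_sub] by simp
qed

text \<open>Over the inclusion \<open>Lie(V) \<rightarrow> Lie(R \<oplus> V)\<close>, both \<open>D\<^sub>f \<circ> e - e' \<circ> D\<^sub>f\<close> and the substitution of \<open>D\<^sub>f(y)\<close> for
  the marked generator in \<open>D\<^sub>g\<close> are derivations, where \<open>e = y \<otimes> g\<close> and \<open>e'\<close> is its lift. Each of them
  sends a generator \<open>v\<close> to \<open>g(v) D\<^sub>f(y)\<close>.\<close>

lemma fox_elem_der:
  assumes f: "f \<in> mod_hom R V (self_mod R)" and g: "g \<in> mod_hom R V (self_mod R)"
    and x: "x \<in> carrier (Lie R V)" and y: "y \<in> carrier (Lie R V)"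
  shows "fox R V f (elem_der R V g y x) =
    pt_lift R V (elem_der R V g y) (fox R V f x) \<oplus>\<^bsub>LP R V\<^esub> pt_der R V (fox R V f y) (fox R V g x)"
proof -
  let ?e = "elem_der R V g y" and ?F = "fox R V f" and ?p = "pt_der R V (fox R V f y)"
  note e = elem_der_der[OF V g y] and eg = elem_der_gen[OF V g y]
  note l = derivations_hom[OF pt_lift_der[OF e]] and lm = derivations_mult[OF pt_lift_der[OF e]]
  have [simp]: "?F u \<in> carrier (LP R V)" "fox R V g u \<in> carrier (LP R V)" "?e u \<in> carrier (Lie R V)"
    if "u \<in> carrier (Lie R V)" for u using that f g e by simp_all
  have lc[simp]: "pt_lift R V ?e u \<in> carrier (LP R V)" if "u \<in> carrier (LP R V)" for u
    using that e by simp
  have p: "?p \<in> derivations R (pt_mod R V)" using y f by simp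
  have "lie_der R V (LP R V) (pt_incl R V) (\<lambda>x. ?F (?e x) \<ominus>\<^bsub>LP R V\<^esub> pt_lift R V ?e (?F x))"
    unfolding lie_der_def
  proof (intro conjI ballI)
    show "(\<lambda>x. ?F (?e x) \<ominus>\<^bsub>LP R V\<^esub> pt_lift R V ?e (?F x)) \<in> mod_hom R (Lie R V) (LP R V)"
      using hom_comp[OF derivations_hom[OF e] fox_hom[OF f]] hom_comp[OF fox_hom[OF f] l] by (intro hom_diff_map) auto
    fix a b assume "a \<in> carrier (Lie R V)" "b \<in> carrier (Lie R V)"
    then show "?F (?e (a \<otimes>\<^bsub>Lie R V\<^esub> b)) \<ominus>\<^bsub>LP R V\<^esub> pt_lift R V ?e (?F (a \<otimes>\<^bsub>Lie R V\<^esub> b)) =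
        (?F (?e a) \<ominus>\<^bsub>LP R V\<^esub> pt_lift R V ?e (?F a)) \<otimes>\<^bsub>LP R V\<^esub> pt_incl R V b \<oplus>\<^bsub>LP R V\<^esub>
        pt_incl R V a \<otimes>\<^bsub>LP R V\<^esub> (?F (?e b) \<ominus>\<^bsub>LP R V\<^esub> pt_lift R V ?e (?F b))"
      using e by (simp add: derivations_mult[OF e] fox_mult[OF f] hom_add[OF fox_hom[OF f]] hom_add[OF l] lm bil_simps mod_ac)
  qed
  moreover have "lie_der R V (LP R V) (pt_incl R V) (\<lambda>x. ?p (fox R V g x))"
    unfolding lie_der_def
    using hom_comp[OF fox_hom[OF g] derivations_hom[OF p]] y p
    by (auto simp: fox_mult[OF g] derivations_mult[OF p] hom_add[OF derivations_hom[OF p]])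
  ultimately have "?F (?e x) \<ominus>\<^bsub>LP R V\<^esub> pt_lift R V ?e (?F x) = ?p (fox R V g x)"
  proof (rule lie_der_unique[OF V LP_bilin pt_incl_lin[OF V] _ _ _ x])
    fix v assume v: "v \<in> carrier V"
    then show "?F (?e (gen R V v)) \<ominus>\<^bsub>LP R V\<^esub> pt_lift R V ?e (?F (gen R V v)) = ?p (fox R V g (gen R V v))"
      using y e hom_closed[OF f v] hom_closed[OF g v]
      by (simp add: eg fox_gen f g hom_smult[OF fox_hom[OF f]] hom_smult[OF l] hom_smult[OF derivations_hom[OF p]] mod_diff_eq)
  qed
  then have "pt_lift R V ?e (?F x) \<oplus>\<^bsub>LP R V\<^esub> ?p (fox R V g x) =
    pt_lift R V ?e (?F x) \<oplus>\<^bsub>LP R V\<^esub> (?F (?e x) \<ominus>\<^bsub>LP R V\<^esub> pt_lift R V ?e (?F x))" by simp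
  also have "\<dots> = ?F (?e x)" using x by (simp add: mod_ac)
  finally show ?thesis by simp
qed

lemma incl_one_lin_pos: "x \<in> carrier (Lie R V) \<Longrightarrow> pt_incl R V x \<otimes>\<^bsub>LP R V\<^esub> pt_one R V \<in> lin_pos R V"
  by (simp add: lin_pos_def incl_lin lie_pos_mult)

text \<open>The Jacobi identity reads \<open>[[u,y],1] = [u,1] \<lhd> [y,1] - [y,1] \<lhd> [u,1]\<close>.\<close>

lemma incl_pos_comm:
  assumes y: "y \<in> lie_part R V {2..}"
  shows "pt_incl R V y \<otimes>\<^bsub>LP R V\<^esub> pt_one R V \<in> lin_comm R V"
proof -
  let ?j = "pt_incl R V" and ?o = "pt_one R V"
  have "y \<in> {y \<in> carrier (Lie R V). ?j y \<otimes>\<^bsub>LP R V\<^esub> ?o \<in> lin_comm R V}"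
  proof (rule lie_pos_induct[OF V _ _ y])
    show "submodule {y \<in> carrier (Lie R V). ?j y \<otimes>\<^bsub>LP R V\<^esub> ?o \<in> lin_comm R V} R (Lie R V)"
      by (rule sub_vimage[OF _ _ hom_comp[OF pt_incl_lin bil_hom2] lin_comm_sub]) auto
    fix u y assume u: "u \<in> carrier V" and y: "y \<in> carrier (Lie R V)"
    then have uc: "gen R V u \<in> carrier (Lie R V)" by simp
    have "?j (gen R V u \<otimes>\<^bsub>Lie R V\<^esub> y) \<otimes>\<^bsub>LP R V\<^esub> ?o =
        ?j (gen R V u) \<otimes>\<^bsub>LP R V\<^esub> (?j y \<otimes>\<^bsub>LP R V\<^esub> ?o) \<ominus>\<^bsub>LP R V\<^esub> ?j y \<otimes>\<^bsub>LP R V\<^esub> (?j (gen R V u) \<otimes>\<^bsub>LP R V\<^esub> ?o)"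
      using uc y lie_leibniz[OF LP_lie, of "?j (gen R V u)" "?j y" ?o] u by (simp add: pt_incl_mult mod_ac)
    also have "\<dots> = pt_der R V (?j y \<otimes>\<^bsub>LP R V\<^esub> ?o) (?j (gen R V u) \<otimes>\<^bsub>LP R V\<^esub> ?o) \<ominus>\<^bsub>LP R V\<^esub>
        pt_der R V (?j (gen R V u) \<otimes>\<^bsub>LP R V\<^esub> ?o) (?j y \<otimes>\<^bsub>LP R V\<^esub> ?o)"
      using uc y by (simp add: pt_der_step del: pt_incl_gen)
    also have "\<dots> \<in> lin_comm R V" by (intro lin_comm_incl incl_one_lin_pos uc y)
    finally show "gen R V u \<otimes>\<^bsub>Lie R V\<^esub> y \<in> {y \<in> carrier (Lie R V). ?j y \<otimes>\<^bsub>LP R V\<^esub> ?o \<in> lin_comm R V}"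
      using uc y by simp
  qed
  then show ?thesis by simp
qed

end

end

section \<open>Modules of finite rank and the divergence\<close>

text \<open>The divergence before passing to the quotient, as an element of \<open>Lie(V;R)\<close>.\<close>

definition div_lin :: "('a, 'r) ring_scheme \<Rightarrow> ('a, 'v, 'm) module_scheme \<Rightarrow> ('a, 'v) der \<Rightarrow> (('a \<times> 'v) tree \<Rightarrow> 'a) set"
  where "div_lin R V d = Phi R V d (pt_one R V)"

context cring
begin

subsection \<open>Bases\<close>

lemma pow_mod_sel[simp]:
  "carrier (pow_mod R n) = {..<n} \<rightarrow>\<^sub>E carrier R" "\<zero>\<^bsub>pow_mod R n\<^esub> = (\<lambda>i\<in>{..<n}. \<zero>)"
  "x \<oplus>\<^bsub>pow_mod R n\<^esub> y = (\<lambda>i\<in>{..<n}. x i \<oplus> y i)" "a \<odot>\<^bsub>pow_mod R n\<^esub> x = (\<lambda>i\<in>{..<n}. a \<otimes> x i)"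
  by (simp_all add: pow_mod_def)

lemma pow_eqI: "x \<in> {..<n} \<rightarrow>\<^sub>E carrier R \<Longrightarrow> y \<in> {..<n} \<rightarrow>\<^sub>E carrier R \<Longrightarrow> (\<And>i. i < n \<Longrightarrow> x i = y i) \<Longrightarrow> x = y"
  by (rule PiE_ext) auto

lemma pow_app: "x \<in> carrier (pow_mod R n) \<Longrightarrow> i < n \<Longrightarrow> x i \<in> carrier R"
  by auto

lemma pow_module[simp]: "module R (pow_mod R n)"
proof -
  have "abelian_group (pow_mod R n)"
  proof (rule abelian_groupI)
    show "\<exists>y\<in>carrier (pow_mod R n). y \<oplus>\<^bsub>pow_mod R n\<^esub> x = \<zero>\<^bsub>pow_mod R n\<^esub>" if x: "x \<in> carrier (pow_mod R n)" for x
    proof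
      show "(\<lambda>i\<in>{..<n}. \<ominus> x i) \<in> carrier (pow_mod R n)" using pow_app[OF x] by auto
      show "(\<lambda>i\<in>{..<n}. \<ominus> x i) \<oplus>\<^bsub>pow_mod R n\<^esub> x = \<zero>\<^bsub>pow_mod R n\<^esub>"
        using pow_app[OF x] by (simp add: l_neg cong: restrict_cong)
    qed
    show "x \<oplus>\<^bsub>pow_mod R n\<^esub> y \<oplus>\<^bsub>pow_mod R n\<^esub> z = x \<oplus>\<^bsub>pow_mod R n\<^esub> (y \<oplus>\<^bsub>pow_mod R n\<^esub> z)"
      if "x \<in> carrier (pow_mod R n)" "y \<in> carrier (pow_mod R n)" "z \<in> carrier (pow_mod R n)" for x y z
      using pow_app[OF that(1)] pow_app[OF that(2)] pow_app[OF that(3)] by (simp add: a_assoc cong: restrict_cong)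
    show "x \<oplus>\<^bsub>pow_mod R n\<^esub> y = y \<oplus>\<^bsub>pow_mod R n\<^esub> x"
      if "x \<in> carrier (pow_mod R n)" "y \<in> carrier (pow_mod R n)" for x y
      using that by (auto intro!: restrict_ext a_comm)
    show "\<zero>\<^bsub>pow_mod R n\<^esub> \<oplus>\<^bsub>pow_mod R n\<^esub> x = x" if x: "x \<in> carrier (pow_mod R n)" for x
    proof (rule pow_eqI)
      show "\<zero>\<^bsub>pow_mod R n\<^esub> \<oplus>\<^bsub>pow_mod R n\<^esub> x \<in> {..<n} \<rightarrow>\<^sub>E carrier R" using pow_app[OF x] by auto
    qed (use x pow_app[OF x] in auto)
  qed auto
  then show ?thesis
  proof (rule moduleI[OF is_cring])
    fix a x assume a: "a \<in> carrier R" and x: "x \<in> carrier (pow_mod R n)"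
    show "a \<odot>\<^bsub>pow_mod R n\<^esub> x \<in> carrier (pow_mod R n)" using a pow_app[OF x] by auto
    fix b assume b: "b \<in> carrier R"
    show "(a \<oplus> b) \<odot>\<^bsub>pow_mod R n\<^esub> x = a \<odot>\<^bsub>pow_mod R n\<^esub> x \<oplus>\<^bsub>pow_mod R n\<^esub> b \<odot>\<^bsub>pow_mod R n\<^esub> x"
      "(a \<otimes> b) \<odot>\<^bsub>pow_mod R n\<^esub> x = a \<odot>\<^bsub>pow_mod R n\<^esub> (b \<odot>\<^bsub>pow_mod R n\<^esub> x)"
      using a b pow_app[OF x] by (simp_all add: l_distr m_assoc cong: restrict_cong)
  next
    fix a x y assume a: "a \<in> carrier R" and x: "x \<in> carrier (pow_mod R n)" and y: "y \<in> carrier (pow_mod R n)"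
    show "a \<odot>\<^bsub>pow_mod R n\<^esub> (x \<oplus>\<^bsub>pow_mod R n\<^esub> y) = a \<odot>\<^bsub>pow_mod R n\<^esub> x \<oplus>\<^bsub>pow_mod R n\<^esub> a \<odot>\<^bsub>pow_mod R n\<^esub> y"
      using a pow_app[OF x] pow_app[OF y] by (simp add: r_distr cong: restrict_cong)
  next
    fix x assume x: "x \<in> carrier (pow_mod R n)"
    show "\<one> \<odot>\<^bsub>pow_mod R n\<^esub> x = x"
    proof (rule pow_eqI)
      show "\<one> \<odot>\<^bsub>pow_mod R n\<^esub> x \<in> {..<n} \<rightarrow>\<^sub>E carrier R" using pow_app[OF x] by auto
    qed (use x pow_app[OF x] in auto)
  qed
qed

lemma pow_eval_hom: "i < n \<Longrightarrow> (\<lambda>x. x i) \<in> mod_hom R (pow_mod R n) (self_mod R)"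
  by (rule mod_homI) auto

definition unit_vec :: "nat \<Rightarrow> nat \<Rightarrow> nat \<Rightarrow> 'a"
  where "unit_vec n i = (\<lambda>j\<in>{..<n}. if i = j then \<one> else \<zero>)"

lemma unit_vec_closed[simp]: "unit_vec n i \<in> {..<n} \<rightarrow>\<^sub>E carrier R"
  by (auto simp: unit_vec_def)

lemma pow_expand:
  assumes x: "x \<in> carrier (pow_mod R n)"
  shows "x = (\<Oplus>\<^bsub>pow_mod R n\<^esub>i\<in>{..<n}. x i \<odot>\<^bsub>pow_mod R n\<^esub> unit_vec n i)"
proof (rule pow_eqI)
  interpret P: abelian_group "pow_mod R n" by (simp add: mod_abelian)
  have t: "x i \<odot>\<^bsub>pow_mod R n\<^esub> unit_vec n i \<in> carrier (pow_mod R n)" if "i < n" for i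
    by (rule mod_smult[OF pow_module pow_app[OF x that]]) simp
  have s: "(\<Oplus>\<^bsub>pow_mod R n\<^esub>i\<in>{..<n}. x i \<odot>\<^bsub>pow_mod R n\<^esub> unit_vec n i) \<in> carrier (pow_mod R n)"
    using t by (intro P.finsum_closed) blast
  then show "(\<Oplus>\<^bsub>pow_mod R n\<^esub>i\<in>{..<n}. x i \<odot>\<^bsub>pow_mod R n\<^esub> unit_vec n i) \<in> {..<n} \<rightarrow>\<^sub>E carrier R" by simp
  fix j assume j: "j < n"
  have "(\<Oplus>\<^bsub>pow_mod R n\<^esub>i\<in>{..<n}. x i \<odot>\<^bsub>pow_mod R n\<^esub> unit_vec n i) j
      = (\<Oplus>\<^bsub>self_mod R\<^esub>i\<in>{..<n}. (x i \<odot>\<^bsub>pow_mod R n\<^esub> unit_vec n i) j)"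
    using t by (intro hom_finsum[OF pow_module module_self pow_eval_hom[OF j]]) (blast | simp)+
  also have "\<dots> = (\<Oplus>i\<in>{..<n}. (x i \<odot>\<^bsub>pow_mod R n\<^esub> unit_vec n i) j)"
    by (simp add: finsum_def finprod_def self_mod_def)
  also have "\<dots> = (\<Oplus>i\<in>{..<n}. if j = i then x i else \<zero>)"
    using j pow_app[OF x] by (intro finsum_cong') (simp_all add: unit_vec_def Pi_iff)
  also have "\<dots> = x j" using pow_app[OF x] j by (intro finsum_singleton) (simp_all add: Pi_iff)
  finally show "x j = (\<Oplus>\<^bsub>pow_mod R n\<^esub>i\<in>{..<n}. x i \<odot>\<^bsub>pow_mod R n\<^esub> unit_vec n i) j" by simp
qed (use x in simp)

lemma mod_iso_inv:
  assumes M: "module R M" and f: "f \<in> mod_iso R M N"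
  shows "inv_into (carrier M) f \<in> mod_hom R N M"
proof -
  let ?g = "inv_into (carrier M) f"
  have h: "f \<in> mod_hom R M N" and b: "bij_betw f (carrier M) (carrier N)" using f by (auto simp: mod_iso_def)
  have g: "?g y \<in> carrier M" "f (?g y) = y" if "y \<in> carrier N" for y
    using that b by (auto simp: bij_betw_def inv_into_into f_inv_into_f)
  have gf: "?g (f x) = x" if "x \<in> carrier M" for x using that b by (simp add: bij_betw_def)
  show ?thesis
  proof (rule mod_homI)
    fix x y assume "x \<in> carrier N" "y \<in> carrier N"
    then show "?g (x \<oplus>\<^bsub>N\<^esub> y) = ?g x \<oplus>\<^bsub>M\<^esub> ?g y"
      using gf[of "?g x \<oplus>\<^bsub>M\<^esub> ?g y"] g M by (simp add: hom_add[OF h])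
  next
    fix a x assume "a \<in> carrier R" "x \<in> carrier N"
    then show "?g (a \<odot>\<^bsub>N\<^esub> x) = a \<odot>\<^bsub>M\<^esub> ?g x"
      using gf[of "a \<odot>\<^bsub>M\<^esub> ?g x"] g M by (simp add: hom_smult[OF h])
  qed (use g in auto)
qed

definition dual_basis :: "('a, 'v, 'm) module_scheme \<Rightarrow> nat \<Rightarrow> (nat \<Rightarrow> 'v) \<Rightarrow> (nat \<Rightarrow> 'v \<Rightarrow> 'a) \<Rightarrow> bool"
  where "dual_basis V n e \<epsilon> \<longleftrightarrow> (\<forall>i<n. e i \<in> carrier V) \<and> (\<forall>i<n. \<epsilon> i \<in> mod_hom R V (self_mod R)) \<and>
    (\<forall>i<n. \<forall>j<n. \<epsilon> i (e j) = (if i = j then \<one> else \<zero>)) \<and>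
    (\<forall>v\<in>carrier V. v = (\<Oplus>\<^bsub>V\<^esub>i\<in>{..<n}. \<epsilon> i v \<odot>\<^bsub>V\<^esub> e i))"

lemma free_basis:
  assumes "free_of_rank R V n"
  shows "\<exists>e \<epsilon>. dual_basis V n e \<epsilon>"
proof -
  obtain F where V: "module R V" and F: "F \<in> mod_iso R (pow_mod R n) V"
    using assms by (auto simp: free_of_rank_def)
  let ?P = "pow_mod R n" and ?G = "inv_into (carrier (pow_mod R n)) F"
  have h: "F \<in> mod_hom R ?P V" and b: "bij_betw F (carrier ?P) (carrier V)" using F by (auto simp: mod_iso_def)
  note G = mod_iso_inv[OF pow_module F]
  have FG: "F (?G v) = v" if "v \<in> carrier V" for v using that b by (simp only: bij_betw_def f_inv_into_f)
  have GF: "?G (F x) = x" if "x \<in> carrier ?P" for x using that b by (simp only: bij_betw_def inv_into_f_f)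
  show ?thesis
    unfolding dual_basis_def
  proof (intro exI[of _ "\<lambda>i. F (unit_vec n i)"] exI[of _ "\<lambda>i v. ?G v i"] conjI allI impI ballI)
    show "F (unit_vec n i) \<in> carrier V" if "i < n" for i using hom_closed[OF h] by simp
    show "(\<lambda>v. ?G v i) \<in> mod_hom R V (self_mod R)" if "i < n" for i
      by (rule hom_comp[OF G pow_eval_hom[OF that]])
    show "?G (F (unit_vec n j)) i = (if i = j then \<one> else \<zero>)" if "i < n" "j < n" for i j
    proof -
      have "?G (F (unit_vec n j)) = unit_vec n j" by (rule GF) simp
      then show ?thesis using that by (simp add: unit_vec_def)
    qed
    show "v = (\<Oplus>\<^bsub>V\<^esub>i\<in>{..<n}. ?G v i \<odot>\<^bsub>V\<^esub> F (unit_vec n i))" if v: "v \<in> carrier V" for v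
    proof -
      have g: "?G v \<in> carrier ?P" using hom_closed[OF G v] .
      have gi: "?G v i \<in> carrier R" if "i < n" for i by (rule pow_app[OF g that])
      have uc: "unit_vec n i \<in> carrier ?P" for i by simp
      have "v = F (\<Oplus>\<^bsub>?P\<^esub>i\<in>{..<n}. ?G v i \<odot>\<^bsub>?P\<^esub> unit_vec n i)"
        using FG[OF v] pow_expand[OF g] by simp
      also have "\<dots> = (\<Oplus>\<^bsub>V\<^esub>i\<in>{..<n}. F (?G v i \<odot>\<^bsub>?P\<^esub> unit_vec n i))"
        by (rule hom_finsum[OF pow_module V h]) (auto intro!: mod_smult[OF pow_module] gi uc simp del: pow_mod_sel)
      also have "\<dots> = (\<Oplus>\<^bsub>V\<^esub>i\<in>{..<n}. ?G v i \<odot>\<^bsub>V\<^esub> F (unit_vec n i))"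
        using V by (intro abelian_monoid.finsum_cong'[OF abelian_group.axioms(1)[OF mod_abelian[OF V]]])
          (auto intro!: hom_smult[OF h] mod_smult[OF V] hom_closed[OF h] gi uc simp del: pow_mod_sel)
      finally show ?thesis .
    qed
  qed
qed

lemma sub_finsum:
  assumes M: "module R M" "submodule H R M" and g: "finite I" "\<And>i. i \<in> I \<Longrightarrow> g i \<in> H"
  shows "finsum M g I \<in> H"
proof -
  interpret M: abelian_group M by (rule mod_abelian[OF M(1)])
  show ?thesis using g
  proof (induction rule: finite_induct)
    case empty
    then show ?case by (simp add: sub_zero[OF M])
  next
    case (insert i I)
    then have "finsum M g (insert i I) = g i \<oplus>\<^bsub>M\<^esub> finsum M g I"
      using sub_carrier[OF M] by (intro M.finsum_insert) auto
    then show ?case using insert by (simp add: sub_add[OF M])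
  qed
qed

text \<open>In terms of dual bases, \<open>d\<close> is the sum of the elementary derivations \<open>d(e\<^sub>i) \<otimes> \<epsilon>\<^sub>i\<close>.\<close>

lemma Der_span_induct:
  fixes V :: "('a, 'v) module"
  assumes free: "free_fin_rank R V" and H: "submodule H R (Der R V)"
    and elem: "\<And>f x. f \<in> mod_hom R V (self_mod R) \<Longrightarrow> x \<in> T \<Longrightarrow> elem_der R V f x \<in> H"
    and T: "T \<subseteq> carrier (Lie R V)" and d: "d \<in> derivations R V" "\<And>v. v \<in> carrier V \<Longrightarrow> d (gen R V v) \<in> T"
  shows "d \<in> H"
proof -
  obtain n where n: "free_of_rank R V n" using free by (auto simp: free_fin_rank_def)
  then have V[simp]: "module R V" by (simp add: free_of_rank_def)
  obtain e \<epsilon> where "dual_basis V n e \<epsilon>" using free_basis[OF n] by blast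
  then have e: "\<And>i. i < n \<Longrightarrow> e i \<in> carrier V" and \<epsilon>: "\<And>i. i < n \<Longrightarrow> \<epsilon> i \<in> mod_hom R V (self_mod R)"
    and exp: "\<And>v. v \<in> carrier V \<Longrightarrow> v = (\<Oplus>\<^bsub>V\<^esub>i\<in>{..<n}. \<epsilon> i v \<odot>\<^bsub>V\<^esub> e i)"
    unfolding dual_basis_def by blast+
  interpret D: abelian_group "Der R V" by (rule mod_abelian) simp
  interpret L: abelian_group "Lie R V" by (rule mod_abelian) simp
  define g where "g i = elem_der R V (\<epsilon> i) (d (gen R V (e i)))" for i
  have x[simp]: "d (gen R V (e i)) \<in> carrier (Lie R V)" if "i < n" for i using d e that by simp
  have gc: "g i \<in> derivations R V" if "i < n" for i using that \<epsilon> by (simp add: g_def)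
  have "d = finsum (Der R V) g {..<n}"
  proof (rule der_eqI[OF V d(1)])
    show c: "finsum (Der R V) g {..<n} \<in> derivations R V"
      using D.finsum_closed[of g "{..<n}"] gc by auto
    fix v assume v: "v \<in> carrier V"
    note dg = der_gen_hom[OF V d(1)]
    have \<epsilon>v: "\<epsilon> i v \<in> carrier R" if "i < n" for i using hom_closed[OF \<epsilon>[OF that] v] by simp
    have "d (gen R V v) = d (gen R V (\<Oplus>\<^bsub>V\<^esub>i\<in>{..<n}. \<epsilon> i v \<odot>\<^bsub>V\<^esub> e i))" using exp[OF v] by simp
    also have "\<dots> = (\<Oplus>\<^bsub>Lie R V\<^esub>i\<in>{..<n}. d (gen R V (\<epsilon> i v \<odot>\<^bsub>V\<^esub> e i)))"
      using e \<epsilon>v by (intro hom_finsum[OF V _ dg]) auto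
    also have "\<dots> = (\<Oplus>\<^bsub>Lie R V\<^esub>i\<in>{..<n}. g i (gen R V v))"
      using e \<epsilon>v \<epsilon> v by (intro L.finsum_cong') (auto simp: g_def elem_der_gen hom_smult[OF dg])
    also have "\<dots> = finsum (Der R V) g {..<n} (gen R V v)"
      using gc v by (intro hom_finsum[OF _ _ der_eval_hom[OF V], symmetric]) auto
    finally show "d (gen R V v) = finsum (Der R V) g {..<n} (gen R V v)" .
  qed
  moreover have "g i \<in> H" if "i < n" for i
    unfolding g_def by (rule elem[OF \<epsilon>[OF that] d(2)[OF e[OF that]]])
  ultimately show ?thesis using sub_finsum[OF _ H, of "{..<n}" g] by simp
qed

subsection \<open>Functoriality of the free Lie algebra\<close>

lemma lie_der_restrict_cong:
  assumes "lie_der R V B j d" "module R V" "\<And>x. x \<in> carrier (Lie R V) \<Longrightarrow> j' x = j x" "\<And>x. x \<in> carrier (Lie R V) \<Longrightarrow> d' x = d x"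
  shows "lie_der R V B j' d'"
  using assms hom_cong[OF lie_der_hom[OF assms(1)], of d'] by (auto simp: lie_der_def)

lemma alg_hom_restrict:
  assumes "bilin_alg R A" "f \<in> alg_hom R A B"
  shows "restrict f (carrier A) \<in> alg_hom R A B"
  using assms hom_restrict[OF _ alg_hom_hom[OF assms(2)]] by (auto simp: alg_hom_def)

lemma lie_map:
  assumes V: "module R V" and W: "module R W" and g: "g \<in> mod_hom R V W"
  shows lie_map_hom: "lie_map R V W g \<in> alg_hom R (Lie R V) (Lie R W)"
    and lie_map_gen: "v \<in> carrier V \<Longrightarrow> lie_map R V W g (gen R V v) = gen R W (g v)"
proof -
  note E = lie_ext[OF V Lie_lie_alg[OF W] hom_comp[OF g gen_hom[OF W]]]
  let ?f = "restrict (lie_ext R (Lie R W) (\<lambda>v. gen R W (g v))) (carrier (Lie R V))"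
  have f: "?f \<in> alg_hom R (Lie R V) (Lie R W)"
    by (rule alg_hom_restrict[OF Lie_bilin[OF V] E(1)])
  have fg: "?f (gen R V v) = gen R W (g v)" if "v \<in> carrier V" for v
    using that E(2) V by simp
  have "lie_map R V W g \<in> alg_hom R (Lie R V) (Lie R W) \<inter> extensional (carrier (Lie R V)) \<and>
      (\<forall>v\<in>carrier V. lie_map R V W g (gen R V v) = gen R W (g v))"
    unfolding lie_map_def
  proof (rule theI[of _ ?f])
    show "?f \<in> alg_hom R (Lie R V) (Lie R W) \<inter> extensional (carrier (Lie R V)) \<and>
      (\<forall>v\<in>carrier V. ?f (gen R V v) = gen R W (g v))" using f fg by simp
    fix f' assume f': "f' \<in> alg_hom R (Lie R V) (Lie R W) \<inter> extensional (carrier (Lie R V)) \<and>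
      (\<forall>v\<in>carrier V. f' (gen R V v) = gen R W (g v))"
    show "f' = ?f"
    proof (rule extensionalityI[of _ "carrier (Lie R V)"])
      fix x assume "x \<in> carrier (Lie R V)"
      then show "f' x = ?f x" using f' f fg Lie_hom_unique[OF V Lie_bilin[OF W], of f' ?f x] by auto
    qed (use f' in auto)
  qed
  then show "lie_map R V W g \<in> alg_hom R (Lie R V) (Lie R W)"
    "v \<in> carrier V \<Longrightarrow> lie_map R V W g (gen R V v) = gen R W (g v)" by auto
qed

lemmas lie_map_lin = alg_hom_hom[OF lie_map_hom]
lemmas lie_map_closed[simp] = hom_closed[OF lie_map_lin]
lemmas lie_map_mult = alg_hom_mult[OF lie_map_hom]

lemma dsum_inl_hom: "module R M \<Longrightarrow> module R N \<Longrightarrow> (\<lambda>x. (x, \<zero>\<^bsub>N\<^esub>)) \<in> mod_hom R M (dsum M N)"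
  and dsum_inr_hom: "module R M \<Longrightarrow> module R N \<Longrightarrow> Pair \<zero>\<^bsub>M\<^esub> \<in> mod_hom R N (dsum M N)"
  by (auto simp: mod_hom_def)

lemma dsum_fst_hom: "fst \<in> mod_hom R (dsum M N) M"
  and dsum_snd_hom: "snd \<in> mod_hom R (dsum M N) N"
  by (auto simp: mod_hom_def)

context
  fixes V :: "('a, 'v) module"
  assumes V[simp]: "module R V"
begin

definition class_sum :: "('v \<times> 'v) tree list \<Rightarrow> (('v \<times> 'v) tree \<Rightarrow> 'a) set"
  where "class_sum ts = foldr (\<lambda>t s. tree_class R (dsum V V) t \<oplus>\<^bsub>Lie R (dsum V V)\<^esub> s) ts \<zero>\<^bsub>Lie R (dsum V V)\<^esub>"

lemma class_sum_simps[simp]: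
  "class_sum [] = \<zero>\<^bsub>Lie R (dsum V V)\<^esub>"
  "class_sum (t # ts) = tree_class R (dsum V V) t \<oplus>\<^bsub>Lie R (dsum V V)\<^esub> class_sum ts"
  by (simp_all add: class_sum_def)

lemma class_sum_closed[simp]: "set ts \<subseteq> trees_on (dsum V V) \<Longrightarrow> class_sum ts \<in> carrier (Lie R (dsum V V))"
  by (induction ts) (auto simp: tree_class_carrier)

lemma class_sum_append:
  "set ts \<subseteq> trees_on (dsum V V) \<Longrightarrow> set us \<subseteq> trees_on (dsum V V) \<Longrightarrow>
    class_sum (ts @ us) = class_sum ts \<oplus>\<^bsub>Lie R (dsum V V)\<^esub> class_sum us"
  by (induction ts) (auto simp: tree_class_carrier mod_assoc)

lemma class_sum_map:
  "set ts \<subseteq> trees_on (dsum V V) \<Longrightarrow> u \<in> trees_on (dsum V V) \<Longrightarrow>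
    class_sum (map (\<lambda>t. Node t u) ts) = class_sum ts \<otimes>\<^bsub>Lie R (dsum V V)\<^esub> tree_class R (dsum V V) u"
  "set ts \<subseteq> trees_on (dsum V V) \<Longrightarrow> u \<in> trees_on (dsum V V) \<Longrightarrow>
    class_sum (map (Node u) ts) = tree_class R (dsum V V) u \<otimes>\<^bsub>Lie R (dsum V V)\<^esub> class_sum ts"
  by (induction ts) (auto simp: tree_class_carrier tree_class_Node bil_ladd bil_radd)

lemma class_sum_finsum:
  assumes "set ts \<subseteq> trees_on (dsum V V)"
  shows "(\<Oplus>\<^bsub>Lie R (dsum V V)\<^esub>k\<in>{..<length ts}. tree_class R (dsum V V) (ts ! k)) = class_sum ts"
proof -
  interpret L: abelian_group "Lie R (dsum V V)" by (rule mod_abelian) simp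
  show ?thesis using assms
  proof (induction ts)
    case (Cons t ts)
    have *: "tree_class R (dsum V V) ((t # ts) ! k) \<in> carrier (Lie R (dsum V V))" if "k < Suc (length ts)" for k
      using Cons.prems that nth_mem[of k "t # ts"] by (intro tree_class_carrier) auto
    have "(\<Oplus>\<^bsub>Lie R (dsum V V)\<^esub>k\<in>{..<length (t # ts)}. tree_class R (dsum V V) ((t # ts) ! k)) =
      (\<Oplus>\<^bsub>Lie R (dsum V V)\<^esub>k\<in>insert 0 (Suc ` {..<length ts}). tree_class R (dsum V V) ((t # ts) ! k))"
      by (simp add: lessThan_Suc_eq_insert_0)
    also have "\<dots> = tree_class R (dsum V V) t \<oplus>\<^bsub>Lie R (dsum V V)\<^esub>
        (\<Oplus>\<^bsub>Lie R (dsum V V)\<^esub>k\<in>Suc ` {..<length ts}. tree_class R (dsum V V) ((t # ts) ! k))"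
      using * [of 0] * by (subst L.finsum_insert) auto
    also have "(\<Oplus>\<^bsub>Lie R (dsum V V)\<^esub>k\<in>Suc ` {..<length ts}. tree_class R (dsum V V) ((t # ts) ! k)) =
        (\<Oplus>\<^bsub>Lie R (dsum V V)\<^esub>k\<in>{..<length ts}. tree_class R (dsum V V) ((t # ts) ! Suc k))"
      using * by (intro L.finsum_reindex) auto
    finally show ?case using Cons by simp
  qed simp
qed

lemma marked_trees_on: "t \<in> trees_on V \<Longrightarrow> set (marked_trees V t) \<subseteq> trees_on (dsum V V)"
  and shift_trees_on: "t \<in> trees_on V \<Longrightarrow> map_tree (Pair \<zero>\<^bsub>V\<^esub>) t \<in> trees_on (dsum V V)"
proof -
  show s: "map_tree (Pair \<zero>\<^bsub>V\<^esub>) t \<in> trees_on (dsum V V)" if "t \<in> trees_on V" for t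
    using that by (induction t) auto
  show "t \<in> trees_on V \<Longrightarrow> set (marked_trees V t) \<subseteq> trees_on (dsum V V)"
    by (induction t) (use s in auto)
qed

text \<open>Marking one leaf in all possible ways is the derivation, over the inclusion of \<open>V\<close> as the second
  summand, that sends \<open>v\<close> to its copy in the first summand.\<close>

lemma lie_delta:
  shows lie_delta_der: "lie_der R V (Lie R (dsum V V)) (lie_map R V (dsum V V) (Pair \<zero>\<^bsub>V\<^esub>)) (lie_delta R V)"
    and lie_delta_gen: "v \<in> carrier V \<Longrightarrow> lie_delta R V (gen R V v) = gen R (dsum V V) (v, \<zero>\<^bsub>V\<^esub>)"
proof -
  let ?L = "Lie R (dsum V V)" and ?j = "lie_map R V (dsum V V) (Pair \<zero>\<^bsub>V\<^esub>)"
  have VV: "module R (dsum V V)" by simp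
  note j = lie_map_hom[OF V VV dsum_inr_hom[OF V V]] and jg = lie_map_gen[OF V VV dsum_inr_hom[OF V V]]
  have h: "(\<lambda>v. gen R (dsum V V) (v, \<zero>\<^bsub>V\<^esub>)) \<in> mod_hom R V ?L"
    by (rule hom_comp[OF dsum_inl_hom[OF V V] gen_hom[OF VV]])
  let ?d = "der_along R V ?L ?L (mult ?L) ?j (\<lambda>v. gen R (dsum V V) (v, \<zero>\<^bsub>V\<^esub>))"
  note D = lie_der_along[OF V Lie_lie_alg[OF VV] j h]
  note Dg = der_along_gen[OF V Lie_lie_alg[OF VV] adjoint_lie_module[OF Lie_lie_alg[OF VV]] j h]
  have jt: "?j (tree_class R V t) = tree_class R (dsum V V) (map_tree (Pair \<zero>\<^bsub>V\<^esub>) t)" if "t \<in> trees_on V" for t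
    using that
  proof (induction t)
    case (Leaf v)
    then show ?case using jg[of v] by (simp add: gen_def)
  qed (auto simp: tree_class_Node tree_class_carrier alg_hom_mult[OF j] shift_trees_on)
  have Dt: "?d (tree_class R V t) = class_sum (marked_trees V t)" if "t \<in> trees_on V" for t
    using that
  proof (induction t)
    case (Leaf v)
    then show ?case using Dg[of v] by (simp add: gen_def tree_class_carrier)
  next
    case (Node s t)
    then have st: "s \<in> trees_on V" "t \<in> trees_on V" by auto
    note m = marked_trees_on[OF st(1)] marked_trees_on[OF st(2)] and sh = shift_trees_on[OF st(1)] shift_trees_on[OF st(2)]
    have "set (map (\<lambda>s'. Node s' (map_tree (Pair \<zero>\<^bsub>V\<^esub>) t)) (marked_trees V s)) \<subseteq> trees_on (dsum V V)"
      "set (map (Node (map_tree (Pair \<zero>\<^bsub>V\<^esub>) s)) (marked_trees V t)) \<subseteq> trees_on (dsum V V)"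
      using m sh by auto
    then show ?case
      using Node.IH st m sh
      by (simp add: tree_class_Node lie_der_mult[OF D] tree_class_carrier jt class_sum_append class_sum_map)
  qed
  let ?dr = "restrict ?d (carrier (Lie R V))"
  have "lie_delta R V = ?dr"
    unfolding lie_delta_def
  proof (rule the_equality)
    show "?dr \<in> mod_hom R (Lie R V) ?L \<inter> extensional (carrier (Lie R V)) \<and>
       (\<forall>t\<in>trees_on V. ?dr (tree_class R V t) =
          (\<Oplus>\<^bsub>?L\<^esub> k\<in>{..<length (marked_trees V t)}. tree_class R (dsum V V) (marked_trees V t ! k)))"
      using hom_restrict[OF Lie_module[OF V] lie_der_hom[OF D]]
      by (auto simp: class_sum_finsum[OF marked_trees_on] Dt tree_class_carrier)
    fix d' assume d': "d' \<in> mod_hom R (Lie R V) ?L \<inter> extensional (carrier (Lie R V)) \<and>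
       (\<forall>t\<in>trees_on V. d' (tree_class R V t) =
          (\<Oplus>\<^bsub>?L\<^esub> k\<in>{..<length (marked_trees V t)}. tree_class R (dsum V V) (marked_trees V t ! k)))"
    show "d' = ?dr"
    proof (rule extensionalityI[of _ "carrier (Lie R V)"])
      fix x assume x: "x \<in> carrier (Lie R V)"
      have d'h: "d' \<in> mod_hom R (Lie R V) ?L" using d' by simp
      have "d' x = ?d x"
      proof (rule span_hom_eq[OF Lie_module[OF V] Lie_module[OF VV] d'h lie_der_hom[OF D]])
        show "tree_class R V ` trees_on V \<subseteq> carrier (Lie R V)" by (auto simp: tree_class_carrier)
        show "x \<in> span_of R (Lie R V) (tree_class R V ` trees_on V)" using x Lie_span[OF V] by simp
        show "d' y = ?d y" if "y \<in> tree_class R V ` trees_on V" for y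
          using that d' by (auto simp: class_sum_finsum[OF marked_trees_on] Dt)
      qed
      then show "d' x = ?dr x" using x by simp
    qed (use d' in auto)
  qed
  then show "lie_der R V ?L ?j (lie_delta R V)"
    "v \<in> carrier V \<Longrightarrow> lie_delta R V (gen R V v) = gen R (dsum V V) (v, \<zero>\<^bsub>V\<^esub>)"
    using lie_der_restrict_cong[OF D V, of ?j ?dr] Dg by auto
qed

text \<open>Composing \<open>\<delta>\<close> with the homomorphism induced by \<open>f\<close> gives a derivation over the inclusion of \<open>Lie(V)\<close>
  with the values \<open>f(v)\<cdot>1\<close> on generators.\<close>

lemma lie_map_delta:
  assumes f: "f \<in> mod_hom R V (self_mod R)" and x: "x \<in> carrier (Lie R V)"
  shows "lie_map R (dsum V V) (pt_mod R V) (map_prod f id) (lie_delta R V x) = fox R V f x"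
proof -
  let ?m = "lie_map R (dsum V V) (pt_mod R V) (map_prod f id)" and ?j = "lie_map R V (dsum V V) (Pair \<zero>\<^bsub>V\<^esub>)"
  have VV: "module R (dsum V V)" by simp
  have p: "map_prod f id \<in> mod_hom R (dsum V V) (pt_mod R V)"
    using hom_closed[OF f] by (auto simp: mod_hom_def hom_add[OF f] hom_smult[OF f])
  note m = lie_map_hom[OF VV P_module[OF V] p] and mg = lie_map_gen[OF VV P_module[OF V] p]
  note j = lie_map_hom[OF V VV dsum_inr_hom[OF V V]] and jg = lie_map_gen[OF V VV dsum_inr_hom[OF V V]]
  have mj: "pt_incl R V y = ?m (?j y)" if "y \<in> carrier (Lie R V)" for y
    by (rule Lie_hom_unique[OF V LP_bilin[OF V] pt_incl_hom[OF V] alg_hom_comp[OF j m] _ that])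
      (use hom_zero[OF V module_self f] in \<open>auto simp: jg mg pt_gen_def\<close>)
  have "lie_der R V (LP R V) (pt_incl R V) (\<lambda>x. ?m (lie_delta R V x))"
    by (rule lie_der_restrict_cong[OF lie_der_post[OF Lie_bilin[OF VV] alg_hom_hom[OF j] lie_delta_der m] V mj]) auto
  then show ?thesis
  proof (rule lie_der_unique[OF V LP_bilin[OF V] pt_incl_lin[OF V] _ fox_der[OF V f] _ x])
    fix v assume v: "v \<in> carrier V"
    then show "?m (lie_delta R V (gen R V v)) = fox R V f (gen R V v)"
      using hom_closed[OF f v] hom_zero[OF V _ pt_gen_hom[OF V]] by (simp add: lie_delta_gen mg fox_gen[OF V f] gen_pt_split)
  qed
qed

end

subsection \<open>Existence of the divergence\<close>

lemma lie_der_finsum: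
  assumes V: "module R V" and B: "bilin_alg R B" and j: "j \<in> mod_hom R (Lie R V) B"
    and "finite I" "\<And>i. i \<in> I \<Longrightarrow> lie_der R V B j (d i)"
  shows "lie_der R V B j (\<lambda>x. \<Oplus>\<^bsub>B\<^esub>i\<in>I. d i x)"
proof -
  interpret B: abelian_group B by (rule mod_abelian) (use B in simp)
  show ?thesis using assms(4,5)
  proof (induction rule: finite_induct)
    case empty
    then show ?case by (simp add: lie_der_zero[OF B j])
  next
    case (insert i I)
    have c: "d k x \<in> carrier B" if "k \<in> insert i I" "x \<in> carrier (Lie R V)" for k x
      using hom_closed[OF lie_der_hom[OF insert.prems[OF that(1)]] that(2)] .
    show ?case
      by (rule lie_der_restrict_cong[OF lie_der_add[OF B j, of "d i" "\<lambda>x. \<Oplus>\<^bsub>B\<^esub>i\<in>I. d i x"] V])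
        (use insert c in \<open>auto intro!: B.finsum_insert\<close>)
  qed
qed

context
  fixes V :: "('a, 'v) module"
  assumes free: "free_fin_rank R V"
begin

lemma free_mod[simp]: "module R V"
  using free by (auto simp: free_fin_rank_def free_of_rank_def)

text \<open>Uniqueness holds because elementary derivations span. For existence, the sum of the Fox derivatives
  along a dual basis has the required values, since the Fox derivative along \<open>f\<close> is the
  combination, with coefficients \<open>f(e\<^sub>i)\<close>, of those along the \<open>\<epsilon>\<^sub>i\<close>.\<close>

lemma Phi:
  shows Phi_hom: "Phi R V \<in> mod_hom R (Der R V) (Der R (pt_mod R V))"
    and Phi_elem: "f \<in> mod_hom R V (self_mod R) \<Longrightarrow> x \<in> carrier (Lie R V) \<Longrightarrow>
      Phi R V (elem_der R V f x) = pt_der R V (fox R V f x)"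
proof -
  note V[simp] = free_mod
  obtain n where n: "free_of_rank R V n" using free by (auto simp: free_fin_rank_def)
  obtain e \<epsilon> where "dual_basis V n e \<epsilon>" using free_basis[OF n] by blast
  then have e: "\<And>i. i < n \<Longrightarrow> e i \<in> carrier V" and \<epsilon>: "\<And>i. i < n \<Longrightarrow> \<epsilon> i \<in> mod_hom R V (self_mod R)"
    and exp: "\<And>v. v \<in> carrier V \<Longrightarrow> v = (\<Oplus>\<^bsub>V\<^esub>i\<in>{..<n}. \<epsilon> i v \<odot>\<^bsub>V\<^esub> e i)"
    unfolding dual_basis_def by blast+
  interpret L: abelian_group "LP R V" by (rule mod_abelian) simp
  define \<psi> where "\<psi> d = (\<Oplus>\<^bsub>LP R V\<^esub>i\<in>{..<n}. fox R V (\<epsilon> i) (d (gen R V (e i))))" for d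
  have \<psi>: "\<psi> \<in> mod_hom R (Der R V) (LP R V)"
    unfolding \<psi>_def
    using e \<epsilon> by (intro hom_finsum_map hom_comp[OF der_eval_hom fox_hom]) auto
  have fox_exp: "(\<Oplus>\<^bsub>LP R V\<^esub>i\<in>{..<n}. f (e i) \<odot>\<^bsub>LP R V\<^esub> fox R V (\<epsilon> i) x) = fox R V f x"
    if f: "f \<in> mod_hom R V (self_mod R)" and x: "x \<in> carrier (Lie R V)" for f x
  proof (rule lie_der_unique[OF V LP_bilin[OF V] pt_incl_lin[OF V] _ fox_der[OF V f] _ x])
    have fe: "f (e i) \<in> carrier R" if "i < n" for i using hom_closed[OF f e[OF that]] by simp
    show "lie_der R V (LP R V) (pt_incl R V) (\<lambda>x. \<Oplus>\<^bsub>LP R V\<^esub>i\<in>{..<n}. f (e i) \<odot>\<^bsub>LP R V\<^esub> fox R V (\<epsilon> i) x)"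
      using fe \<epsilon> by (intro lie_der_finsum[OF V LP_bilin[OF V] pt_incl_lin[OF V]] lie_der_smult[OF LP_bilin[OF V] pt_incl_lin[OF V] fox_der]) auto
    fix v assume v: "v \<in> carrier V"
    have \<epsilon>v: "\<epsilon> i v \<in> carrier R" if "i < n" for i using hom_closed[OF \<epsilon>[OF that] v] by simp
    note fh = hom_comp[OF f hom_form_smult[OF LP_module[OF V] hom_id pt_one_closed[OF V]]]
    have "fox R V f (gen R V v) = f (\<Oplus>\<^bsub>V\<^esub>i\<in>{..<n}. \<epsilon> i v \<odot>\<^bsub>V\<^esub> e i) \<odot>\<^bsub>LP R V\<^esub> pt_one R V"
      using exp[OF v] v by (simp add: fox_gen[OF V f])
    also have "\<dots> = (\<Oplus>\<^bsub>LP R V\<^esub>i\<in>{..<n}. f (\<epsilon> i v \<odot>\<^bsub>V\<^esub> e i) \<odot>\<^bsub>LP R V\<^esub> pt_one R V)"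
      using e \<epsilon>v by (intro hom_finsum[OF V _ fh]) auto
    also have "\<dots> = (\<Oplus>\<^bsub>LP R V\<^esub>i\<in>{..<n}. f (e i) \<odot>\<^bsub>LP R V\<^esub> fox R V (\<epsilon> i) (gen R V v))"
      using e \<epsilon>v fe v \<epsilon> by (intro L.finsum_cong')
        (auto simp: hom_smult[OF f] fox_gen mod_mult_smult mod_smult_comm)
    finally show "(\<Oplus>\<^bsub>LP R V\<^esub>i\<in>{..<n}. f (e i) \<odot>\<^bsub>LP R V\<^esub> fox R V (\<epsilon> i) (gen R V v)) = fox R V f (gen R V v)"
      by simp
  qed
  have \<psi>_elem: "\<psi> (elem_der R V f x) = fox R V f x"
    if f: "f \<in> mod_hom R V (self_mod R)" and x: "x \<in> carrier (Lie R V)" for f x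
  proof -
    have fe: "f (e i) \<in> carrier R" if "i < n" for i using hom_closed[OF f e[OF that]] by simp
    have "\<psi> (elem_der R V f x) = (\<Oplus>\<^bsub>LP R V\<^esub>i\<in>{..<n}. f (e i) \<odot>\<^bsub>LP R V\<^esub> fox R V (\<epsilon> i) x)"
      unfolding \<psi>_def using f x e \<epsilon> fe by (intro L.finsum_cong') (auto simp: elem_der_gen hom_smult[OF fox_hom])
    then show ?thesis using fox_exp[OF f x] by simp
  qed
  let ?D = "Der R V" and ?P = "Der R (pt_mod R V)"
  let ?\<Phi> = "restrict (\<lambda>d. pt_der R V (\<psi> d)) (carrier ?D)"
  have h: "?\<Phi> \<in> mod_hom R ?D ?P"
    by (rule hom_restrict[OF Der_module[OF V] hom_comp[OF \<psi> pt_der_hom[OF V]]])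
  have el: "?\<Phi> (elem_der R V f x) = pt_der R V (fox R V f x)"
    if "f \<in> mod_hom R V (self_mod R)" "x \<in> carrier (Lie R V)" for f x
    using that by (simp add: \<psi>_elem)
  have "Phi R V = ?\<Phi>"
    unfolding Phi_def
  proof (rule the_equality)
    show "?\<Phi> \<in> mod_hom R ?D ?P \<inter> extensional (carrier ?D) \<and>
       (\<forall>x\<in>carrier (Lie R V). \<forall>f\<in>mod_hom R V (self_mod R).
          ?\<Phi> (der_ext R V (\<lambda>v. f v \<odot>\<^bsub>Lie R V\<^esub> x)) =
          pt_der R V (lie_map R (dsum V V) (pt_mod R V) (map_prod f id) (lie_delta R V x)))"
      unfolding elem_der_def[symmetric] using h el by (auto simp: lie_map_delta[OF V])
    fix \<Phi>' assume \<Phi>': "\<Phi>' \<in> mod_hom R ?D ?P \<inter> extensional (carrier ?D) \<and>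
       (\<forall>x\<in>carrier (Lie R V). \<forall>f\<in>mod_hom R V (self_mod R).
          \<Phi>' (der_ext R V (\<lambda>v. f v \<odot>\<^bsub>Lie R V\<^esub> x)) =
          pt_der R V (lie_map R (dsum V V) (pt_mod R V) (map_prod f id) (lie_delta R V x)))"
    show "\<Phi>' = ?\<Phi>"
    proof (rule extensionalityI[of _ "carrier ?D"])
      fix d assume d: "d \<in> carrier ?D"
      have "d \<in> {d \<in> carrier ?D. \<Phi>' d = ?\<Phi> d}"
      proof (rule Der_span_induct[OF free _ _ subset_refl])
        show "submodule {d \<in> carrier ?D. \<Phi>' d = ?\<Phi> d} R ?D"
          using \<Phi>' by (intro sub_equalizer[OF _ _ _ h]) auto
        fix f x assume fx: "f \<in> mod_hom R V (self_mod R)" "x \<in> carrier (Lie R V)"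
        then have "\<Phi>' (elem_der R V f x) = ?\<Phi> (elem_der R V f x)"
          unfolding el[OF fx] using \<Phi>' by (simp add: elem_der_def lie_map_delta[OF V])
        then show "elem_der R V f x \<in> {d \<in> carrier ?D. \<Phi>' d = ?\<Phi> d}" using fx by simp
      qed (use d in auto)
      then show "\<Phi>' d = ?\<Phi> d" by simp
    qed (use \<Phi>' in auto)
  qed
  then show "Phi R V \<in> mod_hom R ?D ?P"
    "f \<in> mod_hom R V (self_mod R) \<Longrightarrow> x \<in> carrier (Lie R V) \<Longrightarrow>
      Phi R V (elem_der R V f x) = pt_der R V (fox R V f x)"
    using h el by auto
qed

lemma div_lin_hom: "div_lin R V \<in> mod_hom R (Der R V) (LP R V)"
  unfolding div_lin_def
  using hom_comp[OF Phi_hom der_eval_hom[OF P_module[OF free_mod] pt_one_closed[OF free_mod]]] .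

lemmas div_lin_closed[simp] = hom_closed[OF div_lin_hom, simplified]

lemma div_lin_elem: "f \<in> mod_hom R V (self_mod R) \<Longrightarrow> x \<in> carrier (Lie R V) \<Longrightarrow> div_lin R V (elem_der R V f x) = fox R V f x"
  by (simp add: div_lin_def Phi_elem)

lemma Phi_div_lin:
  assumes d: "d \<in> derivations R V"
  shows "Phi R V d = pt_der R V (div_lin R V d)"
proof -
  have "d \<in> {d \<in> carrier (Der R V). Phi R V d = pt_der R V (div_lin R V d)}"
  proof (rule Der_span_induct[OF free _ _ subset_refl d])
    show "submodule {d \<in> carrier (Der R V). Phi R V d = pt_der R V (div_lin R V d)} R (Der R V)"
      by (intro sub_equalizer[OF _ _ Phi_hom hom_comp[OF div_lin_hom pt_der_hom]]) auto
  qed (use d in \<open>auto simp: Phi_elem div_lin_elem\<close>)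
  then show ?thesis by simp
qed

end

end

section \<open>The divergence of the algebra generated in degree one\<close>

definition part_ders :: "('a, 'r) ring_scheme \<Rightarrow> ('a, 'v, 'm) module_scheme \<Rightarrow> nat set \<Rightarrow> ('a, 'v) der set"
  where "part_ders R V S = {d \<in> derivations R V. \<forall>v\<in>carrier V. d (gen R V v) \<in> lie_part R V S}"

text \<open>Commutators plus the degree one elements \<open>[v,1]\<close>.\<close>

definition lin_low :: "('a, 'r) ring_scheme \<Rightarrow> ('a, 'v, 'm) module_scheme \<Rightarrow> (('a \<times> 'v) tree \<Rightarrow> 'a) set set"
  where "lin_low R V = {k \<oplus>\<^bsub>LP R V\<^esub> y | k y. k \<in> lin_comm R V \<and>
    y \<in> (\<lambda>v. pt_gen R V v \<otimes>\<^bsub>LP R V\<^esub> pt_one R V) ` carrier V}"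

text \<open>The class of the pointed derivation given by \<open>z\<close> modulo commutators.\<close>

definition der_class :: "('a, 'r) ring_scheme \<Rightarrow> ('a, 'v, 'm) module_scheme \<Rightarrow>
    (('a \<times> 'v) tree \<Rightarrow> 'a) set \<Rightarrow> ('a, 'a \<times> 'v) der set"
  where "der_class R V z = comm_span R (Der_pt_pos R V) +>\<^bsub>Der_pt_pos R V\<^esub> pt_der R V z"

context cring
begin

context
  fixes V :: "('a, 'v) module"
  assumes V[simp]: "module R V"
begin

lemma part_dersI: "d \<in> derivations R V \<Longrightarrow> (\<And>v. v \<in> carrier V \<Longrightarrow> d (gen R V v) \<in> lie_part R V S) \<Longrightarrow> d \<in> part_ders R V S"
  and part_ders_gen: "d \<in> part_ders R V S \<Longrightarrow> v \<in> carrier V \<Longrightarrow> d (gen R V v) \<in> lie_part R V S"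
  and part_ders_der[simp]: "d \<in> part_ders R V S \<Longrightarrow> d \<in> derivations R V"
  by (simp_all add: part_ders_def)

lemma part_ders_sub: "submodule (part_ders R V S) R (Der R V)"
proof (rule subI)
  show "part_ders R V S \<subseteq> carrier (Der R V)" by (rule subsetI) simp
  show "\<zero>\<^bsub>Der R V\<^esub> \<in> part_ders R V S"
    by (rule part_dersI) (simp_all add: Der_zero_closed Der_apply sub_zero[OF _ lie_part_sub])
  show "d \<oplus>\<^bsub>Der R V\<^esub> e \<in> part_ders R V S" if "d \<in> part_ders R V S" "e \<in> part_ders R V S" for d e
    using that by (intro part_dersI) (simp_all add: Der_add_closed Der_apply part_ders_gen sub_add[OF _ lie_part_sub])
  show "a \<odot>\<^bsub>Der R V\<^esub> d \<in> part_ders R V S" if "a \<in> carrier R" "d \<in> part_ders R V S" for a d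
    using that by (intro part_dersI) (simp_all add: Der_smult_closed Der_apply part_ders_gen sub_smult[OF _ lie_part_sub])
qed simp

lemma Der_pos_eq: "Der_pos R V = (Der R V)\<lparr>carrier := part_ders R V {2..}\<rparr>"
  by (simp add: Der_pos_def part_ders_def del: part_ders_der)

lemma der_deg_one_eq: "der_deg_one R V = part_ders R V {2}"
  by (simp add: der_deg_one_def part_ders_def del: part_ders_der)

lemma Der_pos_carrier[simp]: "carrier (Der_pos R V) = part_ders R V {2..}"
  by (simp add: Der_pos_eq)

lemma Der_pos_module[simp]: "module R (Der_pos R V)"
  unfolding Der_pos_eq by (rule submodule.submodule_is_module[OF part_ders_sub]) simp

lemma der_pos_apply: "d \<in> derivations R V \<Longrightarrow> x \<in> lie_part R V {2..} \<Longrightarrow> d x \<in> lie_part R V {2..}"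
  by (rule der_pos_stable[OF V V hom_id derivations_lie_der])

lemma bracket_pos:
  "d \<in> part_ders R V {2..} \<Longrightarrow> e \<in> part_ders R V {2..} \<Longrightarrow> der_bracket R V d e \<in> part_ders R V {2..}"
  by (rule part_dersI)
    (simp_all add: der_bracket_apply der_pos_apply part_ders_gen sub_diff[OF _ lie_part_sub])

lemma Der1_sub: "submodule (Der1 R V) R (Der R V)"
proof -
  have "submodule (carrier (Der R V)) R (Der R V)" by (rule sub_whole) simp
  then show ?thesis
    unfolding Der1_def by (intro sub_Inter) (auto simp: der_deg_one_eq intro!: exI[of _ "derivations R V"])
qed

lemma Der1_bracket: "d \<in> Der1 R V \<Longrightarrow> e \<in> Der1 R V \<Longrightarrow> der_bracket R V d e \<in> Der1 R V"
  unfolding Der1_def by blast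

lemma Der1_deg_one: "d \<in> part_ders R V {2} \<Longrightarrow> d \<in> Der1 R V"
  unfolding Der1_def der_deg_one_eq by blast

lemma Der1_le:
  assumes "submodule H R (Der R V)" "\<And>d e. d \<in> H \<Longrightarrow> e \<in> H \<Longrightarrow> der_bracket R V d e \<in> H"
    "\<And>d. d \<in> part_ders R V {2} \<Longrightarrow> d \<in> H" "d \<in> Der1 R V"
  shows "d \<in> H"
  using assms unfolding Der1_def der_deg_one_eq by blast

lemma deg_one_pos: "d \<in> part_ders R V {2} \<Longrightarrow> d \<in> part_ders R V {2..}"
  by (rule part_dersI) (simp_all add: part_ders_gen lie_two_subset)

lemma Der1_pos: "d \<in> Der1 R V \<Longrightarrow> d \<in> part_ders R V {2..}"
  by (rule Der1_le[OF part_ders_sub bracket_pos deg_one_pos])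

lemma Der1_sub_pos: "submodule (Der1 R V) R (Der_pos R V)"
  using Der1_sub Der1_pos by (auto simp: Der_pos_eq sub_in_sub[OF _ part_ders_sub])

lemma bracket_hom1: "e \<in> derivations R V \<Longrightarrow> (\<lambda>d. der_bracket R V d e) \<in> mod_hom R (Der R V) (Der R V)"
  and bracket_hom2: "e \<in> derivations R V \<Longrightarrow> (\<lambda>d. der_bracket R V e d) \<in> mod_hom R (Der R V) (Der R V)"
  unfolding der_bracket_def by (intro hom_diff_map bil_hom1 bil_hom2; simp)+

lemma lin_gen_hom: "(\<lambda>v. pt_gen R V v \<otimes>\<^bsub>LP R V\<^esub> pt_one R V) \<in> mod_hom R V (LP R V)"
  by (rule hom_comp[OF pt_gen_hom bil_hom2]) auto

lemma lin_low_sub: "submodule (lin_low R V) R (LP R V)"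
  unfolding lin_low_def
  by (intro sub_plus[OF _ lin_comm_sub] sub_image[OF _ _ lin_gen_hom sub_whole]) auto

lemma lin_low_comm: "k \<in> lin_comm R V \<Longrightarrow> k \<in> lin_low R V"
proof -
  assume k: "k \<in> lin_comm R V"
  have "\<zero>\<^bsub>LP R V\<^esub> \<in> (\<lambda>v. pt_gen R V v \<otimes>\<^bsub>LP R V\<^esub> pt_one R V) ` carrier V"
    by (rule sub_zero[OF _ sub_image[OF V _ lin_gen_hom sub_whole]]) auto
  then have "k \<oplus>\<^bsub>LP R V\<^esub> \<zero>\<^bsub>LP R V\<^esub> \<in> lin_low R V" using k unfolding lin_low_def by blast
  then show ?thesis using lin_comm_subset[OF V k] by simp
qed

lemma lin_low_gen: "v \<in> carrier V \<Longrightarrow> pt_gen R V v \<otimes>\<^bsub>LP R V\<^esub> pt_one R V \<in> lin_low R V"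
proof -
  assume v: "v \<in> carrier V"
  have "\<zero>\<^bsub>LP R V\<^esub> \<in> lin_comm R V" by (rule sub_zero[OF _ lin_comm_sub[OF V]]) simp
  then have "\<zero>\<^bsub>LP R V\<^esub> \<oplus>\<^bsub>LP R V\<^esub> pt_gen R V v \<otimes>\<^bsub>LP R V\<^esub> pt_one R V \<in> lin_low R V"
    using v unfolding lin_low_def by blast
  then show ?thesis using v by simp
qed

text \<open>The lift preserves commutators and sends \<open>[v,1]\<close> to \<open>[e(v),1]\<close>, a commutator as \<open>e\<close> is positive.\<close>

lemma pt_lift_low:
  assumes e: "e \<in> part_ders R V {2..}" and z: "z \<in> lin_low R V"
  shows "pt_lift R V e z \<in> lin_comm R V"
proof -
  obtain k v where kv: "k \<in> lin_comm R V" "v \<in> carrier V"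
    "z = k \<oplus>\<^bsub>LP R V\<^esub> pt_gen R V v \<otimes>\<^bsub>LP R V\<^esub> pt_one R V"
    using z unfolding lin_low_def by blast
  have ed: "e \<in> derivations R V" and ev: "e (gen R V v) \<in> lie_part R V {2..}"
    using e kv by (simp_all add: part_ders_gen)
  have kc: "k \<in> carrier (LP R V)" using lin_comm_subset[OF V kv(1)] by simp
  have "pt_lift R V e z = pt_lift R V e k \<oplus>\<^bsub>LP R V\<^esub> pt_incl R V (e (gen R V v)) \<otimes>\<^bsub>LP R V\<^esub> pt_one R V"
    using kv kc ed ev by (simp add: hom_add[OF derivations_hom[OF pt_lift_der]] derivations_mult[OF pt_lift_der])
  then show ?thesis
    using pt_lift_lin_comm[OF V ed kv(1)] incl_pos_comm[OF V ev] sub_add[OF _ lin_comm_sub[OF V]] by simp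
qed

lemma fox_two:
  assumes f: "f \<in> mod_hom R V (self_mod R)" and u: "u \<in> carrier V" and w: "w \<in> carrier V"
  shows "fox R V f (gen R V u \<otimes>\<^bsub>Lie R V\<^esub> gen R V w) =
    pt_gen R V (f w \<odot>\<^bsub>V\<^esub> u \<ominus>\<^bsub>V\<^esub> f u \<odot>\<^bsub>V\<^esub> w) \<otimes>\<^bsub>LP R V\<^esub> pt_one R V"
proof -
  have c: "f u \<in> carrier R" "f w \<in> carrier R" using hom_closed[OF f] u w by auto
  have "pt_one R V \<otimes>\<^bsub>LP R V\<^esub> pt_gen R V w = \<ominus>\<^bsub>LP R V\<^esub> (pt_gen R V w \<otimes>\<^bsub>LP R V\<^esub> pt_one R V)"
    by (rule lie_antisym) (use w in auto)
  then show ?thesis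
    using c u w f
    by (simp add: fox_mult fox_gen bil_simps bil_ldiff hom_diff[OF _ _ pt_gen_hom] hom_smult[OF pt_gen_hom] mod_smult_neg)
      (simp add: mod_ac)
qed

subsection \<open>Classes of pointed derivations\<close>

lemma comm_span_sub: "submodule (comm_span R (Der_pt_pos R V)) R (Der_pt_pos R V)"
proof -
  have "submodule (pt_der R V ` lin_comm R V) R (Der R (pt_mod R V))"
    by (rule sub_image[OF _ _ pt_der_hom lin_comm_sub]) auto
  moreover have "pt_der R V ` lin_comm R V \<subseteq> pt_der R V ` lin_pos R V" using lin_comm_subset[OF V] by blast
  ultimately show ?thesis
    by (subst Der_pt_pos_eq[OF V], subst comm_span_Der_pt_pos[OF V]) (simp add: sub_in_sub[OF _ lin_pos_image_sub])
qed

lemma abel_module[simp]: "module R (abel R (Der_pt_pos R V))"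
  unfolding abel_def by (rule module_quot[OF Der_pt_pos_module[OF V] comm_span_sub])

lemma pt_der_inj: "z \<in> carrier (LP R V) \<Longrightarrow> z' \<in> carrier (LP R V) \<Longrightarrow> pt_der R V z = pt_der R V z' \<longleftrightarrow> z = z'"
  using pt_der_one[OF V, of z] pt_der_one[OF V, of z'] by metis

lemma pt_der_pos_hom: "pt_der R V \<in> mod_hom R ((LP R V)\<lparr>carrier := lin_pos R V\<rparr>) (Der_pt_pos R V)"
  using pt_der_hom[OF V] lin_pos_closed[OF V] unfolding Der_pt_pos_eq[OF V] by (auto simp: mod_hom_def)

lemma der_class_hom: "der_class R V \<in> mod_hom R ((LP R V)\<lparr>carrier := lin_pos R V\<rparr>) (abel R (Der_pt_pos R V))"
  unfolding abel_def der_class_def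
  using hom_comp[OF pt_der_pos_hom proj_hom[OF Der_pt_pos_module[OF V] comm_span_sub]] .

lemma der_class_eq_iff:
  assumes z: "z \<in> lin_pos R V" and z': "z' \<in> lin_pos R V"
  shows "der_class R V z = der_class R V z' \<longleftrightarrow> z \<ominus>\<^bsub>LP R V\<^esub> z' \<in> lin_comm R V"
proof -
  have m: "pt_der R V z \<in> carrier (Der_pt_pos R V)" "pt_der R V z' \<in> carrier (Der_pt_pos R V)"
    using z z' by (auto simp: Der_pt_pos_carrier)
  have "pt_der R V z \<ominus>\<^bsub>Der_pt_pos R V\<^esub> pt_der R V z' = pt_der R V (z \<ominus>\<^bsub>LP R V\<^esub> z')"
    using z z' sub_diff_eq[OF _ lin_pos_image_sub[OF V], of "pt_der R V z" "pt_der R V z'"]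
    by (simp add: Der_pt_pos_eq hom_diff[OF _ _ pt_der_hom])
  then show ?thesis
    unfolding der_class_def coset_eq_iff[OF Der_pt_pos_module[OF V] comm_span_sub m]
    using z z' lin_comm_subset[OF V] by (auto simp: comm_span_Der_pt_pos pt_der_inj)
qed

end

subsection \<open>The divergence as a homomorphism\<close>

context
  fixes V :: "('a, 'v) module"
  assumes free: "free_fin_rank R V"
begin

lemmas [simp] = free_mod[OF free]

lemma div_lin_lin_pos:
  assumes d: "d \<in> part_ders R V {2..}"
  shows "div_lin R V d \<in> lin_pos R V"
proof -
  have "d \<in> {d \<in> carrier (Der R V). div_lin R V d \<in> lin_pos R V}"
  proof (rule Der_span_induct[OF free])
    show "submodule {d \<in> carrier (Der R V). div_lin R V d \<in> lin_pos R V} R (Der R V)"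
      by (rule sub_vimage[OF _ _ div_lin_hom[OF free] lin_pos_sub]) auto
    show "lie_part R V {2..} \<subseteq> carrier (Lie R V)" by auto
    show "elem_der R V f x \<in> {d \<in> carrier (Der R V). div_lin R V d \<in> lin_pos R V}"
      if "f \<in> mod_hom R V (self_mod R)" "x \<in> lie_part R V {2..}" for f x
      using that by (simp add: div_lin_elem[OF free] fox_pos)
  qed (use d in \<open>simp_all add: part_ders_gen\<close>)
  then show ?thesis by simp
qed

lemma Div_der_class: "d \<in> part_ders R V {2..} \<Longrightarrow> Div R V d = der_class R V (div_lin R V d)"
  by (simp add: Div_def der_class_def Phi_div_lin[OF free])

lemma Div_hom: "Div R V \<in> mod_hom R (Der_pos R V) (abel R (Der_pt_pos R V))"
proof -
  have "div_lin R V \<in> mod_hom R (Der_pos R V) ((LP R V)\<lparr>carrier := lin_pos R V\<rparr>)"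
    using div_lin_hom[OF free] div_lin_lin_pos by (auto simp: mod_hom_def Der_pos_eq)
  from hom_comp[OF this der_class_hom[OF free_mod[OF free]]] show ?thesis
    by (rule hom_cong) (auto simp: Div_der_class)
qed

lemma Im_Div_sub: "submodule (Im_Div R V) R (abel R (Der_pt_pos R V))"
  unfolding Im_Div_def by (rule sub_image[OF _ _ Div_hom Der1_sub_pos]) auto

text \<open>Both sides are bilinear in \<open>d\<close> and \<open>e\<close>. For elementary derivations this is the difference of two instances
  of the product rule for the Fox derivative; the two remaining substitution terms form a commutator.\<close>

lemma div_lin_bracket:
  assumes d: "d \<in> part_ders R V {2..}" and e: "e \<in> part_ders R V {2..}"
  shows "div_lin R V (der_bracket R V d e) \<ominus>\<^bsub>LP R V\<^esub>
    (pt_lift R V e (div_lin R V d) \<ominus>\<^bsub>LP R V\<^esub> pt_lift R V d (div_lin R V e)) \<in> lin_comm R V"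
proof -
  let ?D = "\<lambda>d e. div_lin R V (der_bracket R V d e) \<ominus>\<^bsub>LP R V\<^esub>
    (pt_lift R V e (div_lin R V d) \<ominus>\<^bsub>LP R V\<^esub> pt_lift R V d (div_lin R V e))"
  note ph = div_lin_hom[OF free]
  have h1: "(\<lambda>d. ?D d e) \<in> mod_hom R (Der R V) (LP R V)" if "e \<in> derivations R V" for e
    using that div_lin_closed[OF free]
    by (intro hom_diff_map hom_comp[OF bracket_hom1 ph] hom_comp[OF ph derivations_hom[OF pt_lift_der]] pt_lift_hom) auto
  have h2: "(\<lambda>e. ?D d e) \<in> mod_hom R (Der R V) (LP R V)" if "d \<in> derivations R V" for d
    using that div_lin_closed[OF free]
    by (intro hom_diff_map hom_comp[OF bracket_hom2 ph] hom_comp[OF ph derivations_hom[OF pt_lift_der]] pt_lift_hom) auto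
  have lp: "lie_part R V {2..} \<subseteq> carrier (Lie R V)" by auto
  have 0: "?D (elem_der R V f x) (elem_der R V g y) \<in> lin_comm R V"
    if f: "f \<in> mod_hom R V (self_mod R)" and g: "g \<in> mod_hom R V (self_mod R)"
      and x: "x \<in> lie_part R V {2..}" and y: "y \<in> lie_part R V {2..}" for f g x y
  proof -
    let ?d = "elem_der R V f x" and ?e = "elem_der R V g y"
    note D = elem_der_der[OF free_mod[OF free] f lie_part_closed[OF free_mod[OF free] x]] and E = elem_der_der[OF free_mod[OF free] g lie_part_closed[OF free_mod[OF free] y]]
    have ex: "?e x \<in> carrier (Lie R V)" and dy: "?d y \<in> carrier (Lie R V)" using D E x y by auto
    have 1: "?d \<otimes>\<^bsub>Der R V\<^esub> ?e = elem_der R V f (?e x)"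
      using D E f g x y ex hom_closed[OF f]
      by (intro der_eqI[OF free_mod[OF free]]) (simp_all add: Der_mult_apply elem_der_gen hom_smult[OF derivations_hom[OF E]])
    have 2: "?e \<otimes>\<^bsub>Der R V\<^esub> ?d = elem_der R V g (?d y)"
      using D E f g x y dy hom_closed[OF g]
      by (intro der_eqI[OF free_mod[OF free]]) (simp_all add: Der_mult_apply elem_der_gen hom_smult[OF derivations_hom[OF D]])
    have fp: "fox R V f y \<in> lin_pos R V" "fox R V g x \<in> lin_pos R V" using f g x y by (auto intro!: fox_pos)
    note c = lin_pos_closed[OF free_mod[OF free] fp(1)] lin_pos_closed[OF free_mod[OF free] fp(2)] fox_closed[OF free_mod[OF free] f lie_part_closed[OF free_mod[OF free] x]]
      fox_closed[OF free_mod[OF free] g lie_part_closed[OF free_mod[OF free] y]]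
    have "div_lin R V (der_bracket R V ?d ?e) = fox R V f (?e x) \<ominus>\<^bsub>LP R V\<^esub> fox R V g (?d y)"
      unfolding der_bracket_def 1 2 using f g ex dy by (simp add: hom_diff[OF _ _ ph] div_lin_elem[OF free])
    also have "\<dots> = (pt_lift R V ?e (fox R V f x) \<oplus>\<^bsub>LP R V\<^esub> pt_der R V (fox R V f y) (fox R V g x)) \<ominus>\<^bsub>LP R V\<^esub>
        (pt_lift R V ?d (fox R V g y) \<oplus>\<^bsub>LP R V\<^esub> pt_der R V (fox R V g x) (fox R V f y))"
      using fox_elem_der[OF free_mod[OF free] f g, of x y] fox_elem_der[OF free_mod[OF free] g f, of y x] x y by simp
    finally have "?D ?d ?e = pt_der R V (fox R V f y) (fox R V g x) \<ominus>\<^bsub>LP R V\<^esub> pt_der R V (fox R V g x) (fox R V f y)"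
      using c f g x y D E by (simp add: div_lin_elem[OF free] mod_ac)
    then show ?thesis using lin_comm_incl[OF free_mod[OF free] fp(2) fp(1)] by simp
  qed
  have 1: "e \<in> {e \<in> carrier (Der R V). ?D (elem_der R V f x) e \<in> lin_comm R V}"
    if f: "f \<in> mod_hom R V (self_mod R)" and x: "x \<in> lie_part R V {2..}" for f x
  proof (rule Der_span_induct[OF free _ _ lp])
    show "submodule {e \<in> carrier (Der R V). ?D (elem_der R V f x) e \<in> lin_comm R V} R (Der R V)"
      using f x by (intro sub_vimage[OF _ _ h2 lin_comm_sub]) auto
    show "elem_der R V g y \<in> {e \<in> carrier (Der R V). ?D (elem_der R V f x) e \<in> lin_comm R V}"
      if "g \<in> mod_hom R V (self_mod R)" "y \<in> lie_part R V {2..}" for g y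
      using that 0[OF f that(1) x that(2)] by simp
  qed (use e in \<open>simp_all add: part_ders_gen\<close>)
  have "d \<in> {d \<in> carrier (Der R V). ?D d e \<in> lin_comm R V}"
  proof (rule Der_span_induct[OF free _ _ lp])
    show "submodule {d \<in> carrier (Der R V). ?D d e \<in> lin_comm R V} R (Der R V)"
      using e by (intro sub_vimage[OF _ _ h1 lin_comm_sub]) auto
    show "elem_der R V f x \<in> {d \<in> carrier (Der R V). ?D d e \<in> lin_comm R V}"
      if "f \<in> mod_hom R V (self_mod R)" "x \<in> lie_part R V {2..}" for f x
      using that 1[OF that] by simp
  qed (use d in \<open>simp_all add: part_ders_gen\<close>)
  then show ?thesis by simp
qed

lemma div_lin_deg_one:
  assumes d: "d \<in> part_ders R V {2}"
  shows "div_lin R V d \<in> lin_low R V"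
proof -
  have "d \<in> {d \<in> carrier (Der R V). div_lin R V d \<in> lin_low R V}"
  proof (rule Der_span_induct[OF free])
    show "submodule {d \<in> carrier (Der R V). div_lin R V d \<in> lin_low R V} R (Der R V)"
      by (rule sub_vimage[OF _ _ div_lin_hom[OF free] lin_low_sub]) auto
    show "lie_part R V {2} \<subseteq> carrier (Lie R V)" by auto
    fix f x assume f: "f \<in> mod_hom R V (self_mod R)" and x: "x \<in> lie_part R V {2}"
    have "x \<in> {x \<in> carrier (Lie R V). fox R V f x \<in> lin_low R V}"
    proof (rule lie_two_induct[OF free_mod[OF free] _ _ x])
      show "submodule {x \<in> carrier (Lie R V). fox R V f x \<in> lin_low R V} R (Lie R V)"
        by (rule sub_vimage[OF _ _ fox_hom[OF free_mod[OF free] f] lin_low_sub]) auto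
    qed (use f hom_closed[OF f] in \<open>auto simp: fox_two[OF free_mod[OF free]] intro!: lin_low_gen\<close>)
    then show "elem_der R V f x \<in> {d \<in> carrier (Der R V). div_lin R V d \<in> lin_low R V}"
      using f x by (simp add: div_lin_elem[OF free])
  qed (use d in \<open>simp_all add: part_ders_gen\<close>)
  then show ?thesis by simp
qed

text \<open>The positive derivations with this property are closed under the bracket: the divergence of a bracket
  is even a commutator.\<close>

lemma div_lin_Der1:
  assumes d: "d \<in> Der1 R V"
  shows "div_lin R V d \<in> lin_low R V"
proof -
  let ?H = "part_ders R V {2..} \<inter> {d \<in> carrier (Der R V). div_lin R V d \<in> lin_low R V}"
  have "d \<in> ?H"
  proof (rule Der1_le[OF free_mod[OF free] _ _ _ d])
    show "submodule ?H R (Der R V)"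
      by (rule sub_Int[OF _ part_ders_sub sub_vimage[OF _ _ div_lin_hom[OF free] lin_low_sub]]) auto
    show "d \<in> ?H" if "d \<in> part_ders R V {2}" for d
      using that div_lin_deg_one[OF that] Der1_pos[OF free_mod[OF free] Der1_deg_one[OF free_mod[OF free] that]] by simp
    fix d e assume de: "d \<in> ?H" "e \<in> ?H"
    then have p: "d \<in> part_ders R V {2..}" "e \<in> part_ders R V {2..}" by auto
    have l: "pt_lift R V e (div_lin R V d) \<in> lin_comm R V" "pt_lift R V d (div_lin R V e) \<in> lin_comm R V"
      using de pt_lift_low[OF free_mod[OF free]] by auto
    let ?r = "pt_lift R V e (div_lin R V d) \<ominus>\<^bsub>LP R V\<^esub> pt_lift R V d (div_lin R V e)"
    have r: "?r \<in> lin_comm R V" using l by (intro sub_diff[OF _ lin_comm_sub]) auto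
    then have rc: "?r \<in> carrier (LP R V)" using lin_comm_subset[OF free_mod[OF free] r] by simp
    have "(div_lin R V (der_bracket R V d e) \<ominus>\<^bsub>LP R V\<^esub> ?r) \<oplus>\<^bsub>LP R V\<^esub> ?r \<in> lin_comm R V"
      using div_lin_bracket[OF p] r by (intro sub_add[OF _ lin_comm_sub]) auto
    moreover have "(div_lin R V (der_bracket R V d e) \<ominus>\<^bsub>LP R V\<^esub> ?r) \<oplus>\<^bsub>LP R V\<^esub> ?r = div_lin R V (der_bracket R V d e)"
    proof -
      have "a \<ominus>\<^bsub>LP R V\<^esub> b \<oplus>\<^bsub>LP R V\<^esub> b = a" if "a \<in> carrier (LP R V)" "b \<in> carrier (LP R V)" for a b
        using that by (simp add: mod_ac)
      then show ?thesis using rc p div_lin_closed[OF free] by simp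
    qed
    ultimately show "der_bracket R V d e \<in> ?H" using bracket_pos[OF free_mod[OF free] p] lin_low_comm[OF free_mod[OF free]] by simp
  qed
  then show ?thesis by simp
qed

lemma Div_bar_coset:
  assumes "d \<in> part_ders R V {2..}"
  shows "Div_bar R V (Der1 R V +>\<^bsub>Der_pos R V\<^esub> d) = Im_Div R V +>\<^bsub>abel R (Der_pt_pos R V)\<^esub> Div R V d"
  unfolding Div_bar_def
  by (rule induced_coset[OF _ Der1_sub_pos _ Im_Div_sub Div_hom]) (use assms in \<open>auto simp: Im_Div_def\<close>)

lemma Div_bar_hom: "Div_bar R V \<in> mod_hom R (div_source R V) (div_target R V)"
  unfolding Div_bar_def div_source_def div_target_def
  by (rule induced_hom[OF _ Der1_sub_pos _ Im_Div_sub Div_hom]) (auto simp: Im_Div_def)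

end

section \<open>Naturality\<close>

lemma lie_map_class:
  assumes V: "module R V" and W: "module R W" and i: "i \<in> mod_hom R V W"
  shows "t \<in> trees_on V \<Longrightarrow> map_tree i t \<in> trees_on W \<and> leaves (map_tree i t) = leaves t \<and>
    lie_map R V W i (tree_class R V t) = tree_class R W (map_tree i t)"
proof (induction t)
  case (Leaf v)
  then show ?case using lie_map_gen[OF V W i, of v] hom_closed[OF i] by (simp add: gen_def)
next
  case (Node s t)
  then show ?case
    using V W by (auto simp: tree_class_Node tree_class_carrier lie_map_mult[OF V W i])
qed

lemma lie_map_part:
  fixes V :: "('a, 'v) module" and W :: "('a, 'w) module"
  assumes V: "module R V" and W: "module R W" and i: "i \<in> mod_hom R V W" and x: "x \<in> lie_part R V S"
  shows "lie_map R V W i x \<in> lie_part R W S"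
proof (rule span_hom_into[OF _ _ lie_map_lin[OF V W i] lie_part_sub[OF W] lie_part_carrier[OF V] _ x[unfolded lie_part_def]])
  fix y assume "y \<in> tree_class R V ` {t \<in> trees_on V. leaves t \<in> S}"
  then obtain t where t: "t \<in> trees_on V" "leaves t \<in> S" "y = tree_class R V t" by blast
  then show "lie_map R V W i y \<in> lie_part R W S"
    using lie_map_class[OF V W i t(1)] by (auto simp: lie_part_def intro!: span_incl)
qed (use V W in auto)

context
  fixes V :: "('a, 'v) module" and W :: "('a, 'w) module" and i r
  assumes V[simp]: "module R V" and W[simp]: "module R W" and mor: "(i, r) \<in> S_mor R V W"
begin

lemma mor_i: "i \<in> mod_hom R V W" and mor_r: "r \<in> mod_hom R W V" and mor_ri: "v \<in> carrier V \<Longrightarrow> r (i v) = v"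
  using mor by (auto simp: S_mor_def)

lemmas im_closed[simp] = lie_map_closed[OF V W mor_i]
lemmas im_gen[simp] = lie_map_gen[OF V W mor_i]
lemmas im_hom = lie_map_hom[OF V W mor_i]
lemmas im_lin = lie_map_lin[OF V W mor_i]
lemmas r_closed[simp] = hom_closed[OF mor_r]
lemmas i_closed[simp] = hom_closed[OF mor_i]

lemma Der_map:
  assumes d: "d \<in> derivations R V"
  shows Der_map_der[simp]: "Der_map R V W (i, r) d \<in> derivations R W"
    and Der_map_gen: "w \<in> carrier W \<Longrightarrow> Der_map R V W (i, r) d (gen R W w) = lie_map R V W i (d (gen R V (r w)))"
  using der_ext[OF W hom_comp[OF hom_comp[OF mor_r der_gen_hom[OF V d]] im_lin]] by (simp_all add: Der_map_def)

text \<open>Both sides are derivations over \<open>Lie(i)\<close>; they agree on generators because \<open>r \<circ> i = id\<close>. This is what makes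
  the functor compatible with the preLie product.\<close>

lemma Der_map_lie_map:
  assumes d: "d \<in> derivations R V" and x: "x \<in> carrier (Lie R V)"
  shows "Der_map R V W (i, r) d (lie_map R V W i x) = lie_map R V W i (d x)"
  by (rule lie_der_unique[OF V Lie_bilin[OF W] im_lin lie_der_pre[OF im_hom derivations_lie_der[OF Der_map_der[OF d]]]
        lie_der_post[OF Lie_bilin[OF V] hom_id derivations_lie_der[OF d] im_hom] _ x])
    (simp add: Der_map_gen[OF d] mor_ri)

lemma Der_map_hom: "Der_map R V W (i, r) \<in> mod_hom R (Der R V) (Der R W)"
  by (rule mod_homI)
    (auto intro!: der_eqI[OF W] simp: Der_add_closed Der_smult_closed Der_map_gen Der_apply hom_add[OF im_lin] hom_smult[OF im_lin])

lemma Der_map_mult: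
  "d \<in> derivations R V \<Longrightarrow> e \<in> derivations R V \<Longrightarrow>
    Der_map R V W (i, r) (d \<otimes>\<^bsub>Der R V\<^esub> e) = Der_map R V W (i, r) d \<otimes>\<^bsub>Der R W\<^esub> Der_map R V W (i, r) e"
  by (rule der_eqI[OF W]) (simp_all add: Der_map_gen Der_mult_apply Der_map_lie_map)

lemma Der_map_bracket:
  "d \<in> derivations R V \<Longrightarrow> e \<in> derivations R V \<Longrightarrow>
    Der_map R V W (i, r) (der_bracket R V d e) = der_bracket R W (Der_map R V W (i, r) d) (Der_map R V W (i, r) e)"
  by (simp add: der_bracket_def hom_diff[OF _ _ Der_map_hom] Der_map_mult)

lemma Der_map_part: "d \<in> part_ders R V S \<Longrightarrow> Der_map R V W (i, r) d \<in> part_ders R W S"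
  by (rule part_dersI[OF W]) (simp_all add: Der_map_gen part_ders_gen lie_map_part[OF V W mor_i])

lemma Der_map_Der1:
  assumes d: "d \<in> Der1 R V"
  shows "Der_map R V W (i, r) d \<in> Der1 R W"
proof -
  have "d \<in> {d \<in> carrier (Der R V). Der_map R V W (i, r) d \<in> Der1 R W}"
  proof (rule Der1_le[OF V _ _ _ d])
    show "submodule {d \<in> carrier (Der R V). Der_map R V W (i, r) d \<in> Der1 R W} R (Der R V)"
      by (rule sub_vimage[OF _ _ Der_map_hom Der1_sub]) auto
  qed (auto simp: Der_map_bracket Der1_bracket Der_map_part Der1_deg_one)
  then show ?thesis by simp
qed

lemma Der_map_pos_hom: "Der_map R V W (i, r) \<in> mod_hom R (Der_pos R V) (Der_pos R W)"
  using Der_map_hom Der_map_part by (auto simp: mod_hom_def Der_pos_eq)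

lemma Der_map_elem:
  assumes f: "f \<in> mod_hom R V (self_mod R)" and x: "x \<in> carrier (Lie R V)"
  shows "Der_map R V W (i, r) (elem_der R V f x) = elem_der R W (\<lambda>w. f (r w)) (lie_map R V W i x)"
proof (rule der_eqI[OF W])
  note fr = hom_comp[OF mor_r f]
  show "Der_map R V W (i, r) (elem_der R V f x) \<in> derivations R W" using f x by simp
  show "elem_der R W (\<lambda>w. f (r w)) (lie_map R V W i x) \<in> derivations R W" using fr x by simp
  fix w assume "w \<in> carrier W"
  then show "Der_map R V W (i, r) (elem_der R V f x) (gen R W w) = elem_der R W (\<lambda>w. f (r w)) (lie_map R V W i x) (gen R W w)"
    using f x fr hom_closed[OF f] by (simp add: Der_map_gen elem_der_gen hom_smult[OF im_lin])
qed

subsection \<open>The pointed part\<close>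

lemma pt_mor: "(map_prod id i, map_prod id r) \<in> S_mor R (pt_mod R V) (pt_mod R W)"
  using mor by (auto simp: S_mor_def mod_hom_def)

abbreviation "pt_map \<equiv> lie_map R (pt_mod R V) (pt_mod R W) (map_prod id i)"

lemma pt_mor_i: "map_prod id i \<in> mod_hom R (pt_mod R V) (pt_mod R W)"
  using pt_mor by (simp add: S_mor_def)

lemmas pt_map_closed[simp] = lie_map_closed[OF P_module[OF V] P_module[OF W] pt_mor_i]
lemmas pt_map_hom = lie_map_hom[OF P_module[OF V] P_module[OF W] pt_mor_i]
lemmas pt_map_lin = lie_map_lin[OF P_module[OF V] P_module[OF W] pt_mor_i]
lemmas pt_map_mult = lie_map_mult[OF P_module[OF V] P_module[OF W] pt_mor_i]

lemma pt_map_one[simp]: "pt_map (pt_one R V) = pt_one R W"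
  and pt_map_gen[simp]: "v \<in> carrier V \<Longrightarrow> pt_map (pt_gen R V v) = pt_gen R W (i v)"
  using lie_map_gen[OF P_module[OF V] P_module[OF W] pt_mor_i] hom_zero[OF V W mor_i]
  by (simp_all add: pt_one_def pt_gen_def)

lemma pt_map_incl: "x \<in> carrier (Lie R V) \<Longrightarrow> pt_map (pt_incl R V x) = pt_incl R W (lie_map R V W i x)"
  by (rule Lie_hom_unique[OF V LP_bilin[OF W] alg_hom_comp[OF pt_incl_hom[OF V] pt_map_hom] alg_hom_comp[OF im_hom pt_incl_hom[OF W]]]) auto

lemma Der_map_pt_der:
  assumes z: "z \<in> carrier (LP R V)"
  shows "Der_map R (pt_mod R V) (pt_mod R W) (map_prod id i, map_prod id r) (pt_der R V z) = pt_der R W (pt_map z)"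
proof -
  note D = cring.Der_map_der[OF is_cring P_module[OF V] P_module[OF W] pt_mor pt_der_der[OF V z]]
    and G = cring.Der_map_gen[OF is_cring P_module[OF V] P_module[OF W] pt_mor pt_der_der[OF V z]]
  show ?thesis
  proof (rule pt_derivation_eqI[OF W D])
    show "pt_der R W (pt_map z) \<in> derivations R (pt_mod R W)" using z by simp
    show "Der_map R (pt_mod R V) (pt_mod R W) (map_prod id i, map_prod id r) (pt_der R V z) (pt_one R W) =
        pt_der R W (pt_map z) (pt_one R W)"
      using G[of "(\<one>, \<zero>\<^bsub>W\<^esub>)"] z hom_zero[OF W V mor_r] by (simp add: pt_one_def[symmetric])
    show "Der_map R (pt_mod R V) (pt_mod R W) (map_prod id i, map_prod id r) (pt_der R V z) (pt_gen R W w) =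
        pt_der R W (pt_map z) (pt_gen R W w)" if "w \<in> carrier W" for w
      using G[of "(\<zero>, w)"] z that hom_zero[OF _ _ pt_map_lin] by (simp add: pt_gen_def[symmetric])
  qed
qed

lemma pt_map_pt_der:
  assumes y: "y \<in> carrier (LP R V)" and z: "z \<in> carrier (LP R V)"
  shows "pt_map (pt_der R V z y) = pt_der R W (pt_map z) (pt_map y)"
  using cring.Der_map_lie_map[OF is_cring P_module[OF V] P_module[OF W] pt_mor pt_der_der[OF V z] y] z
  by (simp add: Der_map_pt_der)

lemma pt_map_lie_lin:
  assumes z: "z \<in> lie_lin R V (self_mod R)"
  shows "pt_map z \<in> lie_lin R W (self_mod R)"
proof -
  have "z \<in> {z \<in> carrier (LP R V). pt_map z \<in> lie_lin R W (self_mod R)}"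
  proof (rule lie_lin_induct[OF V _ _ _ z])
    show "submodule {z \<in> carrier (LP R V). pt_map z \<in> lie_lin R W (self_mod R)} R (LP R V)"
      by (rule sub_vimage[OF _ _ pt_map_lin lie_lin_sub]) auto
  qed (auto simp: pt_map_mult)
  then show ?thesis by simp
qed

lemma pt_map_lin_pos: "z \<in> lin_pos R V \<Longrightarrow> pt_map z \<in> lin_pos R W"
  by (intro lin_posI[OF W] pt_map_lie_lin lie_map_part[OF P_module[OF V] P_module[OF W] pt_mor_i] lin_pos_pos[OF V]) auto

lemma pt_map_lin_comm:
  assumes z: "z \<in> lin_comm R V"
  shows "pt_map z \<in> lin_comm R W"
proof (rule span_hom_into[OF _ _ pt_map_lin lin_comm_sub[OF W] _ _ z[unfolded lin_comm_def]])
  fix x assume "x \<in> {pt_der R V z y \<ominus>\<^bsub>LP R V\<^esub> pt_der R V y z | y z. y \<in> lin_pos R V \<and> z \<in> lin_pos R V}"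
  then obtain y z where yz: "y \<in> lin_pos R V" "z \<in> lin_pos R V" "x = pt_der R V z y \<ominus>\<^bsub>LP R V\<^esub> pt_der R V y z" by blast
  then have "pt_map x = pt_der R W (pt_map z) (pt_map y) \<ominus>\<^bsub>LP R W\<^esub> pt_der R W (pt_map y) (pt_map z)"
    by (simp add: hom_diff[OF _ _ pt_map_lin] pt_map_pt_der)
  then show "pt_map x \<in> lin_comm R W" using lin_comm_incl[OF W pt_map_lin_pos pt_map_lin_pos] yz by simp
qed auto

lemma fox_natural:
  assumes f: "f \<in> mod_hom R V (self_mod R)" and x: "x \<in> carrier (Lie R V)"
  shows "fox R W (\<lambda>w. f (r w)) (lie_map R V W i x) = pt_map (fox R V f x)"
proof -
  note fr = hom_comp[OF mor_r f]
  have 1: "lie_der R V (LP R W) (\<lambda>x. pt_map (pt_incl R V x)) (\<lambda>x. pt_map (fox R V f x))"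
    by (rule lie_der_post[OF LP_bilin[OF V] pt_incl_lin[OF V] fox_der[OF V f] pt_map_hom])
  have 2: "lie_der R V (LP R W) (\<lambda>x. pt_map (pt_incl R V x)) (\<lambda>x. fox R W (\<lambda>w. f (r w)) (lie_map R V W i x))"
    by (rule lie_der_restrict_cong[OF lie_der_pre[OF im_hom fox_der[OF W fr]] V]) (auto simp: pt_map_incl)
  show ?thesis
    by (rule lie_der_unique[OF V LP_bilin[OF W] hom_comp[OF pt_incl_lin[OF V] pt_map_lin] 2 1 _ x])
      (use f fr hom_closed[OF f] in \<open>auto simp: fox_gen mor_ri hom_smult[OF pt_map_lin]\<close>)
qed

lemma div_lin_natural:
  assumes fV: "free_fin_rank R V" and fW: "free_fin_rank R W" and d: "d \<in> derivations R V"
  shows "div_lin R W (Der_map R V W (i, r) d) = pt_map (div_lin R V d)"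
proof -
  have "d \<in> {d \<in> carrier (Der R V). div_lin R W (Der_map R V W (i, r) d) = pt_map (div_lin R V d)}"
  proof (rule Der_span_induct[OF fV _ _ subset_refl d])
    show "submodule {d \<in> carrier (Der R V). div_lin R W (Der_map R V W (i, r) d) = pt_map (div_lin R V d)} R (Der R V)"
      by (rule sub_equalizer[OF _ _ hom_comp[OF Der_map_hom div_lin_hom[OF fW]] hom_comp[OF div_lin_hom[OF fV] pt_map_lin]]) auto
    fix f x assume f: "f \<in> mod_hom R V (self_mod R)" and x: "x \<in> carrier (Lie R V)"
    then show "elem_der R V f x \<in> {d \<in> carrier (Der R V). div_lin R W (Der_map R V W (i, r) d) = pt_map (div_lin R V d)}"
      using hom_comp[OF mor_r f] by (simp add: Der_map_elem div_lin_elem[OF fV] div_lin_elem[OF fW] fox_natural)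
  qed (use d in auto)
  then show ?thesis by simp
qed

lemma pt_map_der_class:
  assumes z: "z \<in> lin_pos R V"
  shows "induced (Der_pt_pos R W) (comm_span R (Der_pt_pos R W))
      (Der_map R (pt_mod R V) (pt_mod R W) (map_prod id i, map_prod id r)) (der_class R V z) = der_class R W (pt_map z)"
    and "induced (Der_pt_pos R W) (comm_span R (Der_pt_pos R W))
      (Der_map R (pt_mod R V) (pt_mod R W) (map_prod id i, map_prod id r)) \<in> mod_hom R (abel R (Der_pt_pos R V)) (abel R (Der_pt_pos R W))"
proof -
  let ?m = "Der_map R (pt_mod R V) (pt_mod R W) (map_prod id i, map_prod id r)"
  have h: "?m \<in> mod_hom R (Der_pt_pos R V) (Der_pt_pos R W)"
    using cring.Der_map_hom[OF is_cring P_module[OF V] P_module[OF W] pt_mor] pt_map_lin_pos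
    by (auto simp: mod_hom_def Der_pt_pos_eq Der_map_pt_der)
  have k: "?m x \<in> comm_span R (Der_pt_pos R W)" if "x \<in> comm_span R (Der_pt_pos R V)" for x
    using that pt_map_lin_comm lin_comm_subset[OF V] by (auto simp: comm_span_Der_pt_pos Der_map_pt_der)
  show "induced (Der_pt_pos R W) (comm_span R (Der_pt_pos R W)) ?m (der_class R V z) = der_class R W (pt_map z)"
    using induced_coset[OF Der_pt_pos_module[OF V] comm_span_sub[OF V] Der_pt_pos_module[OF W] comm_span_sub[OF W] h k, of "pt_der R V z"] z
    by (simp add: der_class_def Der_pt_pos_carrier Der_map_pt_der)
  show "induced (Der_pt_pos R W) (comm_span R (Der_pt_pos R W)) ?m \<in> mod_hom R (abel R (Der_pt_pos R V)) (abel R (Der_pt_pos R W))"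
    unfolding abel_def
    by (rule induced_hom[OF Der_pt_pos_module[OF V] comm_span_sub[OF V] Der_pt_pos_module[OF W] comm_span_sub[OF W] h k])
qed

lemma source_map_coset:
  assumes d: "d \<in> part_ders R V {2..}"
  shows "div_source_map R V W (i, r) (Der1 R V +>\<^bsub>Der_pos R V\<^esub> d) = Der1 R W +>\<^bsub>Der_pos R W\<^esub> Der_map R V W (i, r) d"
  unfolding div_source_map_def
  using induced_coset[OF Der_pos_module[OF V] Der1_sub_pos[OF V] Der_pos_module[OF W] Der1_sub_pos[OF W] Der_map_pos_hom Der_map_Der1] d
  by simp

lemma source_map_hom: "div_source_map R V W (i, r) \<in> mod_hom R (div_source R V) (div_source R W)"
  unfolding div_source_map_def div_source_def
  by (rule induced_hom[OF Der_pos_module[OF V] Der1_sub_pos[OF V] Der_pos_module[OF W] Der1_sub_pos[OF W] Der_map_pos_hom Der_map_Der1])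

lemma divergence_natural:
  assumes fV: "free_fin_rank R V" and fW: "free_fin_rank R W"
  shows "div_target_map R V W (i, r) \<in> mod_hom R (div_target R V) (div_target R W)"
    and "X \<in> carrier (div_source R V) \<Longrightarrow>
      Div_bar R W (div_source_map R V W (i, r) X) = div_target_map R V W (i, r) (Div_bar R V X)"
proof -
  let ?I = "induced (Der_pt_pos R W) (comm_span R (Der_pt_pos R W))
      (Der_map R (pt_mod R V) (pt_mod R W) (map_prod id i, map_prod id r))"
  have zero: "\<zero>\<^bsub>LP R V\<^esub> \<in> lin_pos R V" by (rule sub_zero[OF _ lin_pos_sub]) auto
  note I = pt_map_der_class(2)[OF zero]
  have ID: "?I (Div R V d) = Div R W (Der_map R V W (i, r) d)" if "d \<in> part_ders R V {2..}" for d
    using that pt_map_der_class(1)[OF div_lin_lin_pos[OF fV that]] Der_map_part[OF that]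
    by (simp add: Div_der_class[OF fV] Div_der_class[OF fW] div_lin_natural[OF fV fW])
  have k: "?I x \<in> Im_Div R W" if "x \<in> Im_Div R V" for x
    using that Der1_pos[OF V] Der_map_Der1 by (auto simp: Im_Div_def ID)
  show "div_target_map R V W (i, r) \<in> mod_hom R (div_target R V) (div_target R W)"
    unfolding div_target_map_def div_target_def fst_conv snd_conv
    by (rule induced_hom[OF abel_module[OF V] Im_Div_sub[OF fV] abel_module[OF W] Im_Div_sub[OF fW] I k])
  assume "X \<in> carrier (div_source R V)"
  then obtain d where d: "d \<in> part_ders R V {2..}" "X = Der1 R V +>\<^bsub>Der_pos R V\<^esub> d"
    by (auto simp: div_source_def quot_carrier)
  have "div_target_map R V W (i, r) (Div_bar R V X) = Im_Div R W +>\<^bsub>abel R (Der_pt_pos R W)\<^esub> ?I (Div R V d)"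
    unfolding d(2) Div_bar_coset[OF fV d(1)] div_target_map_def fst_conv snd_conv
    using hom_closed[OF Div_hom[OF fV], of d] d(1)
    by (intro induced_coset[OF abel_module[OF V] Im_Div_sub[OF fV] abel_module[OF W] Im_Div_sub[OF fW] I k]) auto
  then show "Div_bar R W (div_source_map R V W (i, r) X) = div_target_map R V W (i, r) (Div_bar R V X)"
    using d Div_bar_coset[OF fW Der_map_part[OF d(1)]] by (simp add: source_map_coset ID)
qed

end

end

section \<open>Vanishing of the kernel after three stabilizations\<close>

context cring
begin

lemma elem_der_hom:
  fixes U :: "('a, 'u) module"
  assumes U: "module R U" and f: "f \<in> mod_hom R U (self_mod R)"
  shows "elem_der R U f \<in> mod_hom R (Lie R U) (Der R U)"
  by (rule mod_homI)
    (use U f hom_closed[OF f] in \<open>auto intro!: der_eqI[OF U] simp: elem_der_gen Der_apply Der_add_closed Der_smult_closed mod_smult_add mod_smult_comm\<close>)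

lemma elem_der_part:
  fixes U :: "('a, 'u) module"
  assumes U: "module R U" and f: "f \<in> mod_hom R U (self_mod R)" and x: "x \<in> lie_part R U S"
  shows "elem_der R U f x \<in> part_ders R U S"
proof (rule part_dersI[OF U])
  have xc: "x \<in> carrier (Lie R U)" by (rule lie_part_closed[OF U x])
  show "elem_der R U f x \<in> derivations R U" by (rule elem_der_der[OF U f xc])
  show "elem_der R U f x (gen R U v) \<in> lie_part R U S" if "v \<in> carrier U" for v
    using hom_closed[OF f that] sub_smult[OF _ lie_part_sub[OF U] _ x] U by (simp add: elem_der_gen[OF U f xc that])
qed

lemma elem_der_bracket:
  fixes U :: "('a, 'u) module"
  assumes U: "module R U" and f: "f \<in> mod_hom R U (self_mod R)" and g: "g \<in> mod_hom R U (self_mod R)"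
    and x: "x \<in> carrier (Lie R U)" and y: "y \<in> carrier (Lie R U)"
  shows "der_bracket R U (elem_der R U f x) (elem_der R U g y) =
    elem_der R U f (elem_der R U g y x) \<ominus>\<^bsub>Der R U\<^esub> elem_der R U g (elem_der R U f x y)"
proof -
  note D = elem_der_der[OF U f x] and E = elem_der_der[OF U g y]
  note Dg = elem_der_gen[OF U f x] and Eg = elem_der_gen[OF U g y]
  note ex = derivations_closed[OF E x] and dy = derivations_closed[OF D y]
  have "elem_der R U f x \<otimes>\<^bsub>Der R U\<^esub> elem_der R U g y = elem_der R U f (elem_der R U g y x)"
    by (rule der_eqI[OF U Der_mult_closed[OF U D E] elem_der_der[OF U f ex]])
      (use hom_closed[OF f] in \<open>simp add: Der_mult_apply[OF U D E] Dg elem_der_gen[OF U f ex] hom_smult[OF derivations_hom[OF E] _ x]\<close>)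
  moreover have "elem_der R U g y \<otimes>\<^bsub>Der R U\<^esub> elem_der R U f x = elem_der R U g (elem_der R U f x y)"
    by (rule der_eqI[OF U Der_mult_closed[OF U E D] elem_der_der[OF U g dy]])
      (use hom_closed[OF g] in \<open>simp add: Der_mult_apply[OF U E D] Eg elem_der_gen[OF U g dy] hom_smult[OF derivations_hom[OF D] _ y]\<close>)
  ultimately show ?thesis by (simp add: der_bracket_def)
qed

lemma elem_der_kill:
  fixes U :: "('a, 'u) module" and W :: "('a, 'w) module"
  assumes U: "module R U" and W: "module R W" and f: "f \<in> mod_hom R W (self_mod R)" and x: "x \<in> carrier (Lie R W)"
    and \<kappa>: "\<kappa> \<in> mod_hom R U W" and 0: "\<And>u. u \<in> carrier U \<Longrightarrow> f (\<kappa> u) = \<zero>" and y: "y \<in> carrier (Lie R U)"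
  shows "elem_der R W f x (lie_map R U W \<kappa> y) = \<zero>\<^bsub>Lie R W\<^esub>"
proof (rule lie_der_unique[OF U Lie_bilin[OF W] lie_map_lin[OF U W \<kappa>]
      lie_der_pre[OF lie_map_hom[OF U W \<kappa>] derivations_lie_der[OF elem_der_der[OF W f x]]]
      lie_der_zero[OF Lie_bilin[OF W] lie_map_lin[OF U W \<kappa>]] _ y])
  show "elem_der R W f x (lie_map R U W \<kappa> (gen R U u)) = \<zero>\<^bsub>Lie R W\<^esub>" if "u \<in> carrier U" for u
    using that W x hom_closed[OF \<kappa> that] by (simp add: lie_map_gen[OF U W \<kappa>] elem_der_gen[OF W f x] 0)
qed

context
  fixes V :: "('a, 'v) module"
  assumes V[simp]: "module R V"
begin

abbreviation "W \<equiv> dsum V (pow_mod R 3)"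

text \<open>The \<open>t\<close>-th basis vector of the added summand \<open>R\<^sup>3\<close>; \<open>coord\<close> is the dual form.\<close>

definition fresh :: "nat \<Rightarrow> 'v \<times> (nat \<Rightarrow> 'a)"
  where "fresh t = (\<zero>\<^bsub>V\<^esub>, unit_vec 3 t)"

definition coord :: "nat \<Rightarrow> 'v \<times> (nat \<Rightarrow> 'a) \<Rightarrow> 'a"
  where "coord s w = snd w s"

definition stab_incl :: "'v \<Rightarrow> 'v \<times> (nat \<Rightarrow> 'a)"
  where "stab_incl v = (v, \<zero>\<^bsub>pow_mod R 3\<^esub>)"

text \<open>Puts the \<open>t\<close>-th new basis vector in place of the marked generator.\<close>

definition plug :: "nat \<Rightarrow> 'a \<times> 'v \<Rightarrow> 'v \<times> (nat \<Rightarrow> 'a)"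
  where "plug t p = (snd p, fst p \<odot>\<^bsub>pow_mod R 3\<^esub> unit_vec 3 t)"

lemma W_module: "module R W"
  by simp

lemma unit_vec_carrier: "unit_vec n t \<in> carrier (pow_mod R n)"
  by simp

lemma fresh_closed: "fresh t \<in> carrier W"
  using unit_vec_carrier by (simp add: fresh_def)

lemma coord_hom: "s < 3 \<Longrightarrow> coord s \<in> mod_hom R W (self_mod R)"
proof -
  assume "s < 3"
  have "coord s = (\<lambda>w. snd w s)" by (simp add: coord_def fun_eq_iff)
  then show ?thesis using hom_comp[OF dsum_snd_hom pow_eval_hom[OF \<open>s < 3\<close>]] by simp
qed

lemma coord_fresh: "s < 3 \<Longrightarrow> coord s (fresh t) = (if s = t then \<one> else \<zero>)"
  by (auto simp: coord_def fresh_def unit_vec_def)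

lemma stab_incl_hom: "stab_incl \<in> mod_hom R V W"
  unfolding stab_incl_def using dsum_inl_hom[OF V pow_module] by (simp del: pow_mod_sel)

lemma coord_stab_incl: "s < 3 \<Longrightarrow> coord s (stab_incl v) = \<zero>"
  by (simp add: coord_def stab_incl_def)

lemma fst_stab_incl: "fst (stab_incl v) = v"
  by (simp add: stab_incl_def)

lemma plug_hom: "plug t \<in> mod_hom R (pt_mod R V) W"
  unfolding plug_def
  by (rule mod_homI) (auto simp: mod_add_smult[OF pow_module] mod_mult_smult[OF pow_module] mod_smult[OF pow_module] unit_vec_carrier
      simp del: pow_mod_sel)

lemma coord_plug: "s < 3 \<Longrightarrow> s \<noteq> t \<Longrightarrow> p \<in> carrier (pt_mod R V) \<Longrightarrow> coord s (plug t p) = \<zero>"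
  by (auto simp: coord_def plug_def unit_vec_def)

lemma plug_one: "lie_map R (pt_mod R V) W (plug t) (pt_one R V) = gen R W (fresh t)"
proof -
  have "plug t (\<one>, \<zero>\<^bsub>V\<^esub>) = fresh t"
    using mod_one_smult[OF pow_module unit_vec_carrier] by (simp add: plug_def fresh_def del: pow_mod_sel)
  then show ?thesis using lie_map_gen[OF P_module[OF V] W_module plug_hom, of "(\<one>, \<zero>\<^bsub>V\<^esub>)" t] by (simp add: pt_one_def)
qed

lemma plug_gen: "v \<in> carrier V \<Longrightarrow> lie_map R (pt_mod R V) W (plug t) (pt_gen R V v) = gen R W (stab_incl v)"
proof -
  assume v: "v \<in> carrier V"
  have "plug t (\<zero>, v) = stab_incl v"
    using mod_zero_smult[OF pow_module unit_vec_carrier] by (simp add: plug_def stab_incl_def del: pow_mod_sel)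
  then show ?thesis using lie_map_gen[OF P_module[OF V] W_module plug_hom, of "(\<zero>, v)" t] v by (simp add: pt_gen_def)
qed

lemmas plug_lin = lie_map_lin[OF P_module[OF V] W_module plug_hom]
lemmas plug_mult = lie_map_mult[OF P_module[OF V] W_module plug_hom]
lemmas plug_closed = lie_map_closed[OF P_module[OF V] W_module plug_hom]
lemmas stab_incl_lin = lie_map_lin[OF V W_module stab_incl_hom]
lemmas stab_incl_mult = lie_map_mult[OF V W_module stab_incl_hom]
lemmas stab_incl_closed = lie_map_closed[OF V W_module stab_incl_hom]
lemmas stab_incl_gen = lie_map_gen[OF V W_module stab_incl_hom]
lemmas W_gen = gen_carrier[OF W_module]
lemmas WL = Lie_module[OF W_module] Lie_bilin[OF W_module]

lemma plug_incl: "x \<in> carrier (Lie R V) \<Longrightarrow> lie_map R (pt_mod R V) W (plug t) (pt_incl R V x) = lie_map R V W stab_incl x"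
  by (rule Lie_hom_unique[OF V WL(2) alg_hom_comp[OF pt_incl_hom[OF V] lie_map_hom[OF P_module[OF V] W_module plug_hom]]
        lie_map_hom[OF V W_module stab_incl_hom]]) (simp_all add: plug_gen stab_incl_gen)

text \<open>If \<open>c\<close> does not occur in \<open>u\<close>, then \<open>z \<otimes> c\<^sup>*\<close> turns \<open>[u,c]\<close> into \<open>[u,z]\<close>.\<close>

lemma insert_bracket:
  assumes f: "f \<in> mod_hom R W (self_mod R)" and c: "c < 3" and u: "u \<in> carrier W" and uc: "coord c u = \<zero>"
    and z: "z \<in> carrier (Lie R W)"
  shows "der_bracket R W (elem_der R W f (gen R W u \<otimes>\<^bsub>Lie R W\<^esub> gen R W (fresh c))) (elem_der R W (coord c) z) =
    elem_der R W f (gen R W u \<otimes>\<^bsub>Lie R W\<^esub> z) \<ominus>\<^bsub>Der R W\<^esub>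
    elem_der R W (coord c) (elem_der R W f (gen R W u \<otimes>\<^bsub>Lie R W\<^esub> gen R W (fresh c)) z)"
proof -
  note b = W_gen[OF fresh_closed[of c]] and uu = W_gen[OF u] and e = elem_der_der[OF W_module coord_hom[OF c] z]
  note g = elem_der_gen[OF W_module coord_hom[OF c] z]
  have "elem_der R W (coord c) z (gen R W u \<otimes>\<^bsub>Lie R W\<^esub> gen R W (fresh c)) = gen R W u \<otimes>\<^bsub>Lie R W\<^esub> z"
    using z b uu WL by (simp add: derivations_mult[OF e] g[OF u] g[OF fresh_closed] uc coord_fresh[OF c])
  then show ?thesis
    by (simp add: elem_der_bracket[OF W_module f coord_hom[OF c] bil_closed[OF WL(2) uu b] z])
qed

lemma elem_der_zero: "f \<in> mod_hom R W (self_mod R) \<Longrightarrow> elem_der R W f \<zero>\<^bsub>Lie R W\<^esub> = \<zero>\<^bsub>Der R W\<^esub>"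
  by (rule hom_zero[OF WL(1) Der_module[OF W_module] elem_der_hom[OF W_module]])

text \<open>By induction on \<open>y\<close>: the derivation \<open>[u,y] \<otimes> s\<^sup>*\<close> is the bracket of \<open>[u,c] \<otimes> s\<^sup>*\<close> and \<open>y \<otimes> c\<^sup>*\<close> for a second
  index \<open>c\<close> in \<open>K\<close>, since the correction term vanishes: \<open>y\<close> does not involve the coordinate \<open>s\<close>. The
  first factor has degree one, and the second is covered by the induction, with the roles of the
  indices in \<open>K\<close> interchanged.\<close>

lemma fresh_coordinate:
  fixes U :: "('a, 'u) module"
  assumes U: "module R U" and \<kappa>: "\<kappa> \<in> mod_hom R U W"
    and K: "\<And>s. s \<in> K \<Longrightarrow> s < 3" "\<And>s. s \<in> K \<Longrightarrow> \<exists>c\<in>K. c \<noteq> s"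
    and 0: "\<And>s u. s \<in> K \<Longrightarrow> u \<in> carrier U \<Longrightarrow> coord s (\<kappa> u) = \<zero>"
    and y: "y \<in> lie_part R U {2..}" and s: "s \<in> K"
  shows "elem_der R W (coord s) (lie_map R U W \<kappa> y) \<in> Der1 R W"
proof -
  let ?m = "lie_map R U W \<kappa>"
  note m = lie_map_lin[OF U W_module \<kappa>] and mm = lie_map_mult[OF U W_module \<kappa>] and mg = lie_map_gen[OF U W_module \<kappa>]
  note mc = hom_closed[OF m] and \<kappa>c = hom_closed[OF \<kappa>] and UL = Lie_module[OF U] Lie_bilin[OF U]
  note D1 = Der1_sub[OF W_module] and eh = elem_der_hom[OF W_module coord_hom]
  have key: "y \<in> {y \<in> carrier (Lie R U). \<forall>s\<in>K. \<forall>u\<in>carrier U. elem_der R W (coord s) (?m (gen R U u \<otimes>\<^bsub>Lie R U\<^esub> y)) \<in> Der1 R W}"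
    (is "y \<in> ?H") if y: "y \<in> carrier (Lie R U)" for y
  proof (rule Lie_right_normed_induct[OF U _ _ _ y])
    have hom: "(\<lambda>y. elem_der R W (coord s) (?m (gen R U u \<otimes>\<^bsub>Lie R U\<^esub> y))) \<in> mod_hom R (Lie R U) (Der R W)"
      if "s \<in> K" "u \<in> carrier U" for s u
      using hom_comp[OF hom_comp[OF bil_hom1[OF UL(2) gen_carrier[OF U that(2)]] m] eh[OF K(1)[OF that(1)]]] .
    show "submodule ?H R (Lie R U)"
    proof (rule subI[OF UL(1)])
      show "\<zero>\<^bsub>Lie R U\<^esub> \<in> ?H" using hom_zero[OF UL(1) Der_module[OF W_module] hom] sub_zero[OF _ D1] UL by simp
      show "x \<oplus>\<^bsub>Lie R U\<^esub> y \<in> ?H" if "x \<in> ?H" "y \<in> ?H" for x y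
        using that hom_add[OF hom] sub_add[OF _ D1] UL by simp
      show "a \<odot>\<^bsub>Lie R U\<^esub> x \<in> ?H" if "a \<in> carrier R" "x \<in> ?H" for a x
        using that hom_smult[OF hom] sub_smult[OF _ D1] UL by simp
    qed auto
    fix v assume v: "v \<in> carrier U"
    show "gen R U v \<in> ?H"
    proof (intro CollectI conjI ballI)
      fix s u assume s: "s \<in> K" and u: "u \<in> carrier U"
      have "?m (gen R U u \<otimes>\<^bsub>Lie R U\<^esub> gen R U v) \<in> lie_part R W {2}"
        using lie_two_incl[OF W_module \<kappa>c[OF u] \<kappa>c[OF v]] by (simp add: mm[OF gen_carrier[OF U u] gen_carrier[OF U v]] mg u v)
      then show "elem_der R W (coord s) (?m (gen R U u \<otimes>\<^bsub>Lie R U\<^esub> gen R U v)) \<in> Der1 R W"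
        by (intro Der1_deg_one[OF W_module] elem_der_part[OF W_module coord_hom[OF K(1)[OF s]]])
    qed (rule gen_carrier[OF U v])
    fix y assume y: "y \<in> ?H"
    then have yc: "y \<in> carrier (Lie R U)" by simp
    note vy = bil_closed[OF UL(2) gen_carrier[OF U v] yc]
    show "gen R U v \<otimes>\<^bsub>Lie R U\<^esub> y \<in> ?H"
    proof (intro CollectI conjI ballI)
      fix s u assume s: "s \<in> K" and u: "u \<in> carrier U"
      obtain c where c: "c \<in> K" "c \<noteq> s" using K(2)[OF s] by blast
      let ?x = "gen R W (\<kappa> u) \<otimes>\<^bsub>Lie R W\<^esub> gen R W (fresh c)" and ?z = "?m (gen R U v \<otimes>\<^bsub>Lie R U\<^esub> y)"
      have xp: "?x \<in> lie_part R W {2}" by (rule lie_two_incl[OF W_module \<kappa>c[OF u] fresh_closed])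
      have 1: "elem_der R W (coord s) ?x \<in> Der1 R W"
        by (rule Der1_deg_one[OF W_module elem_der_part[OF W_module coord_hom[OF K(1)[OF s]] xp]])
      have 2: "elem_der R W (coord c) ?z \<in> Der1 R W" using y c v by simp
      have k: "elem_der R W (coord s) ?x ?z = \<zero>\<^bsub>Lie R W\<^esub>"
        by (rule elem_der_kill[OF U W_module coord_hom[OF K(1)[OF s]] lie_part_closed[OF W_module xp] \<kappa> 0[OF s] vy])
      have "der_bracket R W (elem_der R W (coord s) ?x) (elem_der R W (coord c) ?z) =
          elem_der R W (coord s) (gen R W (\<kappa> u) \<otimes>\<^bsub>Lie R W\<^esub> ?z) \<ominus>\<^bsub>Der R W\<^esub> \<zero>\<^bsub>Der R W\<^esub>"
        using insert_bracket[OF coord_hom[OF K(1)[OF s]] K(1)[OF c(1)] \<kappa>c[OF u] 0[OF c(1) u] mc[OF vy]]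
        by (simp add: k elem_der_zero[OF coord_hom[OF K(1)[OF c(1)]]])
      also have "gen R W (\<kappa> u) \<otimes>\<^bsub>Lie R W\<^esub> ?z = ?m (gen R U u \<otimes>\<^bsub>Lie R U\<^esub> (gen R U v \<otimes>\<^bsub>Lie R U\<^esub> y))"
        by (simp add: mm[OF gen_carrier[OF U u] vy] mg u)
      also have "elem_der R W (coord s) \<dots> \<ominus>\<^bsub>Der R W\<^esub> \<zero>\<^bsub>Der R W\<^esub> = elem_der R W (coord s) \<dots>"
        by (rule mod_diff_zero[OF Der_module[OF W_module]])
          (simp add: elem_der_der[OF W_module coord_hom[OF K(1)[OF s]] mc[OF bil_closed[OF UL(2) gen_carrier[OF U u] vy]]])
      finally show "elem_der R W (coord s) (?m (gen R U u \<otimes>\<^bsub>Lie R U\<^esub> (gen R U v \<otimes>\<^bsub>Lie R U\<^esub> y))) \<in> Der1 R W"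
        using Der1_bracket[OF W_module 1 2] by simp
    qed (rule vy)
  qed
  have "y \<in> {y \<in> carrier (Lie R U). elem_der R W (coord s) (?m y) \<in> Der1 R W}"
  proof (rule lie_pos_induct[OF U _ _ y])
    show "submodule {y \<in> carrier (Lie R U). elem_der R W (coord s) (?m y) \<in> Der1 R W} R (Lie R U)"
      by (rule sub_vimage[OF UL(1) Der_module[OF W_module] hom_comp[OF m eh[OF K(1)[OF s]]] D1])
    fix u y assume "u \<in> carrier U" "y \<in> carrier (Lie R U)"
    then show "gen R U u \<otimes>\<^bsub>Lie R U\<^esub> y \<in> {y \<in> carrier (Lie R U). elem_der R W (coord s) (?m y) \<in> Der1 R W}"
      using key[of y] s UL gen_carrier[OF U] by simp
  qed
  then show ?thesis by simp
qed

text \<open>The derivation \<open>z(c\<^sub>t) \<otimes> c\<^sub>s\<^sup>*\<close>.\<close>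

definition plug_der :: "nat \<Rightarrow> nat \<Rightarrow> (('a \<times> 'v) tree \<Rightarrow> 'a) set \<Rightarrow> ('a, 'v \<times> (nat \<Rightarrow> 'a)) der"
  where "plug_der s t z = elem_der R W (coord s) (lie_map R (pt_mod R V) W (plug t) z)"

lemma plug_der_hom: "s < 3 \<Longrightarrow> plug_der s t \<in> mod_hom R (LP R V) (Der R W)"
  unfolding plug_der_def by (rule hom_comp[OF plug_lin elem_der_hom[OF W_module coord_hom]])

lemma plug_der_closed: "s < 3 \<Longrightarrow> z \<in> carrier (LP R V) \<Longrightarrow> plug_der s t z \<in> derivations R W"
  using hom_closed[OF plug_der_hom] by simp

lemma plug_der_off_diagonal:
  assumes st: "s < 3" "t < 3" "s \<noteq> t" and z: "z \<in> lie_part R (pt_mod R V) {2..}"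
  shows "plug_der s t z \<in> Der1 R W"
  unfolding plug_der_def
proof (rule fresh_coordinate[OF P_module[OF V] plug_hom _ _ _ z, of "{..<3} - {t}"])
  fix q assume q: "q \<in> {..<3} - {t}"
  then show "q < 3" by simp
  have "\<exists>c<3. c \<noteq> t \<and> c \<noteq> q"
    by presburger
  then show "\<exists>c\<in>{..<3} - {t}. c \<noteq> q" by blast
  show "coord q (plug t u) = \<zero>" if "u \<in> carrier (pt_mod R V)" for u
    using q that by (intro coord_plug) auto
qed (use st in auto)

text \<open>The derivation replaces \<open>c\<^sub>t\<close> by \<open>z(c\<^sub>s)\<close> and kills \<open>V\<close>.\<close>

lemma plug_der_substitute:
  assumes st: "s < 3" "t < 3" and z: "z \<in> carrier (LP R V)" and y: "y \<in> lie_lin R V (self_mod R)"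
  shows "plug_der t s z (lie_map R (pt_mod R V) W (plug t) y) = lie_map R (pt_mod R V) W (plug s) (pt_der R V z y)"
proof -
  note D = plug_der_closed[OF st(2) z, of s]
  note p = pt_der_der[OF V z]
  have g: "plug_der t s z (gen R W w) = coord t w \<odot>\<^bsub>Lie R W\<^esub> lie_map R (pt_mod R V) W (plug s) z" if "w \<in> carrier W" for w
    unfolding plug_der_def using elem_der_gen[OF W_module coord_hom[OF st(2)] plug_closed[OF z] that] .
  have "y \<in> {y \<in> carrier (LP R V). plug_der t s z (lie_map R (pt_mod R V) W (plug t) y) = lie_map R (pt_mod R V) W (plug s) (pt_der R V z y)}"
    (is "y \<in> ?H")
  proof (rule lie_lin_induct[OF V _ _ _ y])
    show "submodule ?H R (LP R V)"
      by (rule sub_equalizer[OF LP_module[OF V] WL(1) hom_comp[OF plug_lin derivations_hom[OF D]] hom_comp[OF derivations_hom[OF p] plug_lin]])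
    show "pt_one R V \<in> ?H"
      using z plug_closed[OF z] WL by (simp add: plug_one g[OF fresh_closed] coord_fresh[OF st(2)])
    fix v x assume v: "v \<in> carrier V" and x: "x \<in> lie_lin R V (self_mod R)" "x \<in> ?H"
    have xc: "x \<in> carrier (LP R V)" using x by simp
    note iv = hom_closed[OF stab_incl_hom v]
    have "plug_der t s z (lie_map R (pt_mod R V) W (plug t) (pt_gen R V v \<otimes>\<^bsub>LP R V\<^esub> x)) =
        gen R W (stab_incl v) \<otimes>\<^bsub>Lie R W\<^esub> plug_der t s z (lie_map R (pt_mod R V) W (plug t) x)"
      using W_gen[OF iv] plug_closed[OF xc] plug_closed[OF z] WL D
      by (simp add: plug_mult[OF pt_gen_closed[OF V v] xc] plug_gen[OF v] derivations_mult[OF D] g[OF iv] coord_stab_incl[OF st(2)])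
    also have "\<dots> = lie_map R (pt_mod R V) W (plug s) (pt_gen R V v \<otimes>\<^bsub>LP R V\<^esub> pt_der R V z x)"
      using x by (simp add: plug_mult[OF pt_gen_closed[OF V v] pt_der_apply_closed[OF V xc z]] plug_gen[OF v])
    finally show "pt_gen R V v \<otimes>\<^bsub>LP R V\<^esub> x \<in> ?H" using v xc z by (simp add: pt_der_step_gen)
  qed
  then show ?thesis by simp
qed

text \<open>The bracket of \<open>y(c\<^sub>t) \<otimes> c\<^sub>s\<^sup>*\<close> and \<open>z(c\<^sub>s) \<otimes> c\<^sub>t\<^sup>*\<close>.\<close>

lemma plug_der_rotate:
  assumes st: "s < 3" "t < 3" "s \<noteq> t" and y: "y \<in> lin_pos R V" and z: "z \<in> lin_pos R V"
  shows "plug_der s s (pt_der R V z y) \<ominus>\<^bsub>Der R W\<^esub> plug_der t t (pt_der R V y z) \<in> Der1 R W"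
proof -
  have c: "y \<in> carrier (LP R V)" "z \<in> carrier (LP R V)" using y z by simp_all
  have "der_bracket R W (plug_der s t y) (plug_der t s z) \<in> Der1 R W"
    using st by (intro Der1_bracket[OF W_module] plug_der_off_diagonal lin_pos_pos[OF V] y z) auto
  also have "der_bracket R W (plug_der s t y) (plug_der t s z) = plug_der s s (pt_der R V z y) \<ominus>\<^bsub>Der R W\<^esub> plug_der t t (pt_der R V y z)"
    using elem_der_bracket[OF W_module coord_hom[OF st(1)] coord_hom[OF st(2)] plug_closed[OF c(1), of t] plug_closed[OF c(2), of s]]
      plug_der_substitute[OF st(1,2) c(2) lin_posD[OF V y]] plug_der_substitute[OF st(2,1) c(1) lin_posD[OF V z]]
    by (simp add: plug_der_def)
  finally show ?thesis .
qed

lemma plug_der_low: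
  assumes z: "z \<in> lin_low R V"
  shows "plug_der 0 0 z \<in> Der1 R W"
proof -
  note D1 = Der1_sub[OF W_module] and WD = Der_module[OF W_module]
  have comm: "plug_der 0 0 k \<in> Der1 R W" if "k \<in> lin_comm R V" for k
  proof (rule span_hom_into[OF LP_module[OF V] WD plug_der_hom D1 _ _ that[unfolded lin_comm_def]])
    fix x assume "x \<in> {pt_der R V z y \<ominus>\<^bsub>LP R V\<^esub> pt_der R V y z | y z. y \<in> lin_pos R V \<and> z \<in> lin_pos R V}"
    then obtain y z where yz: "y \<in> lin_pos R V" "z \<in> lin_pos R V" "x = pt_der R V z y \<ominus>\<^bsub>LP R V\<^esub> pt_der R V y z" by blast
    let ?a = "pt_der R V z y" and ?b = "pt_der R V y z"
    have c: "?a \<in> carrier (LP R V)" "?b \<in> carrier (LP R V)" using yz by simp_all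
    note cl = plug_der_closed[OF _ c(1)] plug_der_closed[OF _ c(2)]
    \<comment> \<open>The rotations \<open>0 \<rightarrow> 1 \<rightarrow> 2 \<rightarrow> 0\<close> exchange \<open>y\<close> and \<open>z\<close> an odd number of times.\<close>
    have r: "plug_der 0 0 ?a \<ominus>\<^bsub>Der R W\<^esub> plug_der 1 1 ?b \<in> Der1 R W" "plug_der 1 1 ?b \<ominus>\<^bsub>Der R W\<^esub> plug_der 2 2 ?a \<in> Der1 R W"
      "plug_der 2 2 ?a \<ominus>\<^bsub>Der R W\<^esub> plug_der 0 0 ?b \<in> Der1 R W"
      using yz(1,2) by (intro plug_der_rotate; simp)+
    have "((plug_der 0 0 ?a \<ominus>\<^bsub>Der R W\<^esub> plug_der 1 1 ?b) \<oplus>\<^bsub>Der R W\<^esub> (plug_der 1 1 ?b \<ominus>\<^bsub>Der R W\<^esub> plug_der 2 2 ?a)) \<oplus>\<^bsub>Der R W\<^esub>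
        (plug_der 2 2 ?a \<ominus>\<^bsub>Der R W\<^esub> plug_der 0 0 ?b) \<in> Der1 R W"
      by (intro sub_add[OF WD D1] r)
    moreover have "(p \<ominus>\<^bsub>Der R W\<^esub> q) \<oplus>\<^bsub>Der R W\<^esub> (q \<ominus>\<^bsub>Der R W\<^esub> q') \<oplus>\<^bsub>Der R W\<^esub> (q' \<ominus>\<^bsub>Der R W\<^esub> p') = p \<ominus>\<^bsub>Der R W\<^esub> p'"
      if "p \<in> carrier (Der R W)" "q \<in> carrier (Der R W)" "q' \<in> carrier (Der R W)" "p' \<in> carrier (Der R W)" for p q q' p'
      using that WD by (simp add: mod_ac del: Der_sel)
    ultimately have "plug_der 0 0 ?a \<ominus>\<^bsub>Der R W\<^esub> plug_der 0 0 ?b \<in> Der1 R W" using cl by simp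
    then show "plug_der 0 0 x \<in> Der1 R W"
      unfolding yz(3) hom_diff[OF LP_module[OF V] WD plug_der_hom[OF zero_less_numeral] c] .
  qed (use lin_comm_gens[OF V] in auto)
  obtain k v where kv: "k \<in> lin_comm R V" "v \<in> carrier V"
    "z = k \<oplus>\<^bsub>LP R V\<^esub> pt_gen R V v \<otimes>\<^bsub>LP R V\<^esub> pt_one R V"
    using z unfolding lin_low_def by blast
  note vc = bil_closed[OF LP_bilin[OF V] pt_gen_closed[OF V kv(2)] pt_one_closed[OF V]]
  have "plug_der 0 0 (pt_gen R V v \<otimes>\<^bsub>LP R V\<^esub> pt_one R V) \<in> Der1 R W"
    unfolding plug_der_def plug_mult[OF pt_gen_closed[OF V kv(2)] pt_one_closed[OF V]] plug_gen[OF kv(2)] plug_one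
    by (intro Der1_deg_one[OF W_module] elem_der_part[OF W_module coord_hom] lie_two_incl[OF W_module] fresh_closed
        hom_closed[OF stab_incl_hom kv(2)]) simp
  then show ?thesis
    unfolding kv(3) hom_add[OF plug_der_hom[OF zero_less_numeral] lin_pos_closed[OF V lin_comm_subset[OF V kv(1)]] vc]
    by (rule sub_add[OF WD D1 comm[OF kv(1)]])
qed

text \<open>Both sides are derivations over the inclusion of \<open>V\<close> into \<open>V \<oplus> R\<^sup>3\<close> with the values \<open>f(v)[u,c\<^sub>0]\<close> on generators.\<close>

lemma stab_incl_der_fox:
  assumes f: "f \<in> mod_hom R V (self_mod R)" and u: "u \<in> carrier V" and y: "y \<in> carrier (Lie R V)"
  shows "elem_der R W (\<lambda>w. f (fst w)) (gen R W (stab_incl u) \<otimes>\<^bsub>Lie R W\<^esub> gen R W (fresh 0)) (lie_map R V W stab_incl y) =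
    lie_map R (pt_mod R V) W (plug 0) (pt_der R V (pt_gen R V u \<otimes>\<^bsub>LP R V\<^esub> pt_one R V) (fox R V f y))"
proof -
  let ?F = "\<lambda>w. f (fst w)" and ?x = "gen R W (stab_incl u) \<otimes>\<^bsub>Lie R W\<^esub> gen R W (fresh 0)"
  let ?z = "pt_gen R V u \<otimes>\<^bsub>LP R V\<^esub> pt_one R V"
  have F: "?F \<in> mod_hom R W (self_mod R)"
    by (rule hom_comp[OF dsum_fst_hom f])
  have x: "?x \<in> carrier (Lie R W)"
    by (intro bil_closed[OF WL(2)] W_gen hom_closed[OF stab_incl_hom u] fresh_closed)
  have z: "?z \<in> carrier (LP R V)" using u by simp
  have kz: "lie_map R (pt_mod R V) W (plug 0) ?z = ?x"
    by (simp add: plug_mult[OF pt_gen_closed[OF V u] pt_one_closed[OF V]] plug_gen[OF u] plug_one)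
  have pf: "lie_der R V (LP R V) (pt_incl R V) (\<lambda>x. pt_der R V ?z (fox R V f x))"
    unfolding lie_der_def
    using hom_comp[OF fox_hom[OF V f] derivations_hom[OF pt_der_der[OF V z]]] f z
    by (auto simp: fox_mult[OF V f] derivations_mult[OF pt_der_der[OF V z]] hom_add[OF derivations_hom[OF pt_der_der[OF V z]]])
  have 2: "lie_der R V (Lie R W) (lie_map R V W stab_incl) (\<lambda>y. lie_map R (pt_mod R V) W (plug 0) (pt_der R V ?z (fox R V f y)))"
    by (rule lie_der_restrict_cong[OF lie_der_post[OF LP_bilin[OF V] pt_incl_lin[OF V] pf
            lie_map_hom[OF P_module[OF V] W_module plug_hom[of 0]]] V]) (simp_all add: plug_incl)
  show ?thesis
  proof (rule lie_der_unique[OF V WL(2) stab_incl_lin lie_der_pre[OF lie_map_hom[OF V W_module stab_incl_hom]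
          derivations_lie_der[OF elem_der_der[OF W_module F x]]] 2 _ y])
    fix v assume v: "v \<in> carrier V"
    have fv: "f v \<in> carrier R" using hom_closed[OF f v] by simp
    have "elem_der R W ?F ?x (lie_map R V W stab_incl (gen R V v)) = f v \<odot>\<^bsub>Lie R W\<^esub> ?x"
      by (simp add: stab_incl_gen[OF v] elem_der_gen[OF W_module F x hom_closed[OF stab_incl_hom v]] fst_stab_incl)
    also have "\<dots> = lie_map R (pt_mod R V) W (plug 0) (pt_der R V ?z (fox R V f (gen R V v)))"
      using fv v z by (simp add: fox_gen[OF V f] hom_smult[OF derivations_hom[OF pt_der_der[OF V z]]] hom_smult[OF plug_lin] kz)
    finally show "elem_der R W ?F ?x (lie_map R V W stab_incl (gen R V v)) =
      lie_map R (pt_mod R V) W (plug 0) (pt_der R V ?z (fox R V f (gen R V v)))" .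
  qed
qed

lemma stab_mor: "stab_mor R 3 = (stab_incl, fst)" "(stab_incl, fst) \<in> S_mor R V W"
proof -
  show "stab_mor R 3 = (stab_incl, fst)" by (auto simp: stab_mor_def stab_incl_def fun_eq_iff simp del: pow_mod_sel)
  show "(stab_incl, fst) \<in> S_mor R V W"
    using stab_incl_hom dsum_fst_hom[of V "pow_mod R 3"] unfolding S_mor_def by (simp add: fst_stab_incl)
qed

text \<open>It suffices to treat \<open>x = [u,y]\<close>. If \<open>y\<close> is a generator, both terms lie in \<open>Der\<^sup>(\<^sup>1\<^sup>)\<close>. If \<open>y\<close> has arity at
  least two, then \<open>y \<otimes> c\<^sub>0\<^sup>*\<close> lies in \<open>Der\<^sup>(\<^sup>1\<^sup>)\<close>, and its bracket with \<open>[u,c\<^sub>0] \<otimes> f\<close> shows that \<open>x \<otimes> f\<close> is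
  congruent to \<open>p(c\<^sub>0) \<otimes> c\<^sub>0\<^sup>*\<close>, where \<open>p = D\<^sub>f(y) \<lhd> [u,1]\<close>. Finally
  \<open>D\<^sub>f(x) - p = f(u)[1,y] + [u,1] \<lhd> D\<^sub>f(y) - D\<^sub>f(y) \<lhd> [u,1]\<close> is a sum of commutators.\<close>

lemma elem_der_reduce:
  assumes f: "f \<in> mod_hom R V (self_mod R)" and x: "x \<in> lie_part R V {2..}"
  shows "elem_der R W (\<lambda>w. f (fst w)) (lie_map R V W stab_incl x) \<ominus>\<^bsub>Der R W\<^esub> plug_der 0 0 (fox R V f x) \<in> Der1 R W"
proof -
  let ?F = "\<lambda>w. f (fst w)"
  let ?d = "\<lambda>x. elem_der R W ?F (lie_map R V W stab_incl x) \<ominus>\<^bsub>Der R W\<^esub> plug_der 0 0 (fox R V f x)"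
  note D1 = Der1_sub[OF W_module] and WD = Der_module[OF W_module]
  have F: "?F \<in> mod_hom R W (self_mod R)"
    by (rule hom_comp[OF dsum_fst_hom f])
  have l00: "plug_der 0 0 \<in> mod_hom R (LP R V) (Der R W)" by (rule plug_der_hom) simp
  have h: "?d \<in> mod_hom R (Lie R V) (Der R W)"
    by (rule hom_diff_map[OF WD hom_comp[OF stab_incl_lin elem_der_hom[OF W_module F]] hom_comp[OF fox_hom[OF V f] l00]])
  have step: "y \<in> {y \<in> carrier (Lie R V). ?d (gen R V u \<otimes>\<^bsub>Lie R V\<^esub> y) \<in> Der1 R W}" (is "y \<in> ?H")
    if u: "u \<in> carrier V" and y: "y \<in> carrier (Lie R V)" for u y
  proof (rule Lie_split_induct[OF V _ _ _ y])
    note uc = gen_carrier[OF V u] and iu = hom_closed[OF stab_incl_hom u]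
    show "submodule ?H R (Lie R V)"
      by (rule sub_vimage[OF _ WD hom_comp[OF bil_hom1[OF Lie_bilin[OF V] uc] h] D1]) simp
    show "gen R V w \<in> ?H" if w: "w \<in> carrier V" for w
    proof -
      have "lie_map R V W stab_incl (gen R V u \<otimes>\<^bsub>Lie R V\<^esub> gen R V w) \<in> lie_part R W {2}"
        by (rule lie_map_part[OF V W_module stab_incl_hom lie_two_incl[OF V u w]])
      then have "elem_der R W ?F (lie_map R V W stab_incl (gen R V u \<otimes>\<^bsub>Lie R V\<^esub> gen R V w)) \<in> Der1 R W"
        by (intro Der1_deg_one[OF W_module] elem_der_part[OF W_module F])
      moreover have "fox R V f (gen R V u \<otimes>\<^bsub>Lie R V\<^esub> gen R V w) \<in> lin_low R V"
        using u w hom_closed[OF f] by (simp add: fox_two[OF V f] lin_low_gen)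
      ultimately show ?thesis using w uc sub_diff[OF WD D1] plug_der_low by simp
    qed
    fix y assume y: "y \<in> lie_part R V {2..}"
    note yc = lie_part_closed[OF V y]
    let ?b = "gen R W (stab_incl u) \<otimes>\<^bsub>Lie R W\<^esub> gen R W (fresh 0)" and ?z = "pt_gen R V u \<otimes>\<^bsub>LP R V\<^esub> pt_one R V"
    let ?p = "pt_der R V ?z (fox R V f y)" and ?x = "gen R V u \<otimes>\<^bsub>Lie R V\<^esub> y"
    have z: "?z \<in> lin_pos R V" using u by simp
    have fy: "fox R V f y \<in> lin_pos R V" by (rule fox_pos[OF V f y])
    have xc: "?x \<in> carrier (Lie R V)" using uc yc by simp
    have pc: "?p \<in> carrier (LP R V)" "fox R V f ?x \<in> carrier (LP R V)" using z fy f xc by simp_all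
    have bp: "?b \<in> lie_part R W {2}" by (rule lie_two_incl[OF W_module iu fresh_closed])
    have 1: "elem_der R W ?F ?b \<in> Der1 R W"
      by (rule Der1_deg_one[OF W_module elem_der_part[OF W_module F bp]])
    have 2: "elem_der R W (coord 0) (lie_map R V W stab_incl y) \<in> Der1 R W"
    proof (rule fresh_coordinate[OF V stab_incl_hom _ _ _ y, of "{..<3}"])
      fix s :: nat
      show "\<exists>c\<in>{..<3}. c \<noteq> s" by (cases "s = 0") (auto intro: bexI[of _ 0] bexI[of _ 1])
    qed (auto simp: coord_stab_incl)
    have "der_bracket R W (elem_der R W ?F ?b) (elem_der R W (coord 0) (lie_map R V W stab_incl y)) =
        elem_der R W ?F (lie_map R V W stab_incl ?x) \<ominus>\<^bsub>Der R W\<^esub> plug_der 0 0 ?p"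
      using insert_bracket[OF F zero_less_numeral iu coord_stab_incl[OF zero_less_numeral] stab_incl_closed[OF yc]]
      by (simp add: stab_incl_der_fox[OF f u yc] plug_der_def stab_incl_mult[OF uc yc] stab_incl_gen[OF u])
    then have 3: "elem_der R W ?F (lie_map R V W stab_incl ?x) \<ominus>\<^bsub>Der R W\<^esub> plug_der 0 0 ?p \<in> Der1 R W"
      using Der1_bracket[OF W_module 1 2] by simp
    have "fox R V f ?x \<ominus>\<^bsub>LP R V\<^esub> ?p \<in> lin_comm R V"
    proof -
      have a: "pt_one R V \<otimes>\<^bsub>LP R V\<^esub> pt_incl R V y = \<ominus>\<^bsub>LP R V\<^esub> (pt_incl R V y \<otimes>\<^bsub>LP R V\<^esub> pt_one R V)"
        by (rule lie_antisym[OF LP_lie[OF V]]) (use yc in simp_all)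
      have "f u \<odot>\<^bsub>LP R V\<^esub> (pt_one R V \<otimes>\<^bsub>LP R V\<^esub> pt_incl R V y) \<in> lin_comm R V"
        unfolding a using hom_closed[OF f u] incl_pos_comm[OF V y]
        by (intro sub_smult[OF _ lin_comm_sub[OF V]] sub_neg[OF _ lin_comm_sub[OF V]]) simp_all
      moreover have "pt_der R V (fox R V f y) ?z \<ominus>\<^bsub>LP R V\<^esub> ?p \<in> lin_comm R V" by (rule lin_comm_incl[OF V z fy])
      ultimately have "f u \<odot>\<^bsub>LP R V\<^esub> (pt_one R V \<otimes>\<^bsub>LP R V\<^esub> pt_incl R V y) \<oplus>\<^bsub>LP R V\<^esub>
          (pt_der R V (fox R V f y) ?z \<ominus>\<^bsub>LP R V\<^esub> ?p) \<in> lin_comm R V"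
        by (intro sub_add[OF _ lin_comm_sub[OF V]]) simp_all
      also have "f u \<odot>\<^bsub>LP R V\<^esub> (pt_one R V \<otimes>\<^bsub>LP R V\<^esub> pt_incl R V y) \<oplus>\<^bsub>LP R V\<^esub>
          (pt_der R V (fox R V f y) ?z \<ominus>\<^bsub>LP R V\<^esub> ?p) = fox R V f ?x \<ominus>\<^bsub>LP R V\<^esub> ?p"
        using pc u yc f fy hom_closed[OF f u]
        by (simp add: fox_mult[OF V f uc yc] fox_gen[OF V f u] pt_der_step_gen[OF V u] bil_lsmult mod_diff_eq mod_assoc)
      finally show ?thesis .
    qed
    then have 4: "plug_der 0 0 (fox R V f ?x \<ominus>\<^bsub>LP R V\<^esub> ?p) \<in> Der1 R W" by (intro plug_der_low lin_low_comm[OF V])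
    let ?e = "elem_der R W ?F (lie_map R V W stab_incl ?x)"
    have ec: "?e \<in> carrier (Der R W)" using elem_der_der[OF W_module F stab_incl_closed[OF xc]] by simp
    note lc = hom_closed[OF l00 pc(1)] hom_closed[OF l00 pc(2)]
    have "(?e \<ominus>\<^bsub>Der R W\<^esub> plug_der 0 0 ?p) \<ominus>\<^bsub>Der R W\<^esub> plug_der 0 0 (fox R V f ?x \<ominus>\<^bsub>LP R V\<^esub> ?p) \<in> Der1 R W"
      by (rule sub_diff[OF WD D1 3 4])
    also have "(?e \<ominus>\<^bsub>Der R W\<^esub> plug_der 0 0 ?p) \<ominus>\<^bsub>Der R W\<^esub> plug_der 0 0 (fox R V f ?x \<ominus>\<^bsub>LP R V\<^esub> ?p) = ?d ?x"
      using ec lc WD unfolding hom_diff[OF LP_module[OF V] WD l00 pc(2,1)]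
      by (simp add: mod_ac del: Der_sel)
    finally show "y \<in> ?H" using yc by simp
  qed
  have "x \<in> {x \<in> carrier (Lie R V). ?d x \<in> Der1 R W}"
  proof (rule lie_pos_induct[OF V _ _ x])
    show "submodule {x \<in> carrier (Lie R V). ?d x \<in> Der1 R W} R (Lie R V)"
      by (rule sub_vimage[OF _ WD h D1]) simp
    show "gen R V u \<otimes>\<^bsub>Lie R V\<^esub> y \<in> {x \<in> carrier (Lie R V). ?d x \<in> Der1 R W}"
      if "u \<in> carrier V" "y \<in> carrier (Lie R V)" for u y
      using step[OF that] that by simp
  qed
  then show ?thesis by simp
qed

end

context
  fixes V :: "('a, 'v) module"
  assumes free: "free_fin_rank R V"
begin

lemmas [simp] = free_mod[OF free]

lemma stabilize_reduce:
  assumes d: "d \<in> part_ders R V {2..}"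
  shows "Der_map R V (dsum V (pow_mod R 3)) (stab_mor R 3) d \<ominus>\<^bsub>Der R (dsum V (pow_mod R 3))\<^esub> plug_der V 0 0 (div_lin R V d)
    \<in> Der1 R (dsum V (pow_mod R 3))"
proof -
  let ?W = "dsum V (pow_mod R 3)" and ?i = "stab_incl"
  note WM = W_module[OF free_mod[OF free]] and WD = Der_module[OF W_module[OF free_mod[OF free]]] and D1 = Der1_sub[OF W_module[OF free_mod[OF free]]]
  note mor = stab_mor(2)[OF free_mod[OF free]]
  have lp: "lie_part R V {2..} \<subseteq> carrier (Lie R V)" by (rule subsetI) simp
  have "d \<in> {d \<in> carrier (Der R V). Der_map R V ?W (?i, fst) d \<ominus>\<^bsub>Der R ?W\<^esub> plug_der V 0 0 (div_lin R V d) \<in> Der1 R ?W}"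
  proof (rule Der_span_induct[OF free _ _ lp])
    show "submodule {d \<in> carrier (Der R V). Der_map R V ?W (?i, fst) d \<ominus>\<^bsub>Der R ?W\<^esub> plug_der V 0 0 (div_lin R V d) \<in> Der1 R ?W} R (Der R V)"
      by (rule sub_vimage[OF Der_module[OF free_mod[OF free]] WD hom_diff_map[OF WD Der_map_hom[OF free_mod[OF free] WM mor]
              hom_comp[OF div_lin_hom[OF free] plug_der_hom[OF free_mod[OF free] zero_less_numeral]]] D1])
    fix f x assume f: "f \<in> mod_hom R V (self_mod R)" and x: "x \<in> lie_part R V {2..}"
    note xc = lie_part_closed[OF free_mod[OF free] x]
    show "elem_der R V f x \<in> {d \<in> carrier (Der R V). Der_map R V ?W (?i, fst) d \<ominus>\<^bsub>Der R ?W\<^esub> plug_der V 0 0 (div_lin R V d) \<in> Der1 R ?W}"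
      using elem_der_reduce[OF free_mod[OF free] f x] elem_der_der[OF free_mod[OF free] f xc]
      by (simp add: Der_map_elem[OF free_mod[OF free] WM mor f xc] div_lin_elem[OF free f xc])
  qed (use d in \<open>simp_all add: part_ders_gen\<close>)
  then show ?thesis by (simp add: stab_mor(1)[OF free_mod[OF free]])
qed

text \<open>If the divergence of \<open>d\<close> is that of an element of \<open>Der\<^sup>(\<^sup>1\<^sup>)\<close>, then it is a commutator plus some \<open>[v,1]\<close>.
  After stabilization \<open>d\<close> is determined modulo \<open>Der\<^sup>(\<^sup>1\<^sup>)\<close> by its divergence, and for such a divergence it
  vanishes there.\<close>

theorem kernel_torsion:
  assumes X: "X \<in> Div_kernel R V"
  shows "div_source_map R V (dsum V (pow_mod R 3)) (stab_mor R 3) X = \<zero>\<^bsub>div_source R (dsum V (pow_mod R 3))\<^esub>"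
proof -
  let ?W = "dsum V (pow_mod R 3)" and ?i = "stab_incl"
  note WM = W_module[OF free_mod[OF free]] and WD = Der_module[OF W_module[OF free_mod[OF free]]] and D1 = Der1_sub[OF W_module[OF free_mod[OF free]]]
  note mor = stab_mor(2)[OF free_mod[OF free]]
  obtain d where d: "d \<in> part_ders R V {2..}" "X = Der1 R V +>\<^bsub>Der_pos R V\<^esub> d"
    using X free_mod[OF free] by (auto simp: Div_kernel_def div_source_def quot_carrier)
  have "Div R V d \<in> Im_Div R V"
  proof -
    have "Im_Div R V +>\<^bsub>abel R (Der_pt_pos R V)\<^esub> Div R V d = \<zero>\<^bsub>div_target R V\<^esub>"
      using X d Div_bar_coset[OF free d(1)] by (simp add: Div_kernel_def)
    then show ?thesis
      unfolding div_target_def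
      using coset_zero_iff[OF abel_module[OF free_mod[OF free]] Im_Div_sub[OF free]] hom_closed[OF Div_hom[OF free], of d] d(1) by simp
  qed
  then obtain d1 where d1: "d1 \<in> Der1 R V" "Div R V d = Div R V d1" by (auto simp: Im_Div_def)
  note p1 = Der1_pos[OF free_mod[OF free] d1(1)]
  note lp = div_lin_lin_pos[OF free d(1)] div_lin_lin_pos[OF free p1]
  have "div_lin R V d \<ominus>\<^bsub>LP R V\<^esub> div_lin R V d1 \<in> lin_comm R V"
    using d1(2) by (simp add: Div_der_class[OF free d(1)] Div_der_class[OF free p1] der_class_eq_iff[OF free_mod[OF free] lp])
  then have "(div_lin R V d \<ominus>\<^bsub>LP R V\<^esub> div_lin R V d1) \<oplus>\<^bsub>LP R V\<^esub> div_lin R V d1 \<in> lin_low R V"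
    by (intro sub_add[OF LP_module[OF free_mod[OF free]] lin_low_sub[OF free_mod[OF free]]] lin_low_comm[OF free_mod[OF free]] div_lin_Der1[OF free d1(1)])
  moreover have "(div_lin R V d \<ominus>\<^bsub>LP R V\<^esub> div_lin R V d1) \<oplus>\<^bsub>LP R V\<^esub> div_lin R V d1 = div_lin R V d"
    using lin_pos_closed[OF free_mod[OF free] lp(1)] lin_pos_closed[OF free_mod[OF free] lp(2)] LP_module[OF free_mod[OF free]] by (simp add: mod_ac)
  ultimately have low: "div_lin R V d \<in> lin_low R V" by simp
  let ?m = "Der_map R V ?W (?i, fst) d" and ?l = "plug_der V 0 0 (div_lin R V d)"
  have mc: "?m \<in> carrier (Der R ?W)" using Der_map_der[OF free_mod[OF free] WM mor part_ders_der[OF free_mod[OF free] d(1)]] by simp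
  have lc: "?l \<in> carrier (Der R ?W)" using plug_der_closed[OF free_mod[OF free] zero_less_numeral lin_pos_closed[OF free_mod[OF free] lp(1)]] by simp
  have "(?m \<ominus>\<^bsub>Der R ?W\<^esub> ?l) \<oplus>\<^bsub>Der R ?W\<^esub> ?l \<in> Der1 R ?W"
    using stabilize_reduce[OF d(1)] plug_der_low[OF free_mod[OF free] low]
    by (intro sub_add[OF WD D1]) (simp_all add: stab_mor(1)[OF free_mod[OF free]])
  moreover have "(?m \<ominus>\<^bsub>Der R ?W\<^esub> ?l) \<oplus>\<^bsub>Der R ?W\<^esub> ?l = ?m" using mc lc WD by (simp add: mod_ac del: Der_sel)
  ultimately have "?m \<in> Der1 R ?W" by simp
  then have "Der1 R ?W +>\<^bsub>Der_pos R ?W\<^esub> ?m = \<zero>\<^bsub>div_source R ?W\<^esub>"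
    unfolding div_source_def
    using coset_zero_iff[OF Der_pos_module[OF WM] Der1_sub_pos[OF WM]] Der_map_part[OF free_mod[OF free] WM mor d(1)] Der_pos_carrier[OF WM] by simp
  then show ?thesis
    using source_map_coset[OF free_mod[OF free] WM mor d(1)] by (simp add: d(2) stab_mor(1)[OF free_mod[OF free]])
qed

end

end

section \<open>Comparison with the tensor algebra\<close>

context cring
begin

lemma word_free: "free_on R (word_alg R V) (lists (carrier V))"
  by (simp add: free_on_def word_alg_def)

lemmas word_module[simp] = free_module[OF word_free]

lemma word_basis: "w \<in> lists (carrier V) \<Longrightarrow> basis_elem R w \<in> carrier (word_alg R V)"
  by (rule basis_carrier[OF word_free])

lemma word_mult: "(f \<otimes>\<^bsub>word_alg R V\<^esub> g) w = (\<Oplus>k\<in>{..length w}. f (take k w) \<otimes> g (drop k w))"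
  by (simp add: word_alg_def)

lemma word_bilin[simp]: "bilin_alg R (word_alg R V)"
proof -
  let ?W = "word_alg R V"
  note c = free_carrier_iff[OF word_free] and s = free_add[OF word_free] free_smult[OF word_free]
  have val: "f w \<in> carrier R" if "f \<in> carrier ?W" for f w using that by (simp add: c)
  have cl: "f \<otimes>\<^bsub>?W\<^esub> g \<in> carrier ?W" if f: "f \<in> carrier ?W" and g: "g \<in> carrier ?W" for f g
  proof -
    have ex: "\<exists>k. f (take k w) \<noteq> \<zero> \<and> g (drop k w) \<noteq> \<zero>" if "(f \<otimes>\<^bsub>?W\<^esub> g) w \<noteq> \<zero>" for w
    proof (rule ccontr)
      assume "\<not> ?thesis"
      then have "f (take k w) \<otimes> g (drop k w) = \<zero>" for k using val[OF f] val[OF g] by (cases "f (take k w) = \<zero>") auto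
      then have "(f \<otimes>\<^bsub>?W\<^esub> g) w = \<zero>" by (simp add: word_mult)
      then show False using that by simp
    qed
    have "{w. (f \<otimes>\<^bsub>?W\<^esub> g) w \<noteq> \<zero>} \<subseteq> case_prod (@) ` ({x. f x \<noteq> \<zero>} \<times> {x. g x \<noteq> \<zero>})"
    proof
      fix w assume "w \<in> {w. (f \<otimes>\<^bsub>?W\<^esub> g) w \<noteq> \<zero>}"
      then obtain k where "f (take k w) \<noteq> \<zero>" "g (drop k w) \<noteq> \<zero>" using ex by auto
      then show "w \<in> case_prod (@) ` ({x. f x \<noteq> \<zero>} \<times> {x. g x \<noteq> \<zero>})"
        by (intro image_eqI[of _ _ "(take k w, drop k w)"]) auto
    qed
    moreover have "finite (case_prod (@) ` ({x. f x \<noteq> \<zero>} \<times> {x. g x \<noteq> \<zero>}))" using f g by (simp add: c)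
    moreover have "w \<in> lists (carrier V)" if w: "(f \<otimes>\<^bsub>?W\<^esub> g) w \<noteq> \<zero>" for w
    proof -
      obtain k where "f (take k w) \<noteq> \<zero>" "g (drop k w) \<noteq> \<zero>" using ex[OF w] by auto
      then have "take k w \<in> lists (carrier V)" "drop k w \<in> lists (carrier V)" using f g by (simp_all add: c)
      then show ?thesis using append_in_lists_conv[of "take k w" "drop k w"] by simp
    qed
    moreover have "(f \<otimes>\<^bsub>?W\<^esub> g) w \<in> carrier R" for w
      unfolding word_mult using val[OF f] val[OF g] by (intro finsum_closed) auto
    ultimately show ?thesis unfolding c using finite_subset by blast
  qed
  show ?thesis
    unfolding bilin_alg_def
  proof (intro conjI ballI mod_homI word_module cl; assumption?)
    fix x y z assume *: "x \<in> carrier ?W" "y \<in> carrier ?W" "z \<in> carrier ?W"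
    note v = val[OF *(1)] val[OF *(2)] val[OF *(3)]
    show "x \<otimes>\<^bsub>?W\<^esub> (y \<oplus>\<^bsub>?W\<^esub> z) = x \<otimes>\<^bsub>?W\<^esub> y \<oplus>\<^bsub>?W\<^esub> x \<otimes>\<^bsub>?W\<^esub> z"
      "(y \<oplus>\<^bsub>?W\<^esub> z) \<otimes>\<^bsub>?W\<^esub> x = y \<otimes>\<^bsub>?W\<^esub> x \<oplus>\<^bsub>?W\<^esub> z \<otimes>\<^bsub>?W\<^esub> x"
      by (rule ext, simp add: word_mult s v r_distr l_distr finsum_addf Pi_def)+
  next
    fix x y a assume *: "x \<in> carrier ?W" "y \<in> carrier ?W" and a: "a \<in> carrier R"
    note v = val[OF *(1)] val[OF *(2)]
    show "x \<otimes>\<^bsub>?W\<^esub> (a \<odot>\<^bsub>?W\<^esub> y) = a \<odot>\<^bsub>?W\<^esub> (x \<otimes>\<^bsub>?W\<^esub> y)"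
      "(a \<odot>\<^bsub>?W\<^esub> y) \<otimes>\<^bsub>?W\<^esub> x = a \<odot>\<^bsub>?W\<^esub> (y \<otimes>\<^bsub>?W\<^esub> x)"
      by (rule ext, simp add: word_mult s v a m_ac finsum_rdistr Pi_def)+
  qed
qed

lemma word_basis_mult: "basis_elem R u \<otimes>\<^bsub>word_alg R V\<^esub> basis_elem R v = basis_elem R (u @ v)"
proof
  fix w
  have "(basis_elem R u \<otimes>\<^bsub>word_alg R V\<^esub> basis_elem R v) w =
      (\<Oplus>k\<in>{..length w}. if length u = k \<and> w = u @ v then \<one> else \<zero>)"
    unfolding word_mult
  proof (rule finsum_cong')
    fix k assume "k \<in> {..length w}"
    then have "take k w = u \<and> drop k w = v \<longleftrightarrow> length u = k \<and> w = u @ v"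
      by (metis append_eq_conv_conj append_take_drop_id atMost_iff length_take min.absorb2)
    then show "basis_elem R u (take k w) \<otimes> basis_elem R v (drop k w) = (if length u = k \<and> w = u @ v then \<one> else \<zero>)"
      by (auto simp: basis_elem_def)
  qed auto
  also have "\<dots> = basis_elem R (u @ v) w"
  proof (cases "w = u @ v")
    case True
    then have "(\<Oplus>k\<in>{..length w}. if length u = k \<and> w = u @ v then \<one> else \<zero>) = (\<Oplus>k\<in>{..length w}. if length u = k then \<one> else \<zero>)"
      by simp
    also have "\<dots> = \<one>" using True by (intro finsum_singleton[where f = "\<lambda>k. \<one>"]) auto
    finally show ?thesis using True by (simp add: basis_elem_def)
  qed (simp add: basis_elem_def)
  finally show "(basis_elem R u \<otimes>\<^bsub>word_alg R V\<^esub> basis_elem R v) w = basis_elem R (u @ v) w" .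
qed

lemma assoc_by_span:
  assumes A: "bilin_alg R A" and G: "G \<subseteq> carrier A" "carrier A = span_of R A G"
    and eq: "\<And>x y z. x \<in> G \<Longrightarrow> y \<in> G \<Longrightarrow> z \<in> G \<Longrightarrow> (x \<otimes>\<^bsub>A\<^esub> y) \<otimes>\<^bsub>A\<^esub> z = x \<otimes>\<^bsub>A\<^esub> (y \<otimes>\<^bsub>A\<^esub> z)"
    and xyz: "x \<in> carrier A" "y \<in> carrier A" "z \<in> carrier A"
  shows "(x \<otimes>\<^bsub>A\<^esub> y) \<otimes>\<^bsub>A\<^esub> z = x \<otimes>\<^bsub>A\<^esub> (y \<otimes>\<^bsub>A\<^esub> z)"
proof -
  note [simp] = A and h1 = bil_hom1[OF A] and h2 = bil_hom2[OF A] and m = bilin_module[OF A]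
  have Gc[simp]: "x \<in> G \<Longrightarrow> x \<in> carrier A" for x using G(1) by blast
  have S: "x \<in> carrier A \<Longrightarrow> x \<in> span_of R A G" for x using G(2) by simp
  have 1: "(x \<otimes>\<^bsub>A\<^esub> y) \<otimes>\<^bsub>A\<^esub> z = x \<otimes>\<^bsub>A\<^esub> (y \<otimes>\<^bsub>A\<^esub> z)" if "x \<in> G" "y \<in> G" "z \<in> carrier A" for x y z
    by (rule span_hom_eq[OF m m h1 hom_comp[OF h1 h1] G(1)]) (use that eq in \<open>simp_all add: S\<close>)
  have 2: "(x \<otimes>\<^bsub>A\<^esub> y) \<otimes>\<^bsub>A\<^esub> z = x \<otimes>\<^bsub>A\<^esub> (y \<otimes>\<^bsub>A\<^esub> z)" if "x \<in> G" "y \<in> carrier A" "z \<in> carrier A" for x y z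
    by (rule span_hom_eq[OF m m hom_comp[OF h1 h2] hom_comp[OF h2 h1] G(1)]) (use that 1 in \<open>simp_all add: S\<close>)
  show ?thesis
    by (rule span_hom_eq[OF m m hom_comp[OF h2 h2] h2 G(1)]) (use xyz 2 in \<open>simp_all add: S\<close>)
qed

lemma iso_comm_span:
  assumes A: "module R A" and B: "module R B" and f: "f \<in> mod_iso R A B"
    and cl: "\<And>x y. x \<in> carrier A \<Longrightarrow> y \<in> carrier A \<Longrightarrow> x \<otimes>\<^bsub>A\<^esub> y \<in> carrier A"
    and mult: "\<And>x y. x \<in> carrier A \<Longrightarrow> y \<in> carrier A \<Longrightarrow> f (x \<otimes>\<^bsub>A\<^esub> y) = f x \<otimes>\<^bsub>B\<^esub> f y"
  shows "f ` comm_span R A = comm_span R B"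
proof -
  have h: "f \<in> mod_hom R A B" and s: "carrier B = f ` carrier A" using f by (auto simp: mod_iso_def bij_betw_def)
  let ?G = "\<lambda>A. {x \<otimes>\<^bsub>A\<^esub> y \<ominus>\<^bsub>A\<^esub> y \<otimes>\<^bsub>A\<^esub> x | x y. x \<in> carrier A \<and> y \<in> carrier A}"
  have e: "f (x \<otimes>\<^bsub>A\<^esub> y \<ominus>\<^bsub>A\<^esub> y \<otimes>\<^bsub>A\<^esub> x) = f x \<otimes>\<^bsub>B\<^esub> f y \<ominus>\<^bsub>B\<^esub> f y \<otimes>\<^bsub>B\<^esub> f x" if "x \<in> carrier A" "y \<in> carrier A" for x y
    using that by (simp add: hom_diff[OF A B h] cl mult)
  have "f ` ?G A = {x \<otimes>\<^bsub>B\<^esub> y \<ominus>\<^bsub>B\<^esub> y \<otimes>\<^bsub>B\<^esub> x | x y. x \<in> carrier B \<and> y \<in> carrier B}"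
  proof
    show "f ` ?G A \<subseteq> {x \<otimes>\<^bsub>B\<^esub> y \<ominus>\<^bsub>B\<^esub> y \<otimes>\<^bsub>B\<^esub> x | x y. x \<in> carrier B \<and> y \<in> carrier B}"
      using e hom_closed[OF h] by blast
    show "{x \<otimes>\<^bsub>B\<^esub> y \<ominus>\<^bsub>B\<^esub> y \<otimes>\<^bsub>B\<^esub> x | x y. x \<in> carrier B \<and> y \<in> carrier B} \<subseteq> f ` ?G A"
    proof
      fix b assume "b \<in> {x \<otimes>\<^bsub>B\<^esub> y \<ominus>\<^bsub>B\<^esub> y \<otimes>\<^bsub>B\<^esub> x | x y. x \<in> carrier B \<and> y \<in> carrier B}"
      then obtain x y where "x \<in> carrier A" "y \<in> carrier A" "b = f (x \<otimes>\<^bsub>A\<^esub> y \<ominus>\<^bsub>A\<^esub> y \<otimes>\<^bsub>A\<^esub> x)"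
        unfolding s using e by auto
      then show "b \<in> f ` ?G A" by blast
    qed
  qed
  then show ?thesis
    unfolding comm_span_def using A cl by (subst span_image[OF A B h]) auto
qed

context
  fixes V :: "('a, 'v) module"
  assumes V[simp]: "module R V"
begin

lemma tensor_rels_carrier: "tensor_rels R V \<subseteq> carrier (word_alg R V)"
  using basis_carrier[OF word_free, of _ V] by (auto simp: tensor_rels_def Let_def)

lemma tensor_ideal_two_sided: "two_sided_ideal R (word_alg R V) (tensor_ideal R V)"
  unfolding tensor_ideal_def by (rule ideal_two_sided[OF word_bilin tensor_rels_carrier])

lemma tensor_ideal_sub: "submodule (tensor_ideal R V) R (word_alg R V)"
  using tensor_ideal_two_sided by (simp add: two_sided_ideal_def)

lemma tensor_bilin[simp]: "bilin_alg R (tensor_alg R V)"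
  unfolding tensor_alg_def by (rule quot_bilin[OF word_bilin tensor_ideal_two_sided])

lemma tensor_module[simp]: "module R (tensor_alg R V)"
  by simp

lemma word_class_closed: "w \<in> lists (carrier V) \<Longrightarrow> word_class R V w \<in> carrier (tensor_alg R V)"
  unfolding word_class_def tensor_alg_def quot_carrier by (rule imageI) (rule basis_carrier[OF word_free])

lemma word_class_mult: "u \<in> lists (carrier V) \<Longrightarrow> v \<in> lists (carrier V) \<Longrightarrow>
    word_class R V u \<otimes>\<^bsub>tensor_alg R V\<^esub> word_class R V v = word_class R V (u @ v)"
  unfolding word_class_def tensor_alg_def
  by (simp add: coset_mult_eq[OF word_bilin tensor_ideal_two_sided] basis_carrier[OF word_free] word_basis_mult del: in_lists_conv_set)

lemma tensor_span: "carrier (tensor_alg R V) = span_of R (tensor_alg R V) (word_class R V ` lists (carrier V))"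
proof -
  let ?A = "word_alg R V"
  have "carrier (tensor_alg R V) = (\<lambda>x. tensor_ideal R V +>\<^bsub>?A\<^esub> x) ` span_of R ?A (basis_elem R ` lists (carrier V))"
    by (simp add: tensor_alg_def quot_carrier free_span[OF word_free, of V, symmetric])
  also have "\<dots> = span_of R (tensor_alg R V) ((\<lambda>x. tensor_ideal R V +>\<^bsub>?A\<^esub> x) ` basis_elem R ` lists (carrier V))"
    unfolding tensor_alg_def using basis_carrier[OF word_free, of _ V]
    by (intro span_image[OF word_module module_quot[OF word_module tensor_ideal_sub]
          proj_hom[OF word_module tensor_ideal_sub]]) blast
  finally show ?thesis by (simp add: image_image word_class_def)
qed

lemma word_classes: "word_class R V ` lists (carrier V) \<subseteq> carrier (tensor_alg R V)"
  by (rule image_subsetI) (rule word_class_closed)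

lemma tensor_assoc:
  "x \<in> carrier (tensor_alg R V) \<Longrightarrow> y \<in> carrier (tensor_alg R V) \<Longrightarrow> z \<in> carrier (tensor_alg R V) \<Longrightarrow>
    (x \<otimes>\<^bsub>tensor_alg R V\<^esub> y) \<otimes>\<^bsub>tensor_alg R V\<^esub> z = x \<otimes>\<^bsub>tensor_alg R V\<^esub> (y \<otimes>\<^bsub>tensor_alg R V\<^esub> z)"
proof (rule assoc_by_span[OF tensor_bilin word_classes tensor_span]; assumption?)
  fix x y z assume "x \<in> word_class R V ` lists (carrier V)" "y \<in> word_class R V ` lists (carrier V)" "z \<in> word_class R V ` lists (carrier V)"
  then obtain u v w where w: "u \<in> lists (carrier V)" "v \<in> lists (carrier V)" "w \<in> lists (carrier V)"
    "x = word_class R V u" "y = word_class R V v" "z = word_class R V w" by blast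
  have uv: "u @ v \<in> lists (carrier V)" "v @ w \<in> lists (carrier V)" using w(1-3) by simp_all
  show "(x \<otimes>\<^bsub>tensor_alg R V\<^esub> y) \<otimes>\<^bsub>tensor_alg R V\<^esub> z = x \<otimes>\<^bsub>tensor_alg R V\<^esub> (y \<otimes>\<^bsub>tensor_alg R V\<^esub> z)"
    unfolding w(4-6) word_class_mult[OF w(1,2)] word_class_mult[OF w(2,3)] word_class_mult[OF uv(1) w(3)] word_class_mult[OF w(1) uv(2)]
    by simp
qed

lemma word_class_hom: "(\<lambda>v. word_class R V [v]) \<in> mod_hom R V (tensor_alg R V)"
proof -
  let ?A = "word_alg R V" and ?I = "tensor_ideal R V"
  have incl: "x \<in> tensor_rels R V \<Longrightarrow> x \<in> ?I" for x by (simp add: tensor_ideal_def ideal_incl)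
  have b: "basis_elem R [v] \<in> carrier ?A" if "v \<in> carrier V" for v by (rule word_basis) (use that in simp)
  note e = coset_add_eq[OF word_module tensor_ideal_sub] coset_smult_eq[OF word_module tensor_ideal_sub]
  show ?thesis
  proof (rule mod_homI)
    fix v w assume vw: "v \<in> carrier V" "w \<in> carrier V"
    then have "basis_elem R [v \<oplus>\<^bsub>V\<^esub> w] \<ominus>\<^bsub>?A\<^esub> (basis_elem R [v] \<oplus>\<^bsub>?A\<^esub> basis_elem R [w]) \<in> ?I"
      by (intro incl) (unfold tensor_rels_def Let_def, blast)
    then show "word_class R V [v \<oplus>\<^bsub>V\<^esub> w] = word_class R V [v] \<oplus>\<^bsub>tensor_alg R V\<^esub> word_class R V [w]"
      using vw by (simp add: word_class_def tensor_alg_def e b coset_eq_iff[OF word_module tensor_ideal_sub])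
  next
    fix a v assume av: "a \<in> carrier R" "v \<in> carrier V"
    then have "basis_elem R [a \<odot>\<^bsub>V\<^esub> v] \<ominus>\<^bsub>?A\<^esub> (a \<odot>\<^bsub>?A\<^esub> basis_elem R [v]) \<in> ?I"
      by (intro incl) (unfold tensor_rels_def Let_def, blast)
    then show "word_class R V [a \<odot>\<^bsub>V\<^esub> v] = a \<odot>\<^bsub>tensor_alg R V\<^esub> word_class R V [v]"
      using av by (simp add: word_class_def tensor_alg_def e b coset_eq_iff[OF word_module tensor_ideal_sub])
  qed (simp add: word_class_closed)
qed

subsection \<open>A retraction of the free Lie algebra onto the tensor algebra\<close>

text \<open>The tensor algebra acts by left multiplication on itself, and this is a representation of its
  commutator Lie algebra. The derivation with values in it that sends the marked generator to the empty word
  and \<open>V\<close> to zero, over \<open>v \<mapsto> v\<close>, multiplies by \<open>v\<close> on the left when a bracket with \<open>v\<close> is taken.\<close>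

lemma tensor_retraction:
  obtains \<tau> where "\<tau> \<in> mod_hom R (LP R V) (tensor_alg R V)"
    "\<And>w. w \<in> lists (carrier V) \<Longrightarrow> \<tau> (right_normed R V w) = word_class R V w"
proof -
  let ?T = "tensor_alg R V"
  define B where "B = ?T\<lparr>mult := \<lambda>x y. x \<otimes>\<^bsub>?T\<^esub> y \<ominus>\<^bsub>?T\<^esub> y \<otimes>\<^bsub>?T\<^esub> x\<rparr>"
  have sel: "carrier B = carrier ?T" "add B = add ?T" "\<zero>\<^bsub>B\<^esub> = \<zero>\<^bsub>?T\<^esub>" "smult B = smult ?T"
    "\<And>x y. x \<otimes>\<^bsub>B\<^esub> y = x \<otimes>\<^bsub>?T\<^esub> y \<ominus>\<^bsub>?T\<^esub> y \<otimes>\<^bsub>?T\<^esub> x"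
    by (simp_all add: B_def)
  have mB: "module R B" by (rule module_cong[OF tensor_module]) (simp_all add: sel)
  have homB: "mod_hom R M B = mod_hom R M ?T" "mod_hom R B N = mod_hom R ?T N"
    for M :: "('a, 'x, 'm) module_scheme" and N :: "('a, 'y, 'n) module_scheme"
    by (simp_all add: mod_hom_def sel)
  have bB: "bilin_alg R B"
    unfolding bilin_alg_def homB sel
    by (intro conjI ballI mB hom_diff_map tensor_module bil_hom1 bil_hom2 tensor_bilin)
  have lB: "lie_alg R B"
    by (rule lie_algI[OF bB])
      (simp_all add: sel bil_simps bil_ldiff bil_rdiff tensor_assoc, simp_all add: mod_ac)
  have act: "lie_module R B ?T (mult ?T)"
    unfolding lie_module_def homB
    by (simp add: sel bil_hom1 bil_hom2 bil_ldiff tensor_assoc)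
  have h1: "(\<lambda>p. word_class R V [snd p]) \<in> mod_hom R (pt_mod R V) B"
    unfolding homB by (rule hom_comp[OF dsum_snd_hom word_class_hom])
  have e: "word_class R V [] \<in> carrier ?T" by (rule word_class_closed) simp
  have h2: "(\<lambda>p. fst p \<odot>\<^bsub>?T\<^esub> word_class R V []) \<in> mod_hom R (pt_mod R V) ?T"
    by (rule hom_form_smult[OF tensor_module dsum_fst_hom e])
  let ?j = "lie_ext R B (\<lambda>p. word_class R V [snd p])"
  note j = lie_ext_hom[OF P_module[OF V] lB h1] and jg = lie_ext_gen[OF P_module[OF V] lB h1]
  let ?\<tau> = "der_along R (pt_mod R V) B ?T (mult ?T) ?j (\<lambda>p. fst p \<odot>\<^bsub>?T\<^esub> word_class R V [])"
  note D = der_along[OF P_module[OF V] lB act j h2]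
  have jc: "?j z \<in> carrier ?T" if "z \<in> carrier (LP R V)" for z
    using hom_closed[OF alg_hom_hom[OF j] that] by (simp add: sel)
  have j1: "?j (pt_gen R V v) = word_class R V [v]" if "v \<in> carrier V" for v
    using jg that by (simp add: pt_gen_def)
  have t1: "?\<tau> (pt_one R V) = word_class R V []" using D(2) e by (simp add: pt_one_def)
  have t2: "?\<tau> (pt_gen R V v) = \<zero>\<^bsub>?T\<^esub>" if "v \<in> carrier V" for v using D(2) that e by (simp add: pt_gen_def)
  have "?\<tau> (right_normed R V w) = word_class R V w" if "w \<in> lists (carrier V)" for w
    using that
  proof (induction w)
    case Nil
    show ?case using t1 by simp
  next
    case (Cons v w)
    note rc = right_normed_closed[OF V Cons.hyps(2)] and v1 = word_class_closed[of "[v]"]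
    have "?\<tau> (right_normed R V (v # w)) = word_class R V [v] \<otimes>\<^bsub>?T\<^esub> word_class R V w \<ominus>\<^bsub>?T\<^esub>
        ?j (right_normed R V w) \<otimes>\<^bsub>?T\<^esub> \<zero>\<^bsub>?T\<^esub>"
      using D(3)[OF pt_gen_closed[OF V Cons.hyps(1)] rc] Cons by (simp add: j1 t2)
    also have "\<dots> = word_class R V (v # w)"
      using jc[OF rc] Cons.hyps word_class_mult[of "[v]" w] word_class_closed[of "v # w"]
      by (simp add: mod_diff_zero del: in_lists_conv_set)
    finally show ?case .
  qed
  with D(1) that show thesis by blast
qed

subsection \<open>The comparison map\<close>

lemma pt_der_right_normed:
  "u \<in> lists (carrier V) \<Longrightarrow> z \<in> carrier (LP R V) \<Longrightarrow> w \<in> lists (carrier V) \<Longrightarrow>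
    pt_der R V (right_normed R V w) (right_normed R V u) = right_normed R V (u @ w)"
  by (induction u) (use right_normed_closed[OF V] in \<open>simp_all add: pt_der_step_gen del: in_lists_conv_set\<close>)

text \<open>On words, concatenation corresponds to substitution for the marked generator. So the linear
  extension to the free module on words is multiplicative, and its kernel is an ideal, which contains the
  relations of the tensor algebra.\<close>

lemma tensor_to_der:
  shows tensor_to_der_hom: "tensor_to_der R V \<in> alg_hom R (tensor_alg R V) (Der R (pt_mod R V))"
    and tensor_to_der_class: "w \<in> lists (carrier V) \<Longrightarrow> tensor_to_der R V (word_class R V w) = pt_der R V (right_normed R V w)"
proof -
  let ?A = "word_alg R V" and ?D = "Der R (pt_mod R V)" and ?T = "tensor_alg R V" and ?I = "tensor_ideal R V"
  let ?\<phi> = "\<lambda>w. pt_der R V (right_normed R V w)"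
  note DB = Der_bilin[OF P_module[OF V]] and DM = Der_module[OF P_module[OF V]]
  have rc: "?\<phi> w \<in> carrier ?D" if "w \<in> lists (carrier V)" for w
    using pt_der_der[OF V right_normed_closed[OF V that]] by simp
  let ?F = "free_ext R ?D ?\<phi>"
  have Fb: "?F (basis_elem R w) = ?\<phi> w" if "w \<in> lists (carrier V)" for w
    by (rule free_ext_basis[OF word_free DM rc that])
  have F: "?F \<in> alg_hom R ?A ?D"
  proof (rule mult_hom_by_span[OF word_bilin DB free_ext_hom[OF word_free DM rc] _ free_span[OF word_free]])
    show "basis_elem R ` lists (carrier V) \<subseteq> carrier ?A" by (rule image_subsetI) (rule word_basis)
    fix x y assume "x \<in> basis_elem R ` lists (carrier V)" "y \<in> basis_elem R ` lists (carrier V)"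
    then obtain u v where w: "u \<in> lists (carrier V)" "v \<in> lists (carrier V)" "x = basis_elem R u" "y = basis_elem R v" by blast
    have uv: "u @ v \<in> lists (carrier V)" using w(1,2) by simp
    note c = right_normed_closed[OF V w(1)] right_normed_closed[OF V w(2)]
    show "?F (x \<otimes>\<^bsub>?A\<^esub> y) = ?F x \<otimes>\<^bsub>?D\<^esub> ?F y"
      unfolding w(3,4) word_basis_mult Fb[OF uv] Fb[OF w(1)] Fb[OF w(2)] pt_der_mult[OF V c]
        pt_der_right_normed[OF w(1) c(2) w(2)] ..
  qed
  note Fh = alg_hom_hom[OF F]
  have b: "basis_elem R [v] \<in> carrier ?A" if "v \<in> carrier V" for v by (rule word_basis) (use that in simp)
  have g: "(\<lambda>v. ?\<phi> [v]) \<in> mod_hom R V ?D"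
    using hom_comp[OF lin_gen_hom[OF V] pt_der_hom[OF V]] by simp
  have Fb1: "?F (basis_elem R [v]) = ?\<phi> [v]" if "v \<in> carrier V" for v by (rule Fb) (use that in simp)
  have r: "?F x = \<zero>\<^bsub>?D\<^esub>" if "x \<in> tensor_rels R V" for x
  proof -
    from that consider v w where "x = basis_elem R [v \<oplus>\<^bsub>V\<^esub> w] \<ominus>\<^bsub>?A\<^esub> (basis_elem R [v] \<oplus>\<^bsub>?A\<^esub> basis_elem R [w])" "v \<in> carrier V" "w \<in> carrier V"
      | a v where "x = basis_elem R [a \<odot>\<^bsub>V\<^esub> v] \<ominus>\<^bsub>?A\<^esub> a \<odot>\<^bsub>?A\<^esub> basis_elem R [v]" "a \<in> carrier R" "v \<in> carrier V"
      unfolding tensor_rels_def Let_def by blast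
    then show ?thesis
    proof cases
      case 1
      have "?F x = ?\<phi> [v \<oplus>\<^bsub>V\<^esub> w] \<ominus>\<^bsub>?D\<^esub> (?\<phi> [v] \<oplus>\<^bsub>?D\<^esub> ?\<phi> [w])"
        unfolding 1(1) using 1(2,3) b DM by (simp add: hom_diff[OF word_module DM Fh] hom_add[OF Fh] Fb1)
      then show ?thesis
        using hom_add[OF g 1(2,3)] hom_closed[OF g] 1 DM by (simp add: mod_diff_self del: Der_sel)
    next
      case 2
      have "?F x = ?\<phi> [a \<odot>\<^bsub>V\<^esub> v] \<ominus>\<^bsub>?D\<^esub> (a \<odot>\<^bsub>?D\<^esub> ?\<phi> [v])"
        unfolding 2(1) using 2(2,3) b DM by (simp add: hom_diff[OF word_module DM Fh] hom_smult[OF Fh] Fb1)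
      then show ?thesis
        using hom_smult[OF g 2(2,3)] hom_closed[OF g 2(3)] 2 DM by (simp add: mod_diff_self del: Der_sel)
    qed
  qed
  have 0: "?F x = \<zero>\<^bsub>?D\<^esub>" if "x \<in> ?I" for x
  proof -
    have "tensor_rels R V \<subseteq> {x \<in> carrier ?A. ?F x = \<zero>\<^bsub>?D\<^esub>}" using r tensor_rels_carrier by blast
    from ideal_le[OF kernel_two_sided[OF word_bilin DB F] this that[unfolded tensor_ideal_def]] show ?thesis by simp
  qed
  note q = quot_lift_coset[OF word_module tensor_ideal_sub DM Fh 0]
  have qh: "quot_lift ?F \<in> mod_hom R ?T ?D"
    unfolding tensor_alg_def by (rule quot_lift_hom[OF word_module tensor_ideal_sub DM Fh 0])
  have qm: "quot_lift ?F \<in> alg_hom R ?T ?D"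
    unfolding alg_hom_def
  proof (intro CollectI conjI ballI qh)
    fix x y assume "x \<in> carrier ?T" "y \<in> carrier ?T"
    then obtain a b where ab: "a \<in> carrier ?A" "b \<in> carrier ?A" "x = ?I +>\<^bsub>?A\<^esub> a" "y = ?I +>\<^bsub>?A\<^esub> b"
      unfolding tensor_alg_def quot_carrier by blast
    show "quot_lift ?F (x \<otimes>\<^bsub>?T\<^esub> y) = quot_lift ?F x \<otimes>\<^bsub>?D\<^esub> quot_lift ?F y"
      unfolding ab(3,4) tensor_alg_def coset_mult_eq[OF word_bilin tensor_ideal_two_sided ab(1,2)]
      using ab(1,2) by (simp add: q alg_hom_mult[OF F])
  qed
  have qc: "quot_lift ?F (word_class R V w) = ?\<phi> w" if "w \<in> lists (carrier V)" for w
    using Fb[OF that] word_basis[OF that] by (simp add: word_class_def q del: in_lists_conv_set)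
  let ?\<theta> = "restrict (quot_lift ?F) (carrier ?T)"
  have rh: "?\<theta> \<in> mod_hom R ?T ?D" by (rule hom_restrict[OF tensor_module qh])
  have "tensor_to_der R V = ?\<theta>"
    unfolding tensor_to_der_def
  proof (rule the_equality)
    show "?\<theta> \<in> mod_hom R ?T ?D \<inter> extensional (carrier ?T) \<and> (\<forall>w\<in>lists (carrier V). ?\<theta> (word_class R V w) = ?\<phi> w)"
      using rh qc word_class_closed by (auto simp del: in_lists_conv_set)
    fix \<theta> assume \<theta>: "\<theta> \<in> mod_hom R ?T ?D \<inter> extensional (carrier ?T) \<and> (\<forall>w\<in>lists (carrier V). \<theta> (word_class R V w) = ?\<phi> w)"
    show "\<theta> = ?\<theta>"
    proof (rule extensionalityI[of _ "carrier ?T"])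
      fix x assume x: "x \<in> carrier ?T"
      have th: "\<theta> \<in> mod_hom R ?T ?D" using \<theta> by simp
      show "\<theta> x = ?\<theta> x"
      proof (rule span_hom_eq[OF tensor_module DM th rh word_classes _ x[unfolded tensor_span]])
        fix y assume "y \<in> word_class R V ` lists (carrier V)"
        then obtain w where w: "w \<in> lists (carrier V)" "y = word_class R V w" by blast
        then show "\<theta> y = ?\<theta> y" using \<theta> qc[OF w(1)] word_class_closed[OF w(1)] by simp
      qed
    qed (use \<theta> in auto)
  qed
  then show "tensor_to_der R V \<in> alg_hom R ?T ?D"
    "w \<in> lists (carrier V) \<Longrightarrow> tensor_to_der R V (word_class R V w) = ?\<phi> w"
    using alg_hom_restrict[OF tensor_bilin qm] qc word_class_closed by simp_all
qed

lemma tensor_to_der_inj: "inj_on (tensor_to_der R V) (carrier (tensor_alg R V))"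
proof -
  let ?T = "tensor_alg R V"
  obtain \<tau> where \<tau>: "\<tau> \<in> mod_hom R (LP R V) ?T"
    "\<And>w. w \<in> lists (carrier V) \<Longrightarrow> \<tau> (right_normed R V w) = word_class R V w" using tensor_retraction by blast
  have h: "(\<lambda>x. \<tau> (tensor_to_der R V x (pt_one R V))) \<in> mod_hom R ?T ?T"
    by (rule hom_comp[OF hom_comp[OF alg_hom_hom[OF tensor_to_der_hom] der_eval_hom[OF P_module[OF V] pt_one_closed[OF V]]] \<tau>(1)])
  have "\<tau> (tensor_to_der R V x (pt_one R V)) = x" if x: "x \<in> carrier ?T" for x
  proof (rule span_hom_eq[OF tensor_module tensor_module h hom_id word_classes _ x[unfolded tensor_span]])
    fix y assume "y \<in> word_class R V ` lists (carrier V)"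
    then obtain w where w: "w \<in> lists (carrier V)" "y = word_class R V w" by blast
    then show "\<tau> (tensor_to_der R V y (pt_one R V)) = y"
      by (simp add: tensor_to_der_class[OF w(1)] right_normed_closed[OF V w(1)] \<tau>(2)[OF w(1)] del: in_lists_conv_set)
  qed
  then show ?thesis by (rule inj_on_inverseI[where g = "\<lambda>d. \<tau> (d (pt_one R V))"])
qed

lemma pos_words: "word_class R V ` {w \<in> lists (carrier V). w \<noteq> []} \<subseteq> carrier (tensor_alg R V)"
  using word_classes by blast

lemma tensor_pos_sub: "submodule (carrier (tensor_pos R V)) R (tensor_alg R V)"
  using span_sub[OF tensor_module pos_words] by (simp add: tensor_pos_def)

lemma tensor_pos_eq: "tensor_pos R V = (tensor_alg R V)\<lparr>carrier := carrier (tensor_pos R V)\<rparr>"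
  by (simp add: tensor_pos_def)

lemma tensor_pos_module: "module R (tensor_pos R V)"
  by (subst tensor_pos_eq) (rule submodule.submodule_is_module[OF tensor_pos_sub tensor_module])

lemma lin_pos_span: "lin_pos R V = span_of R (LP R V) (right_normed R V ` {w \<in> lists (carrier V). w \<noteq> []})"
    (is "_ = ?S")
proof
  have rc: "right_normed R V ` {w \<in> lists (carrier V). w \<noteq> []} \<subseteq> carrier (LP R V)"
    using right_normed_subset[OF V] by blast
  have S: "submodule ?S R (LP R V)" by (rule span_sub[OF LP_module[OF V] rc])
  have "right_normed R V w \<in> lin_pos R V" if "w \<in> lists (carrier V)" "w \<noteq> []" for w
  proof (cases w)
    case (Cons v u)
    then have vu: "v \<in> carrier V" "u \<in> lists (carrier V)" using that by auto
    have "right_normed R V u \<in> lie_lin R V (self_mod R)"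
      unfolding lie_lin_span[OF V] using vu(2) by (intro span_incl imageI)
    then show ?thesis using Cons vu(1) by simp
  qed (use that in simp)
  then have "right_normed R V ` {w \<in> lists (carrier V). w \<noteq> []} \<subseteq> lin_pos R V" by blast
  then show "?S \<subseteq> lin_pos R V" using span_le[OF lin_pos_sub[OF V]] by blast
  show "lin_pos R V \<subseteq> ?S"
  proof
    fix z assume z: "z \<in> lin_pos R V"
    show "z \<in> ?S"
    proof (rule lin_pos_induct[OF V S _ z])
      fix v z assume v: "v \<in> carrier V" and z: "z \<in> lie_lin R V (self_mod R)"
      show "pt_gen R V v \<otimes>\<^bsub>LP R V\<^esub> z \<in> ?S"
      proof (rule span_hom_into[OF LP_module[OF V] LP_module[OF V] bil_hom1[OF LP_bilin[OF V] pt_gen_closed[OF V v]] S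
            right_normed_subset[OF V] _ z[unfolded lie_lin_span[OF V]]])
        fix x assume "x \<in> right_normed R V ` lists (carrier V)"
        then obtain w where w: "w \<in> lists (carrier V)" "x = right_normed R V w" by blast
        have "right_normed R V (v # w) \<in> ?S" using v w(1) by (intro span_incl imageI) simp
        then show "pt_gen R V v \<otimes>\<^bsub>LP R V\<^esub> x \<in> ?S" using w(2) by simp
      qed
    qed
  qed
qed

lemma tensor_to_der_iso: "tensor_to_der R V \<in> mod_iso R (tensor_pos R V) (Der_pt_pos R V)"
proof -
  let ?D = "Der R (pt_mod R V)" and ?T = "tensor_alg R V" and ?N = "{w \<in> lists (carrier V). w \<noteq> []}"
  note h = alg_hom_hom[OF tensor_to_der_hom]
  have rc: "right_normed R V ` ?N \<subseteq> carrier (LP R V)" using right_normed_subset[OF V] by blast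
  have "tensor_to_der R V ` carrier (tensor_pos R V) = span_of R ?D (tensor_to_der R V ` word_class R V ` ?N)"
    unfolding tensor_pos_def using span_image[OF tensor_module Der_module[OF P_module[OF V]] h pos_words] by simp
  also have "tensor_to_der R V ` word_class R V ` ?N = pt_der R V ` right_normed R V ` ?N"
    unfolding image_image by (rule image_cong[OF refl]) (simp add: tensor_to_der_class del: in_lists_conv_set)
  also have "span_of R ?D \<dots> = pt_der R V ` lin_pos R V"
    unfolding lin_pos_span by (rule span_image[OF LP_module[OF V] Der_module[OF P_module[OF V]] pt_der_hom[OF V] rc, symmetric])
  finally have im: "tensor_to_der R V ` carrier (tensor_pos R V) = carrier (Der_pt_pos R V)"
    by (simp add: Der_pt_pos_carrier)
  have sub: "carrier (tensor_pos R V) \<subseteq> carrier ?T" by (rule sub_subset[OF tensor_module tensor_pos_sub])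
  have "bij_betw (tensor_to_der R V) (carrier (tensor_pos R V)) (carrier (Der_pt_pos R V))"
    using inj_on_subset[OF tensor_to_der_inj sub] im by (simp add: bij_betw_def)
  moreover have "tensor_to_der R V \<in> mod_hom R (tensor_pos R V) (Der_pt_pos R V)"
  proof (rule mod_homI)
    have eq: "add (tensor_pos R V) = add ?T" "smult (tensor_pos R V) = smult ?T"
      "add (Der_pt_pos R V) = add ?D" "smult (Der_pt_pos R V) = smult ?D"
      by (simp_all add: tensor_pos_def Der_pt_pos_def)
    show "tensor_to_der R V x \<in> carrier (Der_pt_pos R V)" if "x \<in> carrier (tensor_pos R V)" for x
      using im that by blast
    show "tensor_to_der R V (x \<oplus>\<^bsub>tensor_pos R V\<^esub> y) = tensor_to_der R V x \<oplus>\<^bsub>Der_pt_pos R V\<^esub> tensor_to_der R V y"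
      if "x \<in> carrier (tensor_pos R V)" "y \<in> carrier (tensor_pos R V)" for x y
      unfolding eq using hom_add[OF h] that sub by blast
    show "tensor_to_der R V (a \<odot>\<^bsub>tensor_pos R V\<^esub> x) = a \<odot>\<^bsub>Der_pt_pos R V\<^esub> tensor_to_der R V x"
      if "a \<in> carrier R" "x \<in> carrier (tensor_pos R V)" for a x
      unfolding eq using hom_smult[OF h] that sub by blast
  qed
  ultimately show ?thesis by (simp add: mod_iso_def)
qed

lemma tensor_pos_mult_closed:
  assumes x: "x \<in> carrier (tensor_pos R V)" and y: "y \<in> carrier (tensor_pos R V)"
  shows "x \<otimes>\<^bsub>tensor_alg R V\<^esub> y \<in> carrier (tensor_pos R V)"
proof -
  let ?T = "tensor_alg R V" and ?N = "{w \<in> lists (carrier V). w \<noteq> []}"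
  have sub: "carrier (tensor_pos R V) \<subseteq> carrier ?T" by (rule sub_subset[OF tensor_module tensor_pos_sub])
  have sp: "carrier (tensor_pos R V) = span_of R ?T (word_class R V ` ?N)" by (simp add: tensor_pos_def)
  have 1: "word_class R V u \<otimes>\<^bsub>?T\<^esub> y \<in> carrier (tensor_pos R V)" if u: "u \<in> ?N" for u
  proof -
    have uL: "u \<in> lists (carrier V)" using u by blast
    show ?thesis
    proof (rule span_hom_into[OF tensor_module tensor_module bil_hom1[OF tensor_bilin word_class_closed[OF uL]] tensor_pos_sub
          pos_words _ y[unfolded sp]])
      fix z assume "z \<in> word_class R V ` ?N"
      then obtain v where v: "v \<in> ?N" "z = word_class R V v" by blast
      then have "v \<in> lists (carrier V)" by blast
      then have "word_class R V u \<otimes>\<^bsub>?T\<^esub> z = word_class R V (u @ v)" unfolding v(2) by (rule word_class_mult[OF uL])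
      moreover have "u @ v \<in> ?N" using u v(1) by simp
      ultimately show "word_class R V u \<otimes>\<^bsub>?T\<^esub> z \<in> carrier (tensor_pos R V)" unfolding sp by (simp add: span_incl)
    qed
  qed
  show ?thesis
    by (rule span_hom_into[OF tensor_module tensor_module bil_hom2[OF tensor_bilin subsetD[OF sub y]] tensor_pos_sub pos_words _ x[unfolded sp]])
      (use 1 in blast)
qed

lemma tensor_comm_span: "tensor_to_der R V ` comm_span R (tensor_pos R V) = comm_span R (Der_pt_pos R V)"
proof (rule iso_comm_span[OF tensor_pos_module Der_pt_pos_module[OF V] tensor_to_der_iso])
  have eq: "mult (tensor_pos R V) = mult (tensor_alg R V)" "mult (Der_pt_pos R V) = mult (Der R (pt_mod R V))"
    by (simp_all add: tensor_pos_def Der_pt_pos_def)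
  have sub: "carrier (tensor_pos R V) \<subseteq> carrier (tensor_alg R V)" by (rule sub_subset[OF tensor_module tensor_pos_sub])
  fix x y assume xy: "x \<in> carrier (tensor_pos R V)" "y \<in> carrier (tensor_pos R V)"
  show "x \<otimes>\<^bsub>tensor_pos R V\<^esub> y \<in> carrier (tensor_pos R V)" unfolding eq by (rule tensor_pos_mult_closed[OF xy])
  show "tensor_to_der R V (x \<otimes>\<^bsub>tensor_pos R V\<^esub> y) = tensor_to_der R V x \<otimes>\<^bsub>Der_pt_pos R V\<^esub> tensor_to_der R V y"
    unfolding eq by (rule alg_hom_mult[OF tensor_to_der_hom]) (use xy sub in blast)+
qed

lemma tensor_comm_sub: "submodule (comm_span R (tensor_pos R V)) R (tensor_pos R V)"
proof -
  have m: "x \<otimes>\<^bsub>tensor_pos R V\<^esub> y \<in> carrier (tensor_pos R V)"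
    if "x \<in> carrier (tensor_pos R V)" "y \<in> carrier (tensor_pos R V)" for x y
    using tensor_pos_mult_closed[OF that] by (simp add: tensor_pos_def)
  show ?thesis
    unfolding comm_span_def using m mod_diff[OF tensor_pos_module] by (intro span_sub[OF tensor_pos_module]) blast
qed

end

subsection \<open>The image of the divergence\<close>

context
  fixes V :: "('a, 'v) module"
  assumes free: "free_fin_rank R V"
begin

lemma der_class_gen_hom: "(\<lambda>v. der_class R V (pt_gen R V v \<otimes>\<^bsub>LP R V\<^esub> pt_one R V)) \<in> mod_hom R V (abel R (Der_pt_pos R V))"
proof -
  have "(\<lambda>v. pt_gen R V v \<otimes>\<^bsub>LP R V\<^esub> pt_one R V) \<in> mod_hom R V ((LP R V)\<lparr>carrier := lin_pos R V\<rparr>)"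
    using lin_gen_hom[OF free_mod[OF free]] gen_lin_pos[OF free_mod[OF free] _ one_lin[OF free_mod[OF free]]] by (auto simp: mod_hom_def)
  from hom_comp[OF this der_class_hom[OF free_mod[OF free]]] show ?thesis .
qed

lemma Im_Div_subset: "Im_Div R V \<subseteq> (\<lambda>v. der_class R V (pt_gen R V v \<otimes>\<^bsub>LP R V\<^esub> pt_one R V)) ` carrier V"
proof
  fix X assume "X \<in> Im_Div R V"
  then obtain d where d: "d \<in> Der1 R V" "X = Div R V d" by (auto simp: Im_Div_def)
  note dp = Der1_pos[OF free_mod[OF free] d(1)]
  obtain k v where kv: "k \<in> lin_comm R V" "v \<in> carrier V" "div_lin R V d = k \<oplus>\<^bsub>LP R V\<^esub> pt_gen R V v \<otimes>\<^bsub>LP R V\<^esub> pt_one R V"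
    using div_lin_Der1[OF free d(1)] unfolding lin_low_def by blast
  let ?g = "pt_gen R V v \<otimes>\<^bsub>LP R V\<^esub> pt_one R V"
  have g: "?g \<in> lin_pos R V" by (rule gen_lin_pos[OF free_mod[OF free] kv(2) one_lin[OF free_mod[OF free]]])
  note c = lin_pos_closed[OF free_mod[OF free] lin_comm_subset[OF free_mod[OF free] kv(1)]] lin_pos_closed[OF free_mod[OF free] g]
  have "div_lin R V d \<ominus>\<^bsub>LP R V\<^esub> ?g = k" unfolding kv(3) using c LP_module[OF free_mod[OF free]] by (simp add: mod_ac)
  then have "der_class R V (div_lin R V d) = der_class R V ?g"
    using der_class_eq_iff[OF free_mod[OF free] div_lin_lin_pos[OF free dp] g] kv(1) by simp
  then show "X \<in> (\<lambda>v. der_class R V (pt_gen R V v \<otimes>\<^bsub>LP R V\<^esub> pt_one R V)) ` carrier V"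
    using kv(2) by (auto simp: d(2) Div_der_class[OF free dp])
qed

text \<open>If \<open>i \<noteq> j\<close>, the divergence of \<open>[e\<^sub>i,e\<^sub>j] \<otimes> \<epsilon>\<^sub>j\<close> is \<open>[e\<^sub>i,1]\<close>. A suitable \<open>j\<close> exists for each \<open>i\<close> unless the rank is one.\<close>

lemma Im_Div_eq:
  assumes rank: "\<not> free_of_rank R V 1"
  shows "Im_Div R V = (\<lambda>v. der_class R V (pt_gen R V v \<otimes>\<^bsub>LP R V\<^esub> pt_one R V)) ` carrier V"
proof
  show "(\<lambda>v. der_class R V (pt_gen R V v \<otimes>\<^bsub>LP R V\<^esub> pt_one R V)) ` carrier V \<subseteq> Im_Div R V"
  proof (rule image_subsetI)
    obtain n where n: "free_of_rank R V n" using free by (auto simp: free_fin_rank_def)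
    have n1: "n \<noteq> 1" using n rank by auto
    obtain e \<epsilon> where "dual_basis V n e \<epsilon>" using free_basis[OF n] by blast
    then have e: "\<And>i. i < n \<Longrightarrow> e i \<in> carrier V" and \<epsilon>: "\<And>i. i < n \<Longrightarrow> \<epsilon> i \<in> mod_hom R V (self_mod R)"
      and dual: "\<And>i j. i < n \<Longrightarrow> j < n \<Longrightarrow> \<epsilon> i (e j) = (if i = j then \<one> else \<zero>)"
      and exp: "\<And>v. v \<in> carrier V \<Longrightarrow> v = (\<Oplus>\<^bsub>V\<^esub>i\<in>{..<n}. \<epsilon> i v \<odot>\<^bsub>V\<^esub> e i)"
      unfolding dual_basis_def by blast+
    let ?H = "{v \<in> carrier V. der_class R V (pt_gen R V v \<otimes>\<^bsub>LP R V\<^esub> pt_one R V) \<in> Im_Div R V}"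
    have H: "submodule ?H R V"
      by (rule sub_vimage[OF free_mod[OF free] abel_module[OF free_mod[OF free]] der_class_gen_hom Im_Div_sub[OF free]])
    have eH: "e i \<in> ?H" if i: "i < n" for i
    proof -
      \<comment> \<open>an index different from \<open>i\<close> and below \<open>n\<close>, as \<open>n \<ge> 2\<close>\<close>
      define j :: nat where "j = (if i = 0 then 1 else 0)"
      have j: "j < n" "j \<noteq> i" using i n1 by (auto simp: j_def)
      let ?x = "gen R V (e i) \<otimes>\<^bsub>Lie R V\<^esub> gen R V (e j)"
      have x: "?x \<in> lie_part R V {2}" by (rule lie_two_incl[OF free_mod[OF free] e[OF i] e[OF j(1)]])
      have d: "elem_der R V (\<epsilon> j) ?x \<in> Der1 R V"
        by (rule Der1_deg_one[OF free_mod[OF free] elem_der_part[OF free_mod[OF free] \<epsilon>[OF j(1)] x]])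
      have "\<epsilon> j (e j) \<odot>\<^bsub>V\<^esub> e i \<ominus>\<^bsub>V\<^esub> \<epsilon> j (e i) \<odot>\<^bsub>V\<^esub> e j = e i"
        using dual[OF j(1) i] dual[OF j(1) j(1)] j(2) e[OF i] e[OF j(1)] free_mod[OF free] by (simp add: mod_diff_zero)
      then have "div_lin R V (elem_der R V (\<epsilon> j) ?x) = pt_gen R V (e i) \<otimes>\<^bsub>LP R V\<^esub> pt_one R V"
        by (simp add: div_lin_elem[OF free \<epsilon>[OF j(1)] lie_part_closed[OF free_mod[OF free] x]] fox_two[OF free_mod[OF free] \<epsilon>[OF j(1)] e[OF i] e[OF j(1)]])
      then have "der_class R V (pt_gen R V (e i) \<otimes>\<^bsub>LP R V\<^esub> pt_one R V) = Div R V (elem_der R V (\<epsilon> j) ?x)"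
        by (simp add: Div_der_class[OF free Der1_pos[OF free_mod[OF free] d]])
      then show ?thesis using d e[OF i] by (simp add: Im_Div_def)
    qed
    fix v assume v: "v \<in> carrier V"
    have "(\<Oplus>\<^bsub>V\<^esub>i\<in>{..<n}. \<epsilon> i v \<odot>\<^bsub>V\<^esub> e i) \<in> ?H"
    proof (rule sub_finsum[OF free_mod[OF free] H])
      fix i assume "i \<in> {..<n}"
      then have i: "i < n" by simp
      have "\<epsilon> i v \<in> carrier R" using hom_closed[OF \<epsilon>[OF i] v] by simp
      then show "\<epsilon> i v \<odot>\<^bsub>V\<^esub> e i \<in> ?H" by (rule sub_smult[OF free_mod[OF free] H _ eH[OF i]])
    qed simp
    then show "der_class R V (pt_gen R V v \<otimes>\<^bsub>LP R V\<^esub> pt_one R V) \<in> Im_Div R V" using exp[OF v] by simp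
  qed
qed (rule Im_Div_subset)

lemma comparison_iso:
  assumes rank: "\<not> free_of_rank R V 1"
  shows "tensor_comparison R V \<in> mod_iso R (quot (abel R (tensor_pos R V)) (tensor_abel_deg_one R V)) (div_target R V)"
proof -
  let ?T = "tensor_pos R V" and ?D = "Der_pt_pos R V"
  let ?I = "induced ?D (comm_span R ?D) (tensor_to_der R V)"
  note TM = tensor_pos_module[OF free_mod[OF free]] and TC = tensor_comm_sub[OF free_mod[OF free]]
  note DM = Der_pt_pos_module[OF free_mod[OF free]] and DC = comm_span_sub[OF free_mod[OF free]]
  note iso = tensor_to_der_iso[OF free_mod[OF free]]
  have h: "tensor_to_der R V \<in> mod_hom R ?T ?D" using iso by (simp add: mod_iso_def)
  have I: "?I \<in> mod_iso R (abel R ?T) (abel R ?D)"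
    unfolding abel_def by (rule induced_iso[OF TM TC DM DC iso tensor_comm_span[OF free_mod[OF free]]])
  have AM: "module R (abel R ?T)" unfolding abel_def by (rule module_quot[OF TM TC])
  have wc: "word_class R V [v] \<in> carrier ?T" if "v \<in> carrier V" for v
    using that by (simp add: tensor_pos_def span_incl)
  have wh: "(\<lambda>v. word_class R V [v]) \<in> mod_hom R V ?T"
    using word_class_hom[OF free_mod[OF free]] wc by (auto simp: mod_hom_def tensor_pos_def)
  have sub: "submodule (tensor_abel_deg_one R V) R (abel R ?T)"
    unfolding tensor_abel_deg_one_def abel_def
    by (rule sub_image[OF free_mod[OF free] module_quot[OF TM TC] hom_comp[OF wh proj_hom[OF TM TC]] sub_whole[OF free_mod[OF free]]])
  have Iv: "?I (comm_span R ?T +>\<^bsub>?T\<^esub> word_class R V [v]) = der_class R V (pt_gen R V v \<otimes>\<^bsub>LP R V\<^esub> pt_one R V)" if "v \<in> carrier V" for v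
  proof -
    have "?I (comm_span R ?T +>\<^bsub>?T\<^esub> word_class R V [v]) = comm_span R ?D +>\<^bsub>?D\<^esub> tensor_to_der R V (word_class R V [v])"
      by (rule induced_coset[OF TM TC DM DC h _ wc[OF that]]) (use tensor_comm_span[OF free_mod[OF free]] in blast)
    then show ?thesis
      using that by (simp add: der_class_def tensor_to_der_class[OF free_mod[OF free]] right_normed_simps[OF free_mod[OF free]])
  qed
  have "?I ` tensor_abel_deg_one R V = Im_Div R V"
    unfolding Im_Div_eq[OF rank] tensor_abel_deg_one_def image_image by (rule image_cong[OF refl Iv])
  then show ?thesis
    unfolding tensor_comparison_def div_target_def
    by (rule induced_iso[OF AM sub abel_module[OF free_mod[OF free]] Im_Div_sub[OF free] I])
qed

end

end

theorem proposition12p9: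
  fixes R :: "('a, 'r) ring_scheme" and V :: "('a, 'v) module"
  assumes "cring R"
    and "fg_stably_free_are_free R"
    and "free_fin_rank R V"
  shows
    "Div_bar R V \<in> mod_hom R (div_source R V) (div_target R V) \<and>
     (\<forall>(W :: ('a, 'w) module) p. free_fin_rank R W \<and> p \<in> S_mor R V W \<longrightarrow>
        div_source_map R V W p \<in> mod_hom R (div_source R V) (div_source R W) \<and>
        div_target_map R V W p \<in> mod_hom R (div_target R V) (div_target R W) \<and>
        (\<forall>X\<in>carrier (div_source R V).
           Div_bar R W (div_source_map R V W p X) = div_target_map R V W p (Div_bar R V X))) \<and>
     (\<not> free_of_rank R V 1 \<longrightarrow>
        tensor_comparison R V \<in>
          mod_iso R (quot (abel R (tensor_pos R V)) (tensor_abel_deg_one R V)) (div_target R V)) \<and>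
     (\<forall>X\<in>Div_kernel R V.
        div_source_map R V (dsum V (pow_mod R 3)) (stab_mor R 3) X =
          \<zero>\<^bsub>div_source R (dsum V (pow_mod R 3))\<^esub>)"
proof -
  interpret cring R by fact
  note V = free_mod[OF assms(3)]
  have natural: "div_source_map R V W p \<in> mod_hom R (div_source R V) (div_source R W) \<and>
      div_target_map R V W p \<in> mod_hom R (div_target R V) (div_target R W) \<and>
      (\<forall>X\<in>carrier (div_source R V). Div_bar R W (div_source_map R V W p X) = div_target_map R V W p (Div_bar R V X))"
    if W: "free_fin_rank R W" and p: "p \<in> S_mor R V W" for W :: "('a, 'w) module" and p
  proof (cases p)
    case (Pair i r)
    then have mor: "(i, r) \<in> S_mor R V W" using p by simp
    note VW = V free_mod[OF W] mor
    show ?thesis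
      unfolding Pair
      by (intro conjI ballI source_map_hom[OF VW] divergence_natural[OF VW assms(3) W])
  qed
  show ?thesis
    using Div_bar_hom[OF assms(3)] natural comparison_iso[OF assms(3)] kernel_torsion[OF assms(3)] by blast
qed

end
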